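(* Let $p\ge 2$ and let $\{N^{n},S^{m},M_{w}^{m}\}$ be a comparison constellation on the interval $[0,\infty[$, with bounding functions $g,\lambda,h$ and precompact extrinsic ball $D_{\rho}(o)$ with smooth boundary in $S^m$. Assume that $h$ and $\lambda$ are balanced with respect to $w$ by the inequality $$\mathcal{M}(r):=(m+p-2)\,\eta_{w}(r)-m\,h(r)-(p-2)\,\lambda(r)\ \ge\ 0\qquad\text{for all } r>0 .$$ Let $$\Lambda(r)=w(r)\exp\left(-\int_{1}^{r}\frac{\mathcal{M}(t)}{(p-1)\,g^{2}(t)}\,dt\right),$$ and suppose that $$\lim_{R\to\infty}\int_{\rho}^{R}\Lambda(t)\,dt<\infty .$$ Then $S^{m}$ is $p$-hyperbolic.
   Context: Setting. $N^n$ is a complete Riemannian manifold with a pole $o$ (i.e. $\exp_o:T_oN\to N$ is a diffeomorphism), $r(x)=\operatorname{dist}_N(o,x)$, and $S^m$ is a non-compact, connected, complete Riemannian submanifold of $N^n$; the restriction of $r$ to $S$ is also denoted $r$. $\nabla^N r$ is the gradient of $r$ in $N$ and $\nabla^S r$ the gradient of $r|_S$ in $S$ (the component of $\nabla^N r$ tangent to $S$). $\alpha_x$ is the second fundamental form of $S$ in $N$ (normal-vector valued), and $H_S(x)=\frac1m\sum_{i=1}^m\alpha_x(X_i,X_i)$ ($\{X_i\}$ an orthonormal basis of $T_xS$) is the mean curvature vector. For $x\in S\setminus\{o\}$ define: the radial mean convexity $\mathcal C(x)=-\langle\nabla^N r(x),H_S(x)\rangle$; the radial component of the second fundamental form $\mathcal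 B(x)=-\langle\nabla^N r(x),\alpha_x(U_r,U_r)\rangle$, where $U_r=\nabla^S r(x)/\|\nabla^S r(x)\|$ (and $U_r=0$ if $\nabla^S r(x)=0$); the radial tangency $\mathcal T(x)=\|\nabla^S r(x)\|$. An $o$-radial sectional curvature $K_{o,N}(\sigma_x)$ at $x\neq o$ is the sectional curvature of a two-plane $\sigma_x\subset T_xN$ containing the tangent vector of the geodesic from $o$ to $x$. Model space. A $w$-model $M_w^m$ is the smooth warped product $[0,\Lambda_0[\,\times_w\mathbb S^{m-1}_1$ ($0<\Lambda_0\le\infty$, unit sphere as fiber, metric $dr^2+w(r)^2g_{\mathbb S^{m-1}}$) with $w(0)=0$, $w'(0)=1$, $w(r)>0$ for $r>0$. Its radial sectional curvatures at distance $r$ from the center are $-w''(r)/w(r)$. Put $\eta_w(r)=w'(r)/w(r)$. An extrinsic ball $D_R(o)$ is a connected component of $\{x\in S: r(x)<R\}$. Comparison constellation. $\{N^n,S^m,M_w^m\}$ is a comparison constellation on an interval $I$ starting at $0$ (with $w$ defined on $I$) if: there is an extrinsic ball $D_\rho(o)$ that is precompact in $S$ with smooth boundary $\partial D_\rho(o)$; $K_{o,N}(\sigma_x)\le -w''(r)/w(r)$ for all $x\in N\setminus\{o\}$ with $r=r(x)\in I$ and all radial two-planes $\sigma_x$; and there are smooth functions $g,\lambda,h$ of $r$, with $0<g\le 1$, such that $\mathcal T(x)\le g(r(x))$, $\mathcal B(x)\le\lambda(r(x))$ and $\mathcal C(x)\le h(r(x))$ for all $x\in S\setminus\{o\}$ with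 $r(x)\in I$. $p$-hyperbolicity. A Riemannian manifold $M$ is $p$-hyperbolic ($1<p<\infty$) if there is a compact set $K\subset M$ with $\operatorname{Cap}_p(K,M)>0$, where $\operatorname{Cap}_p(K,M)=\inf_u\int_M\|\nabla u\|^p\,d\mu$, the infimum being over all real-valued $u\in C_0^\infty(M)$ with $u\ge 1$ on $K$. *)

theory Defs
  imports "HOL-Analysis.Analysis"
begin

section \<open>Smooth maps between normed spaces\<close>

text \<open>
  Derivatives are taken within the set, so that the notion makes sense both on open sets and
  on intervals that contain an end point (with one-sided derivatives there).
\<close>

primrec ck_on :: "nat \<Rightarrow> 'a::real_normed_vector set \<Rightarrow> ('a \<Rightarrow> 'b::real_normed_vector) \<Rightarrow> bool" where
  "ck_on 0 S f \<longleftrightarrow> continuous_on S f"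
| "ck_on (Suc k) S f \<longleftrightarrow> f differentiable_on S \<and>
     (\<forall>v. ck_on k S (\<lambda>x. frechet_derivative f (at x within S) v))"

definition smooth_on :: "'a::real_normed_vector set \<Rightarrow> ('a \<Rightarrow> 'b::real_normed_vector) \<Rightarrow> bool" where
  "smooth_on S f \<longleftrightarrow> (\<forall>k. ck_on k S f)"

definition dir_deriv :: "('a::real_normed_vector \<Rightarrow> 'b::real_normed_vector) \<Rightarrow> 'a \<Rightarrow> 'a \<Rightarrow> 'b" where
  "dir_deriv f y v = frechet_derivative f (at y) v"


section \<open>Riemannian manifolds\<close>

text \<open>
  The points of a manifold form a whole type, whose topology (Hausdorff, second countable) comes
  from its type classes; the dimension is the cardinality of the index type \<open>'m\<close>. A chart is a
  domain with a coordinate map. The metric tensor is given by its Gram matrix in each chart,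
  as a function of the coordinates.
\<close>

type_synonym ('a, 'm) chart = "'a set \<times> ('a \<Rightarrow> real ^ 'm)"

record ('a, 'm::finite) riem =
  atlas :: "('a, 'm::finite) chart set"
  gram :: "('a, 'm::finite) chart \<Rightarrow> real ^ 'm \<Rightarrow> real ^ 'm ^ 'm"

abbreviation cdom :: "('a, 'm::finite) chart \<Rightarrow> 'a set" where "cdom c \<equiv> fst c"
abbreviation cmap :: "('a, 'm::finite) chart \<Rightarrow> 'a \<Rightarrow> real ^ 'm" where "cmap c \<equiv> snd c"

definition cinv :: "('a, 'm::finite) chart \<Rightarrow> real ^ 'm \<Rightarrow> 'a" where
  "cinv c = inv_into (cdom c) (cmap c)"

definition ginner :: "('a, 'm::finite) riem \<Rightarrow> ('a, 'm::finite) chart \<Rightarrow> real ^ 'm \<Rightarrow> real ^ 'm \<Rightarrow> real ^ 'm \<Rightarrow> real" where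
  "ginner M c y u v = u \<bullet> (gram M c y *v v)"

definition smooth_atlas :: "('a::topological_space, 'm::finite) chart set \<Rightarrow> bool" where
  "smooth_atlas A \<longleftrightarrow>
     (\<Union>c\<in>A. cdom c) = UNIV \<and>
     (\<forall>c\<in>A. open (cdom c) \<and> open (cmap c ` cdom c) \<and>
        homeomorphism (cdom c) (cmap c ` cdom c) (cmap c) (cinv c)) \<and>
     (\<forall>c\<in>A. \<forall>d\<in>A. smooth_on (cmap c ` (cdom c \<inter> cdom d)) (cmap d \<circ> cinv c))"

definition riemannian_manifold ::
  "('a::{t2_space, second_countable_topology}, 'm::finite) riem \<Rightarrow> bool" where
  "riemannian_manifold M \<longleftrightarrow>
     smooth_atlas (atlas M) \<and>
     (\<forall>c\<in>atlas M. smooth_on (cmap c ` cdom c) (gram M c) \<and>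
        (\<forall>y\<in>cmap c ` cdom c.
           transpose (gram M c y) = gram M c y \<and> (\<forall>v. v \<noteq> 0 \<longrightarrow> ginner M c y v v > 0))) \<and>
     (\<forall>c\<in>atlas M. \<forall>d\<in>atlas M. \<forall>x\<in>cdom c \<inter> cdom d. \<forall>u v.
        ginner M c (cmap c x) u v =
        ginner M d (cmap d x) (dir_deriv (cmap d \<circ> cinv c) (cmap c x) u)
                              (dir_deriv (cmap d \<circ> cinv c) (cmap c x) v))"

text \<open>
  The tangent space at \<open>x\<close> is identified with the coordinate space by means of a preferred
  chart \<open>chart_at M x\<close>; the scalar quantities below do not depend on this choice.
\<close>

definition chart_at :: "('a, 'm::finite) riem \<Rightarrow> 'a \<Rightarrow> ('a, 'm::finite) chart" where
  "chart_at M x = (SOME c. c \<in> atlas M \<and> x \<in> cdom c)"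

definition inner_at :: "('a, 'm::finite) riem \<Rightarrow> 'a \<Rightarrow> real ^ 'm \<Rightarrow> real ^ 'm \<Rightarrow> real" where
  "inner_at M x u v = ginner M (chart_at M x) (cmap (chart_at M x) x) u v"

definition norm_at :: "('a, 'm::finite) riem \<Rightarrow> 'a \<Rightarrow> real ^ 'm \<Rightarrow> real" where
  "norm_at M x v = sqrt (inner_at M x v v)"

definition smooth_fun_on :: "('a, 'm::finite) riem \<Rightarrow> 'a set \<Rightarrow> ('a \<Rightarrow> real) \<Rightarrow> bool" where
  "smooth_fun_on M V f \<longleftrightarrow> (\<forall>c\<in>atlas M. smooth_on (cmap c ` (cdom c \<inter> V)) (f \<circ> cinv c))"

definition gradient :: "('a, 'm::finite) riem \<Rightarrow> ('a \<Rightarrow> real) \<Rightarrow> 'a \<Rightarrow> real ^ 'm" where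
  "gradient M f x = (let c = chart_at M x; y = cmap c x in
     matrix_inv (gram M c y) *v (\<chi> k. dir_deriv (f \<circ> cinv c) y (axis k 1)))"


section \<open>Levi-Civita connection, curvature, geodesics\<close>

text \<open>
  \<open>christoffel M c y u v\<close> is the covariant derivative at \<open>y\<close>, in direction \<open>u\<close>, of the vector
  field that is constantly \<open>v\<close> in the chart \<open>c\<close>. The formula is the Koszul formula for
  coordinate-constant fields.
\<close>

definition christoffel ::
  "('a, 'm::finite) riem \<Rightarrow> ('a, 'm::finite) chart \<Rightarrow> real ^ 'm \<Rightarrow> real ^ 'm \<Rightarrow> real ^ 'm \<Rightarrow> real ^ 'm" where
  "christoffel M c y u v = matrix_inv (gram M c y) *v (\<chi> k.
     (dir_deriv (\<lambda>z. ginner M c z v (axis k 1)) y u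
      + dir_deriv (\<lambda>z. ginner M c z u (axis k 1)) y v
      - dir_deriv (\<lambda>z. ginner M c z u v) y (axis k 1)) / 2)"

text \<open>Sign convention: \<open>R(u,v)z = \<nabla>\<^sub>u \<nabla>\<^sub>v z - \<nabla>\<^sub>v \<nabla>\<^sub>u z - \<nabla>\<^bsub>[u,v]\<^esub> z\<close>.\<close>

definition curvature ::
  "('a, 'm::finite) riem \<Rightarrow> ('a, 'm::finite) chart \<Rightarrow> real ^ 'm \<Rightarrow> real ^ 'm \<Rightarrow> real ^ 'm \<Rightarrow> real ^ 'm \<Rightarrow> real ^ 'm" where
  "curvature M c y u v z =
     dir_deriv (\<lambda>y'. christoffel M c y' v z) y u - dir_deriv (\<lambda>y'. christoffel M c y' u z) y v
     + christoffel M c y u (christoffel M c y v z) - christoffel M c y v (christoffel M c y u z)"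

definition sectional_curvature :: "('a, 'm::finite) riem \<Rightarrow> 'a \<Rightarrow> real ^ 'm \<Rightarrow> real ^ 'm \<Rightarrow> real" where
  "sectional_curvature M x u v = (let c = chart_at M x in
     inner_at M x (curvature M c (cmap c x) u v v) u /
     (inner_at M x u u * inner_at M x v v - (inner_at M x u v)\<^sup>2))"

definition velocity :: "('a, 'm::finite) riem \<Rightarrow> (real \<Rightarrow> 'a) \<Rightarrow> real \<Rightarrow> real ^ 'm" where
  "velocity M \<gamma> t = vector_derivative (cmap (chart_at M (\<gamma> t)) \<circ> \<gamma>) (at t)"

definition geodesic :: "('a::topological_space, 'm::finite) riem \<Rightarrow> (real \<Rightarrow> 'a) \<Rightarrow> bool" where
  "geodesic M \<gamma> \<longleftrightarrow> continuous_on UNIV \<gamma> \<and>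
     (\<forall>c\<in>atlas M. \<forall>t. \<gamma> t \<in> cdom c \<longrightarrow>
        (let y = cmap c \<circ> \<gamma>; y' = (\<lambda>s. vector_derivative y (at s)) in
           y differentiable (at t) \<and>
           (y' has_vector_derivative - christoffel M c (y t) (y' t) (y' t)) (at t)))"


section \<open>Riemannian distance, completeness, poles\<close>

definition piecewise_C1_curve ::
  "('a::topological_space, 'm::finite) riem \<Rightarrow> (real \<Rightarrow> 'a) \<Rightarrow> bool" where
  "piecewise_C1_curve M \<gamma> \<longleftrightarrow> continuous_on {0..1} \<gamma> \<and>
     (\<exists>F. finite F \<and> (\<forall>t\<in>{0<..<1} - F. \<forall>c\<in>atlas M. \<gamma> t \<in> cdom c \<longrightarrow>
        (\<exists>e>0. (cmap c \<circ> \<gamma>) C1_differentiable_on ball t e)))"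

text \<open>Lengths are extended nonnegative reals: the speed may be unbounded at a break point.\<close>

definition curve_length :: "('a, 'm::finite) riem \<Rightarrow> (real \<Rightarrow> 'a) \<Rightarrow> ennreal" where
  "curve_length M \<gamma> = (\<integral>\<^sup>+ t\<in>{0..1}. ennreal (norm_at M (\<gamma> t) (velocity M \<gamma> t)) \<partial>lborel)"

definition riem_edist :: "('a::topological_space, 'm::finite) riem \<Rightarrow> 'a \<Rightarrow> 'a \<Rightarrow> ennreal" where
  "riem_edist M x y =
     (INF \<gamma>\<in>{\<gamma>. piecewise_C1_curve M \<gamma> \<and> \<gamma> 0 = x \<and> \<gamma> 1 = y}. curve_length M \<gamma>)"

definition riem_dist :: "('a::topological_space, 'm::finite) riem \<Rightarrow> 'a \<Rightarrow> 'a \<Rightarrow> real" where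
  "riem_dist M x y = enn2real (riem_edist M x y)"

definition riem_complete :: "('a::topological_space, 'm::finite) riem \<Rightarrow> bool" where
  "riem_complete M \<longleftrightarrow> (\<forall>X :: nat \<Rightarrow> 'a.
     (\<forall>e>0. \<exists>k. \<forall>i\<ge>k. \<forall>j\<ge>k. riem_edist M (X i) (X j) < ennreal e) \<longrightarrow>
     (\<exists>x. (\<lambda>i. riem_edist M (X i) x) \<longlonglongrightarrow> 0))"

definition is_exp_map ::
  "('a::topological_space, 'n::finite) riem \<Rightarrow> 'a \<Rightarrow> (real ^ 'n \<Rightarrow> 'a) \<Rightarrow> bool" where
  "is_exp_map N q E \<longleftrightarrow>
     (\<forall>v. \<exists>\<gamma>. geodesic N \<gamma> \<and> \<gamma> 0 = q \<and> velocity N \<gamma> 0 = v \<and> E v = \<gamma> 1)"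

definition is_pole :: "('a::topological_space, 'n::finite) riem \<Rightarrow> 'a \<Rightarrow> bool" where
  "is_pole N q \<longleftrightarrow> (\<exists>E. is_exp_map N q E \<and> bij E \<and> continuous_on UNIV E \<and>
     (\<forall>c\<in>atlas N. smooth_on (E -` cdom c) (cmap c \<circ> E) \<and>
        smooth_on (cmap c ` cdom c) (inv E \<circ> cinv c)))"

text \<open>
  \<open>is_radial_vector N q x u\<close>: \<open>u\<close> is the tangent vector at \<open>x\<close> of a geodesic from \<open>q\<close> to \<open>x\<close>.
\<close>

definition is_radial_vector ::
  "('a::topological_space, 'n::finite) riem \<Rightarrow> 'a \<Rightarrow> 'a \<Rightarrow> real ^ 'n \<Rightarrow> bool" where
  "is_radial_vector N q x u \<longleftrightarrow>
     (\<exists>\<gamma> t. geodesic N \<gamma> \<and> \<gamma> 0 = q \<and> t > 0 \<and> \<gamma> t = x \<and> velocity N \<gamma> t = u)"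


section \<open>Riemannian submanifolds\<close>

definition smooth_map ::
  "('s::topological_space, 'm::finite) riem \<Rightarrow> ('a::topological_space, 'n::finite) riem \<Rightarrow> ('s \<Rightarrow> 'a) \<Rightarrow> bool" where
  "smooth_map S N \<iota> \<longleftrightarrow> continuous_on UNIV \<iota> \<and>
     (\<forall>c\<in>atlas S. \<forall>d\<in>atlas N.
        smooth_on (cmap c ` (cdom c \<inter> \<iota> -` cdom d)) (cmap d \<circ> \<iota> \<circ> cinv c))"

definition local_rep ::
  "('s, 'm::finite) riem \<Rightarrow> ('a, 'n::finite) riem \<Rightarrow> ('s \<Rightarrow> 'a) \<Rightarrow> 's \<Rightarrow> real ^ 'm \<Rightarrow> real ^ 'n" where
  "local_rep S N \<iota> x = cmap (chart_at N (\<iota> x)) \<circ> \<iota> \<circ> cinv (chart_at S x)"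

definition tangent_map ::
  "('s, 'm::finite) riem \<Rightarrow> ('a, 'n::finite) riem \<Rightarrow> ('s \<Rightarrow> 'a) \<Rightarrow> 's \<Rightarrow> real ^ 'm \<Rightarrow> real ^ 'n" where
  "tangent_map S N \<iota> x v = dir_deriv (local_rep S N \<iota> x) (cmap (chart_at S x) x) v"

text \<open>
  A Riemannian submanifold is given by an isometric immersion; injectivity of the differential
  follows from positive definiteness of the metric of \<open>S\<close>. Embedded submanifolds are the case
  in which \<open>\<iota>\<close> is the inclusion.
\<close>

definition riemannian_submanifold ::
  "('s::topological_space, 'm::finite) riem \<Rightarrow> ('a::topological_space, 'n::finite) riem \<Rightarrow> ('s \<Rightarrow> 'a) \<Rightarrow> bool" where
  "riemannian_submanifold S N \<iota> \<longleftrightarrow> smooth_map S N \<iota> \<and>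
     (\<forall>x u v. inner_at S x u v =
        inner_at N (\<iota> x) (tangent_map S N \<iota> x u) (tangent_map S N \<iota> x v))"

text \<open>
  Gauss formula: the second fundamental form is the difference of the covariant derivatives in
  \<open>N\<close> and in \<open>S\<close>, here of the coordinate-constant extension of \<open>v\<close> in direction \<open>u\<close>.
\<close>

definition second_fund ::
  "('s, 'm::finite) riem \<Rightarrow> ('a, 'n::finite) riem \<Rightarrow> ('s \<Rightarrow> 'a) \<Rightarrow> 's \<Rightarrow> real ^ 'm \<Rightarrow> real ^ 'm \<Rightarrow> real ^ 'n" where
  "second_fund S N \<iota> x u v =
     (let c = chart_at S x; d = chart_at N (\<iota> x); f = local_rep S N \<iota> x; y = cmap c x in
        dir_deriv (\<lambda>z. dir_deriv f z v) y u
        + christoffel N d (f y) (dir_deriv f y u) (dir_deriv f y v)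
        - dir_deriv f y (christoffel S c y u v))"

definition orthonormal_basis_at :: "('s, 'm::finite) riem \<Rightarrow> 's \<Rightarrow> ('m \<Rightarrow> real ^ 'm) \<Rightarrow> bool" where
  "orthonormal_basis_at S x X \<longleftrightarrow> (\<forall>i j. inner_at S x (X i) (X j) = (if i = j then 1 else 0))"

definition mean_curvature ::
  "('s, 'm::finite) riem \<Rightarrow> ('a, 'n::finite) riem \<Rightarrow> ('s \<Rightarrow> 'a) \<Rightarrow> 's \<Rightarrow> real ^ 'n" where
  "mean_curvature S N \<iota> x = (let X = (SOME X. orthonormal_basis_at S x X) in
     (1 / real CARD('m)) *\<^sub>R (\<Sum>i\<in>UNIV. second_fund S N \<iota> x (X i) (X i)))"

definition radial_mean_convexity ::
  "('s, 'm::finite) riem \<Rightarrow> ('a::topological_space, 'n::finite) riem \<Rightarrow> 'a \<Rightarrow> ('s \<Rightarrow> 'a) \<Rightarrow> 's \<Rightarrow> real" where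
  "radial_mean_convexity S N q \<iota> x =
     - inner_at N (\<iota> x) (gradient N (riem_dist N q) (\<iota> x)) (mean_curvature S N \<iota> x)"

text \<open>\<open>unit_radial\<close> is zero where the tangential gradient vanishes, since \<open>1 / 0 = 0\<close>.\<close>

definition unit_radial ::
  "('s, 'm::finite) riem \<Rightarrow> ('a::topological_space, 'n::finite) riem \<Rightarrow> 'a \<Rightarrow> ('s \<Rightarrow> 'a) \<Rightarrow> 's \<Rightarrow> real ^ 'm" where
  "unit_radial S N q \<iota> x = (let V = gradient S (riem_dist N q \<circ> \<iota>) x in
     (1 / norm_at S x V) *\<^sub>R V)"

definition radial_second_fund ::
  "('s, 'm::finite) riem \<Rightarrow> ('a::topological_space, 'n::finite) riem \<Rightarrow> 'a \<Rightarrow> ('s \<Rightarrow> 'a) \<Rightarrow> 's \<Rightarrow> real" where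
  "radial_second_fund S N q \<iota> x = (let U = unit_radial S N q \<iota> x in
     - inner_at N (\<iota> x) (gradient N (riem_dist N q) (\<iota> x)) (second_fund S N \<iota> x U U))"

definition radial_tangency ::
  "('s, 'm::finite) riem \<Rightarrow> ('a::topological_space, 'n::finite) riem \<Rightarrow> 'a \<Rightarrow> ('s \<Rightarrow> 'a) \<Rightarrow> 's \<Rightarrow> real" where
  "radial_tangency S N q \<iota> x = norm_at S x (gradient S (riem_dist N q \<circ> \<iota>) x)"

definition extrinsic_ball ::
  "('a::topological_space, 'n::finite) riem \<Rightarrow> 'a \<Rightarrow> ('s::topological_space \<Rightarrow> 'a) \<Rightarrow> real \<Rightarrow> 's set \<Rightarrow> bool" where
  "extrinsic_ball N q \<iota> R D \<longleftrightarrow> D \<in> components {x. riem_dist N q (\<iota> x) < R}"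

text \<open>The boundary is, locally, a regular level set of a smooth function.\<close>

definition smooth_boundary :: "('s::topological_space, 'm::finite) riem \<Rightarrow> 's set \<Rightarrow> bool" where
  "smooth_boundary S D \<longleftrightarrow> (\<forall>x\<in>frontier D. \<exists>V f.
     open V \<and> x \<in> V \<and> smooth_fun_on S V f \<and> (\<forall>z\<in>V. gradient S f z \<noteq> 0) \<and>
     frontier D \<inter> V = {z\<in>V. f z = 0})"


section \<open>Model spaces and comparison constellations\<close>

definition start_interval :: "real set \<Rightarrow> bool" where
  "start_interval I \<longleftrightarrow> is_interval I \<and> 0 \<in> I \<and> I \<subseteq> {0..} \<and> I \<noteq> {0}"

text \<open>
  A model space is the warped product \<open>dr\<^sup>2 + w(r)\<^sup>2 g\<close> over the unit sphere; it enters only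
  through its warping function.
\<close>

definition warping_function :: "real set \<Rightarrow> (real \<Rightarrow> real) \<Rightarrow> bool" where
  "warping_function I w \<longleftrightarrow> smooth_on I w \<and> w 0 = 0 \<and>
     (w has_real_derivative 1) (at 0 within I) \<and> (\<forall>r\<in>I. r > 0 \<longrightarrow> w r > 0)"

definition model_radial_curvature :: "real set \<Rightarrow> (real \<Rightarrow> real) \<Rightarrow> real \<Rightarrow> real" where
  "model_radial_curvature I w r =
     - vector_derivative (\<lambda>s. vector_derivative w (at s within I)) (at r within I) / w r"

definition eta :: "(real \<Rightarrow> real) \<Rightarrow> real \<Rightarrow> real" where
  "eta w r = deriv w r / w r"

definition comparison_constellation ::
  "('a::topological_space, 'n::finite) riem \<Rightarrow> 'a \<Rightarrow> ('s::topological_space, 'm::finite) riem \<Rightarrow>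
   ('s \<Rightarrow> 'a) \<Rightarrow> real set \<Rightarrow> (real \<Rightarrow> real) \<Rightarrow> real \<Rightarrow> 's set \<Rightarrow>
   (real \<Rightarrow> real) \<Rightarrow> (real \<Rightarrow> real) \<Rightarrow> (real \<Rightarrow> real) \<Rightarrow> bool" where
  "comparison_constellation N q S \<iota> I w \<rho> D g lam h \<longleftrightarrow>
     start_interval I \<and> warping_function I w \<and>
     extrinsic_ball N q \<iota> \<rho> D \<and> compact (closure D) \<and> smooth_boundary S D \<and>
     (\<forall>x u v. x \<noteq> q \<longrightarrow> riem_dist N q x \<in> I \<longrightarrow> is_radial_vector N q x u \<longrightarrow>
        (\<forall>a b. a *\<^sub>R u + b *\<^sub>R v = 0 \<longrightarrow> a = 0 \<and> b = 0) \<longrightarrow>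
        sectional_curvature N x u v \<le> model_radial_curvature I w (riem_dist N q x)) \<and>
     smooth_on I g \<and> smooth_on I lam \<and> smooth_on I h \<and> (\<forall>r\<in>I. 0 < g r \<and> g r \<le> 1) \<and>
     (\<forall>x. \<iota> x \<noteq> q \<longrightarrow> riem_dist N q (\<iota> x) \<in> I \<longrightarrow>
        radial_tangency S N q \<iota> x \<le> g (riem_dist N q (\<iota> x)) \<and>
        radial_second_fund S N q \<iota> x \<le> lam (riem_dist N q (\<iota> x)) \<and>
        radial_mean_convexity S N q \<iota> x \<le> h (riem_dist N q (\<iota> x)))"

definition balance :: "nat \<Rightarrow> real \<Rightarrow> (real \<Rightarrow> real) \<Rightarrow> (real \<Rightarrow> real) \<Rightarrow> (real \<Rightarrow> real) \<Rightarrow> real \<Rightarrow> real" where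
  "balance m p w h lam r = (real m + p - 2) * eta w r - real m * h r - (p - 2) * lam r"

text \<open>The interval integral is oriented, so \<open>r < 1\<close> is covered.\<close>

definition Lambda_fun ::
  "nat \<Rightarrow> real \<Rightarrow> (real \<Rightarrow> real) \<Rightarrow> (real \<Rightarrow> real) \<Rightarrow> (real \<Rightarrow> real) \<Rightarrow> (real \<Rightarrow> real) \<Rightarrow> real \<Rightarrow> real" where
  "Lambda_fun m p w g h lam r =
     w r * exp (- (LBINT t=ereal 1..ereal r. balance m p w h lam t / ((p - 1) * (g t)\<^sup>2)))"


section \<open>Capacity and hyperbolicity\<close>

text \<open>
  Existence and uniqueness of this measure hold on every Riemannian manifold, because a countable
  subfamily of the charts covers it and the change of variables formula applies on overlaps.
\<close>

definition riem_volume :: "('a::topological_space, 'm::finite) riem \<Rightarrow> 'a measure" where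
  "riem_volume M = (THE \<mu>. sets \<mu> = sets borel \<and>
     (\<forall>c\<in>atlas M. \<forall>A\<in>sets borel. A \<subseteq> cdom c \<longrightarrow>
        emeasure \<mu> A = (\<integral>\<^sup>+ y\<in>cmap c ` A. ennreal (sqrt (det (gram M c y))) \<partial>lborel)))"

definition test_function :: "('a::topological_space, 'm::finite) riem \<Rightarrow> ('a \<Rightarrow> real) \<Rightarrow> bool" where
  "test_function M u \<longleftrightarrow> smooth_fun_on M UNIV u \<and> compact (closure {x. u x \<noteq> 0})"

definition p_capacity :: "real \<Rightarrow> ('a::topological_space, 'm::finite) riem \<Rightarrow> 'a set \<Rightarrow> ennreal" where
  "p_capacity p M K = (INF u\<in>{u. test_function M u \<and> (\<forall>x\<in>K. u x \<ge> 1)}.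
     (\<integral>\<^sup>+ x. ennreal (norm_at M x (gradient M u x) powr p) \<partial>riem_volume M))"

definition p_hyperbolic :: "real \<Rightarrow> ('a::topological_space, 'm::finite) riem \<Rightarrow> bool" where
  "p_hyperbolic p M \<longleftrightarrow> (\<exists>K. compact K \<and> p_capacity p M K > 0)"

end

theory Submission
  imports Defs
begin

text \<open>
  Let \<open>r\<close> be the distance from the pole. By the Gauss lemma and Sturm comparison for the Jacobi fields along
  rays, the Hessian of \<open>r\<close> on \<open>N\<close> is at least \<open>\<eta>\<^sub>w(r) (g\<^sub>N - dr \<otimes> dr)\<close>; the Gauss formula carries this bound
  over to \<open>S\<close>, with error terms controlled by \<open>\<lambda>\<close> and \<open>h\<close>. Hence \<open>f = \<Phi> \<circ> r\<close> is \<open>p\<close>-subharmonic on \<open>S\<close> as soon as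
  \<open>\<Phi>' \<ge> 0\<close> and \<open>\<Phi>'' \<ge> (\<eta>\<^sub>w - \<M> / ((p - 1) g\<^sup>2)) \<Phi>'\<close>. The function \<open>\<Lambda>\<close> solves the equality case for \<open>\<Phi>'\<close>;
  multiplying it by an increasing cut-off gives a \<open>\<Phi>\<close> that vanishes on \<open>[0, c\<^sub>0]\<close> for some \<open>c\<^sub>0 < \<rho>\<close> and is bounded,
  because the integral of \<open>\<Lambda>\<close> converges. It is not constant on \<open>S\<close>, because \<open>S\<close> leaves the precompact ball \<open>D\<^sub>\<rho>\<close>.

  Testing the weak form of \<open>\<Delta>\<^sub>p f \<ge> 0\<close> with \<open>v\<^sup>p f\<close>, for \<open>v\<close> admissible in the capacity of \<open>K\<close>, and absorbing with Young's
  inequality yields \<open>\<integral> v\<^sup>p |\<nabla>f|\<^sup>p \<le> C \<integral> |\<nabla>v|\<^sup>p\<close> with \<open>C\<close> depending on \<open>p\<close> and \<open>sup f\<close> only. So \<open>K\<close> has positive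
  capacity if it is a small ball on which \<open>\<nabla>f \<noteq> 0\<close>.
\<close>

section \<open>Calculus of \<open>C\<^sup>k\<close> maps on open sets\<close>

text \<open>Two singularities shape the construction. The distance r fails to be smooth at the pole,
  over which \<open>S\<close> may pass; the cut-off kills f near the pole, and it is a cube so that
  f stays C^2. The field |\<nabla>f|^(p-2) \<nabla>f need not be differentiable where \<nabla>f = 0;
  so |\<nabla>f|^2 is replaced by |\<nabla>f|^2 + \<epsilon>, and \<epsilon> tends to 0 only after
  the integration by parts.

  The inequality for \<Phi> comes from collecting terms. With T the length of the gradient of r on
  \<open>S\<close>, all multiples of \<eta>_w T^2 cancel and a nonnegative multiple of \<M> (1 - T^2
  / g^2) is left. Here T \<le> g and \<M> \<ge> 0 enter, and this is the origin of g^2 in the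
  exponent of \<Lambda>.

  The capacity bound is a Caccioppoli inequality: a bounded nonconstant subsolution suffices and no
  Dirichlet problem has to be solved. The pole supplies global polar coordinates, so r is a norm
  read through the inverse exponential map and no cut locus occurs.\<close>

lemma dir_deriv_eq: "(f has_derivative f') (at x) \<Longrightarrow> dir_deriv f x = f'"
  unfolding dir_deriv_def using frechet_derivative_at by blast

lemma dir_deriv_cong_open:
  assumes "open U" "x \<in> U" "\<And>y. y \<in> U \<Longrightarrow> f y = g y"
  shows "dir_deriv f x = dir_deriv g x"
proof -
  \<comment> \<open>\<open>frechet_derivative\<close> chooses from the set of derivatives. Both
    functions have the same set, so equality holds even where it is empty.\<close>
  have "(f has_derivative L) (at x) \<longleftrightarrow> (g has_derivative L) (at x)" for L
    using has_derivative_transform_within_open[OF _ assms(1,2)] assms(3) by (metis (no_types, lifting))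
  then show ?thesis unfolding dir_deriv_def frechet_derivative_def by simp
qed

text \<open>On an open set the filters \<open>at x within U\<close> and \<open>at x\<close>
  coincide, so the inductive clause of \<open>ck_on\<close> can be read with two-sided derivatives.
  Calculus in charts goes through this form; on the closed half line the original clause has to be
  used.\<close>

lemma ck_on_Suc_open:
  assumes "open U"
  shows "ck_on (Suc k) U f \<longleftrightarrow> (\<forall>x\<in>U. (f has_derivative dir_deriv f x) (at x)) \<and>
    (\<forall>v. ck_on k U (\<lambda>x. dir_deriv f x v))"
proof -
  have eq: "frechet_derivative f (at x within U) v = dir_deriv f x v" if "x \<in> U" for x v
    unfolding dir_deriv_def at_within_open[OF that assms] ..
  have 1: "f differentiable_on U \<longleftrightarrow> (\<forall>x\<in>U. (f has_derivative dir_deriv f x) (at x))"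
  proof -
    have "f differentiable_on U \<longleftrightarrow> (\<forall>x\<in>U. f differentiable (at x))"
      unfolding differentiable_on_def using at_within_open[OF _ assms] by simp
    also have "\<dots> \<longleftrightarrow> (\<forall>x\<in>U. (f has_derivative dir_deriv f x) (at x))"
      using dir_deriv_eq unfolding differentiable_def by metis
    finally show ?thesis .
  qed
  have cong: "ck_on k U f' = ck_on k U g'" if "\<And>x. x \<in> U \<Longrightarrow> f' x = g' x" for f' g' :: "'a \<Rightarrow> 'b"
    using that
  proof (induction k arbitrary: f' g')
    case 0 then show ?case unfolding ck_on.simps by (intro continuous_on_cong) auto
  next
    case (Suc k)
    have d: "(f' has_derivative L) (at x within U) \<longleftrightarrow> (g' has_derivative L) (at x within U)" if "x \<in> U" for L x
      using has_derivative_transform[OF that, of g' f'] has_derivative_transform[OF that, of f' g'] Suc.prems by auto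
    have "frechet_derivative f' (at x within U) = frechet_derivative g' (at x within U)" if "x \<in> U" for x
      unfolding frechet_derivative_def using d[OF that] by simp
    moreover have "f' differentiable_on U \<longleftrightarrow> g' differentiable_on U"
      unfolding differentiable_on_def differentiable_def using d by simp
    ultimately show ?case using Suc.IH[of "\<lambda>x. frechet_derivative f' (at x within U) _" "\<lambda>x. frechet_derivative g' (at x within U) _"]
      by simp
  qed
  show ?thesis using 1 cong[OF eq] by simp
qed

lemma ck_on_cong:
  assumes "open U" "\<And>x. x \<in> U \<Longrightarrow> f x = g x" "ck_on k U f"
  shows "ck_on k U g"
  using assms(2,3)
proof (induction k arbitrary: f g)
  case 0
  have "continuous_on U f = continuous_on U g" using 0 by (intro continuous_on_cong) auto
  then show ?case using 0 by simp
next
  case (Suc k)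
  have "dir_deriv f x = dir_deriv g x" if "x \<in> U" for x
    using dir_deriv_cong_open assms(1) Suc.prems(1) that by blast
  moreover have "(f has_derivative L) (at x) \<Longrightarrow> (g has_derivative L) (at x)" if "x \<in> U" for x L
    using has_derivative_transform_within_open[OF _ assms(1) that] Suc.prems(1) by blast
  ultimately show ?case using Suc.prems(2) Suc.IH
    unfolding ck_on_Suc_open[OF assms(1)] by (metis (mono_tags, lifting))
qed

lemma ck_on_derivI:
  assumes "open U" "\<And>x. x \<in> U \<Longrightarrow> (f has_derivative f' x) (at x)" "\<And>v. ck_on k U (\<lambda>x. f' x v)"
  shows "ck_on (Suc k) U f"
  unfolding ck_on_Suc_open[OF assms(1)]
proof (intro conjI ballI allI)
  fix x assume "x \<in> U" then show "(f has_derivative dir_deriv f x) (at x)"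
    using assms(2) dir_deriv_eq by metis
next
  fix v show "ck_on k U (\<lambda>x. dir_deriv f x v)"
    by (rule ck_on_cong[OF assms(1) _ assms(3)[of v]]) (use assms(2) dir_deriv_eq in metis)
qed

lemma ck_on_has_derivative:
  "open U \<Longrightarrow> ck_on (Suc k) U f \<Longrightarrow> x \<in> U \<Longrightarrow> (f has_derivative dir_deriv f x) (at x)"
  by (simp add: ck_on_Suc_open del: ck_on.simps)

lemma ck_on_dir_deriv: "open U \<Longrightarrow> ck_on (Suc k) U f \<Longrightarrow> ck_on k U (\<lambda>x. dir_deriv f x v)"
  by (simp add: ck_on_Suc_open del: ck_on.simps)

lemma ck_on_continuous: "ck_on k U f \<Longrightarrow> continuous_on U f"
  by (cases k) (auto intro: differentiable_imp_continuous_on)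

lemma ck_on_Suc_imp: "ck_on (Suc k) U f \<Longrightarrow> ck_on k U f"
proof (induction k arbitrary: f)
  case 0 then show ?case by (simp add: differentiable_imp_continuous_on)
next
  case (Suc k) then show ?case by (metis ck_on.simps(2))
qed

lemma ck_on_le: "ck_on k U f \<Longrightarrow> j \<le> k \<Longrightarrow> ck_on j U f"
  by (induction k) (use ck_on_Suc_imp le_Suc_eq in blast)+

lemma smooth_on_ck: "smooth_on U f \<Longrightarrow> ck_on k U f"
  by (simp add: smooth_on_def)

lemma ck_on_open_subset:
  assumes "ck_on k U f" "open U" "open V" "V \<subseteq> U"
  shows "ck_on k V f"
  using assms(1)
proof (induction k arbitrary: f)
  case 0 then show ?case using assms continuous_on_subset by auto
next
  case (Suc k) then show ?case
    using assms by (simp add: ck_on_Suc_open subset_iff del: ck_on.simps)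
qed

text \<open>Lets smoothness be checked near each point in a chart chosen for that point. This is how
  functions on a manifold, and extensions by zero, are shown to be of class C^k.\<close>

lemma ck_on_local:
  assumes "open U" "\<And>x. x \<in> U \<Longrightarrow> \<exists>V. open V \<and> x \<in> V \<and> V \<subseteq> U \<and> ck_on k V f"
  shows "ck_on k U f"
  using assms(2)
proof (induction k arbitrary: f)
  case 0
  then show ?case using assms(1)
    by (simp) (metis continuous_on_eq_continuous_at continuous_on_eq_continuous_within)
next
  case (Suc k)
  show ?case unfolding ck_on_Suc_open[OF assms(1)]
  proof (intro conjI ballI allI)
    fix x assume "x \<in> U"
    then obtain V where "open V" "x \<in> V" "V \<subseteq> U" "ck_on (Suc k) V f" using Suc.prems by blast
    then show "(f has_derivative dir_deriv f x) (at x)" using ck_on_has_derivative[of V k f x] by blast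
  next
    fix v show "ck_on k U (\<lambda>x. dir_deriv f x v)"
    proof (rule Suc.IH)
      fix x assume "x \<in> U"
      then obtain V where "open V" "x \<in> V" "V \<subseteq> U" "ck_on (Suc k) V f" using Suc.prems by blast
      then show "\<exists>V. open V \<and> x \<in> V \<and> V \<subseteq> U \<and> ck_on k V (\<lambda>x. dir_deriv f x v)"
        using ck_on_dir_deriv[of V k f v] by (intro exI[of _ V]) simp
    qed
  qed
qed

lemma ck_on_const: "open U \<Longrightarrow> ck_on k U (\<lambda>x. c)"
proof (induction k arbitrary: c)
  case 0 then show ?case by simp
next
  case (Suc k)
  show ?case by (rule ck_on_derivI[where f'="\<lambda>x v. 0", OF Suc.prems has_derivative_const Suc.IH[OF Suc.prems]])
qed

lemma ck_on_bounded_linear_comp: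
  assumes "open U" "bounded_linear L" "ck_on k U f"
  shows "ck_on k U (\<lambda>x. L (f x))"
  using assms(3)
proof (induction k arbitrary: f)
  case 0 then show ?case using assms(2) linear_continuous_on_compose
    by (simp add: bounded_linear.continuous_on)
next
  case (Suc k)
  show ?case
  proof (rule ck_on_derivI[OF assms(1)])
    show "((\<lambda>x. L (f x)) has_derivative (\<lambda>v. L (dir_deriv f x v))) (at x)" if "x \<in> U" for x
      by (rule bounded_linear.has_derivative[OF assms(2) ck_on_has_derivative[OF assms(1) Suc.prems that]])
    show "ck_on k U (\<lambda>x. L (dir_deriv f x v))" for v
      by (rule Suc.IH[OF ck_on_dir_deriv[OF assms(1) Suc.prems]])
  qed
qed

lemma ck_on_id: "open U \<Longrightarrow> ck_on k U (\<lambda>x. x)"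
proof (cases k)
  case (Suc j) assume "open U" then show ?thesis unfolding Suc
    by (intro ck_on_derivI[where f'="\<lambda>x v. v"] has_derivative_ident ck_on_const)
qed auto

lemma ck_on_bounded_linear: "open U \<Longrightarrow> bounded_linear L \<Longrightarrow> ck_on k U L"
  using ck_on_bounded_linear_comp[OF _ _ ck_on_id] by blast

lemma ck_on_add:
  assumes "open U" "ck_on k U f" "ck_on k U g"
  shows "ck_on k U (\<lambda>x. f x + g x)"
  using assms(2,3)
proof (induction k arbitrary: f g)
  case 0 then show ?case by (simp add: continuous_on_add)
next
  case (Suc k)
  show ?case
  proof (rule ck_on_derivI[OF assms(1)])
    show "((\<lambda>x. f x + g x) has_derivative (\<lambda>v. dir_deriv f x v + dir_deriv g x v)) (at x)" if "x \<in> U" for x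
      by (rule has_derivative_add[OF ck_on_has_derivative[OF assms(1) Suc.prems(1) that] ck_on_has_derivative[OF assms(1) Suc.prems(2) that]])
    show "ck_on k U (\<lambda>x. dir_deriv f x v + dir_deriv g x v)" for v
      by (intro Suc.IH ck_on_dir_deriv assms(1) Suc.prems)
  qed
qed

lemma ck_on_sum:
  assumes "open U" "\<And>i. i \<in> I \<Longrightarrow> ck_on k U (f i)"
  shows "ck_on k U (\<lambda>x. \<Sum>i\<in>I. f i x)"
  using assms(2) by (induction I rule: infinite_finite_induct) (auto intro: ck_on_const ck_on_add assms(1))

lemma ck_on_bilinear:
  assumes "open U" "bounded_bilinear b" "ck_on k U f" "ck_on k U g"
  shows "ck_on k U (\<lambda>x. b (f x) (g x))"
  using assms(3,4)
proof (induction k arbitrary: f g)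
  case 0 then show ?case by (simp add: bounded_bilinear.continuous_on[OF assms(2)])
next
  case (Suc k)
  show ?case
  proof (rule ck_on_derivI[OF assms(1)])
    show "((\<lambda>x. b (f x) (g x)) has_derivative (\<lambda>v. b (f x) (dir_deriv g x v) + b (dir_deriv f x v) (g x))) (at x)" if "x \<in> U" for x
      by (rule bounded_bilinear.FDERIV[OF assms(2) ck_on_has_derivative[OF assms(1) Suc.prems(1) that] ck_on_has_derivative[OF assms(1) Suc.prems(2) that]])
    show "ck_on k U (\<lambda>x. b (f x) (dir_deriv g x v) + b (dir_deriv f x v) (g x))" for v
      by (intro ck_on_add Suc.IH ck_on_dir_deriv assms(1) Suc.prems ck_on_Suc_imp[OF Suc.prems(1)] ck_on_Suc_imp[OF Suc.prems(2)])
  qed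
qed

lemmas ck_on_mult = ck_on_bilinear[OF _ bounded_bilinear_mult]
lemmas ck_on_scaleR = ck_on_bilinear[OF _ bounded_bilinear_scaleR]
lemmas ck_on_inner = ck_on_bilinear[OF _ bounded_bilinear_inner]
lemmas ck_on_minus = ck_on_bounded_linear_comp[OF _ bounded_linear_minus[OF bounded_linear_ident]]

lemma ck_on_diff:
  assumes "open U" "ck_on k U f" "ck_on k U g"
  shows "ck_on k U (\<lambda>x. f x - g x)"
  using ck_on_add[OF assms(1,2) ck_on_minus[OF assms(1,3)]] by simp

lemma ck_on_prod:
  fixes f :: "'i \<Rightarrow> 'a::real_normed_vector \<Rightarrow> real"
  assumes "open U" "\<And>i. i \<in> I \<Longrightarrow> ck_on k U (f i)"
  shows "ck_on k U (\<lambda>x. \<Prod>i\<in>I. f i x)"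
  using assms(2) by (induction I rule: infinite_finite_induct) (auto intro: ck_on_const ck_on_mult assms(1))

lemma ck_on_vec_nth: "open U \<Longrightarrow> ck_on k U f \<Longrightarrow> ck_on k U (\<lambda>x. f x $ i)"
  by (rule ck_on_bounded_linear_comp[OF _ bounded_linear_vec_nth])

lemma ck_on_vec_lambda:
  fixes f :: "'i::finite \<Rightarrow> 'a::real_normed_vector \<Rightarrow> 'b::euclidean_space"
  assumes "open U" "\<And>i. ck_on k U (f i)"
  shows "ck_on k U (\<lambda>x. \<chi> i. f i x)"
proof -
  have "(\<chi> i. f i x) = (\<Sum>i\<in>UNIV. axis i (f i x))" for x
    by (simp add: vec_eq_iff axis_def if_distrib cong: if_cong)
  moreover have "bounded_linear (axis i :: 'b \<Rightarrow> 'b ^ 'i)" for i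
    unfolding linear_conv_bounded_linear[symmetric] by (rule linearI) (simp_all add: vec_eq_iff axis_def)
  ultimately show ?thesis using assms by (auto intro!: ck_on_sum ck_on_bounded_linear_comp[of _ "axis _"])
qed

lemma ck_on_Pair:
  assumes "open U" "ck_on k U f" "ck_on k U g"
  shows "ck_on k U (\<lambda>x. (f x, g x))"
proof -
  have "bounded_linear (\<lambda>x::'b. (x, 0::'c))" "bounded_linear (\<lambda>x::'c. (0::'b, x))"
    by (auto intro: bounded_linear_intros bounded_linear_Pair)
  then have "ck_on k U (\<lambda>x. (f x, 0) + (0, g x))"
    using assms by (intro ck_on_add) (auto intro: ck_on_bounded_linear_comp)
  then show ?thesis by simp
qed

lemma bounded_linear_euclid_sum:
  fixes x :: "'a::euclidean_space"
  assumes "bounded_linear L"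
  shows "L x = (\<Sum>b\<in>Basis. (x \<bullet> b) *\<^sub>R L b)"
  using linear_sum[OF bounded_linear.linear[OF assms], of "\<lambda>b. (x \<bullet> b) *\<^sub>R b" Basis]
  by (simp add: euclidean_representation linear_scale[OF bounded_linear.linear[OF assms]])

text \<open>In the chain rule the outer derivative is taken in the direction
  \<open>dir_deriv f x v\<close>, which moves with \<open>x\<close>, while the induction hypothesis
  speaks of fixed directions only. Expanding that direction in a basis separates the two
  dependences; hence the Euclidean middle space.\<close>

lemma ck_on_compose:
  fixes f :: "'a::real_normed_vector \<Rightarrow> 'b::euclidean_space"
  assumes "open U" "open V" "f ` U \<subseteq> V" "ck_on k U f" "ck_on k V g"
  shows "ck_on k U (\<lambda>x. g (f x))"
  using assms(4,5)
proof (induction k arbitrary: g)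
  case 0 then show ?case using assms(3) continuous_on_compose2 by (metis ck_on.simps(1))
next
  case (Suc k)
  have dg: "(g has_derivative dir_deriv g (f x)) (at (f x))" if "x \<in> U" for x
    using ck_on_has_derivative[OF assms(2) Suc.prems(2)] assms(3) that by blast
  show ?case
  proof (rule ck_on_derivI[OF assms(1)])
    show "((\<lambda>x. g (f x)) has_derivative (\<lambda>v. dir_deriv g (f x) (dir_deriv f x v))) (at x)" if "x \<in> U" for x
      using has_derivative_compose[OF ck_on_has_derivative[OF assms(1) Suc.prems(1) that] dg[OF that]] .
    fix v
    have "ck_on k U (\<lambda>x. \<Sum>b\<in>Basis. (dir_deriv f x v \<bullet> b) *\<^sub>R dir_deriv g (f x) b)"
    proof (intro ck_on_sum ck_on_scaleR ck_on_inner ck_on_const assms(1))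
      show "ck_on k U (\<lambda>x. dir_deriv f x v)" by (rule ck_on_dir_deriv[OF assms(1) Suc.prems(1)])
      show "ck_on k U (\<lambda>x. dir_deriv g (f x) b)" for b
        by (rule Suc.IH) (use ck_on_Suc_imp[OF Suc.prems(1)] ck_on_dir_deriv[OF assms(2) Suc.prems(2)] in auto)
    qed
    then show "ck_on k U (\<lambda>x. dir_deriv g (f x) (dir_deriv f x v))"
      by (rule ck_on_cong[OF assms(1), rotated])
        (metis bounded_linear_euclid_sum has_derivative_bounded_linear dg)
  qed
qed

lemma dir_deriv_compose:
  assumes "(f has_derivative f') (at x)" "(g has_derivative g') (at (f x))"
  shows "dir_deriv (\<lambda>x. g (f x)) x v = g' (f' v)"
  using dir_deriv_eq[OF has_derivative_compose[OF assms]] by simp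

lemma ck_on_realI:
  fixes f :: "real \<Rightarrow> real"
  assumes "open U" "\<And>x. x \<in> U \<Longrightarrow> (f has_real_derivative f' x) (at x)" "ck_on k U f'"
  shows "ck_on (Suc k) U f"
proof (rule ck_on_derivI[OF assms(1)])
  show "(f has_derivative (*) (f' x)) (at x)" if "x \<in> U" for x
    using assms(2) that has_field_derivative_def by blast
  show "ck_on k U (\<lambda>x. f' x * v)" for v
    by (intro ck_on_mult ck_on_const assms)
qed

lemma ck_on_realD:
  fixes f :: "real \<Rightarrow> real"
  assumes "open U" "ck_on (Suc k) U f" "x \<in> U"
  shows "(f has_real_derivative dir_deriv f x 1) (at x)"
proof -
  have "(f has_derivative dir_deriv f x) (at x)" by (rule ck_on_has_derivative[OF assms])
  moreover from this have "dir_deriv f x = (*) (dir_deriv f x 1)"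
    by (metis has_derivative_bounded_linear real_bounded_linear ext mult.commute mult_1)
  ultimately show ?thesis by (simp add: has_field_derivative_def)
qed

lemma ck_on_inverse_real': "ck_on k (- {0}) (inverse :: real \<Rightarrow> real)"
proof (induction k)
  case 0 then show ?case by (auto intro!: continuous_intros)
next
  case (Suc k)
  show ?case
    by (rule ck_on_realI[where f'="\<lambda>x. - (inverse x * inverse x)"])
      (auto intro!: ck_on_minus ck_on_mult Suc derivative_eq_intros simp: power2_eq_square)
qed

lemma ck_on_divide:
  fixes f g :: "'a::real_normed_vector \<Rightarrow> real"
  assumes "open U" "ck_on k U f" "ck_on k U g" "\<And>x. x \<in> U \<Longrightarrow> g x \<noteq> 0"
  shows "ck_on k U (\<lambda>x. f x / g x)"
proof -
  have "ck_on k U (\<lambda>x. inverse (g x))"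
    by (rule ck_on_compose[OF assms(1) _ _ assms(3) ck_on_inverse_real']) (use assms(4) in auto)
  then show ?thesis unfolding divide_inverse by (intro ck_on_mult assms)
qed

lemma ck_on_powr_real: "ck_on k {0<..} (\<lambda>x::real. x powr a)"
proof (induction k arbitrary: a)
  case 0 then show ?case by (auto intro!: continuous_intros)
next
  case (Suc k)
  show ?case
    by (rule ck_on_realI[where f'="\<lambda>x. a * x powr (a - 1)"])
      (auto intro!: ck_on_mult ck_on_const Suc derivative_eq_intros)
qed

lemma ck_on_powr:
  fixes f :: "'a::real_normed_vector \<Rightarrow> real"
  assumes "open U" "ck_on k U f" "\<And>x. x \<in> U \<Longrightarrow> f x > 0"
  shows "ck_on k U (\<lambda>x. f x powr a)"
  by (rule ck_on_compose[OF assms(1) _ _ assms(2) ck_on_powr_real]) (use assms(3) in auto)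

lemma ck_on_sqrt:
  fixes f :: "'a::real_normed_vector \<Rightarrow> real"
  assumes "open U" "ck_on k U f" "\<And>x. x \<in> U \<Longrightarrow> f x > 0"
  shows "ck_on k U (\<lambda>x. sqrt (f x))"
  by (rule ck_on_cong[OF assms(1) _ ck_on_powr[OF assms, of "1/2"]])
    (simp add: assms(3) less_imp_le powr_half_sqrt)

lemma ck_on_det:
  fixes A :: "'a::real_normed_vector \<Rightarrow> real ^ 'n ^ 'n"
  assumes "open U" "ck_on k U A"
  shows "ck_on k U (\<lambda>x. det (A x))"
  unfolding det_def
  by (intro ck_on_sum ck_on_mult ck_on_const ck_on_prod ck_on_vec_nth assms)

lemma has_vector_derivative_compose:
  assumes "(g has_vector_derivative v) (at t)" "(f has_derivative f') (at (g t))"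
  shows "((\<lambda>t. f (g t)) has_vector_derivative f' v) (at t)"
  using has_derivative_compose[OF assms(1)[unfolded has_vector_derivative_def] assms(2)]
    linear_scale[OF has_derivative_linear[OF assms(2)]]
  by (simp add: has_vector_derivative_def)

section \<open>Symmetry of mixed second derivatives\<close>

lemma symmetric_second_derivative_real:
  fixes f :: "'a::real_normed_vector \<Rightarrow> real"
  assumes U: "open U" and f: "ck_on 2 U f" and x: "x \<in> U"
  shows "dir_deriv (\<lambda>z. dir_deriv f z u) x v = dir_deriv (\<lambda>z. dir_deriv f z v) x u"
proof -
  have f2: "ck_on (Suc (Suc 0)) U f" using f by (simp add: numeral_2_eq_2)
  let ?g = "\<lambda>u v y. dir_deriv (\<lambda>z. dir_deriv f z u) y v"
  obtain e0 where e0: "e0 > 0" "cball x e0 \<subseteq> U" using U x open_contains_cball by blast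
  define c where "c = e0 / (1 + norm u + norm v)"
  have c0: "c > 0" using e0 by (auto simp: c_def intro!: divide_pos_pos add_pos_nonneg)
  have inU: "x + s *\<^sub>R u + t *\<^sub>R v \<in> U" if "\<bar>s\<bar> \<le> c" "\<bar>t\<bar> \<le> c" for s t
  proof -
    have "norm (s *\<^sub>R u + t *\<^sub>R v) \<le> \<bar>s\<bar> * norm u + \<bar>t\<bar> * norm v"
      by (metis norm_scaleR norm_triangle_ineq)
    also have "\<dots> \<le> c * norm u + c * norm v" using that by (intro add_mono mult_right_mono) auto
    also have "\<dots> \<le> c * (1 + norm u + norm v)" using c0 by (simp add: algebra_simps)
    also have "\<dots> = e0" unfolding c_def
      by (metis add_nonneg_nonneg add_pos_nonneg less_irrefl nonzero_eq_divide_eq norm_ge_zero zero_less_one)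
    finally have "dist x (x + (s *\<^sub>R u + t *\<^sub>R v)) \<le> e0" unfolding dist_commute[of x] by (simp add: dist_norm)
    then show ?thesis using e0 by (auto simp: add.assoc)
  qed
  text \<open>The second difference quotient is a value of both mixed derivatives near the point.\<close>
  have key: "\<exists>s t. 0 < s \<and> s < \<delta> \<and> 0 < t \<and> t < \<delta> \<and>
      f (x + \<delta> *\<^sub>R u + \<delta> *\<^sub>R v) - f (x + \<delta> *\<^sub>R u) - f (x + \<delta> *\<^sub>R v) + f x
       = \<delta> * \<delta> * ?g u v (x + s *\<^sub>R u + t *\<^sub>R v)"
    if \<delta>: "0 < \<delta>" "\<delta> < c" and inU: "\<And>s t. \<bar>s\<bar> \<le> c \<Longrightarrow> \<bar>t\<bar> \<le> c \<Longrightarrow> x + s *\<^sub>R u + t *\<^sub>R v \<in> U" for \<delta> u v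
  proof -
    define \<phi> where "\<phi> s = f (x + s *\<^sub>R u + \<delta> *\<^sub>R v) - f (x + s *\<^sub>R u)" for s
    have df: "((\<lambda>s. f (x + s *\<^sub>R u + t *\<^sub>R v)) has_real_derivative dir_deriv f (x + s *\<^sub>R u + t *\<^sub>R v) u) (at s)"
      if "\<bar>s\<bar> \<le> c" "\<bar>t\<bar> \<le> c" for s t
    proof -
      have "((\<lambda>s. x + s *\<^sub>R u + t *\<^sub>R v) has_vector_derivative u) (at s)"
        by (auto intro!: derivative_eq_intros)
      from has_vector_derivative_compose[OF this ck_on_has_derivative[OF U f2 inU[OF that]]]
      show ?thesis by (simp add: has_real_derivative_iff_has_vector_derivative)
    qed
    have "\<exists>s. 0 < s \<and> s < \<delta> \<and> \<phi> \<delta> - \<phi> 0 = (\<delta> - 0) * (dir_deriv f (x + s *\<^sub>R u + \<delta> *\<^sub>R v) u - dir_deriv f (x + s *\<^sub>R u) u)"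
      unfolding \<phi>_def
    proof (rule MVT2)
      fix s assume "0 \<le> s" "s \<le> \<delta>"
      then show "((\<lambda>s. f (x + s *\<^sub>R u + \<delta> *\<^sub>R v) - f (x + s *\<^sub>R u)) has_real_derivative
         dir_deriv f (x + s *\<^sub>R u + \<delta> *\<^sub>R v) u - dir_deriv f (x + s *\<^sub>R u) u) (at s)"
        using df[of s \<delta>] df[of s 0] \<delta> by (auto intro!: DERIV_diff)
    qed (use \<delta> in auto)
    then obtain s where s: "0 < s" "s < \<delta>"
      "\<phi> \<delta> - \<phi> 0 = \<delta> * (dir_deriv f (x + s *\<^sub>R u + \<delta> *\<^sub>R v) u - dir_deriv f (x + s *\<^sub>R u) u)" by auto
    have f1: "ck_on (Suc 0) U (\<lambda>z. dir_deriv f z u)" using ck_on_dir_deriv[OF U f2] .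
    have dg: "((\<lambda>t. dir_deriv f (x + s *\<^sub>R u + t *\<^sub>R v) u) has_real_derivative ?g u v (x + s *\<^sub>R u + t *\<^sub>R v)) (at t)"
      if "0 \<le> t" "t \<le> \<delta>" for t
    proof -
      have xU: "x + s *\<^sub>R u + t *\<^sub>R v \<in> U" using that s \<delta> by (intro inU) auto
      have "((\<lambda>t. x + s *\<^sub>R u + t *\<^sub>R v) has_vector_derivative v) (at t)"
        by (auto intro!: derivative_eq_intros)
      from has_vector_derivative_compose[OF this ck_on_has_derivative[OF U f1 xU]]
      show ?thesis by (simp add: has_real_derivative_iff_has_vector_derivative)
    qed
    obtain t where t: "0 < t" "t < \<delta>"
      "dir_deriv f (x + s *\<^sub>R u + \<delta> *\<^sub>R v) u - dir_deriv f (x + s *\<^sub>R u + 0 *\<^sub>R v) u = (\<delta> - 0) * ?g u v (x + s *\<^sub>R u + t *\<^sub>R v)"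
      using MVT2[OF \<delta>(1) dg] by blast
    have "f (x + \<delta> *\<^sub>R u + \<delta> *\<^sub>R v) - f (x + \<delta> *\<^sub>R u) - f (x + \<delta> *\<^sub>R v) + f x = \<phi> \<delta> - \<phi> 0"
      by (simp add: \<phi>_def)
    with s t show ?thesis by (intro exI[of _ s] exI[of _ t]) (simp add: algebra_simps)
  qed
  have cont: "continuous_on U (?g u v)" for u v
    using ck_on_continuous[OF ck_on_dir_deriv[OF U ck_on_dir_deriv[OF U f2]]] .
  show ?thesis
  proof (rule ccontr)
    assume ne: "?g u v x \<noteq> ?g v u x"
    define e where "e = \<bar>?g u v x - ?g v u x\<bar> / 2"
    have e: "e > 0" using ne by (simp add: e_def)
    have "isCont (?g u v) x" "isCont (?g v u) x"
      using cont U x continuous_on_eq_continuous_at by blast+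
    then obtain d1 d2 where d: "d1 > 0" "d2 > 0"
      and d1: "\<And>y. dist y x < d1 \<Longrightarrow> dist (?g u v y) (?g u v x) < e"
      and d2: "\<And>y. dist y x < d2 \<Longrightarrow> dist (?g v u y) (?g v u x) < e"
      using e unfolding continuous_at_eps_delta by metis
    define \<delta> where "\<delta> = min (c / 2) (min d1 d2 / (1 + norm u + norm v))"
    have pos: "1 + norm u + norm v > 0" by (auto intro!: add_pos_nonneg)
    have \<delta>: "0 < \<delta>" "\<delta> < c" using c0 d pos by (auto simp: \<delta>_def)
    have near: "dist (x + s *\<^sub>R u + t *\<^sub>R v) x < min d1 d2" if "0 < s" "s < \<delta>" "0 < t" "t < \<delta>" for s t
    proof -
      have "dist (x + s *\<^sub>R u + t *\<^sub>R v) x \<le> s * norm u + t * norm v"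
        using that norm_triangle_ineq[of "s *\<^sub>R u" "t *\<^sub>R v"] by (simp add: dist_norm algebra_simps)
      also have "\<dots> \<le> \<delta> * norm u + \<delta> * norm v" using that by (intro add_mono mult_right_mono) auto
      also have "\<dots> < \<delta> * (1 + norm u + norm v)" using \<delta> by (simp add: algebra_simps)
      also have "\<dots> \<le> min d1 d2" using pos unfolding \<delta>_def
        by (metis min.cobounded2 pos_le_divide_eq)
      finally show ?thesis .
    qed
    obtain s t where 1: "0 < s" "s < \<delta>" "0 < t" "t < \<delta>"
      "f (x + \<delta> *\<^sub>R u + \<delta> *\<^sub>R v) - f (x + \<delta> *\<^sub>R u) - f (x + \<delta> *\<^sub>R v) + f x = \<delta> * \<delta> * ?g u v (x + s *\<^sub>R u + t *\<^sub>R v)"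
      using key[OF \<delta> inU] by blast
    have "\<And>s t. \<bar>s\<bar> \<le> c \<Longrightarrow> \<bar>t\<bar> \<le> c \<Longrightarrow> x + s *\<^sub>R v + t *\<^sub>R u \<in> U" using inU by (metis add.assoc add.commute)
    then obtain s' t' where 2: "0 < s'" "s' < \<delta>" "0 < t'" "t' < \<delta>"
      "f (x + \<delta> *\<^sub>R v + \<delta> *\<^sub>R u) - f (x + \<delta> *\<^sub>R v) - f (x + \<delta> *\<^sub>R u) + f x = \<delta> * \<delta> * ?g v u (x + s' *\<^sub>R v + t' *\<^sub>R u)"
      using key[OF \<delta>, of v u] by blast
    have "f (x + \<delta> *\<^sub>R v + \<delta> *\<^sub>R u) - f (x + \<delta> *\<^sub>R v) - f (x + \<delta> *\<^sub>R u) + f x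
       = f (x + \<delta> *\<^sub>R u + \<delta> *\<^sub>R v) - f (x + \<delta> *\<^sub>R u) - f (x + \<delta> *\<^sub>R v) + f x"
      by (simp add: algebra_simps)
    then have "\<delta> * \<delta> * ?g u v (x + s *\<^sub>R u + t *\<^sub>R v) = \<delta> * \<delta> * ?g v u (x + s' *\<^sub>R v + t' *\<^sub>R u)"
      using 1(5) 2(5) by metis
    then have "?g u v (x + s *\<^sub>R u + t *\<^sub>R v) = ?g v u (x + s' *\<^sub>R v + t' *\<^sub>R u)" using \<delta> by simp
    moreover have "dist (?g u v (x + s *\<^sub>R u + t *\<^sub>R v)) (?g u v x) < e" using near[OF 1(1-4)] d1 by auto
    moreover have eq: "x + s' *\<^sub>R v + t' *\<^sub>R u = x + t' *\<^sub>R u + s' *\<^sub>R v" by simp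
    have "dist (?g v u (x + s' *\<^sub>R v + t' *\<^sub>R u)) (?g v u x) < e"
      unfolding eq by (rule d2) (use near[OF 2(3,4,1,2)] in auto)
    ultimately show False unfolding e_def dist_real_def by (auto simp: abs_if split: if_splits)
  qed
qed

lemma symmetric_second_derivative:
  fixes f :: "'a::real_normed_vector \<Rightarrow> 'b::euclidean_space"
  assumes U: "open U" and f: "ck_on 2 U f" and x: "x \<in> U"
  shows "dir_deriv (\<lambda>z. dir_deriv f z u) x v = dir_deriv (\<lambda>z. dir_deriv f z v) x u"
proof (rule euclidean_eqI)
  fix b :: 'b assume "b \<in> Basis"
  have f2: "ck_on (Suc (Suc 0)) U f" using f by (simp add: numeral_2_eq_2)
  have bl: "bounded_linear (\<lambda>x::'b. x \<bullet> b)" by (rule bounded_linear_inner_left)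
  have fb: "ck_on 2 U (\<lambda>x. f x \<bullet> b)" using ck_on_bounded_linear_comp[OF U bl f] .
  have d1: "dir_deriv (\<lambda>x. f x \<bullet> b) y w = dir_deriv f y w \<bullet> b" if "y \<in> U" for y w
    using dir_deriv_eq[OF bounded_linear.has_derivative[OF bl ck_on_has_derivative[OF U f2 that]]] by simp
  have d2: "dir_deriv (\<lambda>z. dir_deriv (\<lambda>x. f x \<bullet> b) z w) x w' = dir_deriv (\<lambda>z. dir_deriv f z w) x w' \<bullet> b" for w w'
  proof -
    have "dir_deriv (\<lambda>z. dir_deriv (\<lambda>x. f x \<bullet> b) z w) x = dir_deriv (\<lambda>z. dir_deriv f z w \<bullet> b) x"
      by (rule dir_deriv_cong_open[OF U x d1])
    then show ?thesis
      using dir_deriv_eq[OF bounded_linear.has_derivative[OF bl ck_on_has_derivative[OF U ck_on_dir_deriv[OF U f2] x]]] by simp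
  qed
  show "dir_deriv (\<lambda>z. dir_deriv f z u) x v \<bullet> b = dir_deriv (\<lambda>z. dir_deriv f z v) x u \<bullet> b"
    using symmetric_second_derivative_real[OF U fb x, of u v] by (simp add: d2)
qed

text \<open>Product rule for a bilinear map whose coefficients depend on a moving point
  \<open>F x\<close>, known to be differentiable only for fixed arguments. Over a basis it becomes a
  finite sum of ordinary products. It is applied to the metric and to the Christoffel symbols along
  a map.\<close>

lemma has_derivative_bilinear_family:
  fixes A :: "'p::real_normed_vector \<Rightarrow> 'b::euclidean_space" and B :: "'p \<Rightarrow> 'c::euclidean_space"
    and F :: "'p \<Rightarrow> 'y::real_normed_vector" and \<beta> :: "'y \<Rightarrow> 'b \<Rightarrow> 'c \<Rightarrow> 'd::euclidean_space"
  assumes U: "open U" "F p \<in> U" and F: "(F has_derivative F') (at p)"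
    and A: "(A has_derivative A') (at p)" and B: "(B has_derivative B') (at p)"
    and bil: "\<And>y. y \<in> U \<Longrightarrow> bilinear (\<beta> y)"
    and \<beta>: "\<And>u v. ((\<lambda>y. \<beta> y u v) has_derivative \<beta>' u v) (at (F p))"
  shows "((\<lambda>x. \<beta> (F x) (A x) (B x)) has_derivative
    (\<lambda>e. \<beta>' (A p) (B p) (F' e) + \<beta> (F p) (A' e) (B p) + \<beta> (F p) (A p) (B' e))) (at p)"
proof -
  have expand: "\<beta> y u v = (\<Sum>i\<in>Basis. \<Sum>j\<in>Basis. ((u \<bullet> i) * (v \<bullet> j)) *\<^sub>R \<beta> y i j)" if "y \<in> U" for y u v
  proof -
    have "\<beta> y u v = \<beta> y (\<Sum>i\<in>Basis. (u \<bullet> i) *\<^sub>R i) (\<Sum>j\<in>Basis. (v \<bullet> j) *\<^sub>R j)"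
      by (simp add: euclidean_representation)
    also have "\<dots> = (\<Sum>(i, j)\<in>Basis \<times> Basis. \<beta> y ((u \<bullet> i) *\<^sub>R i) ((v \<bullet> j) *\<^sub>R j))"
      by (rule bilinear_sum[OF bil[OF that]])
    also have "\<dots> = (\<Sum>i\<in>Basis. \<Sum>j\<in>Basis. ((u \<bullet> i) * (v \<bullet> j)) *\<^sub>R \<beta> y i j)"
      by (simp add: sum.cartesian_product bilinear_lmul[OF bil[OF that]] bilinear_rmul[OF bil[OF that]] mult.commute)
    finally show ?thesis .
  qed
  \<comment> \<open>The derivatives \<open>\<beta>' u v\<close> are given separately for each pair
    of arguments; uniqueness of derivatives makes them inherit the bilinear expansion.\<close>
  have expand': "\<beta>' u v = (\<lambda>e. \<Sum>i\<in>Basis. \<Sum>j\<in>Basis. ((u \<bullet> i) * (v \<bullet> j)) *\<^sub>R \<beta>' i j e)" for u v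
  proof -
    have "((\<lambda>y. \<Sum>i\<in>Basis. \<Sum>j\<in>Basis. ((u \<bullet> i) * (v \<bullet> j)) *\<^sub>R \<beta> y i j) has_derivative
      (\<lambda>e. \<Sum>i\<in>Basis. \<Sum>j\<in>Basis. ((u \<bullet> i) * (v \<bullet> j)) *\<^sub>R \<beta>' i j e)) (at (F p))"
      by (intro has_derivative_sum has_derivative_scaleR_right \<beta>)
    then have "((\<lambda>y. \<beta> y u v) has_derivative
      (\<lambda>e. \<Sum>i\<in>Basis. \<Sum>j\<in>Basis. ((u \<bullet> i) * (v \<bullet> j)) *\<^sub>R \<beta>' i j e)) (at (F p))"
      by (rule has_derivative_transform_within_open[OF _ U]) (simp add: expand)
    then show ?thesis using \<beta> has_derivative_unique by blast
  qed
  have der: "((\<lambda>x. \<Sum>i\<in>Basis. \<Sum>j\<in>Basis. ((A x \<bullet> i) * (B x \<bullet> j)) *\<^sub>R \<beta> (F x) i j) has_derivative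
    (\<lambda>e. \<Sum>i\<in>Basis. \<Sum>j\<in>Basis. ((A p \<bullet> i) * (B p \<bullet> j)) *\<^sub>R \<beta>' i j (F' e)
        + ((A p \<bullet> i) * (B' e \<bullet> j) + (A' e \<bullet> i) * (B p \<bullet> j)) *\<^sub>R \<beta> (F p) i j)) (at p)"
    by (intro has_derivative_sum has_derivative_scaleR has_derivative_mult has_derivative_inner_left A B
        has_derivative_compose[OF F \<beta>])
  have "((\<lambda>x. \<beta> (F x) (A x) (B x)) has_derivative
    (\<lambda>e. \<Sum>i\<in>Basis. \<Sum>j\<in>Basis. ((A p \<bullet> i) * (B p \<bullet> j)) *\<^sub>R \<beta>' i j (F' e)
        + ((A p \<bullet> i) * (B' e \<bullet> j) + (A' e \<bullet> i) * (B p \<bullet> j)) *\<^sub>R \<beta> (F p) i j)) (at p)"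
  proof (rule has_derivative_transform_eventually[OF der])
    have "isCont F p" using F has_derivative_continuous by blast
    then have "\<forall>\<^sub>F x in at p. F x \<in> U" using U by (metis isContD topological_tendstoD)
    then show "\<forall>\<^sub>F x in at p. (\<Sum>i\<in>Basis. \<Sum>j\<in>Basis. ((A x \<bullet> i) * (B x \<bullet> j)) *\<^sub>R \<beta> (F x) i j) = \<beta> (F x) (A x) (B x)"
    proof eventually_elim
      case (elim x)
      show ?case by (rule expand[OF elim, symmetric])
    qed
    show "(\<Sum>i\<in>Basis. \<Sum>j\<in>Basis. ((A p \<bullet> i) * (B p \<bullet> j)) *\<^sub>R \<beta> (F p) i j) = \<beta> (F p) (A p) (B p)"
      by (rule expand[OF U(2), symmetric])
  qed auto
  moreover have "(\<lambda>e. \<Sum>i\<in>Basis. \<Sum>j\<in>Basis. ((A p \<bullet> i) * (B p \<bullet> j)) *\<^sub>R \<beta>' i j (F' e)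
        + ((A p \<bullet> i) * (B' e \<bullet> j) + (A' e \<bullet> i) * (B p \<bullet> j)) *\<^sub>R \<beta> (F p) i j)
    = (\<lambda>e. \<beta>' (A p) (B p) (F' e) + \<beta> (F p) (A' e) (B p) + \<beta> (F p) (A p) (B' e))"
  proof
    fix e
    show "(\<Sum>i\<in>Basis. \<Sum>j\<in>Basis. ((A p \<bullet> i) * (B p \<bullet> j)) *\<^sub>R \<beta>' i j (F' e)
        + ((A p \<bullet> i) * (B' e \<bullet> j) + (A' e \<bullet> i) * (B p \<bullet> j)) *\<^sub>R \<beta> (F p) i j)
      = \<beta>' (A p) (B p) (F' e) + \<beta> (F p) (A' e) (B p) + \<beta> (F p) (A p) (B' e)"
      unfolding expand[OF U(2), of "A' e" "B p"] expand[OF U(2), of "A p" "B' e"]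
      by (subst expand'[of "A p" "B p"]) (simp add: scaleR_add_left sum.distrib add_ac)
  qed
  ultimately show ?thesis by simp
qed

lemma has_derivative_linear_family:
  fixes A :: "'p::real_normed_vector \<Rightarrow> 'b::euclidean_space"
    and F :: "'p \<Rightarrow> 'y::real_normed_vector" and \<beta> :: "'y \<Rightarrow> 'b \<Rightarrow> 'd::euclidean_space"
  assumes U: "open U" "F p \<in> U" and F: "(F has_derivative F') (at p)"
    and A: "(A has_derivative A') (at p)"
    and lin: "\<And>y. y \<in> U \<Longrightarrow> linear (\<beta> y)"
    and \<beta>: "\<And>u. ((\<lambda>y. \<beta> y u) has_derivative \<beta>' u) (at (F p))"
  shows "((\<lambda>x. \<beta> (F x) (A x)) has_derivative (\<lambda>e. \<beta>' (A p) (F' e) + \<beta> (F p) (A' e))) (at p)"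
proof -
  \<comment> \<open>A linear family is the bilinear case with a dummy scalar argument that is held
    equal to 1.\<close>
  have bil: "bilinear (\<lambda>u r::real. r *\<^sub>R \<beta> y u)" if "y \<in> U" for y
    unfolding bilinear_def using lin[OF that]
    by (auto intro!: linearI simp: linear_add linear_scale scaleR_add_right scaleR_add_left)
  show ?thesis
    using has_derivative_bilinear_family[where \<beta>="\<lambda>y u r::real. r *\<^sub>R \<beta> y u" and B="\<lambda>_. 1",
        OF U F A has_derivative_const bil has_derivative_scaleR_right[OF \<beta>]] by simp
qed

text \<open>The second term, with the second derivative of the inner map, is the one that the
  Christoffel correction of a Hessian has to absorb. The formula serves three inner maps: chart
  transitions, the immersion of \<open>S\<close>, and variations through rays.\<close>

lemma second_derivative_compose:
  fixes f :: "'b::euclidean_space \<Rightarrow> 'c::euclidean_space" and \<phi> :: "'a::real_normed_vector \<Rightarrow> 'b"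
  assumes "open U" "y \<in> U" "ck_on 2 U \<phi>" "open V" "\<phi> ` U \<subseteq> V" "ck_on 2 V f"
  shows "dir_deriv (\<lambda>z. dir_deriv (\<lambda>x. f (\<phi> x)) z u) y v =
    dir_deriv (\<lambda>w. dir_deriv f w (dir_deriv \<phi> y u)) (\<phi> y) (dir_deriv \<phi> y v)
    + dir_deriv f (\<phi> y) (dir_deriv (\<lambda>z. dir_deriv \<phi> z u) y v)"
proof -
  have \<phi>2: "ck_on (Suc (Suc 0)) U \<phi>" and f2: "ck_on (Suc (Suc 0)) V f" using assms by (simp_all add: numeral_2_eq_2)
  have df: "(f has_derivative dir_deriv f z) (at z)" if "z \<in> V" for z
    by (rule ck_on_has_derivative[OF assms(4) f2 that])
  have d1: "dir_deriv (\<lambda>x. f (\<phi> x)) z u = dir_deriv f (\<phi> z) (dir_deriv \<phi> z u)" if "z \<in> U" for z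
    by (rule dir_deriv_compose[OF ck_on_has_derivative[OF assms(1) \<phi>2 that] df]) (use assms(5) that in auto)
  have "((\<lambda>z. dir_deriv f (\<phi> z) (dir_deriv \<phi> z u)) has_derivative
    (\<lambda>v. dir_deriv (\<lambda>w. dir_deriv f w (dir_deriv \<phi> y u)) (\<phi> y) (dir_deriv \<phi> y v)
    + dir_deriv f (\<phi> y) (dir_deriv (\<lambda>z. dir_deriv \<phi> z u) y v))) (at y)"
  proof (rule has_derivative_linear_family[where F=\<phi> and \<beta>="dir_deriv f"
        and \<beta>'="\<lambda>u. dir_deriv (\<lambda>w. dir_deriv f w u) (\<phi> y)", OF assms(4)])
    show y: "\<phi> y \<in> V" using assms by auto
    show "((\<lambda>w. dir_deriv f w u) has_derivative dir_deriv (\<lambda>w. dir_deriv f w u) (\<phi> y)) (at (\<phi> y))" for u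
      by (rule ck_on_has_derivative[OF assms(4) ck_on_dir_deriv[OF assms(4) f2] y])
    show "linear (dir_deriv f z)" if "z \<in> V" for z by (rule has_derivative_linear[OF df[OF that]])
    show "(\<phi> has_derivative dir_deriv \<phi> y) (at y)" by (rule ck_on_has_derivative[OF assms(1) \<phi>2 assms(2)])
    show "((\<lambda>z. dir_deriv \<phi> z u) has_derivative dir_deriv (\<lambda>z. dir_deriv \<phi> z u) y) (at y)"
      by (rule ck_on_has_derivative[OF assms(1) ck_on_dir_deriv[OF assms(1) \<phi>2] assms(2)])
  qed
  then have "((\<lambda>z. dir_deriv (\<lambda>x. f (\<phi> x)) z u) has_derivative
    (\<lambda>v. dir_deriv (\<lambda>w. dir_deriv f w (dir_deriv \<phi> y u)) (\<phi> y) (dir_deriv \<phi> y v)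
    + dir_deriv f (\<phi> y) (dir_deriv (\<lambda>z. dir_deriv \<phi> z u) y v))) (at y)"
    by (rule has_derivative_transform_within_open[OF _ assms(1,2)]) (simp add: d1)
  then show ?thesis by (simp add: dir_deriv_eq)
qed

text \<open>Jacobi's formula at the identity. Only the identity permutation contributes: any other
  one moves at least two indices, so after differentiating one factor an off-diagonal entry of the
  identity matrix still remains in the product.\<close>

lemma has_derivative_det_at_id:
  fixes C :: "'a::real_normed_vector \<Rightarrow> real ^ 'm ^ 'm"
  assumes C: "(C has_derivative C') (at y)" and id: "C y = mat 1"
  shows "((\<lambda>y. det (C y)) has_derivative (\<lambda>e. \<Sum>i\<in>UNIV. C' e $ i $ i)) (at y)"
proof -
  have entry: "((\<lambda>y. C y $ i $ j) has_derivative (\<lambda>e. C' e $ i $ j)) (at y)" for i j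
    by (rule bounded_linear.has_derivative[OF bounded_linear_vec_nth bounded_linear.has_derivative[OF bounded_linear_vec_nth C]])
  have "((\<lambda>y. det (C y)) has_derivative (\<lambda>e. \<Sum>p | p permutes UNIV. of_int (sign p) *
      (\<Sum>i\<in>UNIV. C' e $ i $ p i * (\<Prod>j\<in>UNIV - {i}. C y $ j $ p j)))) (at y)"
    unfolding det_def
    by (intro has_derivative_sum has_derivative_mult_right has_derivative_prod entry)
  moreover have "(\<Sum>p | p permutes (UNIV::'m set). of_int (sign p) *
      (\<Sum>i\<in>UNIV. C' e $ i $ p i * (\<Prod>j\<in>UNIV - {i}. C y $ j $ p j))) = (\<Sum>i\<in>UNIV. C' e $ i $ i)" for e
  proof -
    have zero: "(\<Prod>j\<in>UNIV - {i}. C y $ j $ p j) = 0" if p: "p permutes (UNIV::'m set)" "p \<noteq> id" for p i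
    proof -
      obtain j where j: "p j \<noteq> j" using p(2) by (auto simp: fun_eq_iff)
      then have j': "p (p j) \<noteq> p j" using permutes_inj[OF p(1)] by (auto dest: injD)
      obtain l where "l \<noteq> i" "p l \<noteq> l" using j j' by metis
      then show ?thesis by (intro prod_zero) (auto intro!: bexI[of _ l] simp: id mat_def)
    qed
    have "(\<Sum>p | p permutes (UNIV::'m set). of_int (sign p) *
      (\<Sum>i\<in>UNIV. C' e $ i $ p i * (\<Prod>j\<in>UNIV - {i}. C y $ j $ p j)))
      = (\<Sum>p | p permutes (UNIV::'m set). if p = id then (\<Sum>i\<in>UNIV. C' e $ i $ i) else 0)"
    proof (intro sum.cong refl)
      fix p :: "'m \<Rightarrow> 'm" assume "p \<in> {p. p permutes UNIV}"
      then have p: "p permutes UNIV" by simp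
      show "of_int (sign p) * (\<Sum>i\<in>UNIV. C' e $ i $ p i * (\<Prod>j\<in>UNIV - {i}. C y $ j $ p j)) =
         (if p = id then \<Sum>i\<in>UNIV. C' e $ i $ i else 0)"
      proof (cases "p = id")
        case True then show ?thesis by (simp add: sign_id id mat_def)
      next
        case False then show ?thesis
          by (simp only: zero[OF p False] mult_zero_right sum.neutral_const if_False)
      qed
    qed
    also have "\<dots> = (\<Sum>i\<in>UNIV. C' e $ i $ i)"
      by (simp add: finite_permutations permutes_id)
    finally show ?thesis .
  qed
  ultimately show ?thesis by simp
qed

section \<open>Riemannian metrics in charts\<close>

definition cimg :: "('a, 'm::finite) chart \<Rightarrow> (real ^ 'm) set" where
  "cimg c = cmap c ` cdom c"

definition dgram :: "('a, 'm::finite) riem \<Rightarrow> ('a, 'm::finite) chart \<Rightarrow> real ^ 'm \<Rightarrow> real ^ 'm \<Rightarrow> real ^ 'm \<Rightarrow> real ^ 'm \<Rightarrow> real" where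
  "dgram M c y e u v = u \<bullet> (dir_deriv (gram M c) y e *v v)"

definition chart_grad :: "('a, 'm::finite) riem \<Rightarrow> ('a, 'm::finite) chart \<Rightarrow> (real ^ 'm \<Rightarrow> real) \<Rightarrow> real ^ 'm \<Rightarrow> real ^ 'm" where
  "chart_grad M c f y = matrix_inv (gram M c y) *v (\<chi> k. dir_deriv f y (axis k 1))"

text \<open>The covariant Hessian v(u f) - df(\<nabla>_u v), evaluated on fields that are constant
  in the chart.\<close>

definition chart_hess :: "('a, 'm::finite) riem \<Rightarrow> ('a, 'm::finite) chart \<Rightarrow> (real ^ 'm \<Rightarrow> real) \<Rightarrow> real ^ 'm \<Rightarrow> real ^ 'm \<Rightarrow> real ^ 'm \<Rightarrow> real" where
  "chart_hess M c f y u v = dir_deriv (\<lambda>z. dir_deriv f z u) y v - dir_deriv f y (christoffel M c y u v)"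

lemma matrix_inv_right:
  fixes A :: "real ^ 'm ^ 'm"
  assumes "invertible A"
  shows "A ** matrix_inv A = mat 1" "matrix_inv A ** A = mat 1"
proof -
  have "\<exists>B. A ** B = mat 1 \<and> B ** A = mat 1" using assms by (simp add: invertible_def)
  from someI_ex[OF this] show "A ** matrix_inv A = mat 1" "matrix_inv A ** A = mat 1"
    by (simp_all add: matrix_inv_def)
qed

lemma bounded_linear_matrix_left: "bounded_linear (\<lambda>A::real ^ 'm ^ 'n. A *v v)"
  unfolding linear_conv_bounded_linear[symmetric]
  by (rule linearI) (simp_all add: matrix_vector_mult_add_rdistrib scaleR_matrix_vector_assoc)

lemma linear_axis_expand:
  fixes v :: "real ^ 'm" assumes "linear L"
  shows "L v = (\<Sum>k\<in>UNIV. (v $ k) *\<^sub>R L (axis k 1))"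
proof -
  have "L v = L (\<Sum>k\<in>UNIV. (v $ k) *\<^sub>R axis k 1)"
    by (metis basis_expansion scalar_mult_eq_scaleR)
  then show ?thesis using assms by (simp add: linear_sum linear_scale)
qed

locale riemannian =
  fixes M :: "('a::{t2_space, second_countable_topology}, 'm::finite) riem"
  assumes riem: "riemannian_manifold M"
begin

lemma atlasD:
  assumes "c \<in> atlas M"
  shows "open (cdom c)" "open (cimg c)" "homeomorphism (cdom c) (cimg c) (cmap c) (cinv c)"
  using riem assms unfolding riemannian_manifold_def smooth_atlas_def cimg_def by blast+

lemma charts_cover: "\<exists>c\<in>atlas M. x \<in> cdom c"
proof -
  have "(\<Union>c\<in>atlas M. cdom c) = UNIV"
    using riem unfolding riemannian_manifold_def smooth_atlas_def by blast
  then show ?thesis by blast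
qed

lemma chart_at: "chart_at M x \<in> atlas M" "x \<in> cdom (chart_at M x)"
proof -
  have "\<exists>c. c \<in> atlas M \<and> x \<in> cdom c" using charts_cover by blast
  from someI_ex[OF this] show "chart_at M x \<in> atlas M" "x \<in> cdom (chart_at M x)"
    by (simp_all add: chart_at_def)
qed

lemma cmap_cinv: "c \<in> atlas M \<Longrightarrow> y \<in> cimg c \<Longrightarrow> cmap c (cinv c y) = y"
  using atlasD(3) by (simp add: homeomorphism_def)
lemma cinv_cmap: "c \<in> atlas M \<Longrightarrow> x \<in> cdom c \<Longrightarrow> cinv c (cmap c x) = x"
  using atlasD(3) by (simp add: homeomorphism_def)
lemma cinv_in: "c \<in> atlas M \<Longrightarrow> y \<in> cimg c \<Longrightarrow> cinv c y \<in> cdom c"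
  using atlasD(3)[of c] unfolding homeomorphism_def by blast
lemma cmap_in: "x \<in> cdom c \<Longrightarrow> cmap c x \<in> cimg c"
  by (simp add: cimg_def)
lemma continuous_cmap: "c \<in> atlas M \<Longrightarrow> continuous_on (cdom c) (cmap c)"
  using atlasD(3) by (simp add: homeomorphism_def)
lemma continuous_cinv: "c \<in> atlas M \<Longrightarrow> continuous_on (cimg c) (cinv c)"
  using atlasD(3) by (simp add: homeomorphism_def)

lemma open_cmap_image:
  assumes "c \<in> atlas M" "open V"
  shows "open (cmap c ` (cdom c \<inter> V))"
proof -
  have "cmap c ` (cdom c \<inter> V) = cimg c \<inter> cinv c -` V"
  proof (intro equalityI subsetI)
    fix y assume "y \<in> cmap c ` (cdom c \<inter> V)"
    then show "y \<in> cimg c \<inter> cinv c -` V" using cinv_cmap[OF assms(1)] unfolding cimg_def by auto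
  next
    fix y assume y: "y \<in> cimg c \<inter> cinv c -` V"
    then show "y \<in> cmap c ` (cdom c \<inter> V)"
      using cmap_cinv[OF assms(1), of y] cinv_in[OF assms(1), of y] by (intro image_eqI[of _ _ "cinv c y"]) auto
  qed
  then show ?thesis
    using continuous_open_preimage[OF continuous_cinv[OF assms(1)] atlasD(2)[OF assms(1)] assms(2)] by simp
qed

lemma gram_smooth: "c \<in> atlas M \<Longrightarrow> ck_on k (cimg c) (gram M c)"
  using riem unfolding riemannian_manifold_def cimg_def by (intro smooth_on_ck) blast

lemma gram_sym:
  assumes "c \<in> atlas M" "y \<in> cimg c" shows "transpose (gram M c y) = gram M c y"
  using riem assms unfolding riemannian_manifold_def cimg_def by blast

lemma ginner_pos: "c \<in> atlas M \<Longrightarrow> y \<in> cimg c \<Longrightarrow> v \<noteq> 0 \<Longrightarrow> ginner M c y v v > 0"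
  using riem unfolding riemannian_manifold_def cimg_def by blast

lemma ginner_nonneg: "c \<in> atlas M \<Longrightarrow> y \<in> cimg c \<Longrightarrow> ginner M c y v v \<ge> 0"
  using ginner_pos[of c y v] by (cases "v = 0") (auto simp: ginner_def)

lemma ginner_sym:
  assumes "c \<in> atlas M" "y \<in> cimg c"
  shows "ginner M c y u v = ginner M c y v u"
  unfolding ginner_def using gram_sym[OF assms]
  by (metis dot_lmul_matrix inner_commute vector_transpose_matrix)

lemma bilinear_ginner: "bilinear (ginner M c y)"
  unfolding bilinear_def ginner_def
  by (auto intro!: linearI simp: inner_left_distrib inner_right_distrib matrix_vector_right_distrib
      matrix_vector_mult_scaleR)

lemma ginner_smooth:
  assumes "c \<in> atlas M" shows "ck_on k (cimg c) (\<lambda>y. ginner M c y u v)"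
  unfolding ginner_def
  by (intro ck_on_inner ck_on_const atlasD(2)[OF assms]
      ck_on_bounded_linear_comp[OF _ bounded_linear_matrix_left gram_smooth] assms)

lemma gram_has_derivative:
  assumes "c \<in> atlas M" "y \<in> cimg c"
  shows "(gram M c has_derivative dir_deriv (gram M c) y) (at y)"
  by (rule ck_on_has_derivative[OF atlasD(2)[OF assms(1)] gram_smooth[OF assms(1)] assms(2)])

lemma ginner_has_derivative:
  assumes "c \<in> atlas M" "y \<in> cimg c"
  shows "((\<lambda>y. ginner M c y u v) has_derivative (\<lambda>e. dgram M c y e u v)) (at y)"
  unfolding ginner_def dgram_def
  by (rule bounded_linear.has_derivative[OF bounded_linear_inner_right
        bounded_linear.has_derivative[OF bounded_linear_matrix_left gram_has_derivative[OF assms]]])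

lemma dgram_eq:
  assumes "c \<in> atlas M" "y \<in> cimg c"
  shows "dir_deriv (\<lambda>y. ginner M c y u v) y e = dgram M c y e u v"
  using dir_deriv_eq[OF ginner_has_derivative[OF assms]] by simp

lemma dgram_linear:
  assumes "c \<in> atlas M" "y \<in> cimg c"
  shows "linear (\<lambda>e. dgram M c y e u v)" "linear (\<lambda>u. dgram M c y e u v)" "linear (\<lambda>v. dgram M c y e u v)"
  using has_derivative_linear[OF ginner_has_derivative[OF assms]]
  by (auto intro!: linearI simp: dgram_def inner_left_distrib inner_right_distrib matrix_vector_right_distrib
      matrix_vector_mult_scaleR)

lemma dgram_sym:
  assumes "c \<in> atlas M" "y \<in> cimg c"
  shows "dgram M c y e u v = dgram M c y e v u"
proof -
  have "dir_deriv (\<lambda>y. ginner M c y u v) y = dir_deriv (\<lambda>y. ginner M c y v u) y"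
    by (rule dir_deriv_cong_open[OF atlasD(2)[OF assms(1)] assms(2)]) (rule ginner_sym[OF assms(1)])
  then show ?thesis using dgram_eq[OF assms] by metis
qed

lemma ginner_nondeg:
  assumes "c \<in> atlas M" "y \<in> cimg c" "\<And>k. ginner M c y u k = ginner M c y v k"
  shows "u = v"
proof (rule ccontr)
  assume "u \<noteq> v"
  then have "ginner M c y (u - v) (u - v) > 0" by (intro ginner_pos assms) simp
  moreover have "ginner M c y (u - v) (u - v) = 0"
    using assms(3)[of "u - v"] by (simp add: bilinear_lsub[OF bilinear_ginner])
  ultimately show False by simp
qed

lemma gram_invertible:
  assumes "c \<in> atlas M" "y \<in> cimg c" shows "invertible (gram M c y)"
proof -
  have "x = 0" if "gram M c y *v x = 0" for x
    using ginner_pos[OF assms, of x] that by (auto simp: ginner_def)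
  then show ?thesis by (simp add: invertible_left_inverse matrix_left_invertible_ker)
qed

lemma gram_inv_mult:
  assumes "c \<in> atlas M" "y \<in> cimg c"
  shows "gram M c y *v (matrix_inv (gram M c y) *v b) = b"
  using matrix_inv_right(1)[OF gram_invertible[OF assms]] by (simp add: matrix_vector_mul_assoc)

text \<open>Raising an index: the inverse Gram matrix turns a covector into the vector that
  represents it. The formulas for \<open>gradient\<close> and for \<open>christoffel\<close> are
  both instances.\<close>

lemma ginner_gram_inv:
  assumes "c \<in> atlas M" "y \<in> cimg c" "linear L"
  shows "ginner M c y (matrix_inv (gram M c y) *v (\<chi> k. L (axis k 1))) v = L v"
proof -
  have "ginner M c y (matrix_inv (gram M c y) *v (\<chi> k. L (axis k 1))) v = v \<bullet> (\<chi> k. L (axis k 1))"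
    by (subst ginner_sym[OF assms(1,2)]) (simp add: ginner_def gram_inv_mult[OF assms(1,2)])
  also have "\<dots> = L v" by (subst linear_axis_expand[OF assms(3), of v]) (simp add: inner_vec_def)
  finally show ?thesis .
qed

text \<open>The covector of which \<open>christoffel\<close> is the raised form. Identities are
  proved for it and transferred by nondegeneracy of the metric, which keeps the inverse matrix out
  of the computations.\<close>

definition koszul :: "('a, 'm) chart \<Rightarrow> real ^ 'm \<Rightarrow> real ^ 'm \<Rightarrow> real ^ 'm \<Rightarrow> real ^ 'm \<Rightarrow> real" where
  "koszul c y u v k = (dgram M c y u v k + dgram M c y v u k - dgram M c y k u v) / 2"

lemma koszul_linear:
  assumes "c \<in> atlas M" "y \<in> cimg c"
  shows "linear (koszul c y u v)" "linear (\<lambda>u. koszul c y u v k)" "linear (\<lambda>v. koszul c y u v k)"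
  unfolding koszul_def
  by (auto intro!: linearI simp: dgram_linear[OF assms, THEN linear_add] dgram_linear[OF assms, THEN linear_scale]
      algebra_simps add_divide_distrib diff_divide_distrib)

lemma christoffel_koszul:
  assumes "c \<in> atlas M" "y \<in> cimg c"
  shows "ginner M c y (christoffel M c y u v) k = koszul c y u v k"
  unfolding christoffel_def dgram_eq[OF assms]
  using ginner_gram_inv[OF assms koszul_linear(1)[OF assms]] by (simp add: koszul_def)

lemma christoffel_sym:
  assumes "c \<in> atlas M" "y \<in> cimg c"
  shows "christoffel M c y u v = christoffel M c y v u"
  by (rule ginner_nondeg[OF assms]) (simp add: christoffel_koszul[OF assms] koszul_def dgram_sym[OF assms, of _ u v])

lemma bilinear_christoffel:
  assumes "c \<in> atlas M" "y \<in> cimg c"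
  shows "bilinear (christoffel M c y)"
  unfolding bilinear_def
  by (auto intro!: linearI ginner_nondeg[OF assms] simp: christoffel_koszul[OF assms] bilinear_ladd[OF bilinear_ginner]
      bilinear_lmul[OF bilinear_ginner] koszul_linear[OF assms, THEN linear_add] koszul_linear[OF assms, THEN linear_scale])

lemma metric_compatible:
  assumes "c \<in> atlas M" "y \<in> cimg c"
  shows "dgram M c y e u v = ginner M c y (christoffel M c y e u) v + ginner M c y u (christoffel M c y e v)"
  unfolding ginner_sym[OF assms, of u] christoffel_koszul[OF assms] koszul_def
  using dgram_sym[OF assms] by (simp add: field_simps)

text \<open>Cramer's rule writes the solution as a quotient of determinants, so smoothness follows
  from that of polynomials and of division, without differentiating matrix inversion.\<close>

lemma gram_solve_smooth:
  assumes "c \<in> atlas M" "open U" "U \<subseteq> cimg c" "\<And>i. ck_on k U (b i)"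
  shows "ck_on k U (\<lambda>y. matrix_inv (gram M c y) *v (\<chi> i. b i y))"
proof (rule ck_on_cong[OF assms(2)])
  let ?A = "\<lambda>y k. \<chi> i j. if j = k then b i y else gram M c y $ i $ j"
  have det0: "det (gram M c y) \<noteq> 0" if "y \<in> U" for y
    using gram_invertible[OF assms(1)] that assms(3) invertible_det_nz by blast
  show "(\<chi> k. det (?A y k) / det (gram M c y)) = matrix_inv (gram M c y) *v (\<chi> i. b i y)" if "y \<in> U" for y
    using cramer[OF det0[OF that], of "matrix_inv (gram M c y) *v (\<chi> i. b i y)" "\<chi> i. b i y"]
      gram_inv_mult[OF assms(1)] that assms(3) by (auto cong: if_cong)
  have g: "ck_on k U (gram M c)"
    using ck_on_open_subset[OF gram_smooth atlasD(2)] assms by blast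
  have "ck_on k U (\<lambda>y. if j = l then b i y else gram M c y $ i $ j)" for i j l
    using assms(4) ck_on_vec_nth[OF assms(2) ck_on_vec_nth[OF assms(2) g]] by (cases "j = l") simp_all
  then show "ck_on k U (\<lambda>y. \<chi> k. det (?A y k) / det (gram M c y))"
    by (intro ck_on_vec_lambda ck_on_divide ck_on_det assms(2) g det0)
qed

lemma dgram_smooth:
  assumes "c \<in> atlas M" shows "ck_on k (cimg c) (\<lambda>y. dgram M c y e u v)"
  unfolding dgram_def
  by (intro ck_on_inner ck_on_const atlasD(2)[OF assms]
      ck_on_bounded_linear_comp[OF _ bounded_linear_matrix_left ck_on_dir_deriv[OF _ gram_smooth]] assms)

lemma christoffel_smooth:
  assumes "c \<in> atlas M" shows "ck_on k (cimg c) (\<lambda>y. christoffel M c y u v)"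
proof (rule ck_on_cong[OF atlasD(2)[OF assms]])
  have "ck_on k (cimg c) (\<lambda>y. (1/2) * (dgram M c y u v l + dgram M c y v u l - dgram M c y l u v))" for l
    by (intro ck_on_mult ck_on_const ck_on_diff ck_on_add dgram_smooth atlasD(2) assms)
  then show "ck_on k (cimg c) (\<lambda>y. matrix_inv (gram M c y) *v (\<chi> l. koszul c y u v (axis l 1)))"
    by (intro gram_solve_smooth assms atlasD(2) order_refl) (simp add: koszul_def)
  show "matrix_inv (gram M c y) *v (\<chi> l. koszul c y u v (axis l 1)) = christoffel M c y u v"
    if "y \<in> cimg c" for y unfolding christoffel_def dgram_eq[OF assms that] koszul_def ..
qed

lemma chart_grad:
  assumes "c \<in> atlas M" "y \<in> cimg c" "(f has_derivative f') (at y)"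
  shows "ginner M c y (chart_grad M c f y) v = f' v"
  unfolding chart_grad_def dir_deriv_eq[OF assms(3)]
  by (rule ginner_gram_inv[OF assms(1,2) has_derivative_linear[OF assms(3)]])

lemma chart_grad_smooth:
  assumes "c \<in> atlas M" "open U" "U \<subseteq> cimg c" "ck_on (Suc k) U f"
  shows "ck_on k U (chart_grad M c f)"
  unfolding chart_grad_def
  by (rule gram_solve_smooth[OF assms(1-3) ck_on_dir_deriv[OF assms(2,4)]])

subsection \<open>Change of charts\<close>

lemma transition_smooth:
  assumes "c \<in> atlas M" "d \<in> atlas M"
  shows "ck_on k (cmap c ` (cdom c \<inter> cdom d)) (cmap d \<circ> cinv c)"
  using riem assms unfolding riemannian_manifold_def smooth_atlas_def by (intro smooth_on_ck) blast

lemma open_overlap: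
  assumes "c \<in> atlas M" "d \<in> atlas M" shows "open (cmap c ` (cdom c \<inter> cdom d))"
  by (rule open_cmap_image[OF assms(1) atlasD(1)[OF assms(2)]])

lemma transition_has_derivative:
  assumes "c \<in> atlas M" "d \<in> atlas M" "x \<in> cdom c" "x \<in> cdom d"
  shows "((cmap d \<circ> cinv c) has_derivative dir_deriv (cmap d \<circ> cinv c) (cmap c x)) (at (cmap c x))"
  by (rule ck_on_has_derivative[OF open_overlap[OF assms(1,2)] transition_smooth[OF assms(1,2)]])
    (use assms(3,4) in blast)

lemma ginner_transition:
  assumes "c \<in> atlas M" "d \<in> atlas M" "x \<in> cdom c" "x \<in> cdom d"
  shows "ginner M c (cmap c x) u v = ginner M d (cmap d x)
    (dir_deriv (cmap d \<circ> cinv c) (cmap c x) u) (dir_deriv (cmap d \<circ> cinv c) (cmap c x) v)"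
  using riem assms unfolding riemannian_manifold_def by blast

lemma has_derivative_change_chart:
  assumes "c \<in> atlas M" "d \<in> atlas M" "\<phi> z \<in> cdom c" "\<phi> z \<in> cdom d"
    and L: "((cmap c \<circ> \<phi>) has_derivative L) (at z)"
    and ev: "\<forall>\<^sub>F z' in at z. \<phi> z' \<in> cdom c"
  shows "((cmap d \<circ> \<phi>) has_derivative (\<lambda>e. dir_deriv (cmap d \<circ> cinv c) (cmap c (\<phi> z)) (L e))) (at z)"
proof (rule has_derivative_transform_eventually)
  show "((\<lambda>z. (cmap d \<circ> cinv c) ((cmap c \<circ> \<phi>) z)) has_derivative
      (\<lambda>e. dir_deriv (cmap d \<circ> cinv c) (cmap c (\<phi> z)) (L e))) (at z)"
    using has_derivative_compose[OF L, of "cmap d \<circ> cinv c"] transition_has_derivative[OF assms(1-4)] by simp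
  show "\<forall>\<^sub>F z' in at z. (cmap d \<circ> cinv c) ((cmap c \<circ> \<phi>) z') = (cmap d \<circ> \<phi>) z'"
    using ev by eventually_elim (simp add: cinv_cmap[OF assms(1)])
qed (simp_all add: cinv_cmap[OF assms(1)] assms)

lemma transition_inverse:
  assumes "c \<in> atlas M" "d \<in> atlas M" "x \<in> cdom c" "x \<in> cdom d"
  shows "dir_deriv (cmap d \<circ> cinv c) (cmap c x) (dir_deriv (cmap c \<circ> cinv d) (cmap d x) v) = v"
proof -
  have 1: "\<forall>\<^sub>F y in at (cmap d x). cinv d y \<in> cdom c \<inter> cdom d"
  proof -
    have "open (cmap d ` (cdom d \<inter> cdom c))" using open_overlap assms by blast
    then have "\<forall>\<^sub>F y in at (cmap d x). y \<in> cmap d ` (cdom d \<inter> cdom c)"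
      by (rule eventually_at_in_open') (use assms in blast)
    then show ?thesis by eventually_elim (use cinv_cmap[OF assms(2)] in auto)
  qed
  have "((cmap d \<circ> cinv d) has_derivative (\<lambda>e. dir_deriv (cmap d \<circ> cinv c) (cmap c (cinv d (cmap d x)))
      (dir_deriv (cmap c \<circ> cinv d) (cmap d x) e))) (at (cmap d x))"
    by (rule has_derivative_change_chart[OF assms(1,2) _ _ transition_has_derivative[OF assms(2,1,4,3)]])
      (use 1 cinv_cmap[OF assms(2,4)] assms in \<open>auto elim: eventually_mono\<close>)
  moreover have "((cmap d \<circ> cinv d) has_derivative (\<lambda>e. e)) (at (cmap d x))"
    by (rule has_derivative_transform_within_open[OF has_derivative_ident atlasD(2)[OF assms(2)] cmap_in[OF assms(4)]])
      (simp add: cmap_cinv[OF assms(2)])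
  ultimately show ?thesis using has_derivative_unique cinv_cmap[OF assms(2,4)] by metis
qed


text \<open>The invariance of the metric under the transition is differentiated and inserted in the
  Koszul formula. Of the six second-derivative terms, symmetry of mixed derivatives cancels all but
  the one in the directions \<open>u\<close> and \<open>v\<close>.\<close>

lemma christoffel_transition:
  assumes "c \<in> atlas M" "d \<in> atlas M" "x \<in> cdom c" "x \<in> cdom d"
  defines "\<tau> \<equiv> cmap d \<circ> cinv c"
  shows "dir_deriv \<tau> (cmap c x) (christoffel M c (cmap c x) u v) =
    christoffel M d (cmap d x) (dir_deriv \<tau> (cmap c x) u) (dir_deriv \<tau> (cmap c x) v)
    + dir_deriv (\<lambda>z. dir_deriv \<tau> z u) (cmap c x) v"
proof -
  let ?W = "cmap c ` (cdom c \<inter> cdom d)" and ?y = "cmap c x"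
  let ?A = "dir_deriv \<tau> ?y" and ?D = "\<lambda>u e. dir_deriv (\<lambda>z. dir_deriv \<tau> z u) ?y e"
  have W: "open ?W" by (rule open_overlap[OF assms(1,2)])
  have yW: "?y \<in> ?W" using assms(3,4) by blast
  have ck: "ck_on k ?W \<tau>" for k unfolding \<tau>_def by (rule transition_smooth[OF assms(1,2)])
  have yd: "cmap d x \<in> cimg d" and yc: "?y \<in> cimg c" by (intro cmap_in assms(3,4))+
  have \<tau>y: "\<tau> ?y = cmap d x" using assms by (simp add: \<tau>_def cinv_cmap)
  have ck2: "ck_on 2 ?W \<tau>" by (rule ck)
  note symD = symmetric_second_derivative[OF W ck2 yW]
  have dD: "((\<lambda>z. dir_deriv \<tau> z u) has_derivative ?D u) (at ?y)" for u
    by (rule ck_on_has_derivative[OF W ck_on_dir_deriv[OF W ck] yW])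
  have key: "dgram M c ?y e u v = dgram M d (cmap d x) (?A e) (?A u) (?A v)
     + ginner M d (cmap d x) (?D u e) (?A v) + ginner M d (cmap d x) (?A u) (?D v e)" for e u v
  proof -
    have "((\<lambda>z. ginner M d (\<tau> z) (dir_deriv \<tau> z u) (dir_deriv \<tau> z v)) has_derivative
      (\<lambda>e. dgram M d (\<tau> ?y) (?A e) (?A u) (?A v) + ginner M d (\<tau> ?y) (?D u e) (?A v)
        + ginner M d (\<tau> ?y) (?A u) (?D v e))) (at ?y)"
      by (rule has_derivative_bilinear_family[where \<beta>="ginner M d" and F=\<tau>
          and \<beta>'="\<lambda>u v e. dgram M d (\<tau> ?y) e u v", OF atlasD(2)[OF assms(2)] _ ck_on_has_derivative[OF W ck yW] dD dD
          bilinear_ginner ginner_has_derivative[OF assms(2)]]) (simp_all add: \<tau>y yd)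
    then have "((\<lambda>z. ginner M c z u v) has_derivative
      (\<lambda>e. dgram M d (\<tau> ?y) (?A e) (?A u) (?A v) + ginner M d (\<tau> ?y) (?D u e) (?A v)
        + ginner M d (\<tau> ?y) (?A u) (?D v e))) (at ?y)"
    proof (rule has_derivative_transform_within_open[OF _ W yW])
      fix z assume "z \<in> ?W"
      then obtain x' where x': "x' \<in> cdom c" "x' \<in> cdom d" "z = cmap c x'" by blast
      then show "ginner M d (\<tau> z) (dir_deriv \<tau> z u) (dir_deriv \<tau> z v) = ginner M c z u v"
        using ginner_transition[OF assms(1,2) x'(1,2)] by (simp add: \<tau>_def cinv_cmap[OF assms(1)])
    qed
    then show ?thesis
      using fun_cong[OF has_derivative_unique[OF ginner_has_derivative[OF assms(1) yc, of u v]], of _ e] by (simp add: \<tau>y)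
  qed
  show ?thesis
  proof (rule ginner_nondeg[OF assms(2) yd])
    fix l
    \<comment> \<open>Transition derivatives are surjective, so test vectors of the second chart may
      be taken from the image of the first.\<close>
    obtain k where k: "l = ?A k" using transition_inverse[OF assms(1-4)] unfolding \<tau>_def by metis
    have "ginner M d (cmap d x) (?A (christoffel M c ?y u v)) (?A k) = ginner M c ?y (christoffel M c ?y u v) k"
      using ginner_transition[OF assms(1-4)] by (simp add: \<tau>_def)
    also have "\<dots> = koszul d (cmap d x) (?A u) (?A v) (?A k) + ginner M d (cmap d x) (?D u v) (?A k)"
      unfolding christoffel_koszul[OF assms(1) yc] koszul_def key
      using symD[of u v] symD[of u k] symD[of v k] ginner_sym[OF assms(2) yd] by (simp add: field_simps)
    finally show "ginner M d (cmap d x) (?A (christoffel M c ?y u v)) l =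
      ginner M d (cmap d x) (christoffel M d (cmap d x) (?A u) (?A v) + ?D u v) l"
      by (simp add: k bilinear_ladd[OF bilinear_ginner] christoffel_koszul[OF assms(2) yd])
  qed
qed

text \<open>The second derivative of the transition appears once in the chain rule and once in the
  transformation of the Christoffel symbols, with opposite signs. What is left is tensorial.\<close>

lemma chart_hess_transition:
  assumes "c \<in> atlas M" "d \<in> atlas M" "x \<in> cdom c" "x \<in> cdom d"
    and V: "open V" "cmap d x \<in> V" "ck_on 2 V f"
  defines "\<tau> \<equiv> cmap d \<circ> cinv c"
  shows "chart_hess M c (\<lambda>z. f (\<tau> z)) (cmap c x) u v =
    chart_hess M d f (cmap d x) (dir_deriv \<tau> (cmap c x) u) (dir_deriv \<tau> (cmap c x) v)"
proof -
  let ?W = "cmap c ` (cdom c \<inter> cdom d)" and ?y = "cmap c x"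
  have W: "open ?W" by (rule open_overlap[OF assms(1,2)])
  have yW: "?y \<in> ?W" using assms(3,4) by blast
  have ck: "ck_on k ?W \<tau>" for k unfolding \<tau>_def by (rule transition_smooth[OF assms(1,2)])
  have \<tau>y: "\<tau> ?y = cmap d x" using assms by (simp add: \<tau>_def cinv_cmap)
  define U where "U = ?W \<inter> \<tau> -` V"
  have U: "open U" "?y \<in> U" "\<tau> ` U \<subseteq> V"
    using continuous_open_preimage[OF ck_on_continuous[OF ck] W V(1)] yW V(2) \<tau>y by (auto simp: U_def)
  have ckU: "ck_on k U \<tau>" for k by (rule ck_on_open_subset[OF ck W U(1)]) (auto simp: U_def)
  have f2: "(f has_derivative dir_deriv f (cmap d x)) (at (cmap d x))"
    using ck_on_has_derivative[OF V(1) _ V(2), of 1] V(3) by (simp add: numeral_2_eq_2)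
  have \<tau>d: "(\<tau> has_derivative dir_deriv \<tau> ?y) (at ?y)" by (rule ck_on_has_derivative[OF W ck yW])
  have "dir_deriv (\<lambda>z. f (\<tau> z)) ?y w = dir_deriv f (cmap d x) (dir_deriv \<tau> ?y w)" for w
    by (rule dir_deriv_compose[OF \<tau>d]) (simp add: \<tau>y f2)
  then show ?thesis
    unfolding chart_hess_def second_derivative_compose[OF U(1,2) ckU V(1) U(3) V(3)]
    by (simp add: \<tau>y christoffel_transition[OF assms(1-4), folded \<tau>_def] linear_add[OF has_derivative_linear[OF f2]])
qed

lemma chart_grad_transition:
  assumes "c \<in> atlas M" "d \<in> atlas M" "x \<in> cdom c" "x \<in> cdom d"
    and f: "(f has_derivative f') (at (cmap d x))"
  defines "\<tau> \<equiv> cmap d \<circ> cinv c"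
  shows "dir_deriv \<tau> (cmap c x) (chart_grad M c (\<lambda>z. f (\<tau> z)) (cmap c x)) = chart_grad M d f (cmap d x)"
proof (rule ginner_nondeg[OF assms(2) cmap_in[OF assms(4)]])
  fix l
  let ?A = "dir_deriv \<tau> (cmap c x)"
  obtain k where k: "l = ?A k" using transition_inverse[OF assms(1-4)] unfolding \<tau>_def by metis
  have \<tau>d: "(\<tau> has_derivative ?A) (at (cmap c x))"
    using transition_has_derivative[OF assms(1-4)] by (simp add: \<tau>_def)
  have fd: "((\<lambda>z. f (\<tau> z)) has_derivative (\<lambda>v. f' (?A v))) (at (cmap c x))"
    by (rule has_derivative_compose[OF \<tau>d]) (use f cinv_cmap[OF assms(1,3)] in \<open>simp add: \<tau>_def\<close>)
  show "ginner M d (cmap d x) (?A (chart_grad M c (\<lambda>z. f (\<tau> z)) (cmap c x))) l =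
     ginner M d (cmap d x) (chart_grad M d f (cmap d x)) l"
    using ginner_transition[OF assms(1-4)] chart_grad[OF assms(1) cmap_in[OF assms(3)] fd]
      chart_grad[OF assms(2) cmap_in[OF assms(4)] f] by (simp add: \<tau>_def k)
qed

subsection \<open>Orthonormal bases, traces and the volume density\<close>

definition onb :: "('a, 'm) chart \<Rightarrow> real ^ 'm \<Rightarrow> ('m \<Rightarrow> real ^ 'm) \<Rightarrow> bool" where
  "onb c y X \<longleftrightarrow> (\<forall>i j. ginner M c y (X i) (X j) = (if i = j then 1 else 0))"

lemma onb_exists:
  assumes "c \<in> atlas M" "y \<in> cimg c" shows "\<exists>X. onb c y X"
proof -
  have "\<exists>f::nat \<Rightarrow> real ^ 'm. \<forall>i<k. \<forall>j<k. ginner M c y (f i) (f j) = (if i = j then 1 else 0)"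
    if "k \<le> CARD('m)" for k
    using that
  proof (induction k)
    case (Suc k)
    then obtain f :: "nat \<Rightarrow> real ^ 'm"
      where f: "\<And>i j. i < k \<Longrightarrow> j < k \<Longrightarrow> ginner M c y (f i) (f j) = (if i = j then 1 else 0)" by auto
    \<comment> \<open>Euclidean orthogonality to \<open>gram M c y *v f i\<close> is orthogonality
      to \<open>f i\<close> in the metric. Fewer such conditions than dimensions leave a nonzero
      solution, to be normalised.\<close>
    let ?S = "(\<lambda>i. gram M c y *v f i) ` {..<k}"
    have "dim ?S \<le> card ?S" by (rule dim_le_card') simp
    also have "\<dots> \<le> k" using card_image_le[of "{..<k}"] by simp
    finally have "dim ?S < DIM(real ^ 'm)" using Suc.prems by simp
    from orthogonal_to_subspace_exists[OF this] obtain x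
      where x: "x \<noteq> 0" "\<forall>z\<in>span ?S. orthogonal x z" by metis
    have xf: "ginner M c y x (f i) = 0" if "i < k" for i
    proof -
      have "gram M c y *v f i \<in> span ?S" using that by (intro span_base) simp
      then show ?thesis using x(2) by (simp add: ginner_def orthogonal_def)
    qed
    have fx: "ginner M c y (f i) x = 0" if "i < k" for i using xf[OF that] ginner_sym[OF assms] by metis
    have pos: "ginner M c y x x > 0" by (rule ginner_pos[OF assms x(1)])
    define z where "z = (1 / sqrt (ginner M c y x x)) *\<^sub>R x"
    have z: "ginner M c y z z = 1" "\<And>i. i < k \<Longrightarrow> ginner M c y z (f i) = 0" "\<And>i. i < k \<Longrightarrow> ginner M c y (f i) z = 0"
      using pos xf fx by (simp_all add: z_def bilinear_lmul[OF bilinear_ginner] bilinear_rmul[OF bilinear_ginner])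
    show ?case
      by (rule exI[of _ "f(k := z)"]) (use z f in \<open>auto simp: less_Suc_eq\<close>)
  qed auto
  then obtain f :: "nat \<Rightarrow> real ^ 'm"
    where f: "\<And>i j. i < CARD('m) \<Longrightarrow> j < CARD('m) \<Longrightarrow> ginner M c y (f i) (f j) = (if i = j then 1 else 0)" by blast
  obtain h :: "'m \<Rightarrow> nat" where h: "bij_betw h UNIV {0..<CARD('m)}"
    using ex_bij_betw_finite_nat[of "UNIV :: 'm set"] by auto
  have "h i < CARD('m)" "h i = h j \<longleftrightarrow> i = j" for i j
    using h by (auto simp: bij_betw_def inj_eq)
  then have "onb c y (\<lambda>i. f (h i))" unfolding onb_def using f by simp
  then show ?thesis by blast
qed

lemma onb_matrix:
  assumes "onb c y X"
  defines "B \<equiv> \<chi> k i. X i $ k"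
  shows "transpose B ** A ** B = (\<chi> i j. X i \<bullet> (A *v X j))" "transpose B ** gram M c y ** B = mat 1"
    "B ** (transpose B ** gram M c y) = mat 1" "det B \<noteq> 0" "det (gram M c y) * (det B)\<^sup>2 = 1"
proof -
  show 1: "transpose B ** A ** B = (\<chi> i j. X i \<bullet> (A *v X j))" for A
    by (simp add: vec_eq_iff matrix_matrix_mult_def transpose_def B_def inner_vec_def matrix_vector_mult_def
        sum_distrib_left sum_distrib_right matrix_mul_assoc[symmetric] mult.assoc)
      (intro allI sum.swap)
  show 2: "transpose B ** gram M c y ** B = mat 1"
    unfolding 1 using assms(1) by (auto simp: onb_def ginner_def mat_def vec_eq_iff)
  then show "B ** (transpose B ** gram M c y) = mat 1" using matrix_left_right_inverse by blast
  have "det B * det (gram M c y) * det B = 1" using arg_cong[OF 2, of det] by (simp add: det_mul det_transpose)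
  then show "det B \<noteq> 0" "det (gram M c y) * (det B)\<^sup>2 = 1" by (auto simp: power2_eq_square mult_ac)
qed

lemma onb_expand:
  assumes "c \<in> atlas M" "y \<in> cimg c" "onb c y X"
  shows "u = (\<Sum>i\<in>UNIV. ginner M c y u (X i) *\<^sub>R X i)"
proof -
  define B :: "real ^ 'm ^ 'm" where "B = (\<chi> k i. X i $ k)"
  have "u = B *v ((transpose B ** gram M c y) *v u)"
    using onb_matrix(3)[OF assms(3), folded B_def] by (simp add: matrix_vector_mul_assoc)
  also have "(transpose B ** gram M c y) *v u = (\<chi> i. X i \<bullet> (gram M c y *v u))"
    unfolding matrix_vector_mul_assoc[symmetric]
    by (simp add: vec_eq_iff B_def transpose_def inner_vec_def matrix_vector_mult_def)
  also have "B *v \<dots> = (\<Sum>i\<in>UNIV. (X i \<bullet> (gram M c y *v u)) *\<^sub>R X i)"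
    by (simp add: matrix_mult_sum column_def B_def scalar_mult_eq_scaleR vec_lambda_eta)
  finally show ?thesis using ginner_sym[OF assms(1,2)] by (simp add: ginner_def)
qed

text \<open>Coordinate divergences produce the trace in the standard basis, whereas Hessian bounds
  are summed over an orthonormal frame; the trace of an endomorphism does not distinguish
  them.\<close>

lemma onb_trace:
  assumes "c \<in> atlas M" "y \<in> cimg c" "onb c y X" "linear L"
  shows "(\<Sum>i\<in>UNIV. ginner M c y (L (X i)) (X i)) = (\<Sum>k\<in>UNIV. L (axis k 1) $ k)"
proof -
  have "L (axis k 1) $ k = (\<Sum>i\<in>UNIV. ginner M c y (axis k 1) (X i) * L (X i) $ k)" for k
  proof -
    have "L (axis k 1) = L (\<Sum>i\<in>UNIV. ginner M c y (axis k 1) (X i) *\<^sub>R X i)"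
      by (rule arg_cong[OF onb_expand[OF assms(1-3)]])
    then show ?thesis using assms(4) by (simp add: linear_sum linear_scale)
  qed
  then have "(\<Sum>k\<in>UNIV. L (axis k 1) $ k) = (\<Sum>i\<in>UNIV. \<Sum>k\<in>UNIV. (L (X i) $ k) *\<^sub>R ginner M c y (axis k 1) (X i))"
    by (simp add: mult.commute) (rule sum.swap)
  also have "\<dots> = (\<Sum>i\<in>UNIV. ginner M c y (L (X i)) (X i))"
  proof (intro sum.cong refl)
    fix i
    have "linear (\<lambda>u. ginner M c y u (X i))" using bilinear_ginner unfolding bilinear_def by blast
    from linear_axis_expand[OF this, of "L (X i)"]
    show "(\<Sum>k\<in>UNIV. (L (X i) $ k) *\<^sub>R ginner M c y (axis k 1) (X i)) = ginner M c y (L (X i)) (X i)" by simp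
  qed
  finally show ?thesis ..
qed

lemma det_gram_pos:
  assumes "c \<in> atlas M" "y \<in> cimg c" shows "det (gram M c y) > 0"
proof -
  obtain X where "onb c y X" using onb_exists[OF assms] by blast
  from onb_matrix(4,5)[OF this] show ?thesis
    by (metis zero_less_mult_pos2 zero_less_one zero_less_power2)
qed

definition vol_density :: "('a, 'm) chart \<Rightarrow> real ^ 'm \<Rightarrow> real" where
  "vol_density c y = sqrt (det (gram M c y))"

lemma vol_density_pos: "c \<in> atlas M \<Longrightarrow> y \<in> cimg c \<Longrightarrow> vol_density c y > 0"
  by (simp add: vol_density_def det_gram_pos)

lemma vol_density_smooth: "c \<in> atlas M \<Longrightarrow> ck_on k (cimg c) (vol_density c)"
  unfolding vol_density_def by (intro ck_on_sqrt ck_on_det gram_smooth atlasD(2) det_gram_pos)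

text \<open>Conjugating the Gram matrix by an orthonormal frame at \<open>y\<close> makes it the
  identity there, so Jacobi's formula applies at the identity; undoing the constant factor and
  taking the root gives half the trace of the derivative of the metric.\<close>

lemma vol_density_has_derivative:
  assumes "c \<in> atlas M" "y \<in> cimg c" "onb c y X"
  shows "(vol_density c has_derivative (\<lambda>e. vol_density c y * (\<Sum>i\<in>UNIV. dgram M c y e (X i) (X i)) / 2)) (at y)"
proof -
  define B :: "real ^ 'm ^ 'm" where "B = (\<chi> k i. X i $ k)"
  note B = onb_matrix[OF assms(3), folded B_def]
  have bl: "bounded_linear (\<lambda>A. transpose B ** A ** B)"
    unfolding B(1) linear_conv_bounded_linear[symmetric]
    by (rule linearI) (simp_all add: vec_eq_iff inner_right_distrib matrix_vector_mult_add_rdistrib scaleR_matrix_vector_assoc[symmetric])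
  have "((\<lambda>z. det (transpose B ** gram M c z ** B)) has_derivative
      (\<lambda>e. \<Sum>i\<in>UNIV. (transpose B ** dir_deriv (gram M c) y e ** B) $ i $ i)) (at y)"
    by (rule has_derivative_det_at_id[OF bounded_linear.has_derivative[OF bl gram_has_derivative[OF assms(1,2)]] B(2)])
  then have "((\<lambda>z. det (transpose B ** gram M c z ** B) * det (gram M c y)) has_derivative
      (\<lambda>e. (\<Sum>i\<in>UNIV. dgram M c y e (X i) (X i)) * det (gram M c y))) (at y)"
    by (intro has_derivative_mult_left) (simp add: B(1) dgram_def)
  moreover have "det (transpose B ** A ** B) * det (gram M c y) = det A" for A
    using B(5) by (simp add: det_mul det_transpose power2_eq_square mult_ac)
  ultimately have "((\<lambda>z. det (gram M c z)) has_derivative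
      (\<lambda>e. (\<Sum>i\<in>UNIV. dgram M c y e (X i) (X i)) * det (gram M c y))) (at y)" by simp
  from has_derivative_real_sqrt[OF det_gram_pos[OF assms(1,2)] this]
  show ?thesis unfolding vol_density_def
    by (rule has_derivative_eq_rhs) (use det_gram_pos[OF assms(1,2)] in \<open>auto simp: fun_eq_iff field_simps\<close>)
qed

end

section \<open>Covariant derivatives along maps\<close>

context riemannian begin

text \<open>Covariant derivative in direction \<open>e\<close> of a vector field \<open>Y\<close>
  along a map \<open>F\<close>, all read in one fixed chart. \<open>F\<close> need not be injective,
  so \<open>Y\<close> need not extend to a field on the manifold. In the applications the parameters
  are pairs (s, t).\<close>

definition cov :: "('a, 'm) chart \<Rightarrow> ('p::real_normed_vector \<Rightarrow> real ^ 'm) \<Rightarrow> ('p \<Rightarrow> real ^ 'm) \<Rightarrow> 'p \<Rightarrow> 'p \<Rightarrow> real ^ 'm" where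
  "cov c F Y p e = dir_deriv Y p e + christoffel M c (F p) (dir_deriv F p e) (Y p)"

lemma christoffel_has_derivative:
  assumes "c \<in> atlas M" "y \<in> cimg c"
  shows "((\<lambda>y. christoffel M c y u v) has_derivative dir_deriv (\<lambda>y. christoffel M c y u v) y) (at y)"
  by (rule ck_on_has_derivative[OF atlasD(2)[OF assms(1)] christoffel_smooth[OF assms(1)] assms(2)])

lemma cov_torsion_free:
  assumes "c \<in> atlas M" "open W" "ck_on 2 W F" "p \<in> W" "F p \<in> cimg c"
  shows "cov c F (\<lambda>p. dir_deriv F p e) p e' = cov c F (\<lambda>p. dir_deriv F p e') p e"
  unfolding cov_def symmetric_second_derivative[OF assms(2-4), of e e']
  using christoffel_sym[OF assms(1,5)] by simp

lemma cov_metric: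
  assumes "c \<in> atlas M" "F p \<in> cimg c" "(F has_derivative dir_deriv F p) (at p)"
    "(Y has_derivative dir_deriv Y p) (at p)" "(Z has_derivative dir_deriv Z p) (at p)"
  shows "((\<lambda>p. ginner M c (F p) (Y p) (Z p)) has_derivative
    (\<lambda>e. ginner M c (F p) (cov c F Y p e) (Z p) + ginner M c (F p) (Y p) (cov c F Z p e))) (at p)"
proof -
  have "((\<lambda>p. ginner M c (F p) (Y p) (Z p)) has_derivative
    (\<lambda>e. dgram M c (F p) (dir_deriv F p e) (Y p) (Z p) + ginner M c (F p) (dir_deriv Y p e) (Z p)
       + ginner M c (F p) (Y p) (dir_deriv Z p e))) (at p)"
    by (rule has_derivative_bilinear_family[where \<beta>="ginner M c" and F=F
          and \<beta>'="\<lambda>u v e. dgram M c (F p) e u v", OF atlasD(2)[OF assms(1)] assms(2-5) bilinear_ginner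
          ginner_has_derivative[OF assms(1,2)]])
  then show ?thesis
    by (rule has_derivative_eq_rhs)
      (simp add: fun_eq_iff metric_compatible[OF assms(1,2)] cov_def bilinear_ladd[OF bilinear_ginner]
        bilinear_radd[OF bilinear_ginner])
qed

lemma cov_has_derivative:
  assumes "c \<in> atlas M" "open W" "ck_on 2 W F" "ck_on 2 W Y" "p \<in> W" "F p \<in> cimg c"
  shows "((\<lambda>p. cov c F Y p e) has_derivative
     (\<lambda>e'. dir_deriv (\<lambda>p. dir_deriv Y p e) p e'
       + (dir_deriv (\<lambda>y. christoffel M c y (dir_deriv F p e) (Y p)) (F p) (dir_deriv F p e')
       + christoffel M c (F p) (dir_deriv (\<lambda>p. dir_deriv F p e) p e') (Y p)
       + christoffel M c (F p) (dir_deriv F p e) (dir_deriv Y p e')))) (at p)"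
proof -
  have F: "ck_on (Suc (Suc 0)) W F" and Y: "ck_on (Suc (Suc 0)) W Y"
    using assms by (simp_all add: numeral_2_eq_2)
  note dY = ck_on_has_derivative[OF assms(2) ck_on_dir_deriv[OF assms(2) Y] assms(5)]
  note dF = ck_on_has_derivative[OF assms(2) ck_on_dir_deriv[OF assms(2) F] assms(5)]
  show ?thesis unfolding cov_def
    by (intro has_derivative_add dY
        has_derivative_bilinear_family[where \<beta>="christoffel M c" and F=F
          and \<beta>'="\<lambda>u v. dir_deriv (\<lambda>y. christoffel M c y u v) (F p)",
          OF atlasD(2)[OF assms(1)] assms(6) ck_on_has_derivative[OF assms(2) F assms(5)] dF
          ck_on_has_derivative[OF assms(2) Y assms(5)] bilinear_christoffel[OF assms(1)]
          christoffel_has_derivative[OF assms(1,6)]])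
qed

text \<open>The mixed second derivatives of \<open>Y\<close> and of \<open>F\<close> cancel by
  symmetry; the derivatives of the Christoffel symbols and their quadratic terms that survive are
  exactly the curvature. For a variation through geodesics this becomes the Jacobi equation.\<close>

lemma cov_commutator:
  assumes "c \<in> atlas M" "open W" "ck_on 2 W F" "ck_on 2 W Y" "p \<in> W" "F p \<in> cimg c"
  shows "cov c F (\<lambda>p. cov c F Y p e) p e' - cov c F (\<lambda>p. cov c F Y p e') p e =
    curvature M c (F p) (dir_deriv F p e') (dir_deriv F p e) (Y p)"
proof -
  note d = dir_deriv_eq[OF cov_has_derivative[OF assms]]
  note bil = bilinear_christoffel[OF assms(1,6)]
  have 1: "cov c F (\<lambda>p. cov c F Y p e) p e' = dir_deriv (\<lambda>p. dir_deriv Y p e) p e'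
       + (dir_deriv (\<lambda>y. christoffel M c y (dir_deriv F p e) (Y p)) (F p) (dir_deriv F p e')
       + christoffel M c (F p) (dir_deriv (\<lambda>p. dir_deriv F p e) p e') (Y p)
       + christoffel M c (F p) (dir_deriv F p e) (dir_deriv Y p e'))
       + (christoffel M c (F p) (dir_deriv F p e') (dir_deriv Y p e)
       + christoffel M c (F p) (dir_deriv F p e') (christoffel M c (F p) (dir_deriv F p e) (Y p)))" for e e'
    unfolding cov_def[of c F "\<lambda>p. cov c F Y p e"] d by (simp add: cov_def bilinear_radd[OF bil])
  show ?thesis
    unfolding 1 curvature_def symmetric_second_derivative[OF assms(2,3,5), of e e']
      symmetric_second_derivative[OF assms(2,4,5), of e e']
    by (simp add: algebra_simps)
qed

section \<open>Algebraic symmetries of the curvature tensor\<close>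

lemma curvature_linear:
  assumes "c \<in> atlas M" "y \<in> cimg c"
  shows "curvature M c y u v (z + z') = curvature M c y u v z + curvature M c y u v z'"
proof -
  note bil = bilinear_christoffel[OF assms(1)]
  have "dir_deriv (\<lambda>y. christoffel M c y v (z + z')) y u =
    dir_deriv (\<lambda>y. christoffel M c y v z) y u + dir_deriv (\<lambda>y. christoffel M c y v z') y u" for u v
  proof -
    have "dir_deriv (\<lambda>y. christoffel M c y v (z + z')) y =
       dir_deriv (\<lambda>y. christoffel M c y v z + christoffel M c y v z') y"
      by (rule dir_deriv_cong_open[OF atlasD(2)[OF assms(1)] assms(2)]) (rule bilinear_radd[OF bil])
    also have "\<dots> = (\<lambda>u. dir_deriv (\<lambda>y. christoffel M c y v z) y u + dir_deriv (\<lambda>y. christoffel M c y v z') y u)"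
      by (rule dir_deriv_eq[OF has_derivative_add[OF christoffel_has_derivative[OF assms] christoffel_has_derivative[OF assms]]])
    finally show ?thesis by simp
  qed
  then show ?thesis unfolding curvature_def by (simp add: bilinear_radd[OF bil[OF assms(2)]])
qed

text \<open>For constant \<open>z\<close> the second derivatives of |z|^2 are symmetric. By metric
  compatibility their antisymmetric part in \<open>u\<close> and \<open>v\<close> is twice the
  curvature term, since the product of the two first-order Christoffel terms is already
  symmetric.\<close>

lemma curvature_self:
  assumes "c \<in> atlas M" "y \<in> cimg c"
  shows "ginner M c y (curvature M c y u v z) z = 0"
proof -
  let ?h = "\<lambda>y. ginner M c y z z"
  note U = atlasD(2)[OF assms(1)]
  note add = bilinear_ladd[OF bilinear_ginner] bilinear_lsub[OF bilinear_ginner]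
  have 1: "dir_deriv ?h y v = 2 * ginner M c y (christoffel M c y v z) z" if "y \<in> cimg c" for y v
    unfolding dgram_eq[OF assms(1) that] metric_compatible[OF assms(1) that]
    using ginner_sym[OF assms(1) that] by simp
  have 2: "dir_deriv (\<lambda>y. dir_deriv ?h y v) y u = 2 * (ginner M c y (christoffel M c y u (christoffel M c y v z)) z
     + ginner M c y (christoffel M c y v z) (christoffel M c y u z)
     + ginner M c y (dir_deriv (\<lambda>y. christoffel M c y v z) y u) z)" for u v
  proof -
    have "((\<lambda>y. ginner M c y (christoffel M c y v z) z) has_derivative
      (\<lambda>e. dgram M c y e (christoffel M c y v z) z + ginner M c y (dir_deriv (\<lambda>y. christoffel M c y v z) y e) z
        + ginner M c y (christoffel M c y v z) 0)) (at y)"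
      by (rule has_derivative_bilinear_family[where \<beta>="ginner M c" and F="\<lambda>y. y"
          and \<beta>'="\<lambda>u v e. dgram M c y e u v", OF U assms(2) has_derivative_ident
          christoffel_has_derivative[OF assms] has_derivative_const bilinear_ginner ginner_has_derivative[OF assms]])
    from has_derivative_mult_right[OF this, of 2]
    have "((\<lambda>y. dir_deriv ?h y v) has_derivative (\<lambda>e. 2 * (dgram M c y e (christoffel M c y v z) z
        + ginner M c y (dir_deriv (\<lambda>y. christoffel M c y v z) y e) z
        + ginner M c y (christoffel M c y v z) 0))) (at y)"
      by (rule has_derivative_transform_within_open[OF _ U assms(2)]) (simp add: 1)
    from dir_deriv_eq[OF this] show ?thesis
      by (simp add: metric_compatible[OF assms] bilinear_rzero[OF bilinear_ginner])
  qed
  have "dir_deriv (\<lambda>y. dir_deriv ?h y v) y u = dir_deriv (\<lambda>y. dir_deriv ?h y u) y v"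
    by (rule symmetric_second_derivative[OF U ginner_smooth[OF assms(1)] assms(2)])
  then show ?thesis unfolding 2 curvature_def add
    using ginner_sym[OF assms, of "christoffel M c y v z"] by simp
qed

lemma curvature_skew:
  assumes "c \<in> atlas M" "y \<in> cimg c"
  shows "ginner M c y (curvature M c y u v z) z' = - ginner M c y (curvature M c y u v z') z"
  using curvature_self[OF assms, of u v "z + z'"] curvature_self[OF assms, of u v z] curvature_self[OF assms, of u v z']
  by (simp add: curvature_linear[OF assms] bilinear_ladd[OF bilinear_ginner] bilinear_radd[OF bilinear_ginner])

end

section \<open>Uniqueness of geodesics\<close>

lemma C1_locally_lipschitz:
  fixes f :: "'e::euclidean_space \<Rightarrow> 'f::real_normed_vector"
  assumes "open U" "ck_on 1 U f" "x0 \<in> U"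
  obtains r L where "r > 0" "L > 0" "cball x0 r \<subseteq> U" "\<And>a b. a \<in> cball x0 r \<Longrightarrow> b \<in> cball x0 r \<Longrightarrow> norm (f a - f b) \<le> L * norm (a - b)"
proof -
  have f1: "ck_on (Suc 0) U f" using assms by simp
  obtain r where r: "r > 0" "cball x0 r \<subseteq> U" using assms open_contains_cball by blast
  define S where "S y = (\<Sum>b\<in>Basis. norm (dir_deriv f y b))" for y
  have "continuous_on U (\<lambda>y. dir_deriv f y b)" for b
    by (rule ck_on_continuous[OF ck_on_dir_deriv[OF assms(1) f1]])
  then have "continuous_on (cball x0 r) S" unfolding S_def
    by (intro continuous_on_sum continuous_on_norm) (rule continuous_on_subset[OF _ r(2)])
  then have "compact (S ` cball x0 r)" by (intro compact_continuous_image compact_cball)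
  then obtain B where B: "\<And>y. y \<in> cball x0 r \<Longrightarrow> norm (S y) \<le> B"
    using compact_imp_bounded bounded_iff by (metis imageI)
  have lip: "norm (f a - f b) \<le> max B 1 * norm (a - b)" if "a \<in> cball x0 r" "b \<in> cball x0 r" for a b
  proof (rule differentiable_bound[OF convex_cball _ _ that])
    fix y assume y: "y \<in> cball x0 r"
    have d: "(f has_derivative dir_deriv f y) (at y)"
      by (rule ck_on_has_derivative[OF assms(1) f1]) (use y r in auto)
    then show "(f has_derivative dir_deriv f y) (at y within cball x0 r)" by (rule has_derivative_at_withinI)
    show "onorm (dir_deriv f y) \<le> max B 1"
    proof (rule onorm_le)
      fix v :: 'e
      have "norm (dir_deriv f y v) = norm (\<Sum>b\<in>Basis. (v \<bullet> b) *\<^sub>R dir_deriv f y b)"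
        using bounded_linear_euclid_sum[OF has_derivative_bounded_linear[OF d], of v] by simp
      also have "\<dots> \<le> (\<Sum>b\<in>Basis. norm v * norm (dir_deriv f y b))"
        by (rule order_trans[OF norm_sum]) (auto intro!: sum_mono mult_right_mono simp: Basis_le_norm)
      also have "\<dots> = S y * norm v" by (simp add: S_def sum_distrib_left mult.commute)
      also have "\<dots> \<le> max B 1 * norm v" using B[OF y] by (intro mult_right_mono) auto
      finally show "norm (dir_deriv f y v) \<le> max B 1 * norm v" .
    qed
  qed
  show ?thesis by (rule that[of r "max B 1", OF r(1) _ r(2) lip]) auto
qed

text \<open>On an interval of radius \<epsilon> with L \<epsilon> \<le> 1/2, the mean value
  inequality bounds the largest value of |x1 - x2| by half of itself, so it is zero. No Gronwall
  estimate is required.\<close>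

lemma ode_unique_local:
  fixes f :: "'e::euclidean_space \<Rightarrow> 'e"
  assumes U: "open U" "ck_on 1 U f" and \<delta>: "\<delta> > 0"
    and x1: "\<And>t. \<bar>t - t0\<bar> < \<delta> \<Longrightarrow> x1 t \<in> U \<and> (x1 has_vector_derivative f (x1 t)) (at t)"
    and x2: "\<And>t. \<bar>t - t0\<bar> < \<delta> \<Longrightarrow> x2 t \<in> U \<and> (x2 has_vector_derivative f (x2 t)) (at t)"
    and eq: "x1 t0 = x2 t0"
  shows "\<exists>\<epsilon>>0. \<forall>t. \<bar>t - t0\<bar> < \<epsilon> \<longrightarrow> x1 t = x2 t"
proof -
  obtain r L where rL: "r > 0" "L > 0" "cball (x1 t0) r \<subseteq> U"
    "\<And>a b. a \<in> cball (x1 t0) r \<Longrightarrow> b \<in> cball (x1 t0) r \<Longrightarrow> norm (f a - f b) \<le> L * norm (a - b)"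
    using C1_locally_lipschitz[OF U, of "x1 t0"] x1[of t0] \<delta> by auto
  have "isCont x1 t0" "isCont x2 t0"
    using x1[of t0] x2[of t0] \<delta> by (auto intro: has_vector_derivative_continuous)
  then obtain d1 d2 where d: "d1 > 0" "d2 > 0"
    and d1: "\<And>t. dist t t0 < d1 \<Longrightarrow> dist (x1 t) (x1 t0) < r"
    and d2: "\<And>t. dist t t0 < d2 \<Longrightarrow> dist (x2 t) (x2 t0) < r"
    using rL(1) unfolding continuous_at_eps_delta by metis
  define \<epsilon> where "\<epsilon> = min (min d1 d2) (min \<delta> (1 / L)) / 2"
  have \<epsilon>: "\<epsilon> > 0" "\<epsilon> < d1" "\<epsilon> < d2" "\<epsilon> < \<delta>" "L * \<epsilon> \<le> 1 / 2"
  proof -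
    show "\<epsilon> > 0" "\<epsilon> < d1" "\<epsilon> < d2" "\<epsilon> < \<delta>" using d rL \<delta> by (auto simp: \<epsilon>_def)
    have "\<epsilon> \<le> (1 / L) / 2" by (simp add: \<epsilon>_def)
    then have "L * \<epsilon> \<le> L * ((1 / L) / 2)" using rL(2) by (intro mult_left_mono) auto
    then show "L * \<epsilon> \<le> 1 / 2" using rL(2) by simp
  qed
  let ?I = "cball t0 \<epsilon>"
  define z where "z t = x1 t - x2 t" for t
  have I: "\<bar>t - t0\<bar> < \<delta>" "x1 t \<in> cball (x1 t0) r" "x2 t \<in> cball (x1 t0) r" if "t \<in> ?I" for t
    using that \<epsilon> d1[of t] d2[of t] eq by (auto simp: dist_real_def dist_commute abs_minus_commute less_imp_le)
  have dz: "(z has_vector_derivative (f (x1 t) - f (x2 t))) (at t)" if "t \<in> ?I" for t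
    unfolding z_def using x1[OF I(1)[OF that]] x2[OF I(1)[OF that]] by (intro has_vector_derivative_diff) auto
  have "continuous_on ?I z"
    using dz has_vector_derivative_continuous by (intro continuous_at_imp_continuous_on) blast
  then have "continuous_on ?I (\<lambda>t. norm (z t))" by (intro continuous_on_norm)
  then obtain tm where tm: "tm \<in> ?I" "\<And>t. t \<in> ?I \<Longrightarrow> norm (z t) \<le> norm (z tm)"
    using continuous_attains_sup[of ?I "\<lambda>t. norm (z t)"] \<epsilon>(1) by (auto simp: dist_real_def)
  have "norm (z tm - z t0) \<le> (L * norm (z tm)) * norm (tm - t0)"
  proof (rule differentiable_bound[OF convex_cball[of t0 \<epsilon>]])
    show "(z has_derivative (\<lambda>h. h *\<^sub>R (f (x1 t) - f (x2 t)))) (at t within ?I)" if "t \<in> ?I" for t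
      using dz[OF that] unfolding has_vector_derivative_def by (rule has_derivative_at_withinI)
    show "onorm (\<lambda>h. h *\<^sub>R (f (x1 t) - f (x2 t))) \<le> L * norm (z tm)" if "t \<in> ?I" for t
    proof (rule onorm_le)
      fix h :: real
      have "norm (f (x1 t) - f (x2 t)) \<le> L * norm (z t)" unfolding z_def by (rule rL(4)[OF I(2,3)[OF that]])
      also have "\<dots> \<le> L * norm (z tm)" using tm(2)[OF that] rL(2) by simp
      finally show "norm (h *\<^sub>R (f (x1 t) - f (x2 t))) \<le> L * norm (z tm) * norm h"
        by (simp add: mult.commute mult_left_mono)
    qed
  qed (use tm \<epsilon> in auto)
  also have "\<dots> \<le> (L * norm (z tm)) * \<epsilon>"
    using tm(1) rL(2) by (intro mult_left_mono) (auto simp: dist_real_def)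
  also have "\<dots> = (L * \<epsilon>) * norm (z tm)" by simp
  also have "\<dots> \<le> (1 / 2) * norm (z tm)" by (rule mult_right_mono[OF \<epsilon>(5)]) simp
  finally have "norm (z tm) = 0" using eq by (simp add: z_def)
  then have "x1 t = x2 t" if "\<bar>t - t0\<bar> < \<epsilon>" for t
    using tm(2)[of t] that by (simp add: z_def dist_real_def abs_minus_commute)
  then show ?thesis using \<epsilon>(1) by blast
qed

context riemannian begin

lemma geodesicD:
  assumes "geodesic M \<gamma>" "c \<in> atlas M" "\<gamma> t \<in> cdom c"
  defines "y \<equiv> cmap c \<circ> \<gamma>"
  defines "y' \<equiv> \<lambda>s. vector_derivative y (at s)"
  shows "(y has_vector_derivative y' t) (at t)"
    "(y' has_vector_derivative - christoffel M c (y t) (y' t) (y' t)) (at t)"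
proof -
  have "y differentiable (at t) \<and> (y' has_vector_derivative - christoffel M c (y t) (y' t) (y' t)) (at t)"
    using assms unfolding geodesic_def Let_def by blast
  then show "(y has_vector_derivative y' t) (at t)"
    "(y' has_vector_derivative - christoffel M c (y t) (y' t) (y' t)) (at t)"
    unfolding y'_def by (auto simp: vector_derivative_works[symmetric])
qed

lemma geodesic_continuous: "geodesic M \<gamma> \<Longrightarrow> continuous_on UNIV \<gamma>"
  by (simp add: geodesic_def)

lemma geodesic_in_chart_nhd:
  assumes "continuous_on UNIV (\<gamma> :: real \<Rightarrow> 'a)" "c \<in> atlas M" "\<gamma> t \<in> cdom c"
  obtains \<delta> where "\<delta> > 0" "\<And>s. \<bar>s - t\<bar> < \<delta> \<Longrightarrow> \<gamma> s \<in> cdom c"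
proof -
  have "open (\<gamma> -` cdom c)" by (rule open_vimage[OF atlasD(1)[OF assms(2)] assms(1)])
  then obtain \<delta> where "\<delta> > 0" "ball t \<delta> \<subseteq> \<gamma> -` cdom c" using assms(3) open_contains_ball by (metis vimageI2)
  then show ?thesis by (intro that[of \<delta>]) (auto simp: dist_real_def abs_minus_commute subset_iff)
qed

lemma vector_derivative_change_chart:
  assumes "continuous_on UNIV (\<gamma> :: real \<Rightarrow> 'a)" "c \<in> atlas M" "d \<in> atlas M" "\<gamma> t \<in> cdom c" "\<gamma> t \<in> cdom d"
    "((cmap c \<circ> \<gamma>) has_vector_derivative v) (at t)"
  shows "((cmap d \<circ> \<gamma>) has_vector_derivative dir_deriv (cmap d \<circ> cinv c) (cmap c (\<gamma> t)) v) (at t)"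
proof -
  have ev: "\<forall>\<^sub>F s in at t. \<gamma> s \<in> cdom c"
    by (rule eventually_mono[OF eventually_at_in_open'[OF open_vimage[OF atlasD(1)[OF assms(2)] assms(1)], of t]])
      (use assms in auto)
  have lin: "linear (dir_deriv (cmap d \<circ> cinv c) (cmap c (\<gamma> t)))"
    by (rule has_derivative_linear[OF transition_has_derivative[OF assms(2-5)]])
  show ?thesis
    using has_derivative_change_chart[OF assms(2-5) assms(6)[unfolded has_vector_derivative_def] ev]
    by (simp add: has_vector_derivative_def linear_scale[OF lin])
qed

text \<open>The acceleration term of the geodesic equation, as a function of position and velocity
  together. With it the equation becomes a first-order C^1 system to which local uniqueness
  applies.\<close>

lemma christoffel_diag_smooth:
  assumes "c \<in> atlas M"
  shows "ck_on k (cimg c \<times> UNIV) (\<lambda>z. christoffel M c (fst z) (snd z) (snd z))"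
proof -
  have U: "open (cimg c \<times> (UNIV :: (real ^ 'm) set))" by (intro open_Times atlasD(2)[OF assms] open_UNIV)
  have 1: "ck_on k (cimg c \<times> (UNIV :: (real ^ 'm) set)) (\<lambda>z. christoffel M c (fst z) i j)" for i j
    by (rule ck_on_compose[OF U atlasD(2)[OF assms] _ ck_on_bounded_linear[OF U bounded_linear_fst] christoffel_smooth[OF assms]]) auto
  have "ck_on k (cimg c \<times> UNIV) (\<lambda>z. \<Sum>(i, j)\<in>Basis \<times> Basis. ((snd z \<bullet> i) * (snd z \<bullet> j)) *\<^sub>R christoffel M c (fst z) i j)"
    unfolding case_prod_beta
    by (intro ck_on_sum ck_on_scaleR ck_on_mult ck_on_inner ck_on_const U 1 ck_on_bounded_linear[OF U bounded_linear_snd])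
  then show ?thesis
  proof (rule ck_on_cong[OF U, rotated])
    fix z :: "(real ^ 'm) \<times> (real ^ 'm)" assume "z \<in> cimg c \<times> UNIV"
    then have bil: "bilinear (christoffel M c (fst z))" by (intro bilinear_christoffel[OF assms]) auto
    have "christoffel M c (fst z) (snd z) (snd z) =
        christoffel M c (fst z) (\<Sum>i\<in>Basis. (snd z \<bullet> i) *\<^sub>R i) (\<Sum>j\<in>Basis. (snd z \<bullet> j) *\<^sub>R j)"
      by (simp add: euclidean_representation)
    also have "\<dots> = (\<Sum>(i, j)\<in>Basis \<times> Basis. ((snd z \<bullet> i) * (snd z \<bullet> j)) *\<^sub>R christoffel M c (fst z) i j)"
      by (subst bilinear_sum[OF bil]) (simp add: bilinear_lmul[OF bil] bilinear_rmul[OF bil] mult.commute)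
    finally show "(\<Sum>(i, j)\<in>Basis \<times> Basis. ((snd z \<bullet> i) * (snd z \<bullet> j)) *\<^sub>R christoffel M c (fst z) i j) =
       christoffel M c (fst z) (snd z) (snd z)" ..
  qed
qed

text \<open>\<open>velocity\<close> is read in the preferred chart at the point, while local
  uniqueness works in one chart around it; transition derivatives translate between the two.\<close>

lemma velocity_eq_iff:
  assumes "geodesic M \<gamma>1" "geodesic M \<gamma>2" "\<gamma>1 t = \<gamma>2 t" "c \<in> atlas M" "\<gamma>1 t \<in> cdom c"
  shows "velocity M \<gamma>1 t = velocity M \<gamma>2 t \<longleftrightarrow>
    vector_derivative (cmap c \<circ> \<gamma>1) (at t) = vector_derivative (cmap c \<circ> \<gamma>2) (at t)"
proof -
  have tr: "vector_derivative (cmap d \<circ> \<gamma>) (at t) =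
      dir_deriv (cmap d \<circ> cinv c) (cmap c (\<gamma> t)) (vector_derivative (cmap c \<circ> \<gamma>) (at t))"
    if "geodesic M \<gamma>" "c \<in> atlas M" "d \<in> atlas M" "\<gamma> t \<in> cdom c" "\<gamma> t \<in> cdom d" for c d \<gamma>
    using vector_derivative_change_chart[OF geodesic_continuous[OF that(1)] that(2-5) geodesicD(1)[OF that(1,2,4)]]
    by (rule vector_derivative_at)
  show ?thesis
  proof
    assume "velocity M \<gamma>1 t = velocity M \<gamma>2 t"
    then show "vector_derivative (cmap c \<circ> \<gamma>1) (at t) = vector_derivative (cmap c \<circ> \<gamma>2) (at t)"
      using tr[OF assms(1) chart_at(1)[of "\<gamma>1 t"] assms(4) chart_at(2) assms(5)]
        tr[OF assms(2) chart_at(1)[of "\<gamma>2 t"] assms(4) chart_at(2)] assms(3,5)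
      by (simp add: velocity_def)
  next
    assume "vector_derivative (cmap c \<circ> \<gamma>1) (at t) = vector_derivative (cmap c \<circ> \<gamma>2) (at t)"
    then show "velocity M \<gamma>1 t = velocity M \<gamma>2 t"
      using tr[OF assms(1,4) chart_at(1)[of "\<gamma>1 t"] assms(5) chart_at(2)]
        tr[OF assms(2,4) chart_at(1)[of "\<gamma>2 t"] _ chart_at(2)] assms(3,5)
      by (simp add: velocity_def)
  qed
qed

text \<open>The set of times at which position and velocity agree is open by uniqueness for the
  geodesic system. Its complement is open as well: different positions stay apart because the space
  is Hausdorff, and at equal positions different chart velocities stay different by continuity.
  Connectedness of the line does the rest.\<close>

lemma geodesic_unique:
  assumes g: "geodesic M \<gamma>1" "geodesic M \<gamma>2" and 0: "\<gamma>1 0 = \<gamma>2 0" "velocity M \<gamma>1 0 = velocity M \<gamma>2 0"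
  shows "\<gamma>1 = \<gamma>2"
proof -
  define A where "A = {t. \<gamma>1 t = \<gamma>2 t \<and> velocity M \<gamma>1 t = velocity M \<gamma>2 t}"
  note cont = geodesic_continuous[OF g(1)] geodesic_continuous[OF g(2)]
  have "\<exists>\<epsilon>>0. \<forall>s. \<bar>s - t\<bar> < \<epsilon> \<longrightarrow> s \<in> A" if "t \<in> A" for t
  proof -
    define c where "c = chart_at M (\<gamma>1 t)"
    have c: "c \<in> atlas M" "\<gamma>1 t \<in> cdom c" "\<gamma>2 t \<in> cdom c" using chart_at[of "\<gamma>1 t"] that by (auto simp: c_def A_def)
    obtain \<delta>1 where \<delta>1: "\<delta>1 > 0" "\<And>s. \<bar>s - t\<bar> < \<delta>1 \<Longrightarrow> \<gamma>1 s \<in> cdom c"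
      using geodesic_in_chart_nhd[OF cont(1) c(1,2)] by blast
    obtain \<delta>2 where \<delta>2: "\<delta>2 > 0" "\<And>s. \<bar>s - t\<bar> < \<delta>2 \<Longrightarrow> \<gamma>2 s \<in> cdom c"
      using geodesic_in_chart_nhd[OF cont(2) c(1,3)] by blast
    let ?x = "\<lambda>\<gamma> s. ((cmap c \<circ> \<gamma>) s, vector_derivative (cmap c \<circ> \<gamma>) (at s))"
    let ?f = "\<lambda>z. (snd z, - christoffel M c (fst z) (snd z) (snd z))"
    let ?U = "cimg c \<times> (UNIV :: (real ^ 'm) set)"
    have U: "open ?U" by (intro open_Times atlasD(2)[OF c(1)] open_UNIV)
    have f: "ck_on 1 ?U ?f"
      by (intro ck_on_Pair ck_on_minus U christoffel_diag_smooth[OF c(1)] ck_on_bounded_linear[OF U bounded_linear_snd])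
    have x: "?x \<gamma> s \<in> ?U \<and> (?x \<gamma> has_vector_derivative ?f (?x \<gamma> s)) (at s)"
      if "geodesic M \<gamma>" "\<gamma> s \<in> cdom c" for \<gamma> s
      using cmap_in[OF that(2)] geodesicD[OF that(1) c(1) that(2)] by (auto intro!: has_vector_derivative_Pair simp: o_def)
    have "?x \<gamma>1 t = ?x \<gamma>2 t"
      using that velocity_eq_iff[OF g _ c(1,2)] unfolding A_def by auto
    have "\<exists>\<epsilon>>0. \<forall>s. \<bar>s - t\<bar> < \<epsilon> \<longrightarrow> ?x \<gamma>1 s = ?x \<gamma>2 s"
      by (rule ode_unique_local[OF U f _ x[OF g(1)] x[OF g(2)] \<open>?x \<gamma>1 t = ?x \<gamma>2 t\<close>, of "min \<delta>1 \<delta>2"])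
        (use \<delta>1 \<delta>2 in auto)
    then obtain \<epsilon> where \<epsilon>: "\<epsilon> > 0" "\<And>s. \<bar>s - t\<bar> < \<epsilon> \<Longrightarrow> ?x \<gamma>1 s = ?x \<gamma>2 s" by blast
    show ?thesis
    proof (intro exI[of _ "min \<epsilon> (min \<delta>1 \<delta>2)"] conjI allI impI)
      fix s assume "\<bar>s - t\<bar> < min \<epsilon> (min \<delta>1 \<delta>2)"
      then have 1: "\<bar>s - t\<bar> < \<epsilon>" "\<bar>s - t\<bar> < \<delta>1" "\<bar>s - t\<bar> < \<delta>2" by simp_all
      have s: "?x \<gamma>1 s = ?x \<gamma>2 s" "\<gamma>1 s \<in> cdom c" "\<gamma>2 s \<in> cdom c"
        by (rule \<epsilon>(2)[OF 1(1)] \<delta>1(2)[OF 1(2)] \<delta>2(2)[OF 1(3)])+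
      from s(1) have eq: "cmap c (\<gamma>1 s) = cmap c (\<gamma>2 s)"
        and v: "vector_derivative (cmap c \<circ> \<gamma>1) (at s) = vector_derivative (cmap c \<circ> \<gamma>2) (at s)"
        unfolding prod.inject o_apply by blast+
      have \<gamma>: "\<gamma>1 s = \<gamma>2 s" by (metis eq cinv_cmap[OF c(1) s(2)] cinv_cmap[OF c(1) s(3)])
      show "s \<in> A" unfolding A_def using \<gamma> velocity_eq_iff[OF g \<gamma> c(1) s(2)] v by blast
    qed (use \<epsilon>(1) \<delta>1(1) \<delta>2(1) in simp)
  qed
  then have "open A" unfolding open_dist dist_real_def by blast
  moreover have "\<exists>\<epsilon>>0. \<forall>s. \<bar>s - t\<bar> < \<epsilon> \<longrightarrow> s \<in> - A" if "t \<in> - A" for t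
  proof (cases "\<gamma>1 t = \<gamma>2 t")
    case False
    have "closed {t. \<gamma>1 t = \<gamma>2 t}" by (rule closed_Collect_eq[OF cont])
    then have "open {t. \<gamma>1 t \<noteq> \<gamma>2 t}" by (simp add: closed_def Collect_neg_eq)
    then obtain \<epsilon> where "\<epsilon> > 0" "ball t \<epsilon> \<subseteq> {t. \<gamma>1 t \<noteq> \<gamma>2 t}"
      using False openE[of "{t. \<gamma>1 t \<noteq> \<gamma>2 t}" t] by blast
    then show ?thesis by (intro exI[of _ \<epsilon>]) (auto simp: A_def dist_real_def abs_minus_commute subset_iff)
  next
    case True
    define c where "c = chart_at M (\<gamma>1 t)"
    have c: "c \<in> atlas M" "\<gamma>1 t \<in> cdom c" "\<gamma>2 t \<in> cdom c" using chart_at[of "\<gamma>1 t"] True by (auto simp: c_def)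
    let ?y = "\<lambda>\<gamma> s. vector_derivative (cmap c \<circ> \<gamma>) (at s)"
    have "?y \<gamma>1 t - ?y \<gamma>2 t \<noteq> 0" using that True velocity_eq_iff[OF g True c(1,2)] by (auto simp: A_def)
    moreover have "isCont (\<lambda>s. ?y \<gamma>1 s - ?y \<gamma>2 s) t"
      using has_vector_derivative_continuous[OF geodesicD(2)[OF g(1) c(1,2)]]
        has_vector_derivative_continuous[OF geodesicD(2)[OF g(2) c(1,3)]] by (rule continuous_diff)
    ultimately have "\<exists>e>0. \<forall>s. dist t s < e \<longrightarrow> ?y \<gamma>1 s - ?y \<gamma>2 s \<noteq> 0"
      by (intro continuous_at_avoid)
    then obtain \<epsilon>1 where \<epsilon>1: "\<epsilon>1 > 0" "\<And>s. dist t s < \<epsilon>1 \<Longrightarrow> ?y \<gamma>1 s - ?y \<gamma>2 s \<noteq> 0" by blast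
    obtain \<delta>1 where \<delta>1: "\<delta>1 > 0" "\<And>s. \<bar>s - t\<bar> < \<delta>1 \<Longrightarrow> \<gamma>1 s \<in> cdom c"
      using geodesic_in_chart_nhd[OF cont(1) c(1,2)] by blast
    show ?thesis
    proof (intro exI[of _ "min \<epsilon>1 \<delta>1"] conjI allI impI)
      fix s assume "\<bar>s - t\<bar> < min \<epsilon>1 \<delta>1"
      then have "dist t s < \<epsilon>1" "\<bar>s - t\<bar> < \<delta>1" by (simp_all add: dist_real_def abs_minus_commute)
      then have "?y \<gamma>1 s \<noteq> ?y \<gamma>2 s" "\<gamma>1 s \<in> cdom c" using \<epsilon>1(2)[of s] \<delta>1(2)[of s] by simp_all
      then show "s \<in> - A" using velocity_eq_iff[OF g _ c(1), of s] unfolding A_def by blast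
    qed (use \<epsilon>1(1) \<delta>1(1) in simp)
  qed
  then have "open (- A)" unfolding open_dist dist_real_def by blast
  ultimately have "A = {} \<or> A = UNIV" using clopen[of A] by (simp add: closed_def)
  moreover have "0 \<in> A" using 0 by (simp add: A_def)
  ultimately have "A = UNIV" by blast
  then have "\<gamma>1 t = \<gamma>2 t" for t unfolding A_def by blast
  then show ?thesis by (rule ext)
qed

lemma geodesic_scale:
  assumes "geodesic M \<gamma>"
  shows "geodesic M (\<lambda>s. \<gamma> (a * s))" "velocity M (\<lambda>s. \<gamma> (a * s)) 0 = a *\<^sub>R velocity M \<gamma> 0"
proof -
  have d: "((cmap c \<circ> (\<lambda>s. \<gamma> (a * s))) has_vector_derivative a *\<^sub>R vector_derivative (cmap c \<circ> \<gamma>) (at (a * t))) (at t)"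
    if "c \<in> atlas M" "\<gamma> (a * t) \<in> cdom c" for c t
  proof -
    have "((\<lambda>s. a * s) has_real_derivative a) (at t)" by (auto intro!: derivative_eq_intros)
    from vector_diff_chain_at[OF this[unfolded has_real_derivative_iff_has_vector_derivative] geodesicD(1)[OF assms that]]
    show ?thesis by (simp add: o_def)
  qed
  note cont = geodesic_continuous[OF assms]
  have cont': "continuous_on UNIV (\<lambda>s. \<gamma> (a * s))"
    by (rule continuous_on_compose2[OF cont]) (auto intro!: continuous_intros)
  show "geodesic M (\<lambda>s. \<gamma> (a * s))"
    unfolding geodesic_def Let_def
  proof (intro conjI ballI allI impI)
    show "continuous_on UNIV (\<lambda>s. \<gamma> (a * s))" by (rule cont')
  next
    fix c t assume c: "c \<in> atlas M" "\<gamma> (a * t) \<in> cdom c"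
    let ?y = "cmap c \<circ> (\<lambda>s. \<gamma> (a * s))"
    show "?y differentiable (at t)"
      using d[OF c] by (auto simp: has_vector_derivative_def differentiable_def)
    obtain \<delta> where \<delta>: "\<delta> > 0" "\<And>s. \<bar>s - t\<bar> < \<delta> \<Longrightarrow> \<gamma> (a * s) \<in> cdom c"
      using geodesic_in_chart_nhd[OF cont' c] by blast
    have y': "vector_derivative ?y (at s) = a *\<^sub>R vector_derivative (cmap c \<circ> \<gamma>) (at (a * s))" if "\<bar>s - t\<bar> < \<delta>" for s
      by (rule vector_derivative_at[OF d[OF c(1) \<delta>(2)[OF that]]])
    have "((\<lambda>s. a * s) has_real_derivative a) (at t)" by (auto intro!: derivative_eq_intros)
    from vector_diff_chain_at[OF this[unfolded has_real_derivative_iff_has_vector_derivative] geodesicD(2)[OF assms c]]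
    have "((\<lambda>s. vector_derivative (cmap c \<circ> \<gamma>) (at (a * s))) has_vector_derivative
        a *\<^sub>R (- christoffel M c ((cmap c \<circ> \<gamma>) (a * t)) (vector_derivative (cmap c \<circ> \<gamma>) (at (a * t)))
          (vector_derivative (cmap c \<circ> \<gamma>) (at (a * t))))) (at t)" by (simp add: o_def)
    then have "((\<lambda>s. a *\<^sub>R vector_derivative (cmap c \<circ> \<gamma>) (at (a * s))) has_vector_derivative
        a *\<^sub>R a *\<^sub>R (- christoffel M c ((cmap c \<circ> \<gamma>) (a * t)) (vector_derivative (cmap c \<circ> \<gamma>) (at (a * t)))
          (vector_derivative (cmap c \<circ> \<gamma>) (at (a * t))))) (at t)"
      by (intro bounded_linear.has_vector_derivative[OF bounded_linear_scaleR_right])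
    moreover have "a *\<^sub>R a *\<^sub>R (- christoffel M c ((cmap c \<circ> \<gamma>) (a * t)) (vector_derivative (cmap c \<circ> \<gamma>) (at (a * t)))
          (vector_derivative (cmap c \<circ> \<gamma>) (at (a * t))))
        = - christoffel M c (?y t) (vector_derivative ?y (at t)) (vector_derivative ?y (at t))"
      using y'[of t] \<delta>(1) bilinear_lmul[OF bilinear_christoffel[OF c(1) cmap_in[OF c(2)]]]
        bilinear_rmul[OF bilinear_christoffel[OF c(1) cmap_in[OF c(2)]]] by simp
    ultimately have "((\<lambda>s. a *\<^sub>R vector_derivative (cmap c \<circ> \<gamma>) (at (a * s))) has_vector_derivative
        - christoffel M c (?y t) (vector_derivative ?y (at t)) (vector_derivative ?y (at t))) (at t)" by simp
    then show "((\<lambda>s. vector_derivative ?y (at s)) has_vector_derivative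
        - christoffel M c (?y t) (vector_derivative ?y (at t)) (vector_derivative ?y (at t))) (at t)"
      by (rule has_vector_derivative_transform_within_open[of _ _ _ "ball t \<delta>"])
        (use \<delta> y' in \<open>auto simp: dist_real_def abs_minus_commute\<close>)
  qed
  show "velocity M (\<lambda>s. \<gamma> (a * s)) 0 = a *\<^sub>R velocity M \<gamma> 0"
    using vector_derivative_at[OF d[OF chart_at(1), of 0 "\<gamma> 0"]] chart_at(2) by (simp add: velocity_def)
qed

text \<open>\<open>is_exp_map\<close> supplies a separate geodesic for each vector and records only
  its value at time 1. Rescaling time and uniqueness identify all of those on one line through 0, so
  that rays of \<open>E\<close> are geodesics.\<close>

lemma exp_map_geodesic:
  assumes "is_exp_map M q E"
  shows "geodesic M (\<lambda>t. E (t *\<^sub>R v))" "velocity M (\<lambda>t. E (t *\<^sub>R v)) 0 = v" "E 0 = q"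
proof -
  have ex: "\<exists>\<gamma>. geodesic M \<gamma> \<and> \<gamma> 0 = q \<and> velocity M \<gamma> 0 = v \<and> E v = \<gamma> 1" for v
    using assms by (simp add: is_exp_map_def)
  obtain \<gamma> where \<gamma>: "geodesic M \<gamma>" "\<gamma> 0 = q" "velocity M \<gamma> 0 = v" using ex by blast
  have "E (t *\<^sub>R v) = \<gamma> t" for t
  proof -
    obtain \<gamma>' where \<gamma>': "geodesic M \<gamma>'" "\<gamma>' 0 = q" "velocity M \<gamma>' 0 = t *\<^sub>R v" "E (t *\<^sub>R v) = \<gamma>' 1" using ex by blast
    have "\<gamma>' = (\<lambda>s. \<gamma> (t * s))"
      by (rule geodesic_unique[OF \<gamma>'(1) geodesic_scale(1)[OF \<gamma>(1)]]) (simp_all add: \<gamma> \<gamma>' geodesic_scale(2))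
    then show ?thesis using \<gamma>' by simp
  qed
  then have eq: "(\<lambda>t. E (t *\<^sub>R v)) = \<gamma>" by blast
  show "geodesic M (\<lambda>t. E (t *\<^sub>R v))" "velocity M (\<lambda>t. E (t *\<^sub>R v)) 0 = v" unfolding eq by fact+
  show "E 0 = q" using fun_cong[OF eq, of 0] \<gamma>(2) by simp
qed

end

section \<open>The exponential map at a pole\<close>

lemma (in riemannian) ginner_compose_smooth:
  assumes "c \<in> atlas M" "open W" "F ` W \<subseteq> cimg c" "ck_on k W F" "ck_on k W Y" "ck_on k W Z"
  shows "ck_on k W (\<lambda>p. ginner M c (F p) (Y p) (Z p))"
proof -
  have "bilinear (\<lambda>(A::real ^ 'm ^ 'm) v. A *v v)"
    unfolding bilinear_def
    by (auto intro!: linearI simp: matrix_vector_right_distrib matrix_vector_mult_scaleR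
        matrix_vector_mult_add_rdistrib scaleR_matrix_vector_assoc)
  then have "bounded_bilinear (\<lambda>(A::real ^ 'm ^ 'm) v. A *v v)" by (simp add: bilinear_conv_bounded_bilinear)
  from ck_on_bilinear[OF assms(2) this ck_on_compose[OF assms(2) atlasD(2)[OF assms(1)] assms(3,4) gram_smooth[OF assms(1)]] assms(6)]
  show ?thesis unfolding ginner_def by (intro ck_on_inner assms(2,5))
qed

text \<open>\<open>is_pole\<close> asserts that some exponential map is a diffeomorphism; one such
  map is fixed here, so that polar coordinates are available by name.\<close>

locale pole = riemannian N
  for N :: "('a::{t2_space, second_countable_topology}, 'n::finite) riem" +
  fixes q :: 'a and E :: "real ^ 'n \<Rightarrow> 'a"
  assumes exp_map: "is_exp_map N q E" and bij_E: "bij E" and cont_E: "continuous_on UNIV E"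
    and smooth_E: "\<And>c. c \<in> atlas N \<Longrightarrow> smooth_on (E -` cdom c) (cmap c \<circ> E)"
    and smooth_inv_E: "\<And>c. c \<in> atlas N \<Longrightarrow> smooth_on (cmap c ` cdom c) (inv E \<circ> cinv c)"
begin

definition ip0 :: "real ^ 'n \<Rightarrow> real ^ 'n \<Rightarrow> real" where
  "ip0 u v = inner_at N q u v"

abbreviation dE :: "('a, 'n) chart \<Rightarrow> real ^ 'n \<Rightarrow> real ^ 'n \<Rightarrow> real ^ 'n" where
  "dE c x \<equiv> dir_deriv (cmap c \<circ> E) x"

text \<open>\<open>pm\<close> is the pull-back metric \<open>E\<^sup>* g\<^sub>N\<close>.\<close>

definition pm :: "real ^ 'n \<Rightarrow> real ^ 'n \<Rightarrow> real ^ 'n \<Rightarrow> real" where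
  "pm x u v = inner_at N (E x) (dE (chart_at N (E x)) x u) (dE (chart_at N (E x)) x v)"

lemma open_E_vimage: "c \<in> atlas N \<Longrightarrow> open (E -` cdom c)"
  by (rule open_vimage[OF atlasD(1) cont_E])

lemma E_smooth: "c \<in> atlas N \<Longrightarrow> ck_on k (E -` cdom c) (cmap c \<circ> E)"
  by (rule smooth_on_ck[OF smooth_E])

lemma inv_E_smooth: "c \<in> atlas N \<Longrightarrow> ck_on k (cimg c) (inv E \<circ> cinv c)"
  unfolding cimg_def by (rule smooth_on_ck[OF smooth_inv_E])

lemma E_has_derivative:
  assumes "c \<in> atlas N" "E x \<in> cdom c"
  shows "((cmap c \<circ> E) has_derivative dE c x) (at x)"
  by (rule ck_on_has_derivative[OF open_E_vimage[OF assms(1)] E_smooth[OF assms(1)]]) (simp add: assms)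

lemma inv_E_has_derivative:
  assumes "c \<in> atlas N" "y \<in> cimg c"
  shows "((inv E \<circ> cinv c) has_derivative dir_deriv (inv E \<circ> cinv c) y) (at y)"
  by (rule ck_on_has_derivative[OF atlasD(2)[OF assms(1)] inv_E_smooth[OF assms(1)] assms(2)])

lemma inv_E_E [simp]: "inv E (E x) = x" and E_inv_E [simp]: "E (inv E y) = y"
  using bij_E by (simp_all add: bij_def inv_f_f surj_f_inv_f)

lemma dE_inverse:
  assumes "c \<in> atlas N" "E x \<in> cdom c"
  shows "dir_deriv (inv E \<circ> cinv c) (cmap c (E x)) (dE c x u) = u"
    "dE c x (dir_deriv (inv E \<circ> cinv c) (cmap c (E x)) w) = w"
proof -
  let ?y = "cmap c (E x)"
  have y: "?y \<in> cimg c" by (rule cmap_in[OF assms(2)])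
  have x: "(inv E \<circ> cinv c) ?y = x" by (simp add: cinv_cmap[OF assms])
  have "((\<lambda>x. (inv E \<circ> cinv c) ((cmap c \<circ> E) x)) has_derivative
      (\<lambda>u. dir_deriv (inv E \<circ> cinv c) ?y (dE c x u))) (at x)"
    by (rule has_derivative_compose[OF E_has_derivative[OF assms]]) (simp only: o_apply[of "cmap c"] inv_E_has_derivative[OF assms(1) y])
  moreover have "((\<lambda>x. (inv E \<circ> cinv c) ((cmap c \<circ> E) x)) has_derivative (\<lambda>u. u)) (at x)"
    by (rule has_derivative_transform_within_open[OF has_derivative_ident open_E_vimage[OF assms(1)]])
      (simp_all add: assms cinv_cmap[OF assms(1)])
  ultimately have "(\<lambda>u. dir_deriv (inv E \<circ> cinv c) ?y (dE c x u)) = (\<lambda>u. u)" by (rule has_derivative_unique)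
  from fun_cong[OF this] show "dir_deriv (inv E \<circ> cinv c) ?y (dE c x u) = u" .
  have "((\<lambda>y. (cmap c \<circ> E) ((inv E \<circ> cinv c) y)) has_derivative
      (\<lambda>w. dE c x (dir_deriv (inv E \<circ> cinv c) ?y w))) (at ?y)"
    by (rule has_derivative_compose[OF inv_E_has_derivative[OF assms(1) y]])
      (simp only: x E_has_derivative[OF assms])
  moreover have "((\<lambda>y. (cmap c \<circ> E) ((inv E \<circ> cinv c) y)) has_derivative (\<lambda>w. w)) (at ?y)"
    by (rule has_derivative_transform_within_open[OF has_derivative_ident atlasD(2)[OF assms(1)] y])
      (simp add: cmap_cinv[OF assms(1)])
  ultimately have "(\<lambda>w. dE c x (dir_deriv (inv E \<circ> cinv c) ?y w)) = (\<lambda>w. w)" by (rule has_derivative_unique)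
  from fun_cong[OF this] show "dE c x (dir_deriv (inv E \<circ> cinv c) ?y w) = w" .
qed

lemma dE_linear: "c \<in> atlas N \<Longrightarrow> E x \<in> cdom c \<Longrightarrow> linear (dE c x)"
  by (rule has_derivative_linear[OF E_has_derivative])

text \<open>The preferred chart in the definition of \<open>pm\<close> changes with the point in an
  uncontrolled way. Differentiating \<open>pm\<close> needs one chart on a whole neighbourhood,
  which this formula permits.\<close>

lemma pm_chart:
  assumes "c \<in> atlas N" "E x \<in> cdom c"
  shows "pm x u v = ginner N c (cmap c (E x)) (dE c x u) (dE c x v)"
proof -
  let ?d = "chart_at N (E x)"
  note d = chart_at[of "E x"]
  have ev: "\<forall>\<^sub>F z in at x. E z \<in> cdom c"
    using eventually_at_in_open'[OF open_E_vimage[OF assms(1)], of x] assms(2) by simp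
  have "((cmap ?d \<circ> E) has_derivative (\<lambda>e. dir_deriv (cmap ?d \<circ> cinv c) (cmap c (E x)) (dE c x e))) (at x)"
    by (rule has_derivative_change_chart[OF assms(1) d(1) assms(2) d(2) E_has_derivative[OF assms] ev])
  then have "dE ?d x = (\<lambda>e. dir_deriv (cmap ?d \<circ> cinv c) (cmap c (E x)) (dE c x e))" by (rule dir_deriv_eq)
  then show ?thesis
    unfolding pm_def inner_at_def by (simp only: ginner_transition[OF assms(1) d(1) assms(2) d(2)])
qed

lemma bilinear_pm: "bilinear (pm x)"
proof -
  note lin = dE_linear[OF chart_at(1) chart_at(2), of x]
  show ?thesis unfolding bilinear_def pm_def inner_at_def
    by (auto intro!: linearI simp: linear_add[OF lin] linear_scale[OF lin] bilinear_ladd[OF bilinear_ginner]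
        bilinear_radd[OF bilinear_ginner] bilinear_lmul[OF bilinear_ginner] bilinear_rmul[OF bilinear_ginner])
qed

lemma pm_sym: "pm x u v = pm x v u"
  unfolding pm_def inner_at_def by (rule ginner_sym[OF chart_at(1) cmap_in[OF chart_at(2)]])

lemma pm_pos:
  assumes "u \<noteq> 0" shows "pm x u u > 0"
proof -
  note c = chart_at[of "E x"]
  have "dE (chart_at N (E x)) x u \<noteq> 0"
  proof
    assume "dE (chart_at N (E x)) x u = 0"
    moreover have "dE (chart_at N (E x)) x 0 = 0" by (rule linear_0[OF dE_linear[OF c]])
    ultimately show False using dE_inverse(1)[OF c, of u] dE_inverse(1)[OF c, of 0] assms by metis
  qed
  then show ?thesis unfolding pm_def inner_at_def by (intro ginner_pos[OF c(1) cmap_in[OF c(2)]])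
qed

lemma pm_nonneg: "pm x u u \<ge> 0"
  using pm_pos[of u x] bilinear_lzero[OF bilinear_pm] by (cases "u = 0") auto

lemma pm_smooth:
  assumes "open W" "ck_on k W X" "ck_on k W Y" "ck_on k W Z"
  shows "ck_on k W (\<lambda>p. pm (X p) (Y p) (Z p))"
proof (rule ck_on_local[OF assms(1)])
  fix p assume p: "p \<in> W"
  obtain c where c: "c \<in> atlas N" "E (X p) \<in> cdom c" using charts_cover by blast
  define V where "V = W \<inter> X -` (E -` cdom c)"
  have V: "open V" "p \<in> V" "V \<subseteq> W"
    using continuous_open_preimage[OF ck_on_continuous[OF assms(2)] assms(1) open_E_vimage[OF c(1)]] p c
    by (auto simp: V_def)
  note sub = ck_on_open_subset[OF _ assms(1) V(1) V(3)]
  have X: "X ` V \<subseteq> E -` cdom c" by (auto simp: V_def)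
  have F: "ck_on k V (\<lambda>p. (cmap c \<circ> E) (X p))"
    by (rule ck_on_compose[OF V(1) open_E_vimage[OF c(1)] X sub[OF assms(2)] E_smooth[OF c(1)]])
  have dE: "ck_on k V (\<lambda>p. dE c (X p) (Y p))" if "ck_on k W Y" for Y :: "'b \<Rightarrow> real ^ 'n"
  proof (rule ck_on_cong[OF V(1)])
    show "ck_on k V (\<lambda>p. \<Sum>b\<in>Basis. (Y p \<bullet> b) *\<^sub>R dE c (X p) b)"
      by (intro ck_on_sum ck_on_scaleR ck_on_inner ck_on_const V(1) sub[OF that]
          ck_on_compose[OF V(1) open_E_vimage[OF c(1)] X sub[OF assms(2)]
            ck_on_dir_deriv[OF open_E_vimage[OF c(1)] E_smooth[OF c(1)]]])
    fix p assume "p \<in> V"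
    then have "E (X p) \<in> cdom c" by (simp add: V_def)
    from bounded_linear_euclid_sum[OF has_derivative_bounded_linear[OF E_has_derivative[OF c(1) this]], of "Y p"]
    show "(\<Sum>b\<in>Basis. (Y p \<bullet> b) *\<^sub>R dE c (X p) b) = dE c (X p) (Y p)" by (rule sym)
  qed
  have "ck_on k V (\<lambda>p. ginner N c ((cmap c \<circ> E) (X p)) (dE c (X p) (Y p)) (dE c (X p) (Z p)))"
    by (rule ginner_compose_smooth[OF c(1) V(1) _ F dE[OF assms(3)] dE[OF assms(4)]])
      (auto simp: V_def cimg_def)
  then have "ck_on k V (\<lambda>p. pm (X p) (Y p) (Z p))"
    by (rule ck_on_cong[OF V(1), rotated]) (simp add: V_def pm_chart[OF c(1)])
  then show "\<exists>V. open V \<and> p \<in> V \<and> V \<subseteq> W \<and> ck_on k V (\<lambda>p. pm (X p) (Y p) (Z p))" using V by blast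
qed

lemma ray_geodesic: "geodesic N (\<lambda>t. E (t *\<^sub>R v))"
  and E_0: "E 0 = q"
  using exp_map_geodesic[OF exp_map] by blast+

lemma ray_has_vector_derivative:
  assumes "c \<in> atlas N" "E (t *\<^sub>R v) \<in> cdom c"
  shows "((cmap c \<circ> (\<lambda>t. E (t *\<^sub>R v))) has_vector_derivative dE c (t *\<^sub>R v) v) (at t)"
proof -
  have "((\<lambda>t. t *\<^sub>R v) has_vector_derivative v) (at t)" by (auto intro!: derivative_eq_intros)
  from has_vector_derivative_compose[OF this E_has_derivative[OF assms]]
  show ?thesis by (simp add: o_def)
qed

lemma ray_velocity: "velocity N (\<lambda>t. E (t *\<^sub>R v)) t = dE (chart_at N (E (t *\<^sub>R v))) (t *\<^sub>R v) v"
  unfolding velocity_def by (rule vector_derivative_at[OF ray_has_vector_derivative[OF chart_at]])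

text \<open>In the preferred chart at \<open>q\<close> the differential of \<open>E\<close> at 0 is
  the identity, because the ray in direction \<open>u\<close> has initial velocity
  \<open>u\<close>.\<close>

lemma pm_0: "pm 0 u v = ip0 u v"
proof -
  have "dE (chart_at N q) 0 u = u" for u
    using exp_map_geodesic(2)[OF exp_map, of u] ray_velocity[of u 0] E_0 by simp
  then show ?thesis unfolding pm_def ip0_def by (simp add: E_0)
qed

lemma ip0_sym: "ip0 u v = ip0 v u" and bilinear_ip0: "bilinear ip0" and ip0_pos: "u \<noteq> 0 \<Longrightarrow> ip0 u u > 0"
  and ip0_nonneg: "ip0 u u \<ge> 0"
proof -
  have eq: "ip0 = pm 0" by (intro ext) (simp add: pm_0)
  show "ip0 u v = ip0 v u" "bilinear ip0" "u \<noteq> 0 \<Longrightarrow> ip0 u u > 0" "ip0 u u \<ge> 0"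
    unfolding eq by (simp_all add: pm_sym bilinear_pm pm_pos pm_nonneg)
qed

subsection \<open>Variations through rays\<close>

text \<open>The variation t (v + s u) of the ray of \<open>v\<close>, with p = (s, t):
  \<open>fst\<close> is the variation parameter and \<open>snd\<close> the time along the
  ray.\<close>

definition ray_map :: "real ^ 'n \<Rightarrow> real ^ 'n \<Rightarrow> real \<times> real \<Rightarrow> real ^ 'n" where
  "ray_map v u p = snd p *\<^sub>R (v + fst p *\<^sub>R u)"

definition ray_chart :: "('a, 'n) chart \<Rightarrow> real ^ 'n \<Rightarrow> real ^ 'n \<Rightarrow> real \<times> real \<Rightarrow> real ^ 'n" where
  "ray_chart c v u p = (cmap c \<circ> E) (ray_map v u p)"

abbreviation \<open>e\<^sub>s \<equiv> (1::real, 0::real)\<close>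
abbreviation \<open>e\<^sub>t \<equiv> (0::real, 1::real)\<close>

definition ray_dom :: "('a, 'n) chart \<Rightarrow> real ^ 'n \<Rightarrow> real ^ 'n \<Rightarrow> (real \<times> real) set" where
  "ray_dom c v u = ray_map v u -` (E -` cdom c)"

lemma ray_map_smooth: "ck_on k UNIV (ray_map v u)"
  unfolding ray_map_def
  by (intro ck_on_scaleR ck_on_add ck_on_const open_UNIV ck_on_bounded_linear bounded_linear_fst bounded_linear_snd)

lemma ray_map_has_derivative:
  "(ray_map v u has_derivative (\<lambda>e. snd e *\<^sub>R (v + fst p *\<^sub>R u) + (snd p * fst e) *\<^sub>R u)) (at p)"
  unfolding ray_map_def by (auto intro!: derivative_eq_intros simp: algebra_simps)

lemma ray_dom_open: "c \<in> atlas N \<Longrightarrow> open (ray_dom c v u)"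
  unfolding ray_dom_def
  by (rule open_vimage[OF open_E_vimage ck_on_continuous[OF ray_map_smooth[of 0]]])

lemma ray_chart_smooth:
  assumes "c \<in> atlas N" shows "ck_on k (ray_dom c v u) (ray_chart c v u)"
  unfolding ray_chart_def
  by (rule ck_on_compose[OF ray_dom_open[OF assms] open_E_vimage[OF assms] _
        ck_on_open_subset[OF ray_map_smooth open_UNIV ray_dom_open[OF assms]] E_smooth[OF assms]])
    (auto simp: ray_dom_def)

lemma ray_chart_in: "p \<in> ray_dom c v u \<Longrightarrow> ray_chart c v u p \<in> cimg c"
  by (simp add: ray_chart_def ray_dom_def cimg_def)

text \<open>Here \<open>e_t\<close> is a variable for an arbitrary direction in the parameter plane,
  not the unit vector \<open>e\<^sub>t\<close>.\<close>

lemma ray_chart_deriv: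
  assumes "c \<in> atlas N" "p \<in> ray_dom c v u"
  shows "dir_deriv (ray_chart c v u) p e_t = dE c (ray_map v u p) (snd e_t *\<^sub>R (v + fst p *\<^sub>R u) + (snd p * fst e_t) *\<^sub>R u)"
proof -
  have "E (ray_map v u p) \<in> cdom c" using assms(2) by (simp add: ray_dom_def)
  from has_derivative_compose[OF ray_map_has_derivative E_has_derivative[OF assms(1) this]]
  show ?thesis unfolding ray_chart_def by (simp add: dir_deriv_eq)
qed

lemma ray_chart_t:
  assumes "c \<in> atlas N" "p \<in> ray_dom c v u"
  shows "dir_deriv (ray_chart c v u) p e\<^sub>t = dE c (ray_map v u p) (v + fst p *\<^sub>R u)"
    "dir_deriv (ray_chart c v u) p e\<^sub>s = dE c (ray_map v u p) (snd p *\<^sub>R u)"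
  unfolding ray_chart_deriv[OF assms] by simp_all

lemma pm_ray:
  assumes "c \<in> atlas N" "p \<in> ray_dom c v u"
  shows "pm (ray_map v u p) x y = ginner N c (ray_chart c v u p) (dE c (ray_map v u p) x) (dE c (ray_map v u p) y)"
  using pm_chart[OF assms(1), of "ray_map v u p" x y] assms(2) by (simp add: ray_chart_def ray_dom_def)

text \<open>For fixed s the curve in t is the ray of v + s u, a geodesic. The work consists in
  turning its one-variable equation into a statement on the partial derivative of the two-variable
  map.\<close>

lemma ray_cov_zero:
  assumes c: "c \<in> atlas N" and p: "p \<in> ray_dom c v u"
  shows "cov c (ray_chart c v u) (\<lambda>p. dir_deriv (ray_chart c v u) p e\<^sub>t) p e\<^sub>t = 0"
proof -
  obtain s t where st: "p = (s, t)" by (cases p)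
  let ?F = "ray_chart c v u" and ?w = "v + s *\<^sub>R u"
  let ?\<gamma> = "\<lambda>t. E (t *\<^sub>R ?w)"
  have dom: "(s, t') \<in> ray_dom c v u \<longleftrightarrow> ?\<gamma> t' \<in> cdom c" for t'
    by (simp add: ray_dom_def ray_map_def)
  note geo = geodesicD[OF ray_geodesic[of ?w] c, of t]
  have \<gamma>t: "?\<gamma> t \<in> cdom c" using p dom st by simp
  obtain \<delta> where \<delta>: "\<delta> > 0" "\<And>t'. \<bar>t' - t\<bar> < \<delta> \<Longrightarrow> ?\<gamma> t' \<in> cdom c"
    using geodesic_in_chart_nhd[OF geodesic_continuous[OF ray_geodesic] c \<gamma>t] by blast
  have vd: "vector_derivative (cmap c \<circ> ?\<gamma>) (at t') = dir_deriv ?F (s, t') e\<^sub>t" if "?\<gamma> t' \<in> cdom c" for t'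
    using vector_derivative_at[OF ray_has_vector_derivative[OF c that]] ray_chart_t(1)[OF c, of "(s, t')" v u] dom that
    by (simp add: ray_map_def)
  have Ft: "(cmap c \<circ> ?\<gamma>) t = ?F p" by (simp add: st ray_chart_def ray_map_def)
  let ?V = "\<lambda>p. dir_deriv ?F p e\<^sub>t"
  have dV: "(?V has_derivative dir_deriv ?V p) (at p)"
    by (rule ck_on_has_derivative[OF ray_dom_open[OF c] ck_on_dir_deriv[OF ray_dom_open[OF c] ray_chart_smooth[OF c]] p])
  have "((\<lambda>t'. (s, t')) has_vector_derivative e\<^sub>t) (at t)" by (auto intro!: derivative_eq_intros)
  from has_vector_derivative_compose[OF this] dV
  have "((\<lambda>t'. ?V (s, t')) has_vector_derivative dir_deriv ?V p e\<^sub>t) (at t)" unfolding st by blast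
  moreover have "((\<lambda>t'. ?V (s, t')) has_vector_derivative - christoffel N c (?F p) (?V p) (?V p)) (at t)"
  proof (rule has_vector_derivative_transform_within_open[of _ _ _ "ball t \<delta>"])
    show "((\<lambda>t'. vector_derivative (cmap c \<circ> ?\<gamma>) (at t')) has_vector_derivative - christoffel N c (?F p) (?V p) (?V p)) (at t)"
      using geo(2)[OF \<gamma>t] unfolding vd[OF \<gamma>t] Ft st[symmetric] .
    show "vector_derivative (cmap c \<circ> ?\<gamma>) (at t') = ?V (s, t')" if "t' \<in> ball t \<delta>" for t'
      using that by (intro vd \<delta>(2)) (simp add: dist_real_def abs_minus_commute)
  qed (use \<delta> in auto)
  ultimately have "dir_deriv ?V p e\<^sub>t = - christoffel N c (?F p) (?V p) (?V p)"
    by (rule vector_derivative_unique_at)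
  then show ?thesis unfolding cov_def by simp
qed

lemma pm_ray_has_derivative:
  assumes c: "c \<in> atlas N" and p: "p \<in> ray_dom c v u" and e: "e1 \<in> {e\<^sub>s, e\<^sub>t}" "e2 \<in> {e\<^sub>s, e\<^sub>t}"
  defines "F \<equiv> ray_chart c v u"
  shows "((\<lambda>p. ginner N c (F p) (dir_deriv F p e1) (dir_deriv F p e2)) has_derivative
    (\<lambda>e. ginner N c (F p) (cov c F (\<lambda>p. dir_deriv F p e1) p e) (dir_deriv F p e2)
       + ginner N c (F p) (dir_deriv F p e1) (cov c F (\<lambda>p. dir_deriv F p e2) p e))) (at p)"
proof -
  note W = ray_dom_open[OF c, of v u]
  have F: "ck_on k (ray_dom c v u) F" for k unfolding F_def by (rule ray_chart_smooth[OF c])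
  show ?thesis
    by (rule cov_metric[OF c _ ck_on_has_derivative[OF W F p]
          ck_on_has_derivative[OF W ck_on_dir_deriv[OF W F] p] ck_on_has_derivative[OF W ck_on_dir_deriv[OF W F] p]])
      (unfold F_def, rule ray_chart_in[OF p])
qed

lemma has_vector_derivative_snd:
  assumes "(f has_derivative f') (at (s, t))"
  shows "((\<lambda>t. f (s, t)) has_vector_derivative f' e\<^sub>t) (at t)"
proof -
  have "((\<lambda>t'. (s, t')) has_vector_derivative e\<^sub>t) (at t)" by (auto intro!: derivative_eq_intros)
  from has_vector_derivative_compose[OF this assms] show ?thesis .
qed

lemma has_vector_derivative_fst:
  assumes "(f has_derivative f') (at (s, t))"
  shows "((\<lambda>s. f (s, t)) has_vector_derivative f' e\<^sub>s) (at s)"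
proof -
  have "((\<lambda>s'. (s', t)) has_vector_derivative e\<^sub>s) (at s)" by (auto intro!: derivative_eq_intros)
  from has_vector_derivative_compose[OF this assms] show ?thesis .
qed

text \<open>Rays have constant speed: the t-derivative of |\<partial>_t F|^2 is twice the product of
  \<partial>_t F with its vanishing covariant derivative. The value is read off at t = 0.\<close>

lemma pm_radial_radial: "pm (t *\<^sub>R v) v v = ip0 v v"
proof -
  have "((\<lambda>t. pm (t *\<^sub>R v) v v) has_real_derivative 0) (at t)" for t
  proof -
    obtain c where c: "c \<in> atlas N" "E (t *\<^sub>R v) \<in> cdom c" using charts_cover by blast
    let ?F = "ray_chart c v 0"
    have p: "(0, t) \<in> ray_dom c v 0" using c by (simp add: ray_dom_def ray_map_def)
    have "((\<lambda>t'. ginner N c (?F (0, t')) (dir_deriv ?F (0, t') e\<^sub>t) (dir_deriv ?F (0, t') e\<^sub>t)) has_vector_derivative 0) (at t)"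
      using has_vector_derivative_snd[OF pm_ray_has_derivative[OF c(1) p, of e\<^sub>t e\<^sub>t]]
      by (simp add: ray_cov_zero[OF c(1) p] bilinear_lzero[OF bilinear_ginner] bilinear_rzero[OF bilinear_ginner])
    then have "((\<lambda>t. pm (t *\<^sub>R v) v v) has_vector_derivative 0) (at t)"
    proof (rule has_vector_derivative_transform_within_open[of _ _ _ "(\<lambda>t. E (t *\<^sub>R v)) -` cdom c"])
      show "open ((\<lambda>t. E (t *\<^sub>R v)) -` cdom c)"
        by (rule open_vimage[OF atlasD(1)[OF c(1)] geodesic_continuous[OF ray_geodesic]])
      fix t' assume "t' \<in> (\<lambda>t. E (t *\<^sub>R v)) -` cdom c"
      then have p': "(0, t') \<in> ray_dom c v 0" by (simp add: ray_dom_def ray_map_def)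
      show "ginner N c (?F (0, t')) (dir_deriv ?F (0, t') e\<^sub>t) (dir_deriv ?F (0, t') e\<^sub>t) = pm (t' *\<^sub>R v) v v"
        unfolding ray_chart_t[OF c(1) p'] using pm_ray[OF c(1) p', of v v] by (simp add: ray_map_def)
    qed (use c in auto)
    then show ?thesis by (simp add: has_real_derivative_iff_has_vector_derivative)
  qed
  then have "pm (t *\<^sub>R v) v v = pm (0 *\<^sub>R v) v v" by (intro DERIV_isconst_all) blast
  then show ?thesis by (simp add: pm_0)
qed

text \<open>The inner product \<open>\<langle>\<partial>\<^sub>tF, \<partial>\<^sub>sF\<rangle>\<close> has \<open>t\<close>-derivative \<open>\<partial>\<^sub>s |\<partial>\<^sub>tF|\<^sup>2 / 2\<close>, which does not depend on \<open>t\<close>.\<close>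

lemma gauss_lemma: "pm x x u = ip0 x u"
proof -
  define B where "B t = pm (t *\<^sub>R x) x (t *\<^sub>R u) - t * ip0 x u" for t
  have "(B has_real_derivative 0) (at t)" for t
  proof -
    obtain c where c: "c \<in> atlas N" "E (t *\<^sub>R x) \<in> cdom c" using charts_cover by blast
    let ?F = "ray_chart c x u"
    have p: "(0, t) \<in> ray_dom c x u" using c by (simp add: ray_dom_def ray_map_def)
    note W = ray_dom_open[OF c(1), of x u]
    let ?gtt = "\<lambda>p. ginner N c (?F p) (dir_deriv ?F p e\<^sub>t) (dir_deriv ?F p e\<^sub>t)"
    let ?gts = "\<lambda>p. ginner N c (?F p) (dir_deriv ?F p e\<^sub>t) (dir_deriv ?F p e\<^sub>s)"
    let ?Ds = "cov c ?F (\<lambda>p. dir_deriv ?F p e\<^sub>t) (0, t) e\<^sub>s"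
    have tors: "cov c ?F (\<lambda>p. dir_deriv ?F p e\<^sub>s) (0, t) e\<^sub>t = ?Ds"
      by (rule cov_torsion_free[OF c(1) W ray_chart_smooth[OF c(1)] p ray_chart_in[OF p]])
    have sym: "ginner N c (?F (0, t)) a b = ginner N c (?F (0, t)) b a" for a b
      by (rule ginner_sym[OF c(1) ray_chart_in[OF p]])
    have gtt: "?gtt (s, t') = ip0 (x + s *\<^sub>R u) (x + s *\<^sub>R u)" if "(s, t') \<in> ray_dom c x u" for s t'
      unfolding ray_chart_t[OF c(1) that] pm_ray[OF c(1) that, symmetric]
      using pm_radial_radial[of t' "x + s *\<^sub>R u"] by (simp add: ray_map_def)
    have "((\<lambda>s. ip0 (x + s *\<^sub>R u) (x + s *\<^sub>R u)) has_vector_derivative 2 * ginner N c (?F (0, t)) (dir_deriv ?F (0, t) e\<^sub>t) ?Ds) (at 0)"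
    proof (rule has_vector_derivative_transform_within_open[of "\<lambda>s. ?gtt (s, t)" _ _ "(\<lambda>s. (s, t)) -` ray_dom c x u"])
      show "((\<lambda>s. ?gtt (s, t)) has_vector_derivative 2 * ginner N c (?F (0, t)) (dir_deriv ?F (0, t) e\<^sub>t) ?Ds) (at 0)"
        using has_vector_derivative_fst[OF pm_ray_has_derivative[OF c(1) p, of e\<^sub>t e\<^sub>t]] sym[of ?Ds] by simp
      show "open ((\<lambda>s. (s, t)) -` ray_dom c x u)" by (rule open_vimage[OF W]) (intro continuous_intros)
    qed (use p gtt in auto)
    moreover have "((\<lambda>s. ip0 x x + 2 * s * ip0 x u + s\<^sup>2 * ip0 u u) has_vector_derivative 2 * ip0 x u) (at 0)"
      unfolding has_real_derivative_iff_has_vector_derivative[symmetric] by (auto intro!: derivative_eq_intros)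
    moreover have "ip0 (x + s *\<^sub>R u) (x + s *\<^sub>R u) = ip0 x x + 2 * s * ip0 x u + s\<^sup>2 * ip0 u u" for s
      by (simp add: bilinear_ladd[OF bilinear_ip0] bilinear_radd[OF bilinear_ip0] bilinear_lmul[OF bilinear_ip0]
          bilinear_rmul[OF bilinear_ip0] ip0_sym[of u x] power2_eq_square algebra_simps)
    ultimately have half: "ginner N c (?F (0, t)) (dir_deriv ?F (0, t) e\<^sub>t) ?Ds = ip0 x u"
      using vector_derivative_unique_at by fastforce
    have "((\<lambda>t'. ?gts (0, t')) has_vector_derivative ip0 x u) (at t)"
      using has_vector_derivative_snd[OF pm_ray_has_derivative[OF c(1) p, of e\<^sub>t e\<^sub>s]]
      by (simp add: ray_cov_zero[OF c(1) p] tors half bilinear_lzero[OF bilinear_ginner])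
    then have "((\<lambda>t'. pm (t' *\<^sub>R x) x (t' *\<^sub>R u)) has_vector_derivative ip0 x u) (at t)"
    proof (rule has_vector_derivative_transform_within_open[of _ _ _ "(\<lambda>t. E (t *\<^sub>R x)) -` cdom c"])
      show "open ((\<lambda>t. E (t *\<^sub>R x)) -` cdom c)"
        by (rule open_vimage[OF atlasD(1)[OF c(1)] geodesic_continuous[OF ray_geodesic]])
      fix t' assume "t' \<in> (\<lambda>t. E (t *\<^sub>R x)) -` cdom c"
      then have p': "(0, t') \<in> ray_dom c x u" by (simp add: ray_dom_def ray_map_def)
      show "?gts (0, t') = pm (t' *\<^sub>R x) x (t' *\<^sub>R u)"
        unfolding ray_chart_t[OF c(1) p'] using pm_ray[OF c(1) p', of x "t' *\<^sub>R u"] by (simp add: ray_map_def)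
    qed (use c in auto)
    then show ?thesis unfolding B_def
      by (auto intro!: derivative_eq_intros simp: has_real_derivative_iff_has_vector_derivative[symmetric])
  qed
  then have "B 1 = B 0" by (intro DERIV_isconst_all) blast
  then show ?thesis by (simp add: B_def bilinear_rzero[OF bilinear_pm])
qed

lemma pm_cauchy_schwarz: "(pm x u v)\<^sup>2 \<le> pm x u u * pm x v v"
proof -
  note bil = bilinear_ladd[OF bilinear_pm] bilinear_radd[OF bilinear_pm] bilinear_lmul[OF bilinear_pm]
          bilinear_rmul[OF bilinear_pm] bilinear_lsub[OF bilinear_pm] bilinear_rsub[OF bilinear_pm]
  show ?thesis
  proof (cases "u = 0")
    case True then show ?thesis by (simp add: bilinear_lzero[OF bilinear_pm])
  next
    case False
    have "0 \<le> pm x (pm x u u *\<^sub>R v - pm x u v *\<^sub>R u) (pm x u u *\<^sub>R v - pm x u v *\<^sub>R u)" by (rule pm_nonneg)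
    also have "\<dots> = pm x u u * (pm x u u * pm x v v - (pm x u v)\<^sup>2)"
      by (simp add: bil pm_sym[of x v u] algebra_simps power2_eq_square)
    finally show ?thesis using pm_pos[OF False, of x] by (simp add: zero_le_mult_iff)
  qed
qed

text \<open>The form of the Gauss lemma that makes rays minimising: along any curve the rate of
  change of the radius is at most the speed.\<close>

lemma pm_ge_radial: "(ip0 x u)\<^sup>2 \<le> ip0 x x * pm x u u"
  using pm_cauchy_schwarz[of x x u] by (simp add: gauss_lemma)

end

section \<open>The distance from the pole\<close>

text \<open>The speed of a curve comes with neither measurability nor a finite integral. The
  derivative integrates to the increment in the gauge sense; if its positive part is Lebesgue
  integrable that integral dominates the increment, and otherwise the right-hand side is
  infinite.\<close>

lemma increment_le_nn_integral:
  fixes f f' :: "real \<Rightarrow> real" and s :: "real \<Rightarrow> ennreal"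
  assumes "finite F" "continuous_on {0..1} f"
    and d: "\<And>t. t \<in> {0<..<1} - F \<Longrightarrow> (f has_real_derivative f' t) (at t)"
    and le: "\<And>t. t \<in> {0<..<1} - F \<Longrightarrow> ennreal (f' t) \<le> s t"
  shows "ennreal (f 1 - f 0) \<le> (\<integral>\<^sup>+ t\<in>{0..1}. s t \<partial>lborel)"
proof -
  let ?G = "{0<..<1} - F"
  define D where "D t = (if t \<in> ?G then f' t else 0)" for t
  define g where "g t = f (min 1 (max 0 t))" for t
  have "continuous_on UNIV g" unfolding g_def
    by (rule continuous_on_compose2[OF assms(2)]) (auto intro!: continuous_intros)
  then have [measurable]: "g \<in> borel_measurable borel" by (rule borel_measurable_continuous_onI)
  have [measurable]: "?G \<in> sets borel" using borel_closed[OF finite_imp_closed[OF assms(1)]] by (intro sets.Diff) auto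
  \<comment> \<open>The derivative is a pointwise limit of difference quotients of \<open>g\<close>,
    the extension of \<open>f\<close> that is constant on either side of the interval.\<close>
  have "D \<in> borel_measurable borel"
  proof (rule borel_measurable_LIMSEQ_real)
    fix t :: real
    show "(\<lambda>n. if t \<in> ?G then (g (t + inverse (real (Suc n))) - g t) / inverse (real (Suc n)) else 0) \<longlonglongrightarrow> D t"
    proof (cases "t \<in> ?G")
      case True
      have "(g has_real_derivative f' t) (at t)"
        by (rule has_field_derivative_transform_within_open[OF d[OF True], of "{0<..<1}"])
          (use True in \<open>auto simp: g_def min_def max_def\<close>)
      then have lim: "((\<lambda>h. (g (t + h) - g t) / h) \<longlongrightarrow> f' t) (at 0)" by (simp add: DERIV_def)
      have "filterlim (\<lambda>n. inverse (real (Suc n))) (at 0) sequentially"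
        unfolding filterlim_at using LIMSEQ_inverse_real_of_nat by auto
      from filterlim_compose[OF lim this] True show ?thesis by (simp add: D_def)
    next
      case False
      then show ?thesis by (simp only: D_def if_not_P[OF False] if_False tendsto_const)
    qed
  qed measurable
  then have Dm [measurable]: "D \<in> borel_measurable lborel" by simp
  have int: "(D has_integral (f 1 - f 0)) {0..1}"
    by (rule fundamental_theorem_of_calculus_interior_strong[OF assms(1) _ _ assms(2)])
      (use d in \<open>auto simp: D_def has_real_derivative_iff_has_vector_derivative[symmetric]\<close>)
  have "ennreal (f 1 - f 0) \<le> (\<integral>\<^sup>+ t. ennreal (max 0 (D t)) \<partial>lborel)"
  proof (cases "(\<integral>\<^sup>+ t. ennreal (max 0 (D t)) \<partial>lborel) < \<infinity>")
    case True
    then have i: "integrable lborel (\<lambda>t. max 0 (D t))" by (intro integrableI_nonneg) auto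
    let ?I = "integral\<^sup>L lborel (\<lambda>t. max 0 (D t))"
    have "((\<lambda>t. max 0 (D t)) has_integral ?I) UNIV" by (rule has_integral_integral_lborel[OF i])
    then have "((\<lambda>t. if t \<in> {0..1} then max 0 (D t) else 0) has_integral ?I) UNIV"
      by (rule has_integral_eq[rotated]) (simp add: D_def)
    then have "((\<lambda>t. max 0 (D t)) has_integral ?I) {0..1}" by (simp only: has_integral_restrict_UNIV)
    with int have "f 1 - f 0 \<le> ?I" by (rule has_integral_le) simp
    then show ?thesis by (subst nn_integral_eq_integral[OF i]) (auto intro: ennreal_leI)
  next
    case False
    then have "(\<integral>\<^sup>+ t. ennreal (max 0 (D t)) \<partial>lborel) = top" using top.not_eq_extremum by fastforce
    then show ?thesis by simp
  qed
  also have "\<dots> \<le> (\<integral>\<^sup>+ t\<in>{0..1}. s t \<partial>lborel)"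
  proof (rule nn_integral_mono)
    fix t
    show "ennreal (max 0 (D t)) \<le> s t * indicator {0..1} t"
    proof (cases "t \<in> ?G")
      case True
      then have "ennreal (max 0 (D t)) = ennreal (f' t)" by (simp add: D_def max_def ennreal_neg)
      then show ?thesis using le[OF True] True by (simp add: indicator_def)
    next
      case False
      then have "D t = 0" unfolding D_def by (rule if_not_P)
      then show ?thesis by simp
    qed
  qed
  finally show ?thesis .
qed

context pole begin

lemma speed_eq_pm:
  assumes "c \<in> atlas N" "\<gamma> t \<in> cdom c" and ev: "\<forall>\<^sub>F s in at t. \<gamma> s \<in> cdom c"
    and D: "((cmap c \<circ> \<gamma>) has_vector_derivative D) (at t)"
  obtains x' where "((inv E \<circ> \<gamma>) has_vector_derivative x') (at t)"
    "pm (inv E (\<gamma> t)) x' x' = ginner N c (cmap c (\<gamma> t)) D D"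
proof -
  let ?y = "cmap c (\<gamma> t)"
  let ?x' = "dir_deriv (inv E \<circ> cinv c) ?y D"
  have y: "?y \<in> cimg c" by (rule cmap_in[OF assms(2)])
  have "((\<lambda>s. (inv E \<circ> cinv c) ((cmap c \<circ> \<gamma>) s)) has_vector_derivative ?x') (at t)"
    by (rule has_vector_derivative_compose[OF D]) (simp only: o_apply[of "cmap c"] inv_E_has_derivative[OF assms(1) y])
  then have d: "((inv E \<circ> \<gamma>) has_vector_derivative ?x') (at t)"
    unfolding has_vector_derivative_def
  proof (rule has_derivative_transform_eventually)
    show "\<forall>\<^sub>F s in at t. (inv E \<circ> cinv c) ((cmap c \<circ> \<gamma>) s) = (inv E \<circ> \<gamma>) s"
      using ev by eventually_elim (simp add: cinv_cmap[OF assms(1)])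
  qed (simp_all add: cinv_cmap[OF assms(1,2)])
  have Ex: "E (inv E (\<gamma> t)) \<in> cdom c" using assms(2) by simp
  have "pm (inv E (\<gamma> t)) ?x' ?x' = ginner N c ?y D D"
    unfolding pm_chart[OF assms(1) Ex] using dE_inverse(2)[OF assms(1) Ex] by simp
  with d show ?thesis by (rule that)
qed

lemma bounded_bilinear_ip0: "bounded_bilinear ip0"
  using bilinear_ip0 by (simp add: bilinear_conv_bounded_bilinear)

lemma cont_inv_E: "continuous_on UNIV (inv E)"
  unfolding continuous_on_eq_continuous_at[OF open_UNIV]
proof
  fix x
  note c = chart_at[of x]
  let ?c = "chart_at N x"
  have "continuous_on (cdom ?c) (\<lambda>z. (inv E \<circ> cinv ?c) (cmap ?c z))"
    by (rule continuous_on_compose2[OF ck_on_continuous[OF inv_E_smooth[OF c(1), of 0]] continuous_cmap[OF c(1)]])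
      (simp add: cimg_def)
  then have "continuous_on (cdom ?c) (inv E)"
    by (rule continuous_on_eq) (simp add: cinv_cmap[OF c(1)])
  then show "isCont (inv E) x" using continuous_on_eq_continuous_at[OF atlasD(1)[OF c(1)]] c(2) by blast
qed

text \<open>The ray itself gives the upper bound. For the lower bound a competing curve is pulled
  back by \<open>E\<close>; its radius grows from 0 to |v|, at a rate bounded by the speed by the
  Gauss lemma.\<close>

lemma edist_pole: "riem_edist N q (E v) = ennreal (sqrt (ip0 v v))"
proof (rule antisym)
  let ?\<gamma> = "\<lambda>t. E (t *\<^sub>R v)"
  have C1: "piecewise_C1_curve N ?\<gamma>"
    unfolding piecewise_C1_curve_def
  proof (intro conjI exI[of _ "{}"] ballI impI)
    show "continuous_on {0..1} ?\<gamma>" using geodesic_continuous[OF ray_geodesic] by (rule continuous_on_subset) simp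
    fix t c assume c: "c \<in> atlas N" "?\<gamma> t \<in> cdom c"
    obtain \<delta> where \<delta>: "\<delta> > 0" "\<And>s. \<bar>s - t\<bar> < \<delta> \<Longrightarrow> ?\<gamma> s \<in> cdom c"
      using geodesic_in_chart_nhd[OF geodesic_continuous[OF ray_geodesic] c] by blast
    have b: "?\<gamma> s \<in> cdom c" if "s \<in> ball t \<delta>" for s
      using that by (intro \<delta>(2)) (simp add: dist_real_def abs_minus_commute)
    have "(cmap c \<circ> ?\<gamma>) C1_differentiable_on ball t \<delta>"
      unfolding C1_differentiable_on_def
    proof (intro exI[of _ "\<lambda>s. vector_derivative (cmap c \<circ> ?\<gamma>) (at s)"] conjI ballI)
      show "((cmap c \<circ> ?\<gamma>) has_vector_derivative vector_derivative (cmap c \<circ> ?\<gamma>) (at s)) (at s)" if "s \<in> ball t \<delta>" for s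
        by (rule geodesicD(1)[OF ray_geodesic c(1) b[OF that]])
      show "continuous_on (ball t \<delta>) (\<lambda>s. vector_derivative (cmap c \<circ> ?\<gamma>) (at s))"
        by (intro continuous_at_imp_continuous_on ballI has_vector_derivative_continuous[OF geodesicD(2)[OF ray_geodesic c(1) b]])
    qed
    then show "\<exists>e>0. (cmap c \<circ> ?\<gamma>) C1_differentiable_on ball t e" using \<delta>(1) by blast
  qed simp
  have "norm_at N (?\<gamma> t) (velocity N ?\<gamma> t) = sqrt (ip0 v v)" for t
    unfolding norm_at_def ray_velocity using pm_radial_radial[of t v] by (simp add: pm_def)
  then have "curve_length N ?\<gamma> = ennreal (sqrt (ip0 v v))"
    unfolding curve_length_def by (simp add: nn_integral_cmult_indicator)
  moreover have "riem_edist N q (E v) \<le> curve_length N ?\<gamma>"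
    unfolding riem_edist_def by (rule INF_lower) (simp add: C1 E_0)
  ultimately show "riem_edist N q (E v) \<le> ennreal (sqrt (ip0 v v))" by simp
next
  show "ennreal (sqrt (ip0 v v)) \<le> riem_edist N q (E v)"
    unfolding riem_edist_def
  proof (rule INF_greatest)
    fix \<gamma> assume "\<gamma> \<in> {\<gamma>. piecewise_C1_curve N \<gamma> \<and> \<gamma> 0 = q \<and> \<gamma> 1 = E v}"
    then have \<gamma>: "continuous_on {0..1} \<gamma>" "\<gamma> 0 = q" "\<gamma> 1 = E v" and
      "\<exists>F. finite F \<and> (\<forall>t\<in>{0<..<1} - F. \<forall>c\<in>atlas N. \<gamma> t \<in> cdom c \<longrightarrow> (\<exists>e>0. (cmap c \<circ> \<gamma>) C1_differentiable_on ball t e))"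
      by (auto simp: piecewise_C1_curve_def)
    then obtain F where F: "finite F"
      "\<And>t c. t \<in> {0<..<1} - F \<Longrightarrow> c \<in> atlas N \<Longrightarrow> \<gamma> t \<in> cdom c \<Longrightarrow> \<exists>e>0. (cmap c \<circ> \<gamma>) C1_differentiable_on ball t e"
      by blast
    let ?x = "inv E \<circ> \<gamma>"
    have cx: "continuous_on {0..1} ?x"
      by (rule continuous_on_compose[OF \<gamma>(1) continuous_on_subset[OF cont_inv_E]]) simp
    have good: "\<exists>x'. (?x has_vector_derivative x') (at t) \<and>
        pm (?x t) x' x' = (norm_at N (\<gamma> t) (velocity N \<gamma> t))\<^sup>2" if t: "t \<in> {0<..<1} - F" for t
    proof -
      note c = chart_at[of "\<gamma> t"]
      let ?c = "chart_at N (\<gamma> t)"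
      obtain e where e: "e > 0" "(cmap ?c \<circ> \<gamma>) C1_differentiable_on ball t e" using F(2)[OF t c] by blast
      then obtain D where D: "((cmap ?c \<circ> \<gamma>) has_vector_derivative D) (at t)"
        unfolding C1_differentiable_on_def by (metis centre_in_ball)
      have "continuous_on {0<..<1} \<gamma>" by (rule continuous_on_subset[OF \<gamma>(1)]) auto
      then have "open ({0<..<1} \<inter> \<gamma> -` cdom ?c)"
        by (rule continuous_open_preimage[OF _ open_greaterThanLessThan atlasD(1)[OF c(1)]])
      then have "\<forall>\<^sub>F s in at t. s \<in> {0<..<1} \<inter> \<gamma> -` cdom ?c"
        by (rule eventually_at_in_open') (use t c in auto)
      then have ev: "\<forall>\<^sub>F s in at t. \<gamma> s \<in> cdom ?c" by eventually_elim simp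
      obtain x' where x': "(?x has_vector_derivative x') (at t)"
        "pm (inv E (\<gamma> t)) x' x' = ginner N ?c (cmap ?c (\<gamma> t)) D D"
        by (rule speed_eq_pm[OF c ev D])
      have "velocity N \<gamma> t = D" unfolding velocity_def by (rule vector_derivative_at[OF D])
      moreover have "ginner N ?c (cmap ?c (\<gamma> t)) D D \<ge> 0" by (rule ginner_nonneg[OF c(1) cmap_in[OF c(2)]])
      ultimately show ?thesis using x' by (intro exI[of _ x']) (simp add: norm_at_def inner_at_def)
    qed
    \<comment> \<open>The radius |x| is not differentiable at 0, where the curve starts and to which
      it may return. The smooth function sqrt (\<epsilon>^2 + |x|^2) has the same bound on its
      growth, and \<epsilon> tends to 0 at the end.\<close>
    have step: "ennreal (sqrt (\<epsilon>\<^sup>2 + ip0 v v) - \<epsilon>) \<le> curve_length N \<gamma>" if \<epsilon>: "\<epsilon> > 0" for \<epsilon>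
    proof -
      let ?f = "\<lambda>t. sqrt (\<epsilon>\<^sup>2 + ip0 (?x t) (?x t))"
      obtain x' where x': "\<And>t. t \<in> {0<..<1} - F \<Longrightarrow> (?x has_vector_derivative x' t) (at t) \<and>
        pm (?x t) (x' t) (x' t) = (norm_at N (\<gamma> t) (velocity N \<gamma> t))\<^sup>2" using good by metis
      have pos: "\<epsilon>\<^sup>2 + ip0 a a > 0" for a using \<epsilon> ip0_nonneg[of a] by (simp add: add_pos_nonneg)
      have "ennreal (?f 1 - ?f 0) \<le> (\<integral>\<^sup>+ t\<in>{0..1}. ennreal (norm_at N (\<gamma> t) (velocity N \<gamma> t)) \<partial>lborel)"
      proof (rule increment_le_nn_integral[OF F(1)])
        show "continuous_on {0..1} ?f"
          by (intro continuous_intros bounded_bilinear.continuous_on[OF bounded_bilinear_ip0] cx)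
        fix t assume t: "t \<in> {0<..<1} - F"
        let ?s = "norm_at N (\<gamma> t) (velocity N \<gamma> t)"
        have "((\<lambda>t. ip0 (?x t) (?x t)) has_vector_derivative ip0 (?x t) (x' t) + ip0 (x' t) (?x t)) (at t)"
          by (rule bounded_bilinear.has_vector_derivative[OF bounded_bilinear_ip0]) (use x'[OF t] in \<open>auto simp: o_def\<close>)
        then have "((\<lambda>t. ip0 (?x t) (?x t)) has_real_derivative 2 * ip0 (?x t) (x' t)) (at t)"
          by (simp add: has_real_derivative_iff_has_vector_derivative ip0_sym)
        then show "(?f has_real_derivative ip0 (?x t) (x' t) / ?f t) (at t)"
          using pos[of "?x t"] by (auto intro!: derivative_eq_intros simp: divide_simps)
        have s: "pm (?x t) (x' t) (x' t) = ?s\<^sup>2" "?s \<ge> 0"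
          using x'[OF t] by (auto simp: norm_at_def inner_at_def intro!: ginner_nonneg[OF chart_at(1) cmap_in[OF chart_at(2)]])
        have "\<bar>ip0 (?x t) (x' t)\<bar> \<le> sqrt (ip0 (?x t) (?x t)) * ?s"
          using real_sqrt_le_mono[OF pm_ge_radial[of "?x t" "x' t"]] s by (simp add: real_sqrt_mult)
        also have "\<dots> \<le> ?f t * ?s" using s(2) by (intro mult_right_mono real_sqrt_le_mono) auto
        finally have "ip0 (?x t) (x' t) / ?f t \<le> ?s"
          using pos[of "?x t"] by (simp add: pos_divide_le_eq mult.commute abs_le_iff)
        then show "ennreal (ip0 (?x t) (x' t) / ?f t) \<le> ennreal ?s" by (rule ennreal_leI)
      qed
      moreover have "?x 1 = v" "?x 0 = 0" using \<gamma> by (simp_all add: E_0[symmetric])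
      ultimately show ?thesis using \<epsilon> by (simp add: curve_length_def bilinear_lzero[OF bilinear_ip0])
    qed
    show "ennreal (sqrt (ip0 v v)) \<le> curve_length N \<gamma>"
    proof (cases "curve_length N \<gamma>")
      case (real l)
      have "sqrt (ip0 v v) \<le> l + \<epsilon>" if "\<epsilon> > 0" for \<epsilon>
      proof -
        have "sqrt (ip0 v v) \<le> sqrt (\<epsilon>\<^sup>2 + ip0 v v)" by simp
        moreover have "sqrt (\<epsilon>\<^sup>2 + ip0 v v) - \<epsilon> \<le> l"
          using step[OF that] real by (simp add: ennreal_le_iff)
        ultimately show ?thesis by linarith
      qed
      then have "sqrt (ip0 v v) \<le> l" by (rule field_le_epsilon)
      then show ?thesis using real by (simp add: ennreal_leI)
    qed simp
  qed
qed

lemma dist_pole: "riem_dist N q x = sqrt (ip0 (inv E x) (inv E x))"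
  using edist_pole[of "inv E x"] by (simp add: riem_dist_def ip0_nonneg)

lemma dist_pole_pos: "x \<noteq> q \<Longrightarrow> riem_dist N q x > 0"
proof -
  assume "x \<noteq> q"
  then have "inv E x \<noteq> 0" by (metis E_0 E_inv_E)
  then show ?thesis by (simp add: dist_pole ip0_pos)
qed

lemma dist_pole_nonneg: "riem_dist N q x \<ge> 0"
  by (simp add: dist_pole ip0_nonneg)

lemma dist_pole_eq_0: "riem_dist N q q = 0"
  using inv_E_E[of 0] by (simp add: dist_pole E_0 bilinear_lzero[OF bilinear_ip0])

subsection \<open>Smoothness and gradient of the distance\<close>

definition rad :: "('a, 'n) chart \<Rightarrow> real ^ 'n \<Rightarrow> real" where
  "rad c y = riem_dist N q (cinv c y)"

definition punct :: "('a, 'n) chart \<Rightarrow> (real ^ 'n) set" where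
  "punct c = {y \<in> cimg c. cinv c y \<noteq> q}"

lemma punct_open:
  assumes "c \<in> atlas N" shows "open (punct c)"
proof -
  have "punct c = cimg c \<inter> cinv c -` (- {q})" by (auto simp: punct_def)
  then show ?thesis
    using continuous_open_preimage[OF continuous_cinv[OF assms] atlasD(2)[OF assms] open_Compl[OF closed_singleton[of q]]] by simp
qed

lemma rad_smooth:
  assumes "c \<in> atlas N" shows "ck_on k (punct c) (rad c)"
proof -
  have sub: "punct c \<subseteq> cimg c" by (auto simp: punct_def)
  have e: "ck_on k (punct c) (inv E \<circ> cinv c)"
    by (rule ck_on_open_subset[OF inv_E_smooth[OF assms] atlasD(2)[OF assms] punct_open[OF assms] sub])
  have "ck_on k (punct c) (\<lambda>y. sqrt (ip0 ((inv E \<circ> cinv c) y) ((inv E \<circ> cinv c) y)))"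
  proof (intro ck_on_sqrt ck_on_bilinear[OF _ bounded_bilinear_ip0] e punct_open[OF assms])
    fix y assume "y \<in> punct c"
    then show "ip0 ((inv E \<circ> cinv c) y) ((inv E \<circ> cinv c) y) > 0"
      using dist_pole_pos[of "cinv c y"] by (simp add: punct_def dist_pole)
  qed
  then show ?thesis unfolding rad_def dist_pole by (simp add: o_def)
qed

lemma rad_has_derivative:
  "c \<in> atlas N \<Longrightarrow> y \<in> punct c \<Longrightarrow> (rad c has_derivative dir_deriv (rad c) y) (at y)"
  by (rule ck_on_has_derivative[OF punct_open rad_smooth])

lemma rad_E:
  assumes "c \<in> atlas N" "E x \<in> cdom c" shows "rad c (cmap c (E x)) = sqrt (ip0 x x)"
  by (simp add: rad_def cinv_cmap[OF assms] dist_pole)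

lemma punct_E:
  assumes "c \<in> atlas N" "E x \<in> cdom c" "x \<noteq> 0" shows "cmap c (E x) \<in> punct c"
proof -
  have "E x \<noteq> q" using assms(3) by (metis E_0 inv_E_E)
  then show ?thesis using cmap_in[OF assms(2)] by (simp add: punct_def cinv_cmap[OF assms(1,2)])
qed

text \<open>The gradient of r is the unit velocity of the ray. In polar coordinates the derivative
  of the norm is the product with \<open>v\<close> in the fixed metric \<open>ip0\<close>, and the
  Gauss lemma replaces that metric by the one at the point.\<close>

lemma rad_deriv:
  assumes "c \<in> atlas N" "E (t *\<^sub>R v) \<in> cdom c" "t > 0" "ip0 v v = 1"
  shows "dir_deriv (rad c) (cmap c (E (t *\<^sub>R v))) z = ginner N c (cmap c (E (t *\<^sub>R v))) (dE c (t *\<^sub>R v) v) z"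
proof -
  let ?x = "t *\<^sub>R v"
  have v0: "v \<noteq> 0" using assms(4) bilinear_lzero[OF bilinear_ip0] by auto
  have x0: "?x \<noteq> 0" using v0 assms(3) by simp
  obtain \<zeta> where z: "z = dE c ?x \<zeta>" using dE_inverse(2)[OF assms(1,2)] by metis
  have ipx: "ip0 ?x ?x = t\<^sup>2"
    using assms(4) by (simp add: bilinear_lmul[OF bilinear_ip0] bilinear_rmul[OF bilinear_ip0] power2_eq_square)
  have "((\<lambda>x. rad c ((cmap c \<circ> E) x)) has_derivative (\<lambda>\<zeta>. dir_deriv (rad c) (cmap c (E ?x)) (dE c ?x \<zeta>))) (at ?x)"
    by (rule has_derivative_compose[OF E_has_derivative[OF assms(1,2)]])
      (simp only: o_apply rad_has_derivative[OF assms(1) punct_E[OF assms(1,2) x0]])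
  moreover have "((\<lambda>x. rad c ((cmap c \<circ> E) x)) has_derivative (\<lambda>\<zeta>. ip0 v \<zeta>)) (at ?x)"
  proof (rule has_derivative_transform_within_open[OF _ open_E_vimage[OF assms(1)]])
    have "((\<lambda>x. ip0 x x) has_derivative (\<lambda>\<zeta>. ip0 ?x \<zeta> + ip0 \<zeta> ?x)) (at ?x)"
      by (rule bounded_bilinear.FDERIV[OF bounded_bilinear_ip0 has_derivative_ident has_derivative_ident])
    from has_derivative_real_sqrt[OF _ this]
    have "((\<lambda>x. sqrt (ip0 x x)) has_derivative (\<lambda>\<zeta>. (ip0 ?x \<zeta> + ip0 \<zeta> ?x) * (inverse (sqrt (ip0 ?x ?x)) / 2))) (at ?x)"
      using assms(3) ipx by simp
    moreover have "(ip0 ?x \<zeta> + ip0 \<zeta> ?x) * (inverse (sqrt (ip0 ?x ?x)) / 2) = ip0 v \<zeta>" for \<zeta>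
      unfolding ipx ip0_sym[of \<zeta> ?x] using assms(3) by (simp add: bilinear_lmul[OF bilinear_ip0])
    ultimately show "((\<lambda>x. sqrt (ip0 x x)) has_derivative (\<lambda>\<zeta>. ip0 v \<zeta>)) (at ?x)" by simp
    show "sqrt (ip0 x x) = rad c ((cmap c \<circ> E) x)" if "x \<in> E -` cdom c" for x
      using rad_E[OF assms(1), of x] that by simp
  qed (use assms in simp)
  ultimately have "(\<lambda>\<zeta>. dir_deriv (rad c) (cmap c (E ?x)) (dE c ?x \<zeta>)) = (\<lambda>\<zeta>. ip0 v \<zeta>)"
    by (rule has_derivative_unique)
  from fun_cong[OF this, of \<zeta>]
  have "dir_deriv (rad c) (cmap c (E ?x)) z = ip0 v \<zeta>" by (simp add: z)
  also have "ip0 v \<zeta> = pm ?x v \<zeta>"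
    using gauss_lemma[of ?x \<zeta>] assms(3) by (simp add: bilinear_lmul[OF bilinear_ip0] bilinear_lmul[OF bilinear_pm])
  also have "\<dots> = ginner N c (cmap c (E ?x)) (dE c ?x v) z" by (simp add: pm_chart[OF assms(1,2)] z)
  finally show ?thesis .
qed

end

section \<open>Hessian comparison for the distance from the pole\<close>

lemma has_derivative_dir_deriv: "(f has_derivative f') (at x) \<Longrightarrow> (f has_derivative dir_deriv f x) (at x)"
  by (simp add: dir_deriv_eq)

lemma (in riemannian) chart_hess_bilinear:
  assumes "c \<in> atlas M" "open U" "U \<subseteq> cimg c" "y \<in> U" "ck_on 2 U f"
  shows "chart_hess M c f y u v = chart_hess M c f y v u" "bilinear (chart_hess M c f y)"
proof -
  have f: "ck_on (Suc (Suc 0)) U f" using assms(5) by (simp add: numeral_2_eq_2)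
  have yc: "y \<in> cimg c" using assms by blast
  show sym: "chart_hess M c f y u v = chart_hess M c f y v u" for u v
    unfolding chart_hess_def symmetric_second_derivative[OF assms(2,5,4), of u v]
      christoffel_sym[OF assms(1) yc, of u v] ..
  have lin1: "linear (\<lambda>v. dir_deriv (\<lambda>z. dir_deriv f z u) y v)" for u
    by (rule has_derivative_linear[OF ck_on_has_derivative[OF assms(2) ck_on_dir_deriv[OF assms(2) f] assms(4)]])
  have lin2: "linear (dir_deriv f y)" by (rule has_derivative_linear[OF ck_on_has_derivative[OF assms(2) f assms(4)]])
  note bil = bilinear_christoffel[OF assms(1) yc]
  have lin: "linear (chart_hess M c f y u)" for u
    unfolding chart_hess_def
    by (intro linearI) (simp_all add: linear_add[OF lin1] linear_scale[OF lin1] bilinear_radd[OF bil] bilinear_rmul[OF bil]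
        linear_add[OF lin2] linear_scale[OF lin2] algebra_simps)
  moreover have "(\<lambda>u. chart_hess M c f y u v) = chart_hess M c f y v" for v
    by (intro ext) (rule sym)
  ultimately show "bilinear (chart_hess M c f y)" unfolding bilinear_def by simp
qed

text \<open>Smoothness of w on the closed half line is phrased with Frechet derivatives within it,
  the model curvature with vector derivatives within it. Both are unique since every point is a
  limit point from inside, so they can be identified up to the boundary point 0.\<close>

lemma ck_on_half_line:
  fixes f :: "real \<Rightarrow> real"
  assumes "ck_on (Suc (Suc 0)) {0..} f"
  defines "f1 \<equiv> \<lambda>t. vector_derivative f (at t within {0..})"
  shows "\<And>t. t \<ge> 0 \<Longrightarrow> (f has_vector_derivative f1 t) (at t within {0..})"
    "\<And>t. t \<ge> 0 \<Longrightarrow> (f1 has_vector_derivative vector_derivative f1 (at t within {0..})) (at t within {0..})"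
    "\<And>t D. t \<ge> 0 \<Longrightarrow> (f has_vector_derivative D) (at t within {0..}) \<Longrightarrow> D = f1 t"
proof -
  let ?I = "{0::real..}"
  have ne: "at t within ?I \<noteq> bot" if "t \<ge> 0" for t
  proof -
    have "t islimpt {t..t + 1}" by (simp add: islimpt_Icc)
    then have "t islimpt ?I" by (rule islimpt_subset) (use that in auto)
    then show ?thesis by (simp add: trivial_limit_within)
  qed
  have d: "f differentiable (at t within ?I)" if "t \<ge> 0" for t
    using assms(1) that unfolding ck_on.simps differentiable_on_def by simp
  then show 1: "(f has_vector_derivative f1 t) (at t within ?I)" if "t \<ge> 0" for t
    using that unfolding f1_def by (simp add: vector_derivative_works[symmetric])
  show uniq: "D = f1 t" if "t \<ge> 0" "(f has_vector_derivative D) (at t within ?I)" for t D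
    by (rule vector_derivative_unique_within[OF ne[OF that(1)] that(2) 1[OF that(1)]])
  have eq: "frechet_derivative f (at t within ?I) 1 = f1 t" if "t \<ge> 0" for t
  proof (rule uniq[OF that])
    have "(f has_derivative frechet_derivative f (at t within ?I)) (at t within ?I)"
      using d[OF that] by (simp add: frechet_derivative_works)
    moreover from has_derivative_linear[OF this]
    have "frechet_derivative f (at t within ?I) = (\<lambda>h. h *\<^sub>R frechet_derivative f (at t within ?I) 1)"
      by (intro ext) (metis linear_scale mult.right_neutral real_scaleR_def)
    ultimately show "(f has_vector_derivative frechet_derivative f (at t within ?I) 1) (at t within ?I)"
      unfolding has_vector_derivative_def by metis
  qed
  show "(f1 has_vector_derivative vector_derivative f1 (at t within ?I)) (at t within ?I)" if "t \<ge> 0" for t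
  proof -
    have "(\<lambda>x. frechet_derivative f (at x within ?I) 1) differentiable (at t within ?I)"
      using assms(1) that unfolding ck_on.simps differentiable_on_def by simp
    then obtain L where "((\<lambda>x. frechet_derivative f (at x within ?I) 1) has_derivative L) (at t within ?I)"
      unfolding differentiable_def by blast
    then have "(f1 has_derivative L) (at t within ?I)"
      by (rule has_derivative_transform[rotated 2]) (use that eq in auto)
    then have "f1 differentiable (at t within ?I)" unfolding differentiable_def by blast
    then show ?thesis by (simp add: vector_derivative_works[symmetric])
  qed
qed

text \<open>Reconciles \<open>deriv\<close> in \<open>eta\<close> with the one-sided derivatives in
  \<open>model_radial_curvature\<close>: they agree for t > 0. At 0 only the limits survive, and
  these are the initial conditions of the Sturm comparison.\<close>

lemma warping_function_derivs:
  assumes "warping_function {0..} w"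
  shows "\<exists>w2. (\<forall>t>0. (w has_real_derivative deriv w t) (at t) \<and> (deriv w has_real_derivative w2 t) (at t)
      \<and> model_radial_curvature {0..} w t = - w2 t / w t)"
    and "(deriv w \<longlongrightarrow> 1) (at_right 0)" "(w \<longlongrightarrow> 0) (at_right 0)"
proof -
  let ?I = "{0::real..}"
  define w1 where "w1 t = vector_derivative w (at t within ?I)" for t
  define w2 where "w2 t = vector_derivative w1 (at t within ?I)" for t
  have "ck_on (Suc (Suc 0)) ?I w" using assms unfolding warping_function_def by (intro smooth_on_ck) blast
  note w = ck_on_half_line[OF this, folded w1_def, folded w2_def]
  have at: "at t within ?I = at t" if "t > 0" for t
    using that by (intro at_within_interior) (simp add: interior_real_atLeast)
  have d: "(w has_real_derivative w1 t) (at t)" "(w1 has_real_derivative w2 t) (at t)" if "t > 0" for t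
    using w(1,2)[of t] that at[OF that] by (auto simp: has_real_derivative_iff_has_vector_derivative)
  have eq: "deriv w t = w1 t" if "t > 0" for t using DERIV_imp_deriv[OF d(1)[OF that]] .
  have w10: "w1 0 = 1"
    using w(3)[of 0 1] assms by (simp add: warping_function_def has_real_derivative_iff_has_vector_derivative)
  have lim: "(f \<longlongrightarrow> f 0) (at_right 0)" if "(f has_vector_derivative D) (at 0 within ?I)" for f :: "real \<Rightarrow> real" and D
  proof -
    have "(f \<longlongrightarrow> f 0) (at 0 within ?I)"
      using has_vector_derivative_continuous[OF that] by (simp add: continuous_within)
    then show ?thesis by (rule tendsto_within_subset) auto
  qed
  show "\<exists>w2. (\<forall>t>0. (w has_real_derivative deriv w t) (at t) \<and> (deriv w has_real_derivative w2 t) (at t)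
      \<and> model_radial_curvature {0..} w t = - w2 t / w t)"
  proof (intro exI[of _ w2] allI impI conjI)
    fix t :: real assume t: "t > 0"
    show "(w has_real_derivative deriv w t) (at t)" using d(1)[OF t] eq[OF t] by simp
    show "(deriv w has_real_derivative w2 t) (at t)"
      by (rule has_field_derivative_transform_within_open[OF d(2)[OF t], of "{0<..}"]) (use t eq in auto)
    show "model_radial_curvature {0..} w t = - w2 t / w t"
      by (simp add: model_radial_curvature_def w2_def w1_def[abs_def])
  qed
  show "(w \<longlongrightarrow> 0) (at_right 0)" using lim[OF w(1)] assms by (simp add: warping_function_def)
  have "(w1 \<longlongrightarrow> 1) (at_right 0)" using lim[OF w(2)] w10 by simp
  moreover have "\<forall>\<^sub>F t in at_right 0. w1 t = deriv w t"
    unfolding eventually_at_right_field using eq by (intro exI[of _ 1]) simp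
  ultimately show "(deriv w \<longlongrightarrow> 1) (at_right 0)" by (rule Lim_transform_eventually)
qed

text \<open>Here j is the square of the norm f = t sqrt(k) of a Jacobi field, and
  \<open>ineq\<close> is f'' \<ge> (w''/w) f written in terms of j; the factor t^2 encodes the zero
  of the field at t = 0. Hence the Wronskian f' w - f w' is nondecreasing. It tends to 0 at 0, so it
  is nonnegative, which is the claim multiplied by w / f.\<close>

lemma sturm_comparison:
  fixes k k1 k2 w w1 w2 :: "real \<Rightarrow> real"
  assumes k: "\<And>t. k t > 0" "\<And>t. (k has_real_derivative k1 t) (at t)" "\<And>t. (k1 has_real_derivative k2 t) (at t)"
    and w: "\<And>t. t > 0 \<Longrightarrow> w t > 0" "\<And>t. t > 0 \<Longrightarrow> (w has_real_derivative w1 t) (at t)"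
      "\<And>t. t > 0 \<Longrightarrow> (w1 has_real_derivative w2 t) (at t)"
    and lim: "(w \<longlongrightarrow> 0) (at_right 0)" "(w1 \<longlongrightarrow> 1) (at_right 0)"
  defines "j \<equiv> \<lambda>t. t\<^sup>2 * k t" and "j1 \<equiv> \<lambda>t. 2 * t * k t + t\<^sup>2 * k1 t"
    and "j2 \<equiv> \<lambda>t. 2 * k t + 4 * t * k1 t + t\<^sup>2 * k2 t"
  assumes ineq: "\<And>t. t > 0 \<Longrightarrow> j2 t * j t / 2 \<ge> w2 t / w t * (j t)\<^sup>2 + (j1 t)\<^sup>2 / 4"
    and t: "t > 0"
  shows "j1 t / 2 \<ge> w1 t / w t * j t"
proof -
  define f where "f t = t * sqrt (k t)" for t
  define f1 where "f1 t = sqrt (k t) + t * k1 t / (2 * sqrt (k t))" for t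
  define Q where "Q t = f1 t * w t - f t * w1 t" for t
  have sk: "sqrt (k t) > 0" for t using k(1) by simp
  have sk2: "sqrt (k t) * sqrt (k t) = k t" for t using k(1)[of t] by simp
  have f: "f t > 0" "j t = (f t)\<^sup>2" "j1 t = 2 * f t * f1 t" if "t > 0" for t
  proof -
    show "f t > 0" using that sk by (simp add: f_def)
    show "j t = (f t)\<^sup>2" using k(1)[of t] by (simp add: j_def f_def power_mult_distrib)
    show "j1 t = 2 * f t * f1 t"
      using sk[of t] sk2[of t] by (simp add: j1_def f_def f1_def field_simps power2_eq_square)
  qed
  \<comment> \<open>The second derivative of f, solved from j'' = 2 f'^2 + 2 f f''.\<close>
  define f2 where "f2 t = (j2 t - 2 * (f1 t)\<^sup>2) / (2 * f t)" for t
  have dj: "(j1 has_real_derivative j2 t) (at t)" for t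
    unfolding j1_def j2_def by (auto intro!: derivative_eq_intros k simp: power2_eq_square algebra_simps)
  have df: "(f has_real_derivative f1 t) (at t)" for t
    unfolding f_def f1_def using sk[of t] k(1)[of t]
    by (auto intro!: derivative_eq_intros k(2) simp: field_simps)
  have df1: "(f1 has_real_derivative f2 t) (at t)" if "t > 0" for t
  proof -
    have "((\<lambda>t. j1 t / (2 * f t)) has_real_derivative (j2 t * (2 * f t) - j1 t * (2 * f1 t)) / (2 * f t * (2 * f t))) (at t)"
      using f(1)[OF that] by (intro DERIV_divide dj DERIV_cmult df) auto
    moreover have "(j2 t * (2 * f t) - j1 t * (2 * f1 t)) / (2 * f t * (2 * f t)) = f2 t"
      using f[OF that] by (simp add: f2_def field_simps power2_eq_square)
    moreover have "j1 s / (2 * f s) = f1 s" if "s \<in> {0<..}" for s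
      using f[of s] that by simp
    ultimately show ?thesis
      using has_field_derivative_transform_within_open[of "\<lambda>t. j1 t / (2 * f t)" _ t "{0<..}" f1] that by auto
  qed
  have dQ: "(Q has_real_derivative f2 t * w t - f t * w2 t) (at t)" if "t > 0" for t
    unfolding Q_def using that by (auto intro!: derivative_eq_intros df df1 w simp: algebra_simps)
  have Q_inc: "f2 t * w t - f t * w2 t \<ge> 0" if "t > 0" for t
  proof -
    note ft = f[OF that] and wt = w(1)[OF that]
    have "w2 t / w t * (f t)^4 + (f t)\<^sup>2 * (f1 t)\<^sup>2 \<le> j2 t * (f t)\<^sup>2 / 2"
      using ineq[OF that] unfolding ft(2,3) by (simp add: power_mult_distrib power2_eq_square algebra_simps power4_eq_xxxx)
    then have "(f t)\<^sup>2 * (w2 t / w t * (f t)\<^sup>2 + (f1 t)\<^sup>2) \<le> (f t)\<^sup>2 * (j2 t / 2)"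
      by (simp add: power2_eq_square algebra_simps power4_eq_xxxx)
    then have "w2 t / w t * (f t)\<^sup>2 + (f1 t)\<^sup>2 \<le> j2 t / 2" using ft(1) by simp
    moreover have "f2 t * f t = j2 t / 2 - (f1 t)\<^sup>2" using ft(1) by (simp add: f2_def field_simps)
    ultimately have "w2 t / w t * (f t)\<^sup>2 \<le> f2 t * f t" by linarith
    then have "(w2 t / w t * f t) * f t \<le> f2 t * f t" by (simp add: power2_eq_square mult.assoc)
    then have "w2 t / w t * f t \<le> f2 t" by (rule mult_right_le_imp_le[OF _ ft(1)])
    then show ?thesis using wt by (simp add: field_simps)
  qed
  have "isCont f 0" using df[of 0] by (rule DERIV_isCont)
  then have "(f \<longlongrightarrow> f 0) (at_right 0)" unfolding isCont_def by (rule tendsto_within_subset) auto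
  moreover have "isCont k 0" "isCont k1 0" using k(2,3) by (auto intro: DERIV_isCont)
  then have "isCont f1 0" unfolding f1_def using k(1)[of 0] by (intro continuous_intros) auto
  then have "(f1 \<longlongrightarrow> f1 0) (at_right 0)" unfolding isCont_def by (rule tendsto_within_subset) auto
  ultimately have "(Q \<longlongrightarrow> f1 0 * 0 - f 0 * 1) (at_right 0)" unfolding Q_def by (intro tendsto_intros lim)
  then have limQ: "(Q \<longlongrightarrow> 0) (at_right 0)" by (simp add: f_def)
  have mono: "Q s \<le> Q t" if "0 < s" "s \<le> t" for s t
    by (rule DERIV_nonneg_imp_nondecreasing[OF that(2)]) (use that dQ Q_inc in \<open>meson order_less_le_trans\<close>)
  have "0 \<le> Q t"
  proof (rule tendsto_upperbound[OF limQ])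
    show "\<forall>\<^sub>F s in at_right 0. Q s \<le> Q t"
      using t by (auto simp: eventually_at_right intro!: exI[of _ t] mono)
  qed simp
  then have "w1 t * f t \<le> f1 t * w t" by (simp add: Q_def mult.commute)
  then have "w1 t * f t * f t \<le> f1 t * w t * f t" using f(1)[OF t] by simp
  then show ?thesis using f[OF t] w(1)[OF t] by (simp add: field_simps power2_eq_square)
qed


context pole begin

lemma ip0_line: "ip0 V V = 1 \<Longrightarrow> ip0 V W = 0 \<Longrightarrow> ip0 (V + s *\<^sub>R W) (V + s *\<^sub>R W) = 1 + s\<^sup>2 * ip0 W W"
  by (simp add: bilinear_ladd[OF bilinear_ip0] bilinear_radd[OF bilinear_ip0] bilinear_lmul[OF bilinear_ip0]
      bilinear_rmul[OF bilinear_ip0] ip0_sym[of W V] power2_eq_square)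

text \<open>Along the variation t (V + s W) with |V| = 1 and W orthogonal to V, the distance from
  the pole is t sqrt(1 + s^2 |W|^2); \<omega> stands for |W|^2. At s = 0 the only second derivative
  different from zero is the one in s twice.\<close>

lemma rad_ray_second_derivs:
  fixes t \<omega> :: real
  assumes \<omega>: "\<omega> \<ge> 0"
  defines "R \<equiv> \<lambda>p::real \<times> real. snd p * sqrt (1 + (fst p)\<^sup>2 * \<omega>)"
  shows "dir_deriv (\<lambda>z. dir_deriv R z e\<^sub>t) (0, t) e = 0"
    "dir_deriv (\<lambda>z. dir_deriv R z e\<^sub>s) (0, t) e = t * \<omega> * fst e"
proof -
  have pos: "1 + (fst z)\<^sup>2 * \<omega> > 0" for z :: "real \<times> real" using \<omega> by (simp add: add_pos_nonneg)
  have sq: "((\<lambda>p. sqrt (1 + (fst p)\<^sup>2 * \<omega>)) has_derivative (\<lambda>e. fst z * fst e * \<omega> / sqrt (1 + (fst z)\<^sup>2 * \<omega>))) (at z)" for z :: "real \<times> real"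
    using pos[of z] by (auto intro!: derivative_eq_intros simp: fun_eq_iff field_simps)
  have "(R has_derivative (\<lambda>e. snd z * (fst z * fst e * \<omega> / sqrt (1 + (fst z)\<^sup>2 * \<omega>)) + snd e * sqrt (1 + (fst z)\<^sup>2 * \<omega>))) (at z)" for z
    unfolding R_def by (intro has_derivative_mult sq has_derivative_snd has_derivative_ident)
  note dR = dir_deriv_eq[OF this]
  show "dir_deriv (\<lambda>z. dir_deriv R z e\<^sub>t) (0, t) e = 0"
    unfolding dR using dir_deriv_eq[OF sq[of "(0, t)"]] by simp
  have "((\<lambda>z::real \<times> real. snd z * (fst z * \<omega> / sqrt (1 + (fst z)\<^sup>2 * \<omega>))) has_derivative (\<lambda>e. t * \<omega> * fst e)) (at (0, t))"
    using pos[of "(0, t)"] by (auto intro!: derivative_eq_intros simp: fun_eq_iff)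
  then show "dir_deriv (\<lambda>z. dir_deriv R z e\<^sub>s) (0, t) e = t * \<omega> * fst e"
    unfolding dR using fun_cong[OF dir_deriv_eq, of _ "\<lambda>e. t * \<omega> * fst e" "(0, t)" e] by simp
qed

text \<open>The chain rule for r along the variation expresses its Hessian by derivatives in the
  parameter plane minus the product of \<partial>_t F with a covariant derivative, since
  \<partial>_t F is the gradient of r. The radial entries vanish because |\<partial>_t F| does not
  depend on t and is stationary at s = 0; the last entry becomes half the t-derivative of
  |\<partial>_s F|^2.\<close>

lemma chart_hess_rad_ray:
  assumes c: "c \<in> atlas N" and Ec: "E (t *\<^sub>R V) \<in> cdom c" and t: "t > 0"
    and V: "ip0 V V = 1" and W: "ip0 V W = 0"
  defines "F \<equiv> ray_chart c V W"
  defines "Ft \<equiv> \<lambda>p. dir_deriv F p e\<^sub>t" and "Fs \<equiv> \<lambda>p. dir_deriv F p e\<^sub>s"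
  shows "chart_hess N c (rad c) (F (0, t)) (Ft (0, t)) (Ft (0, t)) = 0"
    "chart_hess N c (rad c) (F (0, t)) (Ft (0, t)) (Fs (0, t)) = 0"
    "chart_hess N c (rad c) (F (0, t)) (Fs (0, t)) (Fs (0, t)) = ginner N c (F (0, t)) (cov c F Fs (0, t) e\<^sub>t) (Fs (0, t))"
proof -
  let ?p = "(0::real, t)" and ?\<omega> = "ip0 W W"
  let ?R = "\<lambda>p::real \<times> real. snd p * sqrt (1 + (fst p)\<^sup>2 * ?\<omega>)"
  define U where "U = ray_dom c V W \<inter> {p. snd p > 0}"
  have U: "open U" unfolding U_def
    by (intro open_Int ray_dom_open c open_Collect_less continuous_intros)
  have pd: "?p \<in> ray_dom c V W" using Ec by (simp add: ray_dom_def ray_map_def)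
  have pU: "?p \<in> U" using pd t by (simp add: U_def)
  have nz: "V + s *\<^sub>R W \<noteq> 0" for s
  proof
    assume "V + s *\<^sub>R W = 0"
    then have "1 + s\<^sup>2 * ?\<omega> = 0" using ip0_line[OF V W, of s] bilinear_lzero[OF bilinear_ip0] by simp
    then show False using ip0_nonneg[of W] by (smt (verit) mult_nonneg_nonneg zero_le_power2)
  qed
  have FU: "F ` U \<subseteq> punct c"
    using nz unfolding F_def ray_chart_def by (auto intro!: punct_E[OF c] simp: U_def ray_dom_def ray_map_def)
  have Fdom: "ck_on k (ray_dom c V W) F" for k unfolding F_def by (rule ray_chart_smooth[OF c])
  have FckU: "ck_on k U F" for k
    by (rule ck_on_open_subset[OF Fdom ray_dom_open[OF c] U]) (auto simp: U_def)
  have R: "rad c (F p) = ?R p" if "p \<in> U" for p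
  proof -
    have "E (ray_map V W p) \<in> cdom c" and pos: "snd p > 0" using that by (auto simp: U_def ray_dom_def)
    then have "rad c (F p) = sqrt (ip0 (ray_map V W p) (ray_map V W p))"
      unfolding F_def ray_chart_def using rad_E[OF c] by simp
    also have "ip0 (ray_map V W p) (ray_map V W p) = (snd p)\<^sup>2 * (1 + (fst p)\<^sup>2 * ?\<omega>)"
      using ip0_line[OF V W, of "fst p"]
      by (simp add: ray_map_def bilinear_lmul[OF bilinear_ip0] bilinear_rmul[OF bilinear_ip0] power2_eq_square)
    finally show ?thesis using pos by (simp add: real_sqrt_mult)
  qed
  have yc: "F ?p \<in> cimg c" unfolding F_def by (rule ray_chart_in[OF pd])
  have grad: "dir_deriv (rad c) (F ?p) z = ginner N c (F ?p) (Ft ?p) z" for z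
    using rad_deriv[OF c Ec t V, of z] ray_chart_t(1)[OF c pd]
    by (simp add: F_def Ft_def ray_chart_def ray_map_def)
  have radlin: "linear (dir_deriv (rad c) (F ?p))"
    by (rule has_derivative_linear[OF rad_has_derivative[OF c]]) (use FU pU in blast)
  have H: "chart_hess N c (rad c) (F ?p) (dir_deriv F ?p e) (dir_deriv F ?p e') =
      dir_deriv (\<lambda>z. dir_deriv ?R z e) ?p e' - ginner N c (F ?p) (Ft ?p) (cov c F (\<lambda>p. dir_deriv F p e) ?p e')" for e e'
  proof -
    have "dir_deriv (\<lambda>z. dir_deriv ?R z e) ?p e' = dir_deriv (\<lambda>z. dir_deriv (\<lambda>x. rad c (F x)) z e) ?p e'"
    proof -
      have "dir_deriv ?R z = dir_deriv (\<lambda>x. rad c (F x)) z" if "z \<in> U" for z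
        by (rule dir_deriv_cong_open[OF U that]) (simp add: R)
      then have "dir_deriv (\<lambda>z. dir_deriv ?R z e) ?p = dir_deriv (\<lambda>z. dir_deriv (\<lambda>x. rad c (F x)) z e) ?p"
        by (intro dir_deriv_cong_open[OF U pU]) simp
      then show ?thesis by simp
    qed
    also have "\<dots> = dir_deriv (\<lambda>w. dir_deriv (rad c) w (dir_deriv F ?p e)) (F ?p) (dir_deriv F ?p e')
       + dir_deriv (rad c) (F ?p) (dir_deriv (\<lambda>z. dir_deriv F z e) ?p e')"
      by (rule second_derivative_compose[OF U pU FckU punct_open[OF c] FU rad_smooth[OF c]])
    finally show ?thesis
      unfolding chart_hess_def grad[symmetric] cov_def
      using christoffel_sym[OF c yc, of "dir_deriv F ?p e"] by (simp add: linear_add[OF radlin])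
  qed
  have cov0: "cov c F Ft ?p e\<^sub>t = 0" unfolding F_def Ft_def by (rule ray_cov_zero[OF c pd])
  have tors: "cov c F Fs ?p e\<^sub>t = cov c F Ft ?p e\<^sub>s"
    unfolding Fs_def Ft_def by (rule cov_torsion_free[OF c ray_dom_open[OF c] Fdom pd yc])
  show "chart_hess N c (rad c) (F ?p) (Ft ?p) (Ft ?p) = 0"
    using H[of e\<^sub>t e\<^sub>t] cov0 rad_ray_second_derivs(1)[OF ip0_nonneg]
    by (simp add: Ft_def bilinear_rzero[OF bilinear_ginner])
  note sym = ginner_sym[OF c yc]
  have opn: "open ((\<lambda>s. (s, t)) -` ray_dom c V W)"
    by (rule open_vimage[OF ray_dom_open[OF c]]) (intro continuous_intros)
  have "((\<lambda>s. ginner N c (F (s, t)) (Ft (s, t)) (Ft (s, t))) has_vector_derivative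
      2 * ginner N c (F ?p) (Ft ?p) (cov c F Ft ?p e\<^sub>s)) (at 0)"
    using has_vector_derivative_fst[OF pm_ray_has_derivative[OF c pd, of e\<^sub>t e\<^sub>t]] sym[of "cov c F Ft ?p e\<^sub>s"]
    by (simp add: F_def Ft_def)
  then have "((\<lambda>s. 1 + s\<^sup>2 * ?\<omega>) has_vector_derivative 2 * ginner N c (F ?p) (Ft ?p) (cov c F Ft ?p e\<^sub>s)) (at 0)"
  proof (rule has_vector_derivative_transform_within_open[OF _ opn])
    fix s assume "s \<in> (\<lambda>s. (s, t)) -` ray_dom c V W"
    then have s: "(s, t) \<in> ray_dom c V W" by simp
    show "ginner N c (F (s, t)) (Ft (s, t)) (Ft (s, t)) = 1 + s\<^sup>2 * ?\<omega>"
      unfolding Ft_def F_def ray_chart_t[OF c s] pm_ray[OF c s, symmetric]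
      using pm_radial_radial[of t "V + s *\<^sub>R W"] ip0_line[OF V W, of s] by (simp add: ray_map_def)
  qed (use pd in simp)
  moreover have "((\<lambda>s. 1 + s\<^sup>2 * ?\<omega>) has_vector_derivative 0) (at 0)"
    unfolding has_real_derivative_iff_has_vector_derivative[symmetric] by (auto intro!: derivative_eq_intros)
  ultimately have ts: "ginner N c (F ?p) (Ft ?p) (cov c F Ft ?p e\<^sub>s) = 0"
    using vector_derivative_unique_at by fastforce
  then show "chart_hess N c (rad c) (F ?p) (Ft ?p) (Fs ?p) = 0"
    using H[of e\<^sub>t e\<^sub>s] rad_ray_second_derivs(1)[OF ip0_nonneg] by (simp add: Ft_def Fs_def)
  \<comment> \<open>The Gauss lemma computes this product as t s |W|^2. Differentiating it in s at 0
    trades the unknown covariant derivative of \<partial>_s F in s for the one in t.\<close>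
  have "((\<lambda>s. ginner N c (F (s, t)) (Ft (s, t)) (Fs (s, t))) has_vector_derivative
      ginner N c (F ?p) (cov c F Ft ?p e\<^sub>s) (Fs ?p) + ginner N c (F ?p) (Ft ?p) (cov c F Fs ?p e\<^sub>s)) (at 0)"
    using has_vector_derivative_fst[OF pm_ray_has_derivative[OF c pd, of e\<^sub>t e\<^sub>s]]
    by (simp add: F_def Ft_def Fs_def)
  then have "((\<lambda>s. t * s * ?\<omega>) has_vector_derivative
      ginner N c (F ?p) (cov c F Ft ?p e\<^sub>s) (Fs ?p) + ginner N c (F ?p) (Ft ?p) (cov c F Fs ?p e\<^sub>s)) (at 0)"
  proof (rule has_vector_derivative_transform_within_open[OF _ opn])
    fix s assume "s \<in> (\<lambda>s. (s, t)) -` ray_dom c V W"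
    then have s: "(s, t) \<in> ray_dom c V W" by simp
    have "pm (t *\<^sub>R (V + s *\<^sub>R W)) (t *\<^sub>R (V + s *\<^sub>R W)) W = ip0 (t *\<^sub>R (V + s *\<^sub>R W)) W" by (rule gauss_lemma)
    then have "pm (t *\<^sub>R (V + s *\<^sub>R W)) (V + s *\<^sub>R W) W = s * ?\<omega>"
      unfolding bilinear_lmul[OF bilinear_pm] bilinear_lmul[OF bilinear_ip0] using t W
      by (simp add: bilinear_ladd[OF bilinear_ip0] bilinear_lmul[OF bilinear_ip0])
    then show "ginner N c (F (s, t)) (Ft (s, t)) (Fs (s, t)) = t * s * ?\<omega>"
      unfolding Ft_def Fs_def F_def ray_chart_t[OF c s] pm_ray[OF c s, symmetric]
      by (simp add: ray_map_def bilinear_rmul[OF bilinear_pm])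
  qed (use pd in simp)
  moreover have "((\<lambda>s. t * s * ?\<omega>) has_vector_derivative t * ?\<omega>) (at 0)"
    unfolding has_real_derivative_iff_has_vector_derivative[symmetric] by (auto intro!: derivative_eq_intros)
  ultimately have ss: "ginner N c (F ?p) (cov c F Ft ?p e\<^sub>s) (Fs ?p) + ginner N c (F ?p) (Ft ?p) (cov c F Fs ?p e\<^sub>s) = t * ?\<omega>"
    by (rule vector_derivative_unique_at)
  show "chart_hess N c (rad c) (F ?p) (Fs ?p) (Fs ?p) = ginner N c (F ?p) (cov c F Fs ?p e\<^sub>t) (Fs ?p)"
    using H[of e\<^sub>s e\<^sub>s] ss rad_ray_second_derivs(2)[OF ip0_nonneg[of W], of t e\<^sub>s] unfolding tors
    by (simp add: Fs_def)
qed

lemma jacobi_norm_deriv: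
  assumes c: "c \<in> atlas N" and p: "(0, t) \<in> ray_dom c V W"
  defines "F \<equiv> ray_chart c V W"
  defines "Fs \<equiv> \<lambda>p. dir_deriv F p e\<^sub>s"
  shows "((\<lambda>t. t\<^sup>2 * pm (t *\<^sub>R V) W W) has_real_derivative 2 * ginner N c (F (0, t)) (cov c F Fs (0, t) e\<^sub>t) (Fs (0, t))) (at t)"
proof -
  have yc: "F (0, t) \<in> cimg c" unfolding F_def by (rule ray_chart_in[OF p])
  have opn: "open ((\<lambda>t. (0, t)) -` ray_dom c V W)"
    by (rule open_vimage[OF ray_dom_open[OF c]]) (intro continuous_intros)
  have "((\<lambda>t. ginner N c (F (0, t)) (Fs (0, t)) (Fs (0, t))) has_vector_derivative
      2 * ginner N c (F (0, t)) (cov c F Fs (0, t) e\<^sub>t) (Fs (0, t))) (at t)"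
    using has_vector_derivative_snd[OF pm_ray_has_derivative[OF c p, of e\<^sub>s e\<^sub>s]] ginner_sym[OF c yc, of "Fs (0, t)"]
    by (simp add: F_def Fs_def)
  then have "((\<lambda>t. t\<^sup>2 * pm (t *\<^sub>R V) W W) has_vector_derivative
      2 * ginner N c (F (0, t)) (cov c F Fs (0, t) e\<^sub>t) (Fs (0, t))) (at t)"
  proof (rule has_vector_derivative_transform_within_open[OF _ opn])
    fix t assume "t \<in> (\<lambda>t. (0, t)) -` ray_dom c V W"
    then have t: "(0, t) \<in> ray_dom c V W" by simp
    show "ginner N c (F (0, t)) (Fs (0, t)) (Fs (0, t)) = t\<^sup>2 * pm (t *\<^sub>R V) W W"
      unfolding Fs_def F_def ray_chart_t[OF c t] pm_ray[OF c t, symmetric]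
      by (simp add: ray_map_def bilinear_rmul[OF bilinear_pm] bilinear_lmul[OF bilinear_pm] power2_eq_square)
  qed (use p in simp)
  then show ?thesis by (simp add: has_real_derivative_iff_has_vector_derivative)
qed

text \<open>Along a ray, the variation field \<open>\<partial>\<^sub>sF\<close> satisfies the Jacobi equation.\<close>

lemma jacobi_norm_second_deriv:
  assumes t: "t > 0" and V: "ip0 V V = 1" and W: "ip0 V W = 0" and W0: "W \<noteq> 0"
    and j1: "\<And>t. ((\<lambda>t. t\<^sup>2 * pm (t *\<^sub>R V) W W) has_real_derivative j1 t) (at t)"
    and j2: "(j1 has_real_derivative j2) (at t)"
  defines "c \<equiv> chart_at N (E (t *\<^sub>R V))"
  defines "F \<equiv> ray_chart c V W"
  defines "T \<equiv> dir_deriv F (0, t) e\<^sub>t" and "J \<equiv> dir_deriv F (0, t) e\<^sub>s" and "j \<equiv> t\<^sup>2 * pm (t *\<^sub>R V) W W"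
  shows "j2 * j / 2 \<ge> - sectional_curvature N (E (t *\<^sub>R V)) T J * j\<^sup>2 + (j1 t)\<^sup>2 / 4"
    "is_radial_vector N q (E (t *\<^sub>R V)) T" "\<And>a b. a *\<^sub>R T + b *\<^sub>R J = 0 \<Longrightarrow> a = 0 \<and> b = 0"
proof -
  let ?p = "(0::real, t)" and ?x = "t *\<^sub>R V"
  have c: "c \<in> atlas N" and Ec: "E ?x \<in> cdom c" using chart_at[of "E ?x"] by (auto simp: c_def)
  have p: "?p \<in> ray_dom c V W" using Ec by (simp add: ray_dom_def ray_map_def)
  have yc: "F ?p \<in> cimg c" unfolding F_def by (rule ray_chart_in[OF p])
  have y: "F ?p = cmap c (E ?x)" by (simp add: F_def ray_chart_def ray_map_def)
  have Teq: "T = dE c ?x V" unfolding T_def F_def ray_chart_t[OF c p] by (simp add: ray_map_def)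
  note dom = ray_dom_open[OF c, of V W]
  have F: "ck_on k (ray_dom c V W) F" for k unfolding F_def by (rule ray_chart_smooth[OF c])
  let ?Fs = "\<lambda>p. dir_deriv F p e\<^sub>s" and ?Ft = "\<lambda>p. dir_deriv F p e\<^sub>t"
  have Fs: "ck_on k (ray_dom c V W) ?Fs" and Ft: "ck_on k (ray_dom c V W) ?Ft" for k
    by (rule ck_on_dir_deriv[OF dom F])+
  note bil = bilinear_ladd[OF bilinear_ginner] bilinear_radd[OF bilinear_ginner] bilinear_lmul[OF bilinear_ginner]
    bilinear_rmul[OF bilinear_ginner]
  note sym = ginner_sym[OF c yc]
  have gTT: "ginner N c (F ?p) T T = 1"
    using pm_ray[OF c p, of V V] pm_radial_radial[of t V] V unfolding F_def[symmetric] Teq by (simp add: ray_map_def)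
  have gTJ: "ginner N c (F ?p) T J = 0"
  proof -
    have "pm ?x ?x W = ip0 ?x W" by (rule gauss_lemma)
    then have "pm ?x V W = 0" unfolding bilinear_lmul[OF bilinear_pm] bilinear_lmul[OF bilinear_ip0] using t W by simp
    then show ?thesis
      unfolding T_def J_def F_def ray_chart_t[OF c p] pm_ray[OF c p, symmetric]
      by (simp add: ray_map_def bilinear_rmul[OF bilinear_pm])
  qed
  have gJJ: "ginner N c (F ?p) J J = j"
    unfolding j_def J_def F_def ray_chart_t[OF c p] pm_ray[OF c p, symmetric]
    by (simp add: ray_map_def bilinear_rmul[OF bilinear_pm] bilinear_lmul[OF bilinear_pm] power2_eq_square)
  have jpos: "j > 0" unfolding j_def using t pm_pos[OF W0] by simp
  show "is_radial_vector N q (E ?x) T"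
    unfolding is_radial_vector_def
    by (intro exI[of _ "\<lambda>t. E (t *\<^sub>R V)"] exI[of _ t])
      (simp add: ray_geodesic E_0 t ray_velocity Teq c_def)
  show "a = 0 \<and> b = 0" if "a *\<^sub>R T + b *\<^sub>R J = 0" for a b
  proof
    have "0 = ginner N c (F ?p) T (a *\<^sub>R T + b *\<^sub>R J)" using that bilinear_rzero[OF bilinear_ginner] by simp
    then show "a = 0" by (simp add: bil gTT gTJ)
    have "0 = ginner N c (F ?p) J (a *\<^sub>R T + b *\<^sub>R J)" using that bilinear_rzero[OF bilinear_ginner] by simp
    then show "b = 0" using jpos by (simp add: bil gJJ sym[of J T] gTJ)
  qed
  let ?Y = "\<lambda>p. cov c F ?Fs p e\<^sub>t"
  have tors: "?Y p = cov c F ?Ft p e\<^sub>s" if "p \<in> ray_dom c V W" for p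
    by (rule cov_torsion_free[OF c dom F that]) (unfold F_def, rule ray_chart_in[OF that])
  have dY: "(?Y has_derivative dir_deriv ?Y ?p) (at ?p)"
    by (rule has_derivative_dir_deriv[OF cov_has_derivative[OF c dom F Fs p yc]])
  \<comment> \<open>With T = \<partial>_t F and J = \<partial>_s F: \<nabla>_t \<nabla>_t J =
    \<nabla>_t \<nabla>_s T by torsion-freeness, and this is R(T,J)T + \<nabla>_s \<nabla>_t T,
    whose last term vanishes because the curves in t are geodesics.\<close>
  have curv: "cov c F ?Y ?p e\<^sub>t = curvature N c (F ?p) T J T"
  proof -
    have 1: "cov c F ?Y ?p e\<^sub>t = cov c F (\<lambda>p. cov c F ?Ft p e\<^sub>s) ?p e\<^sub>t"
      unfolding cov_def[of c F ?Y] cov_def[of c F "\<lambda>p. cov c F ?Ft p e\<^sub>s"]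
      by (simp only: dir_deriv_cong_open[OF dom p tors] tors[OF p])
    have z: "cov c F ?Ft p e\<^sub>t = 0" if "p \<in> ray_dom c V W" for p
      unfolding F_def by (rule ray_cov_zero[OF c that])
    have "dir_deriv (\<lambda>p. cov c F ?Ft p e\<^sub>t) ?p = dir_deriv (\<lambda>_. 0) ?p"
      by (rule dir_deriv_cong_open[OF dom p z])
    then have 2: "cov c F (\<lambda>p. cov c F ?Ft p e\<^sub>t) ?p e\<^sub>s = 0"
      unfolding cov_def[of c F "\<lambda>p. cov c F ?Ft p e\<^sub>t"] z[OF p] dir_deriv_eq[OF has_derivative_const]
      using bilinear_rzero[OF bilinear_christoffel[OF c yc]] dir_deriv_eq[OF has_derivative_const] by simp
    show ?thesis using cov_commutator[OF c dom F Ft p yc, of e\<^sub>s e\<^sub>t] unfolding 1 2 T_def J_def by simp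
  qed
  have "((\<lambda>p. ginner N c (F p) (?Y p) (?Fs p)) has_derivative
    (\<lambda>e. ginner N c (F ?p) (cov c F ?Y ?p e) J + ginner N c (F ?p) (?Y ?p) (cov c F ?Fs ?p e))) (at ?p)"
    unfolding J_def
    by (rule cov_metric[OF c yc ck_on_has_derivative[OF dom F p] dY ck_on_has_derivative[OF dom Fs p]])
  from has_vector_derivative_snd[OF has_derivative_mult_right[OF this, of 2]]
  have "((\<lambda>t. 2 * ginner N c (F (0, t)) (?Y (0, t)) (?Fs (0, t))) has_vector_derivative
     2 * (ginner N c (F ?p) (curvature N c (F ?p) T J T) J + ginner N c (F ?p) (?Y ?p) (?Y ?p))) (at t)"
    unfolding curv .
  then have "(j1 has_vector_derivative
     2 * (ginner N c (F ?p) (curvature N c (F ?p) T J T) J + ginner N c (F ?p) (?Y ?p) (?Y ?p))) (at t)"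
  proof (rule has_vector_derivative_transform_within_open)
    show "open ((\<lambda>t. (0, t)) -` ray_dom c V W)"
      by (rule open_vimage[OF dom]) (intro continuous_intros)
    fix t assume "t \<in> (\<lambda>t. (0, t)) -` ray_dom c V W"
    then have "(0, t) \<in> ray_dom c V W" by simp
    from jacobi_norm_deriv[OF c this] show "2 * ginner N c (F (0, t)) (?Y (0, t)) (?Fs (0, t)) = j1 t"
      unfolding F_def[symmetric] by (rule DERIV_unique[OF _ j1])
  qed (use p in simp)
  then have j2eq: "j2 = 2 * (ginner N c (F ?p) (curvature N c (F ?p) T J T) J + ginner N c (F ?p) (?Y ?p) (?Y ?p))"
    using j2[unfolded has_real_derivative_iff_has_vector_derivative] by (rule vector_derivative_unique_at[rotated])
  have j1eq: "j1 t = 2 * ginner N c (F ?p) (?Y ?p) J"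
    using DERIV_unique[OF j1 jacobi_norm_deriv[OF c p]] by (simp add: F_def J_def)
  \<comment> \<open>T is a unit vector orthogonal to J, so the denominator of the sectional
    curvature is just j; skew symmetry in the last two slots supplies the sign.\<close>
  have K: "ginner N c (F ?p) (curvature N c (F ?p) T J T) J = - sectional_curvature N (E ?x) T J * j"
  proof -
    have "sectional_curvature N (E ?x) T J = ginner N c (F ?p) (curvature N c (F ?p) T J J) T / (1 * j - 0\<^sup>2)"
      unfolding sectional_curvature_def Let_def inner_at_def c_def[symmetric] y[symmetric] gTT gTJ gJJ ..
    then show ?thesis using jpos curvature_skew[OF c yc, of T J T J] by simp
  qed
  \<comment> \<open>Cauchy-Schwarz for \<nabla>_t J and J, done after pulling both back by
    \<open>E\<close>. It produces the term (j')^2 / 4, so that no equation for the full vector J has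
    to be solved.\<close>
  have "(ginner N c (F ?p) (?Y ?p) J)\<^sup>2 \<le> ginner N c (F ?p) (?Y ?p) (?Y ?p) * j"
  proof -
    obtain a where a: "?Y ?p = dE c ?x a" using dE_inverse(2)[OF c Ec] by metis
    obtain b where b: "J = dE c ?x b" using dE_inverse(2)[OF c Ec] by metis
    show ?thesis using pm_cauchy_schwarz[of ?x a b]
      unfolding gJJ[symmetric] a b y pm_chart[OF c Ec, symmetric] .
  qed
  then show "j2 * j / 2 \<ge> - sectional_curvature N (E ?x) T J * j\<^sup>2 + (j1 t)\<^sup>2 / 4"
    unfolding j2eq j1eq K by (simp add: power2_eq_square algebra_simps)
qed

text \<open>Split \<open>z\<close> into its radial part a T, with a = dr(z), and an orthogonal part,
  which is the value J of a Jacobi field vanishing at the pole. The Hessian sees only J, where it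
  equals half the derivative of |J|^2 along the ray, and Sturm comparison bounds that below by
  \<eta>_w |J|^2.\<close>

lemma hessian_comparison:
  assumes w: "warping_function {0..} w"
    and curv: "\<And>x u v. x \<noteq> q \<Longrightarrow> is_radial_vector N q x u \<Longrightarrow>
        (\<forall>a b. a *\<^sub>R u + b *\<^sub>R v = 0 \<longrightarrow> a = 0 \<and> b = 0) \<Longrightarrow>
        sectional_curvature N x u v \<le> model_radial_curvature {0..} w (riem_dist N q x)"
    and x: "x \<noteq> q"
  defines "c \<equiv> chart_at N x"
  shows "chart_hess N c (rad c) (cmap c x) z z \<ge>
    eta w (riem_dist N q x) * (ginner N c (cmap c x) z z - (dir_deriv (rad c) (cmap c x) z)\<^sup>2)"
proof -
  define x0 where "x0 = inv E x"
  define t0 where "t0 = riem_dist N q x"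
  define V where "V = (1 / t0) *\<^sub>R x0"
  have t0: "t0 > 0" unfolding t0_def by (rule dist_pole_pos[OF x])
  have x0: "x0 = t0 *\<^sub>R V" using t0 by (simp add: V_def)
  have Ex: "E (t0 *\<^sub>R V) = x" by (simp add: x0[symmetric] x0_def)
  have "t0\<^sup>2 = ip0 x0 x0" using dist_pole[of x] ip0_nonneg by (simp add: t0_def x0_def)
  then have V: "ip0 V V = 1" using t0
    by (simp add: V_def bilinear_lmul[OF bilinear_ip0] bilinear_rmul[OF bilinear_ip0] power2_eq_square flip: \<open>t0\<^sup>2 = ip0 x0 x0\<close>)
  have c: "c \<in> atlas N" and xc: "x \<in> cdom c" using chart_at[of x] by (auto simp: c_def)
  have Ec: "E (t0 *\<^sub>R V) \<in> cdom c" using xc Ex by simp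
  let ?y = "cmap c x"
  have yc: "?y \<in> cimg c" by (rule cmap_in[OF xc])
  obtain \<zeta> where z: "z = dE c (t0 *\<^sub>R V) \<zeta>" using dE_inverse(2)[OF c Ec] by metis
  define a where "a = ip0 V \<zeta>"
  \<comment> \<open>Since \<partial>_s F at time t0 is the image of t0 W, the division by t0 makes
    it exactly the orthogonal part of \<open>z\<close>.\<close>
  define W where "W = (1 / t0) *\<^sub>R (\<zeta> - a *\<^sub>R V)"
  have W: "ip0 V W = 0" using V
    by (simp add: W_def a_def bilinear_rmul[OF bilinear_ip0] bilinear_rsub[OF bilinear_ip0])
  let ?F = "ray_chart c V W" and ?p = "(0::real, t0)"
  let ?T = "dir_deriv ?F ?p e\<^sub>t" and ?J = "dir_deriv ?F ?p e\<^sub>s"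
  have p: "?p \<in> ray_dom c V W" using Ec by (simp add: ray_dom_def ray_map_def)
  have Fp: "?F ?p = ?y" by (simp add: ray_chart_def ray_map_def Ex)
  note lin = dE_linear[OF c Ec]
  have T: "?T = dE c (t0 *\<^sub>R V) V" and J: "?J = dE c (t0 *\<^sub>R V) (t0 *\<^sub>R W)"
    unfolding ray_chart_t[OF c p] by (simp_all add: ray_map_def)
  have "\<zeta> = a *\<^sub>R V + t0 *\<^sub>R W" using t0 by (simp add: W_def)
  then have zTJ: "z = a *\<^sub>R ?T + ?J" unfolding z T J by (simp only: linear_add[OF lin] linear_scale[OF lin])
  have gTT: "ginner N c ?y ?T ?T = 1"
    using pm_ray[OF c p, of V V] pm_radial_radial[of t0 V] V unfolding Fp T by (simp add: ray_map_def)
  have gTJ: "ginner N c ?y ?T ?J = 0"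
  proof -
    have "pm (t0 *\<^sub>R V) (t0 *\<^sub>R V) W = ip0 (t0 *\<^sub>R V) W" by (rule gauss_lemma)
    then have "pm (t0 *\<^sub>R V) V W = 0" unfolding bilinear_lmul[OF bilinear_pm] bilinear_lmul[OF bilinear_ip0] using t0 W by simp
    then show ?thesis
      unfolding Fp[symmetric] ray_chart_t[OF c p] pm_ray[OF c p, symmetric]
      by (simp add: ray_map_def bilinear_rmul[OF bilinear_pm])
  qed
  let ?j = "\<lambda>t. t\<^sup>2 * pm (t *\<^sub>R V) W W"
  have gJJ: "ginner N c ?y ?J ?J = ?j t0"
    unfolding Fp[symmetric] ray_chart_t[OF c p] pm_ray[OF c p, symmetric]
    by (simp add: ray_map_def bilinear_rmul[OF bilinear_pm] bilinear_lmul[OF bilinear_pm] power2_eq_square)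
  note bil = bilinear_ladd[OF bilinear_ginner] bilinear_radd[OF bilinear_ginner] bilinear_lmul[OF bilinear_ginner]
    bilinear_rmul[OF bilinear_ginner]
  have dz: "dir_deriv (rad c) ?y z = a"
    using rad_deriv[OF c Ec t0 V, of z] unfolding Ex T[symmetric] zTJ by (simp add: bil gTT gTJ)
  have gzz: "ginner N c ?y z z = a\<^sup>2 + ?j t0"
    unfolding zTJ using ginner_sym[OF c yc, of ?J ?T] by (simp add: bil gTT gTJ gJJ power2_eq_square)
  have punc: "?y \<in> punct c" using x yc by (simp add: punct_def cinv_cmap[OF c xc])
  have sub: "punct c \<subseteq> cimg c" by (auto simp: punct_def)
  note H = chart_hess_bilinear[OF c punct_open[OF c] sub punc rad_smooth[OF c]]
  note hess = chart_hess_rad_ray[OF c Ec t0 V W, unfolded Fp]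
  have Hzz: "chart_hess N c (rad c) ?y z z = ginner N c ?y (cov c ?F (\<lambda>p. dir_deriv ?F p e\<^sub>s) ?p e\<^sub>t) ?J"
    unfolding zTJ bilinear_ladd[OF H(2)] bilinear_radd[OF H(2)] bilinear_lmul[OF H(2)] bilinear_rmul[OF H(2)]
    using hess H(1)[of ?J ?T] by simp
  have "eta w t0 * ?j t0 \<le> chart_hess N c (rad c) ?y z z"
  \<comment> \<open>For radial \<open>z\<close> both sides are 0. Otherwise the Jacobi field has no
    zero for t > 0, as the Sturm comparison requires.\<close>
  proof (cases "W = 0")
    case True
    then have "?J = 0" unfolding J using linear_0[OF lin] by simp
    then show ?thesis unfolding Hzz using True by (simp add: bilinear_rzero[OF bilinear_ginner] bilinear_rzero[OF bilinear_pm])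
  next
    case False
    define k where "k t = pm (t *\<^sub>R V) W W" for t
    have tV: "ck_on i UNIV (\<lambda>t::real. t *\<^sub>R V)" for i
      by (intro ck_on_scaleR ck_on_id ck_on_const open_UNIV)
    have k: "ck_on i UNIV k" for i
      unfolding k_def by (intro pm_smooth open_UNIV tV ck_on_const)
    define k1 where "k1 t = dir_deriv k t 1" for t
    define k2 where "k2 t = dir_deriv k1 t 1" for t
    have dk: "(k has_real_derivative k1 t) (at t)" for t
      unfolding k1_def by (rule ck_on_realD[OF open_UNIV k]) simp
    have "ck_on i UNIV k1" for i unfolding k1_def by (rule ck_on_dir_deriv[OF open_UNIV k])
    then have dk1: "(k1 has_real_derivative k2 t) (at t)" for t
      unfolding k2_def by (rule ck_on_realD[OF open_UNIV]) simp
    have dj: "(?j has_real_derivative 2 * t * k t + t\<^sup>2 * k1 t) (at t)" for t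
      unfolding k_def[symmetric] by (auto intro!: derivative_eq_intros dk)
    have dj1: "((\<lambda>t. 2 * t * k t + t\<^sup>2 * k1 t) has_real_derivative 2 * k t + 4 * t * k1 t + t\<^sup>2 * k2 t) (at t)" for t
      by (auto intro!: derivative_eq_intros dk dk1 simp: power2_eq_square algebra_simps)
    obtain w2 where w2': "\<forall>t>0. (w has_real_derivative deriv w t) (at t) \<and> (deriv w has_real_derivative w2 t) (at t)
      \<and> model_radial_curvature {0..} w t = - w2 t / w t"
      using warping_function_derivs(1)[OF w] by blast
    have w2: "(w has_real_derivative deriv w t) (at t)" "(deriv w has_real_derivative w2 t) (at t)"
      "model_radial_curvature {0..} w t = - w2 t / w t" if "t > 0" for t
      using w2' that by blast+
    have wpos: "w t > 0" if "t > 0" for t using w that by (simp add: warping_function_def)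
    have "deriv w t0 / w t0 * (t0\<^sup>2 * k t0) \<le> (2 * t0 * k t0 + t0\<^sup>2 * k1 t0) / 2"
    proof (rule sturm_comparison[OF _ dk dk1 wpos w2(1,2) warping_function_derivs(3,2)[OF w] _ t0])
      show "k t > 0" for t unfolding k_def by (rule pm_pos[OF False])
      fix t :: real assume t: "t > 0"
      let ?c = "chart_at N (E (t *\<^sub>R V))"
      let ?G = "ray_chart ?c V W"
      let ?T = "dir_deriv ?G (0, t) e\<^sub>t" and ?J = "dir_deriv ?G (0, t) e\<^sub>s"
      note jac = jacobi_norm_second_deriv[OF t V W False dj dj1]
      have "ip0 (t *\<^sub>R V) (t *\<^sub>R V) = t\<^sup>2"
        using V by (simp add: bilinear_lmul[OF bilinear_ip0] bilinear_rmul[OF bilinear_ip0] power2_eq_square)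
      then have dist: "riem_dist N q (E (t *\<^sub>R V)) = t" using t by (simp add: dist_pole)
      have "E (t *\<^sub>R V) \<noteq> q" using dist t dist_pole_eq_0 by auto
      then have "sectional_curvature N (E (t *\<^sub>R V)) ?T ?J \<le> - w2 t / w t"
        using curv[OF _ jac(2), of ?J] jac(3) by (simp add: dist w2(3)[OF t])
      then have "w2 t / w t \<le> - sectional_curvature N (E (t *\<^sub>R V)) ?T ?J" by simp
      then have "w2 t / w t * (t\<^sup>2 * k t)\<^sup>2 \<le> - sectional_curvature N (E (t *\<^sub>R V)) ?T ?J * (t\<^sup>2 * k t)\<^sup>2"
        by (rule mult_right_mono) simp
      then show "w2 t / w t * (t\<^sup>2 * k t)\<^sup>2 + (2 * t * k t + t\<^sup>2 * k1 t)\<^sup>2 / 4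
         \<le> (2 * k t + 4 * t * k1 t + t\<^sup>2 * k2 t) * (t\<^sup>2 * k t) / 2"
        using jac(1) unfolding k_def[symmetric] by linarith
    qed
    also have "(2 * t0 * k t0 + t0\<^sup>2 * k1 t0) / 2 = chart_hess N c (rad c) ?y z z"
      unfolding Hzz using DERIV_unique[OF dj jacobi_norm_deriv[OF c p]] by (simp add: Fp)
    finally show ?thesis by (simp add: eta_def k_def)
  qed
  then show ?thesis unfolding gzz dz t0_def[symmetric] by simp
qed

end

section \<open>The distance function on a submanifold\<close>

context riemannian begin

lemma onb_at_iff: "orthonormal_basis_at M x X \<longleftrightarrow> onb (chart_at M x) (cmap (chart_at M x) x) X"
  by (simp add: orthonormal_basis_at_def onb_def inner_at_def)

text \<open>\<open>mean_curvature\<close> sums over a frame picked by choice, while the Laplacian is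
  to be bounded for every orthonormal frame. A bilinear form is represented by an endomorphism,
  whose trace ignores the frame.\<close>

lemma onb_trace_unique:
  assumes c: "c \<in> atlas M" "y \<in> cimg c" and X: "onb c y X" and Y: "onb c y Y" and H: "bilinear H"
  shows "(\<Sum>i\<in>UNIV. H (X i) (X i)) = (\<Sum>i\<in>UNIV. H (Y i) (Y i) :: real)"
proof -
  define L where "L u = matrix_inv (gram M c y) *v (\<chi> k. H u (axis k 1))" for u
  have lr: "linear (H u)" and ll: "linear (\<lambda>u. H u v)" for u v using H by (simp_all add: bilinear_def)
  have L: "ginner M c y (L u) v = H u v" for u v
    unfolding L_def by (rule ginner_gram_inv[OF c lr])
  have "linear L"
    by (intro linearI ginner_nondeg[OF c])
      (simp_all add: L bilinear_ladd[OF bilinear_ginner] bilinear_lmul[OF bilinear_ginner] linear_add[OF ll] linear_scale[OF ll])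
  from onb_trace[OF c X this] onb_trace[OF c Y this] show ?thesis by (simp add: L)
qed

lemma onb_sum_square:
  assumes c: "c \<in> atlas M" "y \<in> cimg c" and X: "onb c y X"
  shows "(\<Sum>i\<in>UNIV. ginner M c y u (X i) * ginner M c y v (X i)) = ginner M c y u v"
proof -
  have lin: "linear (\<lambda>v. ginner M c y u v)" using bilinear_ginner by (simp add: bilinear_def)
  have "ginner M c y u v = ginner M c y u (\<Sum>i\<in>UNIV. ginner M c y v (X i) *\<^sub>R X i)"
    by (rule arg_cong[OF onb_expand[OF c X]])
  then show ?thesis by (simp add: linear_sum[OF lin] linear_scale[OF lin] mult.commute)
qed

lemma onb_transition:
  assumes "c \<in> atlas M" "d \<in> atlas M" "x \<in> cdom c" "x \<in> cdom d" "onb c (cmap c x) X"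
  shows "onb d (cmap d x) (\<lambda>i. dir_deriv (cmap d \<circ> cinv c) (cmap c x) (X i))"
  using assms(5) unfolding onb_def by (simp add: ginner_transition[OF assms(1-4), symmetric])

end

locale submfd = N: pole N q E + S: riemannian S
  for N :: "('a::{t2_space, second_countable_topology}, 'n::finite) riem" and q :: 'a and E :: "real ^ 'n \<Rightarrow> 'a"
    and S :: "('s::{t2_space, second_countable_topology}, 'm::finite) riem" +
  fixes \<iota> :: "'s \<Rightarrow> 'a"
  assumes submanifold: "riemannian_submanifold S N \<iota>"
begin

definition rS :: "'s \<Rightarrow> real" where "rS x = riem_dist N q (\<iota> x)"

definition spunct :: "('s, 'm) chart \<Rightarrow> (real ^ 'm) set" where
  "spunct c = {y \<in> cimg c. \<iota> (cinv c y) \<noteq> q}"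

lemma cont_\<iota>: "continuous_on UNIV \<iota>"
  using submanifold by (simp add: riemannian_submanifold_def smooth_map_def)

lemma open_\<iota>_vimage: "open V \<Longrightarrow> open (\<iota> -` V)"
  by (rule open_vimage[OF _ cont_\<iota>])

lemma local_rep_smooth:
  assumes "c \<in> atlas S" "d \<in> atlas N"
  shows "ck_on k (cmap c ` (cdom c \<inter> \<iota> -` cdom d)) (cmap d \<circ> \<iota> \<circ> cinv c)"
  using submanifold assms unfolding riemannian_submanifold_def smooth_map_def by (intro smooth_on_ck) blast

lemma spunct_eq: "spunct c = {y \<in> cimg c. cinv c y \<in> \<iota> -` (- {q})}" by (auto simp: spunct_def)

lemma open_preimage_chart:
  assumes "c \<in> atlas S" "open V" shows "open {y \<in> cimg c. cinv c y \<in> V}"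
proof -
  have "{y \<in> cimg c. cinv c y \<in> V} = cimg c \<inter> cinv c -` V" by blast
  then show ?thesis
    using continuous_open_preimage[OF S.continuous_cinv[OF assms(1)] S.atlasD(2)[OF assms(1)] assms(2)] by simp
qed

lemma spunct_open: "c \<in> atlas S \<Longrightarrow> open (spunct c)"
  unfolding spunct_eq by (rule open_preimage_chart) (auto intro!: open_\<iota>_vimage)

lemma rS_local:
  assumes c: "c \<in> atlas S" and d: "d \<in> atlas N" and y: "y \<in> spunct c" "\<iota> (cinv c y) \<in> cdom d"
  obtains U where "open U" "y \<in> U" "U \<subseteq> spunct c" "\<And>k. ck_on k U (cmap d \<circ> \<iota> \<circ> cinv c)"
    "(cmap d \<circ> \<iota> \<circ> cinv c) ` U \<subseteq> N.punct d"
    "\<And>z. z \<in> U \<Longrightarrow> (rS \<circ> cinv c) z = N.rad d ((cmap d \<circ> \<iota> \<circ> cinv c) z)"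
proof -
  let ?W = "cmap c ` (cdom c \<inter> \<iota> -` cdom d)"
  have W: "open ?W" by (rule S.open_cmap_image[OF c open_\<iota>_vimage[OF N.atlasD(1)[OF d]]])
  have yc: "y \<in> cimg c" using y by (simp add: spunct_def)
  have yW: "y \<in> ?W" using y(2) S.cmap_cinv[OF c yc] S.cinv_in[OF c yc] by (intro image_eqI[of _ _ "cinv c y"]) auto
  have inW: "\<iota> (cinv c z) \<in> cdom d" if "z \<in> ?W" for z using that S.cinv_cmap[OF c] by auto
  let ?U = "?W \<inter> spunct c"
  have U: "open ?U" using W spunct_open[OF c] by blast
  show ?thesis
  proof (rule that[of ?U])
    show "ck_on k ?U (cmap d \<circ> \<iota> \<circ> cinv c)" for k
      by (rule ck_on_open_subset[OF local_rep_smooth[OF c d] W U]) blast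
    show "(cmap d \<circ> \<iota> \<circ> cinv c) ` ?U \<subseteq> N.punct d"
    proof (rule image_subsetI)
      fix z assume z: "z \<in> ?U"
      then have "\<iota> (cinv c z) \<in> cdom d" "\<iota> (cinv c z) \<noteq> q" using inW by (auto simp: spunct_def)
      then show "(cmap d \<circ> \<iota> \<circ> cinv c) z \<in> N.punct d"
        using N.cmap_in by (simp add: N.punct_def N.cinv_cmap[OF d] cimg_def)
    qed
    show "(rS \<circ> cinv c) z = N.rad d ((cmap d \<circ> \<iota> \<circ> cinv c) z)" if "z \<in> ?U" for z
      using inW[of z] that by (simp add: rS_def N.rad_def N.cinv_cmap[OF d])
  qed (use U yW y in auto)
qed

lemma rS_smooth:
  assumes c: "c \<in> atlas S" shows "ck_on k (spunct c) (rS \<circ> cinv c)"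
proof (rule ck_on_local[OF spunct_open[OF c]])
  fix y assume y: "y \<in> spunct c"
  obtain d where d: "d \<in> atlas N" "\<iota> (cinv c y) \<in> cdom d" using N.charts_cover by blast
  obtain U where U: "open U" "y \<in> U" "U \<subseteq> spunct c" "\<And>k. ck_on k U (cmap d \<circ> \<iota> \<circ> cinv c)"
    "(cmap d \<circ> \<iota> \<circ> cinv c) ` U \<subseteq> N.punct d"
    "\<And>z. z \<in> U \<Longrightarrow> (rS \<circ> cinv c) z = N.rad d ((cmap d \<circ> \<iota> \<circ> cinv c) z)"
    by (rule rS_local[OF c d(1) y d(2)]) (rule that)
  have "ck_on k U (\<lambda>z. N.rad d ((cmap d \<circ> \<iota> \<circ> cinv c) z))"
    by (rule ck_on_compose[OF U(1) N.punct_open[OF d(1)] U(5) U(4) N.rad_smooth[OF d(1)]])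
  then have "ck_on k U (rS \<circ> cinv c)" by (rule ck_on_cong[OF U(1), rotated]) (simp only: U(6))
  then show "\<exists>V. open V \<and> y \<in> V \<and> V \<subseteq> spunct c \<and> ck_on k V (rS \<circ> cinv c)" using U(1-3) by blast
qed

lemma cont_rS: "continuous_on UNIV rS"
proof -
  have "continuous_on UNIV (\<lambda>x. sqrt (N.ip0 (inv E x) (inv E x)))"
    by (intro continuous_intros bounded_bilinear.continuous_on[OF N.bounded_bilinear_ip0] N.cont_inv_E)
  then have "continuous_on UNIV (riem_dist N q)" by (simp only: N.dist_pole[abs_def])
  then show ?thesis unfolding rS_def by (rule continuous_on_compose2[OF _ cont_\<iota>]) simp
qed

text \<open>The Gauss formula turns the Hessian of \<open>r\<close> on \<open>N\<close> into the one on \<open>S\<close>.\<close>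

lemma submfd_hess:
  assumes x: "\<iota> x \<noteq> q"
  defines "c \<equiv> chart_at S x" and "d \<equiv> chart_at N (\<iota> x)"
  defines "y \<equiv> cmap c x" and "dr \<equiv> inner_at N (\<iota> x) (gradient N (riem_dist N q) (\<iota> x))"
  shows "chart_hess S c (rS \<circ> cinv c) y u u =
      chart_hess N d (N.rad d) (cmap d (\<iota> x)) (tangent_map S N \<iota> x u) (tangent_map S N \<iota> x u) + dr (second_fund S N \<iota> x u u)"
    and "dir_deriv (rS \<circ> cinv c) y u = dir_deriv (N.rad d) (cmap d (\<iota> x)) (tangent_map S N \<iota> x u)"
    and "dr z = dir_deriv (N.rad d) (cmap d (\<iota> x)) z"
proof -
  have c: "c \<in> atlas S" "x \<in> cdom c" using S.chart_at[of x] by (auto simp: c_def)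
  have d: "d \<in> atlas N" "\<iota> x \<in> cdom d" using N.chart_at[of "\<iota> x"] by (auto simp: d_def)
  let ?f = "cmap d \<circ> \<iota> \<circ> cinv c"
  have f: "local_rep S N \<iota> x = ?f" by (simp add: local_rep_def c_def d_def)
  have cy: "cinv c y = x" by (simp add: y_def S.cinv_cmap[OF c])
  have yp: "y \<in> spunct c" using x S.cmap_in[OF c(2)] by (simp add: spunct_def y_def S.cinv_cmap[OF c])
  have fy: "?f y = cmap d (\<iota> x)" by (simp add: cy)
  obtain U where U: "open U" "y \<in> U" "U \<subseteq> spunct c" "\<And>k. ck_on k U ?f"
    "?f ` U \<subseteq> N.punct d" "\<And>z. z \<in> U \<Longrightarrow> (rS \<circ> cinv c) z = N.rad d (?f z)"
    by (rule rS_local[OF c(1) d(1) yp, unfolded cy, OF d(2)]) (rule that)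
  have fd: "(?f has_derivative dir_deriv ?f y) (at y)" by (rule ck_on_has_derivative[OF U(1) U(4) U(2)])
  have rd: "(N.rad d has_derivative dir_deriv (N.rad d) (cmap d (\<iota> x))) (at (?f y))"
    unfolding fy by (rule N.rad_has_derivative[OF d(1)]) (use U(2,5) fy in auto)
  have D1: "dir_deriv (rS \<circ> cinv c) z = dir_deriv (\<lambda>z. N.rad d (?f z)) z" if "z \<in> U" for z
    by (rule dir_deriv_cong_open[OF U(1) that]) (rule U(6))
  have D1': "dir_deriv (rS \<circ> cinv c) y v = dir_deriv (N.rad d) (cmap d (\<iota> x)) (dir_deriv ?f y v)" for v
    unfolding D1[OF U(2)] by (rule dir_deriv_compose[OF fd rd])
  have D2: "dir_deriv (\<lambda>z. dir_deriv (rS \<circ> cinv c) z u) y u = dir_deriv (\<lambda>z. dir_deriv (\<lambda>z. N.rad d (?f z)) z u) y u"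
    by (rule fun_cong[OF dir_deriv_cong_open[OF U(1,2)]]) (simp only: D1)
  have lin: "linear (dir_deriv (N.rad d) (cmap d (\<iota> x)))" by (rule has_derivative_linear[OF rd])
  show tr: "dr z = dir_deriv (N.rad d) (cmap d (\<iota> x)) z" for z
  proof -
    have "N.rad d = riem_dist N q \<circ> cinv d" by (auto simp: N.rad_def)
    then have "gradient N (riem_dist N q) (\<iota> x) = chart_grad N d (N.rad d) (cmap d (\<iota> x))"
      by (simp add: gradient_def chart_grad_def Let_def d_def)
    then show ?thesis
      unfolding dr_def inner_at_def d_def[symmetric]
      using N.chart_grad[OF d(1) N.cmap_in[OF d(2)] rd[unfolded fy]] by simp
  qed
  show "dir_deriv (rS \<circ> cinv c) y u = dir_deriv (N.rad d) (cmap d (\<iota> x)) (tangent_map S N \<iota> x u)"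
    unfolding D1' tangent_map_def f by (simp add: c_def y_def)
  show "chart_hess S c (rS \<circ> cinv c) y u u =
      chart_hess N d (N.rad d) (cmap d (\<iota> x)) (tangent_map S N \<iota> x u) (tangent_map S N \<iota> x u) + dr (second_fund S N \<iota> x u u)"
    unfolding chart_hess_def D2 D1' tr
      second_derivative_compose[OF U(1,2) U(4) N.punct_open[OF d(1)] U(5) N.rad_smooth[OF d(1)]]
    unfolding second_fund_def tangent_map_def Let_def f c_def[symmetric] d_def[symmetric] y_def[symmetric] fy
    by (simp add: linear_add[OF lin] linear_diff[OF lin])
qed

end

locale comparison = submfd N q E S \<iota>
  for N :: "('a::{t2_space, second_countable_topology}, 'n::finite) riem" and q :: 'a and E :: "real ^ 'n \<Rightarrow> 'a"
    and S :: "('s::{t2_space, second_countable_topology}, 'm::finite) riem" and \<iota> :: "'s \<Rightarrow> 'a" +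
  fixes w g lam h :: "real \<Rightarrow> real"
  assumes warp: "warping_function {0..} w"
    and curvature_bound: "\<And>x u v. x \<noteq> q \<Longrightarrow> is_radial_vector N q x u \<Longrightarrow>
        (\<forall>a b. a *\<^sub>R u + b *\<^sub>R v = 0 \<longrightarrow> a = 0 \<and> b = 0) \<Longrightarrow>
        sectional_curvature N x u v \<le> model_radial_curvature {0..} w (riem_dist N q x)"
    and bounds: "\<And>x. \<iota> x \<noteq> q \<Longrightarrow> radial_tangency S N q \<iota> x \<le> g (rS x) \<and>
        radial_second_fund S N q \<iota> x \<le> lam (rS x) \<and> radial_mean_convexity S N q \<iota> x \<le> h (rS x)"
begin

lemma radial_tangency_eq:
  assumes x: "\<iota> x \<noteq> q"
  defines "c \<equiv> chart_at S x"
  defines "V \<equiv> chart_grad S c (rS \<circ> cinv c) (cmap c x)"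
  shows "gradient S (riem_dist N q \<circ> \<iota>) x = V"
    "radial_tangency S N q \<iota> x \<ge> 0" "(radial_tangency S N q \<iota> x)\<^sup>2 = ginner S c (cmap c x) V V"
    "dir_deriv (rS \<circ> cinv c) (cmap c x) u = ginner S c (cmap c x) V u"
proof -
  have c: "c \<in> atlas S" "x \<in> cdom c" using S.chart_at[of x] by (auto simp: c_def)
  have rs: "riem_dist N q \<circ> \<iota> = rS" by (auto simp: rS_def)
  show V: "gradient S (riem_dist N q \<circ> \<iota>) x = V"
    unfolding rs V_def by (simp add: gradient_def chart_grad_def Let_def c_def)
  have nn: "ginner S c (cmap c x) V V \<ge> 0" by (rule S.ginner_nonneg[OF c(1) S.cmap_in[OF c(2)]])
  show "radial_tangency S N q \<iota> x \<ge> 0" "(radial_tangency S N q \<iota> x)\<^sup>2 = ginner S c (cmap c x) V V"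
    unfolding radial_tangency_def V norm_at_def inner_at_def using nn by (simp_all add: c_def)
  have "cmap c x \<in> spunct c" using x S.cmap_in[OF c(2)] by (simp add: spunct_def S.cinv_cmap[OF c])
  from S.chart_grad[OF c(1) S.cmap_in[OF c(2)] ck_on_has_derivative[OF spunct_open[OF c(1)] rS_smooth[OF c(1)] this]]
  show "dir_deriv (rS \<circ> cinv c) (cmap c x) u = ginner S c (cmap c x) V u" by (simp add: V_def)
qed

lemma hess_lower_bound:
  assumes x: "\<iota> x \<noteq> q"
  defines "c \<equiv> chart_at S x"
  shows "chart_hess S c (rS \<circ> cinv c) (cmap c x) u u \<ge>
    eta w (rS x) * (ginner S c (cmap c x) u u - (dir_deriv (rS \<circ> cinv c) (cmap c x) u)\<^sup>2)
    + inner_at N (\<iota> x) (gradient N (riem_dist N q) (\<iota> x)) (second_fund S N \<iota> x u u)"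
proof -
  let ?d = "chart_at N (\<iota> x)" and ?Tu = "tangent_map S N \<iota> x u"
  have iso: "ginner S c (cmap c x) u u = ginner N ?d (cmap ?d (\<iota> x)) ?Tu ?Tu"
    using submanifold by (simp add: riemannian_submanifold_def inner_at_def c_def)
  have "eta w (riem_dist N q (\<iota> x)) * (ginner N ?d (cmap ?d (\<iota> x)) ?Tu ?Tu - (dir_deriv (N.rad ?d) (cmap ?d (\<iota> x)) ?Tu)\<^sup>2)
     \<le> chart_hess N ?d (N.rad ?d) (cmap ?d (\<iota> x)) ?Tu ?Tu"
    by (rule N.hessian_comparison[OF warp curvature_bound x]) assumption+
  then show ?thesis
    using submfd_hess(1,2)[OF x, of u] unfolding iso by (simp add: rS_def c_def)
qed

text \<open>Both bounds come from \<open>hess_lower_bound\<close>. Summing over a frame turns the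
  second fundamental form into m times the mean curvature, and the squares of dr add up to T^2; in
  the direction of the gradient, normalised to unit length, the second fundamental form is the
  radial component. If T = 0 the second bound is trivial.\<close>

lemma laplacian_hess_bounds:
  assumes x: "\<iota> x \<noteq> q"
  defines "c \<equiv> chart_at S x" and "T \<equiv> radial_tangency S N q \<iota> x"
  defines "V \<equiv> chart_grad S c (rS \<circ> cinv c) (cmap c x)"
  assumes X: "S.onb c (cmap c x) X"
  shows "(\<Sum>i\<in>UNIV. chart_hess S c (rS \<circ> cinv c) (cmap c x) (X i) (X i))
      \<ge> eta w (rS x) * (real CARD('m) - T\<^sup>2) - real CARD('m) * h (rS x)"
    and "chart_hess S c (rS \<circ> cinv c) (cmap c x) V V \<ge> T\<^sup>2 * (eta w (rS x) * (1 - T\<^sup>2) - lam (rS x))"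
proof -
  let ?y = "cmap c x" and ?H = "chart_hess S c (rS \<circ> cinv c) (cmap c x)"
  let ?dr = "inner_at N (\<iota> x) (gradient N (riem_dist N q) (\<iota> x))" and ?\<alpha> = "second_fund S N \<iota> x"
  have c: "c \<in> atlas S" "x \<in> cdom c" using S.chart_at[of x] by (auto simp: c_def)
  have yc: "?y \<in> cimg c" by (rule S.cmap_in[OF c(2)])
  have yp: "?y \<in> spunct c" using x yc by (simp add: spunct_def S.cinv_cmap[OF c])
  have sub: "spunct c \<subseteq> cimg c" by (auto simp: spunct_def)
  note H = S.chart_hess_bilinear[OF c(1) spunct_open[OF c(1)] sub yp rS_smooth[OF c(1)]]
  note tang = radial_tangency_eq[OF x, folded c_def, folded V_def T_def]
  note low = hess_lower_bound[OF x, folded c_def, unfolded tang(4)]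
  have lin: "linear ?dr" unfolding inner_at_def using N.bilinear_ginner by (simp add: bilinear_def)
  define Y where "Y = (SOME X. orthonormal_basis_at S x X)"
  have "\<exists>X. orthonormal_basis_at S x X" using X unfolding S.onb_at_iff c_def by blast
  then have "orthonormal_basis_at S x Y" unfolding Y_def by (rule someI_ex)
  then have Y: "S.onb c ?y Y" unfolding S.onb_at_iff c_def .
  have "(\<Sum>i\<in>UNIV. eta w (rS x) * (ginner S c ?y (Y i) (Y i) - (ginner S c ?y V (Y i))\<^sup>2) + ?dr (?\<alpha> (Y i) (Y i)))
      \<le> (\<Sum>i\<in>UNIV. ?H (Y i) (Y i))"
    by (intro sum_mono low)
  also have "(\<Sum>i\<in>UNIV. ?H (Y i) (Y i)) = (\<Sum>i\<in>UNIV. ?H (X i) (X i))"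
    by (rule S.onb_trace_unique[OF c(1) yc Y X H(2)])
  also have "(\<Sum>i\<in>UNIV. eta w (rS x) * (ginner S c ?y (Y i) (Y i) - (ginner S c ?y V (Y i))\<^sup>2) + ?dr (?\<alpha> (Y i) (Y i)))
     = eta w (rS x) * (real CARD('m) - T\<^sup>2) + ?dr (\<Sum>i\<in>UNIV. ?\<alpha> (Y i) (Y i))"
    using S.onb_sum_square[OF c(1) yc Y, of V V] Y
    by (simp add: S.onb_def sum.distrib sum_subtractf tang(3)[unfolded power2_eq_square, symmetric] power2_eq_square linear_sum[OF lin]
        flip: sum_distrib_left)
  also have "?dr (\<Sum>i\<in>UNIV. ?\<alpha> (Y i) (Y i)) = - real CARD('m) * radial_mean_convexity S N q \<iota> x"
    by (simp add: radial_mean_convexity_def mean_curvature_def Y_def[symmetric] linear_scale[OF lin])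
  finally have "eta w (rS x) * (real CARD('m) - T\<^sup>2) - real CARD('m) * radial_mean_convexity S N q \<iota> x
     \<le> (\<Sum>i\<in>UNIV. ?H (X i) (X i))" by linarith
  moreover have "real CARD('m) * radial_mean_convexity S N q \<iota> x \<le> real CARD('m) * h (rS x)"
    using bounds[OF x] by (intro mult_left_mono) auto
  ultimately show "eta w (rS x) * (real CARD('m) - T\<^sup>2) - real CARD('m) * h (rS x) \<le> (\<Sum>i\<in>UNIV. ?H (X i) (X i))"
    by linarith
  show "?H V V \<ge> T\<^sup>2 * (eta w (rS x) * (1 - T\<^sup>2) - lam (rS x))"
  proof (cases "T = 0")
    case True
    then have "V = 0" using S.ginner_pos[OF c(1) yc, of V] tang(3) by auto
    then show ?thesis using True bilinear_lzero[OF H(2)] by simp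
  next
    case False
    define U where "U = (1 / T) *\<^sub>R V"
    have T: "norm_at S x V = T" using tang(2,3)
      by (simp add: norm_at_def inner_at_def c_def[symmetric] flip: tang(3))
    have U: "unit_radial S N q \<iota> x = U" unfolding unit_radial_def Let_def tang(1) T U_def ..
    note gm = bilinear_lmul[OF S.bilinear_ginner] bilinear_rmul[OF S.bilinear_ginner]
    have gU: "ginner S c ?y U U = 1" "ginner S c ?y V U = T"
      using False by (simp_all add: U_def gm power2_eq_square flip: tang(3))
    have "?H U U \<ge> eta w (rS x) * (1 - T\<^sup>2) + ?dr (?\<alpha> U U)" using low[of U] by (simp add: gU)
    moreover have "- ?dr (?\<alpha> U U) \<le> lam (rS x)"
      using bounds[OF x] by (simp add: radial_second_fund_def U Let_def)
    ultimately have "?H U U \<ge> eta w (rS x) * (1 - T\<^sup>2) - lam (rS x)" by linarith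
    then have "T\<^sup>2 * (eta w (rS x) * (1 - T\<^sup>2) - lam (rS x)) \<le> T\<^sup>2 * ?H U U" by (rule mult_left_mono) simp
    also have "\<dots> = ?H V V" using False
      by (simp add: U_def bilinear_lmul[OF H(2)] bilinear_rmul[OF H(2)] power2_eq_square)
    finally show ?thesis .
  qed
qed

end

section \<open>A bounded radial subsolution\<close>

text \<open>With n = 1 and n = 0 this gives the first two derivatives of the cubed positive part,
  the cut-off used for the radial profile. At 0 the difference quotient is at most
  |h|^(n+1).\<close>

lemma has_real_derivative_pos_part_power:
  "((\<lambda>s::real. max 0 s ^ Suc (Suc n)) has_real_derivative real (Suc (Suc n)) * max 0 s ^ Suc n) (at s)"
proof -
  consider "s < 0" | "s = 0" | "s > 0" by linarith
  then show ?thesis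
  proof cases
    case 1
    have "((\<lambda>s::real. max 0 s ^ Suc (Suc n)) has_real_derivative 0) (at s)"
      by (rule has_field_derivative_transform_within_open[where f="\<lambda>_. 0" and S="{..<0}"]) (use 1 in auto)
    then show ?thesis using 1 by simp
  next
    case 2
    have "(\<lambda>h::real. max 0 h ^ Suc (Suc n) / h) \<midarrow>0\<rightarrow> 0"
    proof (rule Lim_null_comparison[where g="\<lambda>h. \<bar>h\<bar> ^ Suc n"])
      show "\<forall>\<^sub>F h in at 0. norm (max 0 h ^ Suc (Suc n) / h) \<le> \<bar>h\<bar> ^ Suc n"
      proof (rule always_eventually, rule allI)
        fix h :: real
        show "norm (max 0 h ^ Suc (Suc n) / h) \<le> \<bar>h\<bar> ^ Suc n"
        proof (cases "h > 0")
          case False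
          then have "max 0 h = 0" by simp
          then have "norm (max 0 h ^ Suc (Suc n) / h) = 0" by simp
          moreover have "0 \<le> \<bar>h\<bar> ^ Suc n" by (rule zero_le_power) simp
          ultimately show ?thesis by (simp only:)
        qed simp
      qed
      have "(\<lambda>h::real. \<bar>h\<bar> ^ Suc n) \<midarrow>0\<rightarrow> \<bar>0\<bar> ^ Suc n" by (intro tendsto_intros)
      then show "(\<lambda>h::real. \<bar>h\<bar> ^ Suc n) \<midarrow>0\<rightarrow> 0" by simp
    qed
    then show ?thesis using 2 by (simp add: DERIV_def)
  next
    case 3
    have "((\<lambda>s::real. s ^ Suc (Suc n)) has_real_derivative real (Suc (Suc n)) * s ^ Suc n) (at s)"
      by (rule DERIV_cong[OF DERIV_pow]) simp
    then have "((\<lambda>s::real. max 0 s ^ Suc (Suc n)) has_real_derivative real (Suc (Suc n)) * s ^ Suc n) (at s)"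
      by (rule has_field_derivative_transform_within_open[of _ _ _ "{0<..}"]) (use 3 in \<open>auto simp: max_def\<close>)
    then show ?thesis using 3 by (simp add: max_def)
  qed
qed

text \<open>The integral is oriented, so the formula also holds for x < c. An interval that contains
  both points in its interior makes the one-sided fundamental theorem two-sided.\<close>

lemma has_real_derivative_interval_integral:
  fixes b :: "real \<Rightarrow> real"
  assumes "continuous_on {0<..} b" "c > 0" "x > 0"
  shows "((\<lambda>u. LBINT t=ereal c..ereal u. b t) has_real_derivative b x) (at x)"
proof -
  let ?a = "min c x / 2" and ?d = "max c x + 1"
  have "((\<lambda>u. LBINT t=ereal c..ereal u. b t) has_vector_derivative b x) (at x within {?a..?d})"
  proof (rule interval_integral_FTC2)
    show "continuous_on {?a..?d} b" by (rule continuous_on_subset[OF assms(1)]) (use assms in auto)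
  qed (use assms in auto)
  moreover have "at x within {?a..?d} = at x"
    by (rule at_within_interior) (use assms in \<open>auto simp: interior_atLeastAtMost_real\<close>)
  ultimately show ?thesis by (simp add: has_real_derivative_iff_has_vector_derivative)
qed

text \<open>The condition on \<Phi> is first order and linear in \<Phi>': it asks for \<Phi>'' \<ge>
  a \<Phi>', and \<Lambda> satisfies \<Lambda>' = a \<Lambda>. Let \<psi> be the primitive of
  \<Lambda> that vanishes at c0. For \<Phi> the cube of its positive part, \<Phi>'' - a \<Phi>' = 6
  \<psi>_+ \<Lambda>^2 \<ge> 0, so composing with an increasing convex function preserves the
  condition.\<close>

lemma radial_profile:
  fixes w g lam h :: "real \<Rightarrow> real"
  assumes w: "warping_function {0..} w" and gs: "smooth_on {0..} g" and ls: "smooth_on {0..} lam" and hs: "smooth_on {0..} h"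
    and g: "\<And>r. r > 0 \<Longrightarrow> 0 < g r" and p: "p \<ge> (2::real)" and c0: "0 < c0" "c0 < \<rho>"
    and lim: "((\<lambda>R. integral {\<rho>..R} (Lambda_fun m p w g h lam)) \<longlongrightarrow> L) at_top"
  obtains \<Phi> \<Phi>1 \<Phi>2 B where "ck_on 2 {0<..} \<Phi>"
    "\<And>r. r > 0 \<Longrightarrow> (\<Phi> has_real_derivative \<Phi>1 r) (at r)" "\<And>r. r > 0 \<Longrightarrow> (\<Phi>1 has_real_derivative \<Phi>2 r) (at r)"
    "\<And>r. r \<le> c0 \<Longrightarrow> \<Phi> r = 0" "\<And>r. r > c0 \<Longrightarrow> \<Phi> r > 0" "\<And>r. r > 0 \<Longrightarrow> \<Phi>1 r \<ge> 0"
    "\<And>r. r > 0 \<Longrightarrow> \<Phi>2 r \<ge> (eta w r - balance m p w h lam r / ((p - 1) * (g r)\<^sup>2)) * \<Phi>1 r"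
    "\<And>r. \<Phi> r \<ge> 0" "\<And>r. \<Phi> r \<le> B"
proof -
  let ?b = "\<lambda>t. balance m p w h lam t / ((p - 1) * (g t)\<^sup>2)"
  let ?\<Lambda> = "Lambda_fun m p w g h lam"
  obtain w2 where w2: "\<forall>t>0. (w has_real_derivative deriv w t) (at t) \<and> (deriv w has_real_derivative w2 t) (at t)
      \<and> model_radial_curvature {0..} w t = - w2 t / w t"
    using warping_function_derivs(1)[OF w] by blast
  have dw: "(w has_real_derivative deriv w t) (at t)" "(deriv w has_real_derivative w2 t) (at t)" if "t > 0" for t
    using w2 that by blast+
  have wpos: "w t > 0" if "t > 0" for t using w that by (simp add: warping_function_def)
  have wnz: "w t \<noteq> 0" and gnz: "g t \<noteq> 0" if "t > 0" for t using wpos[OF that] g[OF that] by simp_all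
  have cont: "continuous_on {0<..} f" if "smooth_on {0..} f" for f :: "real \<Rightarrow> real"
    using ck_on_continuous[OF smooth_on_ck[OF that, of 0]] by (rule continuous_on_subset) auto
  have cw: "continuous_on {0<..} w" "continuous_on {0<..} (deriv w)"
    by (intro continuous_at_imp_continuous_on ballI, use dw DERIV_isCont in force)+
  have ceta: "continuous_on {0<..} (eta w)" unfolding eta_def[abs_def]
    by (intro continuous_intros cw) (use wnz in auto)
  have cb: "continuous_on {0<..} ?b" unfolding balance_def
    by (intro continuous_intros ceta cont gs ls hs) (use gnz p in auto)
  \<comment> \<open>The logarithmic derivative of \<Lambda>: \<open>eta w\<close> comes from the
    factor w, the other term from the exponential.\<close>
  define a where "a t = eta w t - ?b t" for t
  have ca: "continuous_on {0<..} a" unfolding a_def by (intro continuous_intros ceta cb)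
  have \<Lambda>pos: "?\<Lambda> t > 0" if "t > 0" for t using wpos[OF that] by (simp add: Lambda_fun_def)
  have d\<Lambda>: "(?\<Lambda> has_real_derivative a t * ?\<Lambda> t) (at t)" if "t > 0" for t
  proof -
    have "(?\<Lambda> has_real_derivative deriv w t * exp (- (LBINT t=ereal 1..ereal t. ?b t))
        + (exp (- (LBINT t=ereal 1..ereal t. ?b t)) * - ?b t) * w t) (at t)"
      unfolding Lambda_fun_def[abs_def]
      by (rule DERIV_mult[OF dw(1)[OF that] DERIV_chain2[OF DERIV_exp DERIV_minus[OF has_real_derivative_interval_integral[OF cb _ that]]]]) simp
    then show ?thesis
      by (rule DERIV_cong) (use wpos[OF that] in \<open>simp add: a_def eta_def Lambda_fun_def field_simps\<close>)
  qed
  have c\<Lambda>: "continuous_on {0<..} ?\<Lambda>"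
    by (intro continuous_at_imp_continuous_on ballI) (use d\<Lambda> DERIV_isCont in force)
  define \<psi> where "\<psi> r = (LBINT t=ereal c0..ereal r. ?\<Lambda> t)" for r
  have d\<psi>: "(\<psi> has_real_derivative ?\<Lambda> r) (at r)" if "r > 0" for r
    unfolding \<psi>_def by (rule has_real_derivative_interval_integral[OF c\<Lambda> c0(1) that])
  have \<psi>c0: "\<psi> c0 = 0" by (simp add: \<psi>_def)
  have \<psi>mono: "\<psi> r \<le> \<psi> s" if "0 < r" "r \<le> s" for r s
    by (rule DERIV_nonneg_imp_nondecreasing[OF that(2)]) (use d\<psi> \<Lambda>pos that in \<open>meson less_imp_le order_less_le_trans\<close>)
  have \<psi>pos: "\<psi> r > 0" if "r > c0" for r
  proof -
    have "\<psi> c0 < \<psi> r"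
      by (rule DERIV_pos_imp_increasing[OF that]) (use d\<psi> \<Lambda>pos c0 in \<open>meson order_less_le_trans\<close>)
    then show ?thesis by (simp add: \<psi>c0)
  qed
  have \<psi>neg: "\<psi> r \<le> 0" if "0 < r" "r \<le> c0" for r using \<psi>mono[OF that] \<psi>c0 by simp
  have int: "integral {\<rho>..R} ?\<Lambda> = \<psi> R - \<psi> \<rho>" if "R \<ge> \<rho>" for R
  proof (rule integral_unique[OF fundamental_theorem_of_calculus[OF that]])
    fix x assume "x \<in> {\<rho>..R}"
    then have "x > 0" using c0 by auto
    then show "(\<psi> has_vector_derivative ?\<Lambda> x) (at x within {\<rho>..R})"
      using d\<psi> by (simp add: has_real_derivative_iff_has_vector_derivative has_vector_derivative_at_within)
  qed
  \<comment> \<open>Beyond \<rho> the increasing function \<psi> stays below its limit;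
    \<open>max 0 L\<close> makes the same bound serve up to \<rho>.\<close>
  have \<psi>bound: "\<psi> r \<le> \<psi> \<rho> + max 0 L" if "r > 0" for r
  proof (cases "r \<le> \<rho>")
    case True then show ?thesis using \<psi>mono[OF that True] by simp
  next
    case False
    have "\<psi> r - \<psi> \<rho> \<le> L"
    proof (rule tendsto_lowerbound[OF lim])
      show "\<forall>\<^sub>F R in at_top. \<psi> r - \<psi> \<rho> \<le> integral {\<rho>..R} ?\<Lambda>"
        using eventually_ge_at_top[of r]
        by eventually_elim (use False int \<psi>mono[OF that] in simp)
    qed simp
    then show ?thesis by simp
  qed
  \<comment> \<open>A cube, because the square of a positive part is only C^1. The value 0 for r
    \<le> 0 is a convention that keeps \<Phi> bounded and nonnegative everywhere.\<close>
  define \<Phi> where "\<Phi> r = (if r > 0 then max 0 (\<psi> r) ^ 3 else 0)" for r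
  define \<Phi>1 where "\<Phi>1 r = 3 * max 0 (\<psi> r) ^ 2 * ?\<Lambda> r" for r
  define \<Phi>2 where "\<Phi>2 r = 6 * max 0 (\<psi> r) * (?\<Lambda> r)\<^sup>2 + a r * \<Phi>1 r" for r
  have d\<Phi>: "(\<Phi> has_real_derivative \<Phi>1 r) (at r)" if "r > 0" for r
  proof -
    have "((\<lambda>r. max 0 (\<psi> r) ^ 3) has_real_derivative \<Phi>1 r) (at r)"
      using DERIV_chain2[OF has_real_derivative_pos_part_power[of 1] d\<psi>[OF that]]
      by (simp add: \<Phi>1_def numeral_2_eq_2 numeral_3_eq_3)
    then show ?thesis
      by (rule has_field_derivative_transform_within_open[of _ _ _ "{0<..}"]) (use that in \<open>auto simp: \<Phi>_def\<close>)
  qed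
  have d\<Phi>1: "(\<Phi>1 has_real_derivative \<Phi>2 r) (at r)" if "r > 0" for r
  proof -
    have "((\<lambda>r. max 0 (\<psi> r) ^ 2) has_real_derivative 2 * max 0 (\<psi> r) * ?\<Lambda> r) (at r)"
      using DERIV_chain2[OF has_real_derivative_pos_part_power[of 0] d\<psi>[OF that]] by (simp add: numeral_2_eq_2)
    from DERIV_mult[OF DERIV_cmult[OF this, of 3] d\<Lambda>[OF that]]
    show ?thesis unfolding \<Phi>1_def[abs_def]
      by (rule DERIV_cong) (simp add: \<Phi>2_def \<Phi>1_def power2_eq_square algebra_simps)
  qed
  have c\<psi>: "continuous_on {0<..} \<psi>"
    by (intro continuous_at_imp_continuous_on ballI) (use d\<psi> DERIV_isCont in force)
  have "continuous_on {0<..} \<Phi>2" unfolding \<Phi>2_def \<Phi>1_def by (intro continuous_intros c\<psi> c\<Lambda> ca)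
  then have ck: "ck_on 2 {0<..} \<Phi>" unfolding numeral_2_eq_2
    by (intro ck_on_realI[where f'=\<Phi>1] ck_on_realI[where f'=\<Phi>2] open_greaterThan d\<Phi> d\<Phi>1) auto
  show ?thesis
  proof (rule that[OF ck d\<Phi> d\<Phi>1])
    show "\<Phi> r = 0" if "r \<le> c0" for r using \<psi>neg[of r] that by (auto simp: \<Phi>_def max_def)
    show "\<Phi> r > 0" if "r > c0" for r using \<psi>pos[OF that] c0 that by (simp add: \<Phi>_def max_def)
    show "\<Phi>1 r \<ge> 0" if "r > 0" for r using \<Lambda>pos[OF that] by (simp add: \<Phi>1_def)
    show "\<Phi>2 r \<ge> (eta w r - ?b r) * \<Phi>1 r" if "r > 0" for r by (simp add: \<Phi>2_def a_def)
    show "\<Phi> r \<ge> 0" for r by (simp add: \<Phi>_def)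
    show "\<Phi> r \<le> (max 0 (\<psi> \<rho> + max 0 L)) ^ 3" for r
    proof (cases "r > 0")
      case True
      have "max 0 (\<psi> r) \<le> max 0 (\<psi> \<rho> + max 0 L)" using \<psi>bound[OF True] by linarith
      then show ?thesis using True by (simp add: \<Phi>_def power_mono)
    qed (simp add: \<Phi>_def)
  qed
qed

context riemannian begin

lemma chart_comp_transition:
  assumes "c \<in> atlas M" "d \<in> atlas M" "z \<in> cmap c ` (cdom c \<inter> cdom d)"
  shows "(F \<circ> cinv c) z = (F \<circ> cinv d) ((cmap d \<circ> cinv c) z)"
  using assms(3) cinv_cmap[OF assms(1)] cinv_cmap[OF assms(2)] by auto

lemma fun_hess_transition:
  assumes "c \<in> atlas M" "d \<in> atlas M" "x \<in> cdom c" "x \<in> cdom d" and F: "ck_on 2 (cimg d) (F \<circ> cinv d)"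
  defines "A \<equiv> dir_deriv (cmap d \<circ> cinv c) (cmap c x)"
  shows "chart_hess M c (F \<circ> cinv c) (cmap c x) u v = chart_hess M d (F \<circ> cinv d) (cmap d x) (A u) (A v)"
    and "A (chart_grad M c (F \<circ> cinv c) (cmap c x)) = chart_grad M d (F \<circ> cinv d) (cmap d x)"
proof -
  let ?W = "cmap c ` (cdom c \<inter> cdom d)" and ?G = "\<lambda>z. (F \<circ> cinv d) ((cmap d \<circ> cinv c) z)"
  have W: "open ?W" "cmap c x \<in> ?W" using open_overlap[OF assms(1,2)] assms(3,4) by auto
  have D: "dir_deriv (F \<circ> cinv c) z = dir_deriv ?G z" if "z \<in> ?W" for z
    by (rule dir_deriv_cong_open[OF W(1) that chart_comp_transition[OF assms(1,2)]])
  have D2: "dir_deriv (\<lambda>z. dir_deriv (F \<circ> cinv c) z u) (cmap c x) = dir_deriv (\<lambda>z. dir_deriv ?G z u) (cmap c x)"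
    by (rule dir_deriv_cong_open[OF W]) (simp only: D)
  have "chart_hess M c (F \<circ> cinv c) (cmap c x) u v = chart_hess M c ?G (cmap c x) u v"
    unfolding chart_hess_def D2 D[OF W(2)] ..
  also have "\<dots> = chart_hess M d (F \<circ> cinv d) (cmap d x) (A u) (A v)"
    unfolding A_def by (rule chart_hess_transition[OF assms(1-4) atlasD(2)[OF assms(2)] cmap_in[OF assms(4)] F])
  finally show "chart_hess M c (F \<circ> cinv c) (cmap c x) u v = chart_hess M d (F \<circ> cinv d) (cmap d x) (A u) (A v)" .
  have "ck_on (Suc 1) (cimg d) (F \<circ> cinv d)" using F by (simp add: numeral_2_eq_2)
  note fd = ck_on_has_derivative[OF atlasD(2)[OF assms(2)] this cmap_in[OF assms(4)]]
  have "chart_grad M c (F \<circ> cinv c) (cmap c x) = chart_grad M c ?G (cmap c x)"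
    unfolding chart_grad_def D[OF W(2)] ..
  then show "A (chart_grad M c (F \<circ> cinv c) (cmap c x)) = chart_grad M d (F \<circ> cinv d) (cmap d x)"
    unfolding A_def using chart_grad_transition[OF assms(1-4) fd] by simp
qed

text \<open>The \<open>p\<close>-Laplacian of \<open>f\<close> is nonnegative. It is \<open>|\<nabla>f|\<^bsup>p-4\<^esup>\<close> times the expression in the second clause
  where \<open>\<nabla>f \<noteq> 0\<close>; where \<open>\<nabla>f = 0\<close> it vanishes if \<open>p > 2\<close> and is the Laplacian if \<open>p = 2\<close>.\<close>

definition p_subharmonic_at :: "real \<Rightarrow> ('a, 'm) chart \<Rightarrow> (real ^ 'm \<Rightarrow> real) \<Rightarrow> real ^ 'm \<Rightarrow> bool" where
  "p_subharmonic_at p c f y \<longleftrightarrow> (\<forall>X. onb c y X \<longrightarrow> (let V = chart_grad M c f y; Q = ginner M c y V V;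
     A = (\<Sum>i\<in>UNIV. chart_hess M c f y (X i) (X i)) in
     (p = 2 \<longrightarrow> Q = 0 \<longrightarrow> A \<ge> 0) \<and> (Q > 0 \<longrightarrow> Q * A + (p - 2) * chart_hess M c f y V V \<ge> 0)))"

lemma p_subharmonic_transition:
  assumes "c \<in> atlas M" "d \<in> atlas M" "x \<in> cdom c" "x \<in> cdom d" and F: "ck_on 2 (cimg d) (F \<circ> cinv d)"
    and sub: "p_subharmonic_at p d (F \<circ> cinv d) (cmap d x)"
  shows "p_subharmonic_at p c (F \<circ> cinv c) (cmap c x)"
  unfolding p_subharmonic_at_def
proof (intro allI impI)
  fix X assume X: "onb c (cmap c x) X"
  note X' = onb_transition[OF assms(1-4) X]
  show "let V = chart_grad M c (F \<circ> cinv c) (cmap c x); Q = ginner M c (cmap c x) V V;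
     A = (\<Sum>i\<in>UNIV. chart_hess M c (F \<circ> cinv c) (cmap c x) (X i) (X i)) in
     (p = 2 \<longrightarrow> Q = 0 \<longrightarrow> A \<ge> 0) \<and> (Q > 0 \<longrightarrow> Q * A + (p - 2) * chart_hess M c (F \<circ> cinv c) (cmap c x) V V \<ge> 0)"
    using sub X' unfolding p_subharmonic_at_def Let_def fun_hess_transition(1)[OF assms(1-4) F]
      ginner_transition[OF assms(1-4)] fun_hess_transition(2)[OF assms(1-4) F] by blast
qed

end

context comparison begin

lemma hess_radial_function:
  fixes \<Phi> :: "real \<Rightarrow> real"
  assumes c: "c \<in> atlas S" and y: "y \<in> spunct c" and \<Phi>: "ck_on 2 {0<..} \<Phi>"
    and d: "\<And>r. r > 0 \<Longrightarrow> (\<Phi> has_real_derivative \<Phi>1 r) (at r)" "\<And>r. r > 0 \<Longrightarrow> (\<Phi>1 has_real_derivative \<Phi>2 r) (at r)"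
  defines "r \<equiv> rS \<circ> cinv c" and "f \<equiv> (\<lambda>x. \<Phi> (rS x)) \<circ> cinv c"
  shows "chart_hess S c f y u v = \<Phi>2 (r y) * dir_deriv r y u * dir_deriv r y v + \<Phi>1 (r y) * chart_hess S c r y u v"
    "chart_grad S c f y = \<Phi>1 (r y) *\<^sub>R chart_grad S c r y"
    "ck_on 2 (spunct c) f"
proof -
  have f: "f = (\<lambda>z. \<Phi> (r z))" by (simp add: f_def r_def o_def)
  have r0: "r z > 0" if "z \<in> spunct c" for z
    using N.dist_pole_pos[of "\<iota> (cinv c z)"] that by (simp add: r_def rS_def spunct_def)
  have rpos: "r ` spunct c \<subseteq> {0<..}" using r0 by auto
  have r: "ck_on k (spunct c) r" for k unfolding r_def by (rule rS_smooth[OF c])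
  note U = spunct_open[OF c]
  show "ck_on 2 (spunct c) f" unfolding f by (rule ck_on_compose[OF U open_greaterThan rpos r \<Phi>])
  have D\<Phi>: "dir_deriv \<Phi> t k = \<Phi>1 t * k" if "t > 0" for t k
    using dir_deriv_eq[OF d(1)[OF that, unfolded has_field_derivative_def]] by simp
  have dr: "(r has_derivative dir_deriv r y) (at y)" by (rule ck_on_has_derivative[OF U r y])
  have Df: "dir_deriv f y v = \<Phi>1 (r y) * dir_deriv r y v" for v
    unfolding f by (rule dir_deriv_compose[OF dr d(1)[OF r0[OF y], unfolded has_field_derivative_def]])
  have D2\<Phi>: "dir_deriv (\<lambda>w. dir_deriv \<Phi> w k) (r y) l = \<Phi>2 (r y) * k * l" for k l
  proof -
    have "((\<lambda>w. \<Phi>1 w * k) has_derivative (\<lambda>l. \<Phi>2 (r y) * l * k)) (at (r y))"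
      by (rule has_derivative_mult_left[OF d(2)[OF r0[OF y], unfolded has_field_derivative_def]])
    then have "((\<lambda>w. dir_deriv \<Phi> w k) has_derivative (\<lambda>l. \<Phi>2 (r y) * l * k)) (at (r y))"
      by (rule has_derivative_transform_within_open[OF _ open_greaterThan]) (use r0[OF y] D\<Phi> in auto)
    then show ?thesis by (simp add: dir_deriv_eq)
  qed
  show "chart_hess S c f y u v = \<Phi>2 (r y) * dir_deriv r y u * dir_deriv r y v + \<Phi>1 (r y) * chart_hess S c r y u v"
    unfolding chart_hess_def Df unfolding f second_derivative_compose[OF U y r open_greaterThan rpos \<Phi>] D2\<Phi> D\<Phi>[OF r0[OF y]]
    by (simp add: algebra_simps)
  have "(\<chi> k. dir_deriv f y (axis k 1)) = \<Phi>1 (r y) *\<^sub>R (\<chi> k. dir_deriv r y (axis k 1))"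
    by (simp add: vec_eq_iff Df)
  then show "chart_grad S c f y = \<Phi>1 (r y) *\<^sub>R chart_grad S c r y"
    unfolding chart_grad_def by (simp add: matrix_vector_mult_scaleR)
qed

lemma rS_nonneg: "rS x \<ge> 0" by (simp add: rS_def N.dist_pole_nonneg)

lemma rS_pos_iff: "rS x > 0 \<longleftrightarrow> \<iota> x \<noteq> q"
  using N.dist_pole_pos[of "\<iota> x"] N.dist_pole_eq_0 by (auto simp: rS_def)

text \<open>r is not smooth over the pole, but \<Phi> vanishes for r \<le> c0, so near such points
  the composite is the zero function.\<close>

lemma radial_function_smooth:
  fixes \<Phi> :: "real \<Rightarrow> real"
  assumes c: "c \<in> atlas S" and \<Phi>: "ck_on 2 {0<..} \<Phi>"
    and d: "\<And>r. r > 0 \<Longrightarrow> (\<Phi> has_real_derivative \<Phi>1 r) (at r)" "\<And>r. r > 0 \<Longrightarrow> (\<Phi>1 has_real_derivative \<Phi>2 r) (at r)"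
    and c0: "c0 > 0" and zero: "\<And>r. r \<le> c0 \<Longrightarrow> \<Phi> r = 0"
  shows "ck_on 2 (cimg c) ((\<lambda>x. \<Phi> (rS x)) \<circ> cinv c)"
proof (rule ck_on_local[OF S.atlasD(2)[OF c]])
  fix y assume y: "y \<in> cimg c"
  let ?f = "(\<lambda>x. \<Phi> (rS x)) \<circ> cinv c"
  show "\<exists>V. open V \<and> y \<in> V \<and> V \<subseteq> cimg c \<and> ck_on 2 V ?f"
  proof (cases "y \<in> spunct c")
    case True
    then show ?thesis
      using hess_radial_function(3)[OF c True \<Phi> d] spunct_open[OF c] by (intro exI[of _ "spunct c"]) (auto simp: spunct_def)
  next
    case False
    let ?V = "{y \<in> cimg c. cinv c y \<in> rS -` {..<c0}}"
    have V: "open ?V" by (intro open_preimage_chart[OF c] open_vimage cont_rS open_lessThan)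
    have "\<iota> (cinv c y) = q" using False y by (simp add: spunct_def)
    then have "y \<in> ?V" using y c0 by (simp add: rS_def N.dist_pole_eq_0)
    moreover have "ck_on 2 ?V ?f"
      by (rule ck_on_cong[OF V _ ck_on_const[OF V, of 2 0]]) (simp add: zero)
    ultimately show ?thesis using V by blast
  qed
qed

text \<open>The Hessian of \<Phi> \<circ> r is \<Phi>'' dr \<otimes> dr + \<Phi>' Hess r, so with T
  = |\<nabla>r| everything reduces to an inequality between numbers. The condition is verified in
  the preferred chart, where the bounds on \<open>S\<close> are stated, and carried to other charts
  by invariance.\<close>

lemma radial_p_subharmonic:
  fixes \<Phi> :: "real \<Rightarrow> real"
  assumes \<Phi>: "ck_on 2 {0<..} \<Phi>"
    and d: "\<And>r. r > 0 \<Longrightarrow> (\<Phi> has_real_derivative \<Phi>1 r) (at r)" "\<And>r. r > 0 \<Longrightarrow> (\<Phi>1 has_real_derivative \<Phi>2 r) (at r)"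
    and c0: "c0 > 0" and zero: "\<And>r. r \<le> c0 \<Longrightarrow> \<Phi> r = 0"
    and \<Phi>1: "\<And>r. r > 0 \<Longrightarrow> \<Phi>1 r \<ge> 0"
    and \<Phi>2: "\<And>r. r > 0 \<Longrightarrow> \<Phi>2 r \<ge> (eta w r - balance CARD('m) p w h lam r / ((p - 1) * (g r)\<^sup>2)) * \<Phi>1 r"
    and p: "p \<ge> 2" and gpos: "\<And>r. r > 0 \<Longrightarrow> 0 < g r" and bal: "\<And>r. r > 0 \<Longrightarrow> balance CARD('m) p w h lam r \<ge> 0"
    and c: "c \<in> atlas S" and x: "x \<in> cdom c"
  shows "S.p_subharmonic_at p c ((\<lambda>x. \<Phi> (rS x)) \<circ> cinv c) (cmap c x)"
proof (rule S.p_subharmonic_transition[OF c S.chart_at(1)[of x] x S.chart_at(2) radial_function_smooth[OF S.chart_at(1) \<Phi> d c0 zero]])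
  define c where "c = chart_at S x"
  let ?f = "(\<lambda>x. \<Phi> (rS x)) \<circ> cinv c" and ?y = "cmap c x"
  have c: "c \<in> atlas S" "x \<in> cdom c" using S.chart_at[of x] by (auto simp: c_def)
  have yc: "?y \<in> cimg c" by (rule S.cmap_in[OF c(2)])
  have "S.p_subharmonic_at p c ?f ?y"
  proof (cases "\<iota> x = q")
    case True
    let ?V = "{y \<in> cimg c. cinv c y \<in> rS -` {..<c0}}"
    have V: "open ?V" by (intro open_preimage_chart[OF c(1)] open_vimage cont_rS open_lessThan)
    have yV: "?y \<in> ?V" using True yc c0 by (simp add: S.cinv_cmap[OF c] rS_def N.dist_pole_eq_0)
    have D: "dir_deriv ?f z = (\<lambda>_. 0)" if "z \<in> ?V" for z
    proof -
      have "dir_deriv ?f z = dir_deriv (\<lambda>_. 0) z"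
        by (rule dir_deriv_cong_open[OF V that]) (simp add: zero)
      then show ?thesis using dir_deriv_eq[OF has_derivative_const] by simp
    qed
    have D2: "dir_deriv (\<lambda>z. dir_deriv ?f z u) ?y = (\<lambda>_. 0)" for u
    proof -
      have "dir_deriv (\<lambda>z. dir_deriv ?f z u) ?y = dir_deriv (\<lambda>_. 0) ?y"
        by (rule dir_deriv_cong_open[OF V yV]) (simp only: D)
      then show ?thesis using dir_deriv_eq[OF has_derivative_const] by simp
    qed
    have "chart_hess S c ?f ?y u v = 0" for u v unfolding chart_hess_def D2 D[OF yV] by simp
    then show ?thesis unfolding S.p_subharmonic_at_def Let_def by simp
  next
    case False
    then have r: "rS x > 0" by (simp add: rS_pos_iff)
    have ysp: "?y \<in> spunct c" using False yc by (simp add: spunct_def S.cinv_cmap[OF c])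
    have ry: "(rS \<circ> cinv c) ?y = rS x" by (simp add: S.cinv_cmap[OF c])
    note hf = hess_radial_function[OF c(1) ysp \<Phi> d, unfolded ry]
    let ?r = "rS \<circ> cinv c"
    define G where "G = chart_grad S c ?r ?y"
    define T where "T = radial_tangency S N q \<iota> x"
    define H where "H = chart_hess S c ?r ?y"
    note tang = radial_tangency_eq[OF False, folded c_def, folded G_def T_def]
    define P1 P2 M \<eta> where "P1 = \<Phi>1 (rS x)" and "P2 = \<Phi>2 (rS x)"
      and "M = balance CARD('m) p w h lam (rS x)" and "\<eta> = eta w (rS x)"
    let ?m = "real CARD('m)"
    note gm = bilinear_lmul[OF S.bilinear_ginner] bilinear_rmul[OF S.bilinear_ginner]
    have sub: "spunct c \<subseteq> cimg c" by (auto simp: spunct_def)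
    have Hbil: "bilinear H" unfolding H_def
      by (rule S.chart_hess_bilinear(2)[OF c(1) spunct_open[OF c(1)] sub ysp rS_smooth[OF c(1)]])
    show ?thesis
      unfolding S.p_subharmonic_at_def Let_def
    proof (intro allI impI)
      fix X assume X: "S.onb c ?y X"
      define A where "A = (\<Sum>i\<in>UNIV. H (X i) (X i))"
      note low = laplacian_hess_bounds[OF False, folded c_def, OF X, folded H_def T_def G_def, folded A_def \<eta>_def]
      have grad: "chart_grad S c ?f ?y = P1 *\<^sub>R G" using hf(2) unfolding P1_def G_def .
      have Q: "ginner S c ?y (chart_grad S c ?f ?y) (chart_grad S c ?f ?y) = P1\<^sup>2 * T\<^sup>2"
        unfolding grad by (simp add: gm power2_eq_square tang(3)[unfolded power2_eq_square])
      have hfuv: "chart_hess S c ?f ?y u v = P2 * ginner S c ?y G u * ginner S c ?y G v + P1 * H u v" for u v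
        using hf(1)[of u v] unfolding tang(4) P1_def P2_def H_def .
      have Af: "(\<Sum>i\<in>UNIV. chart_hess S c ?f ?y (X i) (X i)) = P2 * T\<^sup>2 + P1 * A"
        unfolding hfuv tang(3)
        using S.onb_sum_square[OF c(1) yc X, of G G]
        by (simp add: sum.distrib A_def mult.assoc flip: sum_distrib_left)
      have Hf: "chart_hess S c ?f ?y (chart_grad S c ?f ?y) (chart_grad S c ?f ?y) = P1\<^sup>2 * (P2 * (T\<^sup>2)\<^sup>2 + P1 * H G G)"
        unfolding grad hfuv
        by (simp add: gm bilinear_lmul[OF Hbil] bilinear_rmul[OF Hbil] tang(3)[unfolded power2_eq_square] power2_eq_square algebra_simps)
      have P1: "P1 \<ge> 0" and P2: "P2 \<ge> (\<eta> - M / ((p - 1) * (g (rS x))\<^sup>2)) * P1" and M: "M \<ge> 0"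
        using \<Phi>1[OF r] \<Phi>2[OF r] bal[OF r] by (simp_all add: P1_def P2_def M_def \<eta>_def)
      have Meq: "M = (?m + p - 2) * \<eta> - ?m * h (rS x) - (p - 2) * lam (rS x)"
        by (simp add: M_def balance_def \<eta>_def)
      have key: "P1\<^sup>2 * T\<^sup>2 * (P2 * T\<^sup>2 + P1 * A) + (p - 2) * (P1\<^sup>2 * (P2 * (T\<^sup>2)\<^sup>2 + P1 * H G G)) \<ge> 0"
      proof -
        have g: "g (rS x) > 0" by (rule gpos[OF r])
        have Tg: "T\<^sup>2 \<le> (g (rS x))\<^sup>2" using bounds[OF False] tang(2) by (intro power_mono) (auto simp: T_def)
        have p1: "p - 1 > 0" using p by simp
        have "(p - 1) * P2 * T\<^sup>2 \<ge> (p - 1) * ((\<eta> - M / ((p - 1) * (g (rS x))\<^sup>2)) * P1) * T\<^sup>2"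
          using P2 p1 by (intro mult_right_mono mult_left_mono) auto
        moreover have "P1 * A \<ge> P1 * (\<eta> * (?m - T\<^sup>2) - ?m * h (rS x))" by (rule mult_left_mono[OF low(1) P1])
        ultimately have 1: "T\<^sup>2 * ((p - 1) * P2 * T\<^sup>2 + P1 * A) \<ge>
            T\<^sup>2 * ((p - 1) * ((\<eta> - M / ((p - 1) * (g (rS x))\<^sup>2)) * P1) * T\<^sup>2 + P1 * (\<eta> * (?m - T\<^sup>2) - ?m * h (rS x)))"
          by (intro mult_left_mono) auto
        have 2: "(p - 2) * P1 * H G G \<ge> (p - 2) * P1 * (T\<^sup>2 * (\<eta> * (1 - T\<^sup>2) - lam (rS x)))"
          using p P1 by (intro mult_left_mono[OF low(2)]) auto
        \<comment> \<open>The terms with \<eta> T^2 have coefficients p - 1, -1 and -(p - 2), hence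
          cancel. What remains of \<eta>, h and lam is M, reduced by M T^2 / g^2.\<close>
        have "T\<^sup>2 * ((p - 1) * ((\<eta> - M / ((p - 1) * (g (rS x))\<^sup>2)) * P1) * T\<^sup>2 + P1 * (\<eta> * (?m - T\<^sup>2) - ?m * h (rS x)))
           + (p - 2) * P1 * (T\<^sup>2 * (\<eta> * (1 - T\<^sup>2) - lam (rS x))) = P1 * T\<^sup>2 * (M * (1 - T\<^sup>2 / (g (rS x))\<^sup>2))"
          using p1 g by (simp add: field_simps) (simp add: Meq algebra_simps)
        also have "\<dots> \<ge> 0" using P1 M Tg g by (intro mult_nonneg_nonneg) (auto simp: divide_le_eq_1)
        finally have "0 \<le> T\<^sup>2 * ((p - 1) * P2 * T\<^sup>2 + P1 * A) + (p - 2) * P1 * H G G" using 1 2 by linarith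
        then have "0 \<le> P1\<^sup>2 * (T\<^sup>2 * ((p - 1) * P2 * T\<^sup>2 + P1 * A) + (p - 2) * P1 * H G G)"
          by (intro mult_nonneg_nonneg) auto
        also have "\<dots> = P1\<^sup>2 * T\<^sup>2 * (P2 * T\<^sup>2 + P1 * A) + (p - 2) * (P1\<^sup>2 * (P2 * (T\<^sup>2)\<^sup>2 + P1 * H G G))"
          by (simp add: algebra_simps power2_eq_square)
        finally show ?thesis .
      qed
      \<comment> \<open>At critical points with p = 2 the Laplacian itself has to be nonnegative. If
        \<Phi>' = 0, then \<Phi>'' \<ge> 0; if T = 0, the lower bound for the Laplacian of r is
        exactly M.\<close>
      have "P2 * T\<^sup>2 + P1 * A \<ge> 0" if "p = 2" "P1\<^sup>2 * T\<^sup>2 = 0"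
      proof (cases "P1 = 0")
        case True then show ?thesis using P2 by simp
      next
        case False
        then have T0: "T = 0" using that by simp
        have "A \<ge> M" using low(1) that(1) T0 by (simp add: Meq algebra_simps)
        then show ?thesis using M P1 T0 by simp
      qed
      then show "(p = 2 \<longrightarrow> ginner S c ?y (chart_grad S c ?f ?y) (chart_grad S c ?f ?y) = 0 \<longrightarrow>
            0 \<le> (\<Sum>i\<in>UNIV. chart_hess S c ?f ?y (X i) (X i))) \<and>
          (0 < ginner S c ?y (chart_grad S c ?f ?y) (chart_grad S c ?f ?y) \<longrightarrow>
            0 \<le> ginner S c ?y (chart_grad S c ?f ?y) (chart_grad S c ?f ?y) * (\<Sum>i\<in>UNIV. chart_hess S c ?f ?y (X i) (X i))
             + (p - 2) * chart_hess S c ?f ?y (chart_grad S c ?f ?y) (chart_grad S c ?f ?y))"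
        unfolding Q Af Hf using key by blast
    qed
  qed
  then show "S.p_subharmonic_at p (chart_at S x) ((\<lambda>x. \<Phi> (rS x)) \<circ> cinv (chart_at S x)) (cmap (chart_at S x) x)"
    unfolding c_def .
qed

end

section \<open>Integration by parts in a chart\<close>

lemma integrable_compact_support:
  fixes f :: "'a::euclidean_space \<Rightarrow> real"
  assumes "compact K" "continuous_on K f" shows "integrable lborel (\<lambda>x. indicator K x * f x)"
  using borel_integrable_compact[OF assms] by (simp add: mult.commute)

lemma dir_deriv_const [simp]: "dir_deriv (\<lambda>_. c) x = (\<lambda>_. 0)"
  by (rule dir_deriv_eq) simp

text \<open>By translation invariance every difference quotient has integral 0. The mean value
  theorem bounds the quotients uniformly on one fixed ball, so dominated convergence passes to the
  derivative, in any direction.\<close>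

lemma integral_dir_deriv_compact_support:
  fixes Z :: "'a::euclidean_space \<Rightarrow> real"
  assumes Z: "ck_on 1 UNIV Z" and K: "compact K" and zero: "\<And>y. y \<notin> K \<Longrightarrow> Z y = 0"
  shows "integrable lborel (\<lambda>y. dir_deriv Z y v)" "(LINT y|lborel. dir_deriv Z y v) = 0"
proof -
  let ?D = "\<lambda>y. dir_deriv Z y v"
  have Z1: "ck_on (Suc 0) UNIV Z" using Z by simp
  have contZ: "continuous_on UNIV Z" by (rule ck_on_continuous[OF Z])
  have contD: "continuous_on UNIV ?D" by (rule ck_on_continuous[OF ck_on_dir_deriv[OF open_UNIV Z1]])
  have [measurable]: "Z \<in> borel_measurable borel" "?D \<in> borel_measurable borel"
    by (intro borel_measurable_continuous_onI contZ contD)+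
  have D0: "?D y = 0" if "y \<notin> K" for y
  proof -
    have "dir_deriv Z y = dir_deriv (\<lambda>_. 0) y"
      by (rule dir_deriv_cong_open[OF open_Compl[OF compact_imp_closed[OF K]]]) (use that zero in auto)
    then show ?thesis by simp
  qed
  have Zi: "(\<lambda>x. indicator K x * Z x) = Z" "(\<lambda>x. indicator K x * ?D x) = ?D"
    using zero D0 by (auto simp: fun_eq_iff indicator_def)
  have intZ: "integrable lborel Z"
    using integrable_compact_support[OF K continuous_on_subset[OF contZ]] Zi(1) by simp
  show intD: "integrable lborel ?D"
    using integrable_compact_support[OF K continuous_on_subset[OF contD]] Zi(2) by simp
  have "compact (?D ` K)" by (intro compact_continuous_image continuous_on_subset[OF contD] K) simp
  then obtain C0 where "\<And>y. y \<in> K \<Longrightarrow> norm (?D y) \<le> C0" using compact_imp_bounded bounded_iff by (metis imageI)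
  then have C: "\<bar>?D y\<bar> \<le> max C0 0" for y using D0 by (cases "y \<in> K") (force simp: max_def)+
  obtain R where R: "\<And>y. y \<in> K \<Longrightarrow> norm y \<le> R" using compact_imp_bounded[OF K] bounded_iff by metis
  define s where "s n y = (Z (y + (1 / real (Suc n)) *\<^sub>R v) - Z y) * real (Suc n)" for n y
  have line: "((\<lambda>t. Z (y + t *\<^sub>R v)) has_real_derivative ?D (y + t *\<^sub>R v)) (at t)" for y t
  proof -
    have "((\<lambda>t. y + t *\<^sub>R v) has_vector_derivative v) (at t)" by (auto intro!: derivative_eq_intros)
    from has_vector_derivative_compose[OF this ck_on_has_derivative[OF open_UNIV Z1 UNIV_I]]
    show ?thesis by (simp add: has_real_derivative_iff_has_vector_derivative)
  qed
  have [measurable]: "s n \<in> borel_measurable borel" for n unfolding s_def by measurable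
  have shift: "(LINT y|lborel. Z (y + u)) = (LINT y|lborel. Z y)" "integrable lborel (\<lambda>y. Z (y + u))" for u
  proof -
    have eq: "lborel = distr lborel borel ((+) u)" by (rule lborel_distr_plus[symmetric])
    show "(LINT y|lborel. Z (y + u)) = (LINT y|lborel. Z y)"
      by (subst (2) eq) (simp add: integral_distr add.commute)
    show "integrable lborel (\<lambda>y. Z (y + u))"
      using intZ by (subst (asm) eq) (simp add: integrable_distr_eq add.commute)
  qed
  have "(LINT y|lborel. s n y) = 0" for n
    unfolding s_def using shift intZ by simp
  moreover have "(\<lambda>n. LINT y|lborel. s n y) \<longlonglongrightarrow> (LINT y|lborel. ?D y)"
  proof (rule integral_dominated_convergence[where w="\<lambda>y. max C0 0 * indicator (cball 0 (R + norm v)) y"])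
    show "integrable lborel (\<lambda>y::'a. max C0 0 * indicator (cball 0 (R + norm v)) y)"
      using integrable_compact_support[OF compact_cball continuous_on_const, of 0 "R + norm v" "max C0 0"]
      by (simp only: mult.commute[of "max C0 0"])
    show "AE y in lborel. (\<lambda>n. s n y) \<longlonglongrightarrow> ?D y"
    proof (rule AE_I2)
      fix y
      have lim: "((\<lambda>h. (Z (y + h *\<^sub>R v) - Z y) / h) \<longlongrightarrow> ?D y) (at 0)"
        using line[of y 0] by (simp add: DERIV_def)
      have "filterlim (\<lambda>n. 1 / real (Suc n)) (at 0) sequentially"
        unfolding filterlim_at using LIMSEQ_inverse_real_of_nat by (auto simp: inverse_eq_divide)
      from filterlim_compose[OF lim this] show "(\<lambda>n. s n y) \<longlonglongrightarrow> ?D y" by (simp add: s_def)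
    qed
    show "AE y in lborel. norm (s n y) \<le> max C0 0 * indicator (cball 0 (R + norm v)) y" for n
    proof (rule AE_I2)
      fix y
      let ?h = "1 / real (Suc n)"
      show "norm (s n y) \<le> max C0 0 * indicator (cball 0 (R + norm v)) y"
      proof (cases "norm y \<le> R + norm v")
        case True
        obtain z where "Z (y + ?h *\<^sub>R v) - Z (y + 0 *\<^sub>R v) = (?h - 0) * ?D (y + z *\<^sub>R v)"
          using MVT2[of 0 ?h "\<lambda>t. Z (y + t *\<^sub>R v)" "\<lambda>t. ?D (y + t *\<^sub>R v)"] line by auto
        then have "s n y = ?D (y + z *\<^sub>R v)" by (simp add: s_def)
        then show ?thesis using C True by simp
      next
        case False
        have "y \<notin> K" using R[of y] False norm_ge_zero[of v] by linarith
        moreover have "y + ?h *\<^sub>R v \<notin> K"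
        proof
          assume "y + ?h *\<^sub>R v \<in> K"
          then have "norm (y + ?h *\<^sub>R v) \<le> R" by (rule R)
          moreover have "norm y \<le> norm (y + ?h *\<^sub>R v) + norm (?h *\<^sub>R v)"
            using norm_triangle_ineq4[of "y + ?h *\<^sub>R v" "?h *\<^sub>R v"] by simp
          moreover have "norm (?h *\<^sub>R v) \<le> 1 * norm v" unfolding norm_scaleR by (intro mult_right_mono) auto
          ultimately show False using False by simp
        qed
        ultimately show ?thesis using False by (simp add: s_def zero)
      qed
    qed
  qed measurable
  ultimately show "(LINT y|lborel. ?D y) = 0" by (simp add: LIMSEQ_const_iff)
qed

text \<open>The factor |\<nabla>f|^(p-2) as a function of t = |\<nabla>f|^2. The case p = 2 is
  separate because \<open>0 powr 0\<close> is 0, whereas the weight has to be 1 at critical points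
  too.\<close>

definition flux_weight :: "real \<Rightarrow> real \<Rightarrow> real" where
  "flux_weight p t = (if p = 2 then 1 else t powr ((p - 2) / 2))"

context riemannian begin

text \<open>The coordinate divergence of the density times Y is the density times the trace of
  \<nabla>Y: the derivative of the density contributes half the trace of the derivative of the
  metric, which is the trace of the Christoffel term.\<close>

lemma divergence_formula:
  assumes c: "c \<in> atlas M" "y \<in> cimg c" and X: "onb c y X" and Y: "(Y has_derivative Y') (at y)"
  shows "(\<Sum>k\<in>UNIV. dir_deriv (\<lambda>z. vol_density c z * Y z $ k) y (axis k 1)) =
    vol_density c y * (\<Sum>i\<in>UNIV. ginner M c y (Y' (X i) + christoffel M c y (X i) (Y y)) (X i))"
proof -
  let ?d = "\<lambda>e. vol_density c y * (\<Sum>i\<in>UNIV. dgram M c y e (X i) (X i)) / 2"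
  note dd = vol_density_has_derivative[OF c X]
  have "((\<lambda>z. vol_density c z * Y z $ k) has_derivative (\<lambda>e. vol_density c y * Y' e $ k + ?d e * Y y $ k)) (at y)" for k
    by (rule has_derivative_mult[OF dd bounded_linear.has_derivative[OF bounded_linear_vec_nth Y]])
  from dir_deriv_eq[OF this]
  have "(\<Sum>k\<in>UNIV. dir_deriv (\<lambda>z. vol_density c z * Y z $ k) y (axis k 1)) =
      (\<Sum>k\<in>UNIV. vol_density c y * Y' (axis k 1) $ k + ?d (axis k 1) * Y y $ k)" by simp
  also have "\<dots> = vol_density c y * (\<Sum>k\<in>UNIV. Y' (axis k 1) $ k) + (\<Sum>k\<in>UNIV. (Y y $ k) *\<^sub>R ?d (axis k 1))"
    by (simp add: sum.distrib sum_distrib_left mult.commute)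
  also have "(\<Sum>k\<in>UNIV. (Y y $ k) *\<^sub>R ?d (axis k 1)) = ?d (Y y)"
    by (rule linear_axis_expand[OF has_derivative_linear[OF dd], symmetric])
  also have "(\<Sum>k\<in>UNIV. Y' (axis k 1) $ k) = (\<Sum>i\<in>UNIV. ginner M c y (Y' (X i)) (X i))"
    by (rule onb_trace[OF c X has_derivative_linear[OF Y], symmetric])
  also have "?d (Y y) = vol_density c y * (\<Sum>i\<in>UNIV. ginner M c y (christoffel M c y (X i) (Y y)) (X i))"
    unfolding christoffel_koszul[OF c] koszul_def using dgram_sym[OF c, of _ "Y y"]
    by (simp flip: sum_divide_distrib)
  finally show ?thesis by (simp add: bilinear_ladd[OF bilinear_ginner] sum.distrib algebra_simps)
qed

text \<open>Differentiate the defining identity <\<nabla>f, v> = df(v) and use metric compatibility;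
  the second claim is the same for the product of the gradient with itself.\<close>

lemma grad_covariant_derivative:
  assumes c: "c \<in> atlas M" and U: "open U" "U \<subseteq> cimg c" "y \<in> U" and f: "ck_on 2 U f"
  defines "V \<equiv> chart_grad M c f"
  shows "ginner M c y (dir_deriv V y u + christoffel M c y u (V y)) v = chart_hess M c f y u v"
    "((\<lambda>z. ginner M c z (V z) (V z)) has_derivative (\<lambda>u. 2 * chart_hess M c f y (V y) u)) (at y)"
proof -
  have f2: "ck_on (Suc (Suc 0)) U f" using f by (simp add: numeral_2_eq_2)
  have yc: "y \<in> cimg c" using U by blast
  have V: "ck_on (Suc 0) U V" unfolding V_def by (rule chart_grad_smooth[OF c U(1,2) f2])
  note dV = ck_on_has_derivative[OF U(1) V U(3)]
  have gV: "ginner M c z (V z) v = dir_deriv f z v" if "z \<in> U" for z v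
    unfolding V_def by (rule chart_grad[OF c _ ck_on_has_derivative[OF U(1) f2 that]]) (use U that in blast)
  note fam = has_derivative_bilinear_family[where \<beta>="ginner M c" and F="\<lambda>y. y"
        and \<beta>'="\<lambda>u v e. dgram M c y e u v", OF atlasD(2)[OF c] yc has_derivative_ident dV _ bilinear_ginner
        ginner_has_derivative[OF c yc]]
  have "((\<lambda>z. ginner M c z (V z) v) has_derivative (\<lambda>u. dgram M c y u (V y) v + ginner M c y (dir_deriv V y u) v + ginner M c y (V y) 0)) (at y)" for v
    by (rule fam[OF has_derivative_const])
  then have "((\<lambda>z. dir_deriv f z v) has_derivative (\<lambda>u. dgram M c y u (V y) v + ginner M c y (dir_deriv V y u) v + ginner M c y (V y) 0)) (at y)" for v
    by (rule has_derivative_transform_within_open[OF _ U(1,3)]) (simp add: gV)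
  from dir_deriv_eq[OF this]
  have "dir_deriv (\<lambda>z. dir_deriv f z v) y u = dgram M c y u (V y) v + ginner M c y (dir_deriv V y u) v" for u v
    by (simp add: bilinear_rzero[OF bilinear_ginner])
  then have H: "ginner M c y (dir_deriv V y u + christoffel M c y u (V y)) v = chart_hess M c f y v u" for u v
    unfolding chart_hess_def metric_compatible[OF c yc]
    using gV[OF U(3), of "christoffel M c y u v"] christoffel_sym[OF c yc, of v u]
    by (simp add: bilinear_ladd[OF bilinear_ginner])
  then show "ginner M c y (dir_deriv V y u + christoffel M c y u (V y)) v = chart_hess M c f y u v"
    using chart_hess_bilinear(1)[OF c U f] by simp
  show "((\<lambda>z. ginner M c z (V z) (V z)) has_derivative (\<lambda>u. 2 * chart_hess M c f y (V y) u)) (at y)"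
  proof (rule has_derivative_eq_rhs[OF fam[OF dV]], rule ext)
    fix u
    show "dgram M c y u (V y) (V y) + ginner M c y (dir_deriv V y u) (V y) + ginner M c y (V y) (dir_deriv V y u)
        = 2 * chart_hess M c f y (V y) u"
      unfolding metric_compatible[OF c yc] H[of u "V y", symmetric]
      using ginner_sym[OF c yc, of "V y"] by (simp add: bilinear_ladd[OF bilinear_ginner])
  qed
qed

text \<open>With s = (p-2)/2 this is the p-Laplacian regularised by \<epsilon>, which keeps the base
  of the power positive at critical points. The exponent s = 0 gives the ordinary Laplacian.\<close>

lemma regularised_divergence:
  assumes c: "c \<in> atlas M" and U: "open U" "U \<subseteq> cimg c" "y \<in> U" and f: "ck_on 2 U f" and X: "onb c y X" and \<epsilon>: "\<epsilon> > 0"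
  defines "V \<equiv> chart_grad M c f"
  defines "Q \<equiv> \<lambda>z. ginner M c z (V z) (V z)"
  shows "(\<Sum>k\<in>UNIV. dir_deriv (\<lambda>z. vol_density c z * ((Q z + \<epsilon>) powr s *\<^sub>R V z) $ k) y (axis k 1)) =
    vol_density c y * ((Q y + \<epsilon>) powr s * (\<Sum>i\<in>UNIV. chart_hess M c f y (X i) (X i))
      + 2 * s * (Q y + \<epsilon>) powr (s - 1) * chart_hess M c f y (V y) (V y))"
proof -
  have f2: "ck_on (Suc (Suc 0)) U f" using f by (simp add: numeral_2_eq_2)
  have yc: "y \<in> cimg c" using U by blast
  have V: "ck_on (Suc 0) U V" unfolding V_def by (rule chart_grad_smooth[OF c U(1,2) f2])
  note dV = ck_on_has_derivative[OF U(1) V U(3)]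
  note gc = grad_covariant_derivative[OF c U f, folded V_def]
  have Qpos: "Q y + \<epsilon> > 0" unfolding Q_def using ginner_nonneg[OF c yc] \<epsilon> by (simp add: add_nonneg_pos)
  have dQ: "((\<lambda>z. Q z + \<epsilon>) has_derivative (\<lambda>u. 2 * chart_hess M c f y (V y) u)) (at y)"
    unfolding Q_def using gc(2) by (rule has_derivative_add_const)
  have "((\<lambda>t. t powr s) has_real_derivative s * (Q y + \<epsilon>) powr (s - 1)) (at (Q y + \<epsilon>))"
    using Qpos by (auto intro!: derivative_eq_intros)
  from has_derivative_compose[OF dQ this[unfolded has_field_derivative_def]]
  have dP: "((\<lambda>z. (Q z + \<epsilon>) powr s) has_derivative (\<lambda>u. s * (Q y + \<epsilon>) powr (s - 1) * (2 * chart_hess M c f y (V y) u))) (at y)"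
    by simp
  note dX = has_derivative_scaleR[OF dP dV]
  let ?P = "(Q y + \<epsilon>) powr s" and ?P1 = "s * (Q y + \<epsilon>) powr (s - 1)"
  let ?H = "chart_hess M c f y"
  note Hb = chart_hess_bilinear(2)[OF c U f]
  have Hlin: "linear (?H u)" for u using Hb by (simp add: bilinear_def)
  note bg = bilinear_ladd[OF bilinear_ginner] bilinear_lmul[OF bilinear_ginner]
  have "(\<Sum>i\<in>UNIV. ?H (V y) (X i) * ginner M c y (V y) (X i)) = ?H (V y) (\<Sum>i\<in>UNIV. ginner M c y (V y) (X i) *\<^sub>R X i)"
    by (simp add: linear_sum[OF Hlin] linear_scale[OF Hlin] mult.commute)
  also have "\<dots> = ?H (V y) (V y)" using onb_expand[OF c yc X, of "V y"] by simp
  finally have HV: "(\<Sum>i\<in>UNIV. ?H (V y) (X i) * ginner M c y (V y) (X i)) = ?H (V y) (V y)" .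
  have "ginner M c y (?P *\<^sub>R dir_deriv V y (X i) + (?P1 * (2 * ?H (V y) (X i))) *\<^sub>R V y
         + christoffel M c y (X i) (?P *\<^sub>R V y)) (X i)
      = ?P * ?H (X i) (X i) + 2 * ?P1 * (?H (V y) (X i) * ginner M c y (V y) (X i))" for i
    unfolding gc(1)[of "X i" "X i", symmetric] bilinear_rmul[OF bilinear_christoffel[OF c yc]] bg
    by (simp add: algebra_simps)
  then have "(\<Sum>i\<in>UNIV. ginner M c y (?P *\<^sub>R dir_deriv V y (X i) + (?P1 * (2 * ?H (V y) (X i))) *\<^sub>R V y
         + christoffel M c y (X i) (?P *\<^sub>R V y)) (X i))
      = ?P * (\<Sum>i\<in>UNIV. ?H (X i) (X i)) + 2 * ?P1 * ?H (V y) (V y)"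
    by (simp add: sum.distrib HV flip: sum_distrib_left)
  then show ?thesis unfolding divergence_formula[OF c yc X dX] by simp
qed

section \<open>Uniform bounds over compact coordinate sets\<close>

lemma ginner_lower_bound:
  assumes c: "c \<in> atlas M" and K: "compact K" "K \<subseteq> cimg c"
  obtains \<kappa> where "\<kappa> > 0" "\<And>y v. y \<in> K \<Longrightarrow> \<kappa> * (norm v)\<^sup>2 \<le> ginner M c y v v"
proof (cases "K = {}")
  case True then show ?thesis by (intro that[of 1]) auto
next
  case False
  let ?S = "K \<times> sphere (0::real ^ 'm) 1"
  have "continuous_on ?S (\<lambda>p. ginner M c (fst p) (snd p) (snd p))"
  proof -
    let ?W = "cimg c \<times> (UNIV :: (real ^ 'm) set)"
    have W: "open ?W" by (intro open_Times atlasD(2)[OF c] open_UNIV)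
    have "ck_on 0 ?W (\<lambda>p. ginner M c (fst p) (snd p) (snd p))"
      by (rule ginner_compose_smooth[OF c W _ ck_on_bounded_linear[OF W bounded_linear_fst]
            ck_on_bounded_linear[OF W bounded_linear_snd] ck_on_bounded_linear[OF W bounded_linear_snd]]) auto
    then show ?thesis using K(2) by (auto intro: continuous_on_subset)
  qed
  moreover have "compact ?S" by (intro compact_Times K compact_sphere)
  moreover have "?S \<noteq> {}" using False by (auto intro!: exI[of _ "axis undefined 1"])
  ultimately obtain p where p: "p \<in> ?S" "\<And>p'. p' \<in> ?S \<Longrightarrow> ginner M c (fst p) (snd p) (snd p) \<le> ginner M c (fst p') (snd p') (snd p')"
    using continuous_attains_inf[of ?S] by blast
  let ?\<kappa> = "ginner M c (fst p) (snd p) (snd p)"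
  have "?\<kappa> > 0" by (rule ginner_pos[OF c]) (use p K in auto)
  moreover have "?\<kappa> * (norm v)\<^sup>2 \<le> ginner M c y v v" if "y \<in> K" for y v
  proof (cases "v = 0")
    case True then show ?thesis by (simp add: bilinear_lzero[OF bilinear_ginner])
  next
    case v: False
    have "?\<kappa> \<le> ginner M c y ((1 / norm v) *\<^sub>R v) ((1 / norm v) *\<^sub>R v)"
      using p(2)[of "(y, (1 / norm v) *\<^sub>R v)"] that v by simp
    then have "?\<kappa> * (norm v)\<^sup>2 \<le> ginner M c y ((1 / norm v) *\<^sub>R v) ((1 / norm v) *\<^sub>R v) * (norm v)\<^sup>2"
      by (rule mult_right_mono) simp
    then show ?thesis using v
      by (simp add: bilinear_lmul[OF bilinear_ginner] bilinear_rmul[OF bilinear_ginner] power2_eq_square)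
  qed
  ultimately show ?thesis by (rule that)
qed

text \<open>Needed because the exponent s - 1 may be negative: applied to the gradient, the bound by
  |\<nabla>f|^2 restores the missing power, so the regularised divergence stays bounded as
  \<epsilon> tends to 0.\<close>

lemma hess_quadratic_bound:
  assumes c: "c \<in> atlas M" and f: "ck_on 2 (cimg c) f" and K: "compact K" "K \<subseteq> cimg c"
  obtains C where "C \<ge> 0" "\<And>y v. y \<in> K \<Longrightarrow> \<bar>chart_hess M c f y v v\<bar> \<le> C * ginner M c y v v"
proof -
  note U = atlasD(2)[OF c]
  have f2: "ck_on (Suc (Suc 0)) (cimg c) f" using f by (simp add: numeral_2_eq_2)
  obtain \<kappa> where \<kappa>: "\<kappa> > 0" "\<And>y v. y \<in> K \<Longrightarrow> \<kappa> * (norm v)\<^sup>2 \<le> ginner M c y v v"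
    by (rule ginner_lower_bound[OF c K]) (rule that)
  have df: "(f has_derivative dir_deriv f z) (at z)" if "z \<in> cimg c" for z
    by (rule ck_on_has_derivative[OF U f2 that])
  have conth: "continuous_on (cimg c) (\<lambda>y. chart_hess M c f y i j)" for i j
  proof -
    have "ck_on 0 (cimg c) (\<lambda>y. \<Sum>b\<in>Basis. (christoffel M c y i j \<bullet> b) *\<^sub>R dir_deriv f y b)"
      by (intro ck_on_sum ck_on_scaleR ck_on_inner ck_on_const U christoffel_smooth[OF c]
          ck_on_le[OF ck_on_dir_deriv[OF U f2]]) simp
    then have "ck_on 0 (cimg c) (\<lambda>y. dir_deriv f y (christoffel M c y i j))"
      by (rule ck_on_cong[OF U, rotated])
        (rule bounded_linear_euclid_sum[OF has_derivative_bounded_linear[OF df], symmetric])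
    then have "ck_on 0 (cimg c) (\<lambda>y. chart_hess M c f y i j)"
      unfolding chart_hess_def by (intro ck_on_diff U ck_on_dir_deriv[OF U ck_on_dir_deriv[OF U f2]])
    then show ?thesis by simp
  qed
  define S where "S y = (\<Sum>i\<in>Basis. \<Sum>j\<in>Basis. \<bar>chart_hess M c f y i j\<bar>)" for y
  have "continuous_on K S" unfolding S_def
    by (intro continuous_on_sum continuous_on_rabs continuous_on_subset[OF conth K(2)])
  then have "compact (S ` K)" by (intro compact_continuous_image K(1))
  then obtain B where B: "\<And>y. y \<in> K \<Longrightarrow> norm (S y) \<le> B" using compact_imp_bounded bounded_iff by (metis imageI)
  have bound: "\<bar>chart_hess M c f y v v\<bar> \<le> (max B 0 / \<kappa>) * ginner M c y v v" if y: "y \<in> K" for y v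
  proof -
    let ?H = "chart_hess M c f y"
    have yc: "y \<in> cimg c" using y K by blast
    note Hb = chart_hess_bilinear(2)[OF c U order_refl yc f]
    have "?H v v = ?H (\<Sum>i\<in>Basis. (v \<bullet> i) *\<^sub>R i) (\<Sum>j\<in>Basis. (v \<bullet> j) *\<^sub>R j)" by (simp add: euclidean_representation)
    also have "\<dots> = (\<Sum>i\<in>Basis. \<Sum>j\<in>Basis. (v \<bullet> i) * (v \<bullet> j) * ?H i j)"
      by (subst bilinear_sum[OF Hb]) (simp add: sum.cartesian_product bilinear_lmul[OF Hb] bilinear_rmul[OF Hb] mult_ac)
    also have "\<bar>\<dots>\<bar> \<le> (\<Sum>i\<in>Basis. \<Sum>j\<in>Basis. (norm v)\<^sup>2 * \<bar>?H i j\<bar>)"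
    proof (intro order_trans[OF sum_abs] sum_mono)
      fix i j :: "real ^ 'm" assume "i \<in> Basis" "j \<in> Basis"
      then have "\<bar>v \<bullet> i\<bar> * \<bar>v \<bullet> j\<bar> \<le> norm v * norm v" by (intro mult_mono Basis_le_norm) auto
      then show "\<bar>(v \<bullet> i) * (v \<bullet> j) * ?H i j\<bar> \<le> (norm v)\<^sup>2 * \<bar>?H i j\<bar>"
        unfolding abs_mult power2_eq_square by (rule mult_right_mono) simp
    qed
    also have "\<dots> = (norm v)\<^sup>2 * S y" by (simp add: S_def sum_distrib_left)
    also have "\<dots> \<le> (norm v)\<^sup>2 * max B 0" using B[OF y] by (intro mult_left_mono) auto
    also have "\<dots> = (max B 0 / \<kappa>) * (\<kappa> * (norm v)\<^sup>2)" using \<kappa>(1) by simp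
    also have "\<dots> \<le> (max B 0 / \<kappa>) * ginner M c y v v" using \<kappa> y by (intro mult_left_mono) auto
    finally show ?thesis .
  qed
  show ?thesis by (rule that[OF _ bound]) (use \<kappa> in auto)
qed


lemma chart_weak_inequality:
  assumes c: "c \<in> atlas M" and f: "ck_on 2 (cimg c) f" and p: "p \<ge> 2"
    and sub: "\<And>y. y \<in> cimg c \<Longrightarrow> p_subharmonic_at p c f y"
    and \<eta>: "ck_on 1 (cimg c) \<eta>" "\<And>y. y \<in> cimg c \<Longrightarrow> \<eta> y \<ge> 0"
    and K: "compact K" "K \<subseteq> cimg c" "\<And>y. y \<in> cimg c \<Longrightarrow> y \<notin> K \<Longrightarrow> \<eta> y = 0"
  defines "V \<equiv> chart_grad M c f"
  defines "Q \<equiv> \<lambda>z. ginner M c z (V z) (V z)"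
  defines "I \<equiv> \<lambda>y. indicator K y * (vol_density c y * (flux_weight p (Q y) * dir_deriv \<eta> y (V y)))"
  shows "integrable lborel I" "(LINT y|lborel. I y) \<le> 0"
proof -
  define s where "s = (p - 2) / 2"
  have s: "s \<ge> 0" using p by (simp add: s_def)
  note U = atlasD(2)[OF c]
  have f2: "ck_on (Suc (Suc 0)) (cimg c) f" using f by (simp add: numeral_2_eq_2)
  have \<eta>1: "ck_on (Suc 0) (cimg c) \<eta>" using \<eta> by simp
  have V: "ck_on 1 (cimg c) V" unfolding V_def using chart_grad_smooth[OF c U order_refl f2] by simp
  have Q: "ck_on 1 (cimg c) Q" unfolding Q_def by (rule ginner_compose_smooth[OF c U _ ck_on_id[OF U] V V]) simp
  have Qnn: "Q y \<ge> 0" if "y \<in> cimg c" for y unfolding Q_def by (rule ginner_nonneg[OF c that])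
  have dens: "ck_on k (cimg c) (vol_density c)" for k by (rule vol_density_smooth[OF c])
  have d\<eta>: "(\<eta> has_derivative dir_deriv \<eta> y) (at y)" if "y \<in> cimg c" for y
    by (rule ck_on_has_derivative[OF U \<eta>1 that])
  define X where "X y = (SOME X. onb c y X)" for y
  have X: "onb c y (X y)" if "y \<in> cimg c" for y unfolding X_def by (rule someI_ex[OF onb_exists[OF c that]])
  define A where "A y = (\<Sum>i\<in>UNIV. chart_hess M c f y (X y i) (X y i))" for y
  define B where "B y = chart_hess M c f y (V y) (V y)" for y
  \<comment> \<open>A sequence, as dominated convergence requires; \<epsilon> \<le> 1 makes the
    bounds below independent of n.\<close>
  define \<epsilon> where "\<epsilon> n = 1 / real (Suc n)" for n
  have \<epsilon>: "\<epsilon> n > 0" "\<epsilon> n \<le> 1" for n by (simp_all add: \<epsilon>_def)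
  have \<epsilon>0: "\<epsilon> \<longlonglongrightarrow> 0" unfolding \<epsilon>_def using LIMSEQ_inverse_real_of_nat by (simp add: inverse_eq_divide)
  define P where "P n y = (Q y + \<epsilon> n) powr s" for n y
  define E where "E y = dir_deriv \<eta> y (V y)" for y
  define D where "D n y = P n y * A y + 2 * s * (Q y + \<epsilon> n) powr (s - 1) * B y" for n y
  \<comment> \<open>By the product rule \<open>a n\<close> and \<open>b n\<close> together form the
    divergence of \<eta> times the flux: \<open>a n\<close> holds the derivative of \<eta>,
    \<open>b n\<close> the divergence of the flux.\<close>
  define a where "a n y = indicator K y * (vol_density c y * (P n y * E y))" for n y
  define b where "b n y = indicator K y * (vol_density c y * \<eta> y * D n y)" for n y
  have Ppos: "Q y + \<epsilon> n > 0" if "y \<in> cimg c" for n y using Qnn[OF that] \<epsilon>(1)[of n] by simp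
  have P: "ck_on 1 (cimg c) (P n)" for n
    unfolding P_def by (intro ck_on_powr ck_on_add ck_on_const U Q Ppos)
  have div: "(\<Sum>k\<in>UNIV. dir_deriv (\<lambda>z. vol_density c z * (P n z *\<^sub>R V z) $ k) y (axis k 1)) = vol_density c y * D n y"
    if "y \<in> cimg c" for n y
    unfolding P_def D_def A_def B_def Q_def V_def
    by (rule regularised_divergence[OF c U order_refl that f X[OF that] \<epsilon>(1)])
  have KO: "open (- K)" by (rule open_Compl[OF compact_imp_closed[OF K(1)]])
  \<comment> \<open>The flux exists only on the chart image. Because \<eta> vanishes off
    \<open>K\<close>, the product extends by 0 to a C^1 function on the whole coordinate
    space.\<close>
  define W where "W n k y = (if y \<in> cimg c then \<eta> y * (vol_density c y * (P n y *\<^sub>R V y) $ k) else 0)" for n k y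
  have Y: "ck_on 1 (cimg c) (\<lambda>y. vol_density c y * (P n y *\<^sub>R V y) $ k)" for n k
    by (intro ck_on_mult ck_on_vec_nth ck_on_scaleR U dens P V)
  have W0: "W n k y = 0" if "y \<notin> K" for n k y using that K(3) by (simp add: W_def)
  have W: "ck_on 1 UNIV (W n k)" for n k
  proof (rule ck_on_local[OF open_UNIV])
    fix y :: "real ^ 'm"
    show "\<exists>V. open V \<and> y \<in> V \<and> V \<subseteq> UNIV \<and> ck_on 1 V (W n k)"
    proof (cases "y \<in> cimg c")
      case True
      have "ck_on 1 (cimg c) (W n k)"
        by (rule ck_on_cong[OF U _ ck_on_mult[OF U \<eta>(1) Y[of n k]]]) (simp add: W_def)
      then show ?thesis using U True by blast
    next
      case False
      have "ck_on 1 (- K) (W n k)"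
        by (rule ck_on_cong[OF KO _ ck_on_const[OF KO]]) (simp add: W0)
      then show ?thesis using KO False K(2) by blast
    qed
  qed
  note parts = integral_dir_deriv_compact_support[OF W K(1) W0]
  have sumW: "(\<Sum>k\<in>UNIV. dir_deriv (W n k) y (axis k 1)) = a n y + b n y" for n y
  proof (cases "y \<in> K")
    case False
    have "dir_deriv (W n k) y = dir_deriv (\<lambda>_. 0) y" for k
      by (rule dir_deriv_cong_open[OF KO]) (use False W0 in auto)
    then show ?thesis using False by (simp add: a_def b_def)
  next
    case True
    then have y: "y \<in> cimg c" using K by blast
    let ?Y = "\<lambda>k z. vol_density c z * (P n z *\<^sub>R V z) $ k"
    have "dir_deriv (W n k) y v = \<eta> y * dir_deriv (?Y k) y v + dir_deriv \<eta> y v * ?Y k y" for k v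
    proof -
      have "dir_deriv (W n k) y = dir_deriv (\<lambda>y. \<eta> y * ?Y k y) y"
        by (rule dir_deriv_cong_open[OF U y]) (simp add: W_def)
      moreover have "ck_on (Suc 0) (cimg c) (?Y k)" using Y by simp
      from has_derivative_mult[OF d\<eta>[OF y] ck_on_has_derivative[OF U this y]]
      have "dir_deriv (\<lambda>y. \<eta> y * ?Y k y) y = (\<lambda>v. \<eta> y * dir_deriv (?Y k) y v + dir_deriv \<eta> y v * ?Y k y)"
        by (rule dir_deriv_eq)
      ultimately show ?thesis by simp
    qed
    then have "(\<Sum>k\<in>UNIV. dir_deriv (W n k) y (axis k 1)) =
       \<eta> y * (\<Sum>k\<in>UNIV. dir_deriv (?Y k) y (axis k 1)) + vol_density c y * P n y * (\<Sum>k\<in>UNIV. (V y $ k) *\<^sub>R dir_deriv \<eta> y (axis k 1))"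
      by (simp add: sum.distrib sum_distrib_left algebra_simps)
    also have "(\<Sum>k\<in>UNIV. (V y $ k) *\<^sub>R dir_deriv \<eta> y (axis k 1)) = E y"
      unfolding E_def by (rule linear_axis_expand[OF has_derivative_linear[OF d\<eta>[OF y]], symmetric])
    finally show ?thesis using True unfolding div[OF y] by (simp add: a_def b_def algebra_simps)
  qed
  have Econt: "continuous_on K E"
  proof -
    have "ck_on 0 (cimg c) (\<lambda>y. \<Sum>b\<in>Basis. (V y \<bullet> b) *\<^sub>R dir_deriv \<eta> y b)"
      by (intro ck_on_sum ck_on_scaleR ck_on_inner ck_on_const U ck_on_le[OF V] ck_on_dir_deriv[OF U \<eta>1]) simp
    then have "ck_on 0 (cimg c) E"
      unfolding E_def by (rule ck_on_cong[OF U, rotated])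
        (rule bounded_linear_euclid_sum[OF has_derivative_bounded_linear[OF d\<eta>], symmetric])
    then show ?thesis using K(2) continuous_on_subset by auto
  qed
  have contK: "continuous_on K F" if "ck_on k (cimg c) F" for F :: "real ^ 'm \<Rightarrow> real" and k
    using ck_on_continuous[OF that] K(2) by (rule continuous_on_subset)
  have inta: "integrable lborel (a n)" for n
    unfolding a_def by (intro integrable_compact_support K(1) continuous_on_mult contK[OF dens] contK[OF P] Econt)
  have intT: "integrable lborel (\<lambda>y. a n y + b n y)" "(LINT y|lborel. a n y + b n y) = 0" for n
    using parts unfolding sumW[symmetric] by (simp_all add: Bochner_Integration.integral_sum)
  have intb: "integrable lborel (b n)" for n
    using Bochner_Integration.integrable_diff[OF intT(1)[of n] inta[of n]] by simp
  have ab: "(LINT y|lborel. a n y) = - (LINT y|lborel. b n y)" for n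
    using intT(2)[of n] inta intb by simp
  obtain HC where HC: "HC \<ge> 0" "\<And>y. y \<in> K \<Longrightarrow> \<bar>B y\<bar> \<le> HC * Q y"
    unfolding B_def Q_def using hess_quadratic_bound[OF c f K(1,2)] by metis
  \<comment> \<open>The frames \<open>X y\<close> are chosen pointwise without any continuity. The
    trace is nevertheless continuous, since it is the divergence of the gradient: the exponent 0
    case of the regularised formula with \<epsilon> = 1.\<close>
  have Acont: "continuous_on K A"
  proof -
    have "ck_on 1 (cimg c) (\<lambda>z. vol_density c z * V z $ k)" for k
      by (intro ck_on_mult ck_on_vec_nth U dens V)
    then have w: "ck_on (Suc 0) (cimg c) (\<lambda>z. vol_density c z * V z $ k)" for k by simp
    have nz: "vol_density c y \<noteq> 0" if "y \<in> cimg c" for y using vol_density_pos[OF c that] by simp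
    have "ck_on 0 (cimg c) (\<lambda>y. (\<Sum>k\<in>UNIV. dir_deriv (\<lambda>z. vol_density c z * V z $ k) y (axis k 1)) / vol_density c y)"
      by (intro ck_on_divide ck_on_sum U ck_on_dir_deriv[OF U w] dens nz)
    moreover have "(\<Sum>k\<in>UNIV. dir_deriv (\<lambda>z. vol_density c z * V z $ k) y (axis k 1)) / vol_density c y = A y" if y: "y \<in> cimg c" for y
    proof -
      have "dir_deriv (\<lambda>z. vol_density c z * V z $ k) y = dir_deriv (\<lambda>z. vol_density c z * ((Q z + 1) powr 0 *\<^sub>R V z) $ k) y" for k
        by (rule dir_deriv_cong_open[OF U y]) (use Qnn in \<open>simp add: add_nonneg_eq_0_iff\<close>)
      then show ?thesis
        using regularised_divergence[OF c U order_refl y f X[OF y], of 1 0] vol_density_pos[OF c y]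
          Qnn[OF y] by (simp add: A_def Q_def V_def add_nonneg_eq_0_iff)
    qed
    ultimately have "ck_on 0 (cimg c) A" by (intro ck_on_cong[OF U, of _ A]) auto
    then show ?thesis by (rule contK)
  qed
  have bdd: "\<exists>C. C \<ge> 0 \<and> (\<forall>y\<in>K. \<bar>F y\<bar> \<le> C)" if "continuous_on K F" for F :: "real ^ 'm \<Rightarrow> real"
  proof -
    have "compact (F ` K)" by (rule compact_continuous_image[OF that K(1)])
    then obtain C where C: "\<And>y. y \<in> K \<Longrightarrow> norm (F y) \<le> C" using compact_imp_bounded bounded_iff by (metis imageI)
    have "\<bar>F y\<bar> \<le> max C 0" if "y \<in> K" for y using C[OF that] by simp
    then show ?thesis by (intro exI[of _ "max C 0"]) simp
  qed
  obtain C1 where C1: "C1 \<ge> 0" "\<And>y. y \<in> K \<Longrightarrow> \<bar>vol_density c y\<bar> \<le> C1" using bdd[OF contK[OF dens]] by blast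
  obtain C2 where C2: "C2 \<ge> 0" "\<And>y. y \<in> K \<Longrightarrow> \<bar>Q y\<bar> \<le> C2" using bdd[OF contK[OF Q]] by blast
  obtain C3 where C3: "C3 \<ge> 0" "\<And>y. y \<in> K \<Longrightarrow> \<bar>E y\<bar> \<le> C3" using bdd[OF Econt] by blast
  obtain C4 where C4: "C4 \<ge> 0" "\<And>y. y \<in> K \<Longrightarrow> \<bar>\<eta> y\<bar> \<le> C4" using bdd[OF contK[OF \<eta>(1)]] by blast
  obtain C5 where C5: "C5 \<ge> 0" "\<And>y. y \<in> K \<Longrightarrow> \<bar>A y\<bar> \<le> C5" using bdd[OF Acont] by blast
  have Pb: "0 \<le> P n y" "P n y \<le> (C2 + 1) powr s" if "y \<in> K" for n y
    unfolding P_def using C2(2)[OF that] \<epsilon>[of n] Qnn[of y] K(2) that s by (auto intro!: powr_mono2)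
  \<comment> \<open>Here the bound |B| \<le> HC Q turns (Q + \<epsilon>)^(s-1) |B| into at most HC
    (Q + \<epsilon>)^s, uniformly in n even for s < 1.\<close>
  have Db: "\<bar>D n y\<bar> \<le> (C2 + 1) powr s * (C5 + 2 * s * HC)" if y: "y \<in> K" for n y
  proof -
    have yc: "y \<in> cimg c" using y K by blast
    have "(Q y + \<epsilon> n) powr (s - 1) * \<bar>B y\<bar> \<le> (Q y + \<epsilon> n) powr (s - 1) * (HC * (Q y + \<epsilon> n))"
    proof (rule mult_left_mono)
      have "HC * Q y \<le> HC * (Q y + \<epsilon> n)" using HC(1) \<epsilon>(1)[of n] by (intro mult_left_mono) auto
      then show "\<bar>B y\<bar> \<le> HC * (Q y + \<epsilon> n)" using HC(2)[OF y] by linarith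
    qed simp
    also have "\<dots> = HC * P n y" using Ppos[OF yc, of n] unfolding P_def
      by (simp add: powr_diff)
    finally have "(Q y + \<epsilon> n) powr (s - 1) * \<bar>B y\<bar> \<le> HC * P n y" .
    then have "2 * s * ((Q y + \<epsilon> n) powr (s - 1) * \<bar>B y\<bar>) \<le> 2 * s * (HC * P n y)"
      using s by (intro mult_left_mono) auto
    moreover have "P n y * \<bar>A y\<bar> \<le> P n y * C5" using C5(2)[OF y] Pb[OF y] by (intro mult_left_mono) auto
    moreover have "\<bar>D n y\<bar> \<le> P n y * \<bar>A y\<bar> + 2 * s * ((Q y + \<epsilon> n) powr (s - 1) * \<bar>B y\<bar>)"
      unfolding D_def using Pb(1)[OF y, of n] s
      by (intro order_trans[OF abs_triangle_ineq]) (simp add: abs_mult)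
    ultimately have "\<bar>D n y\<bar> \<le> P n y * (C5 + 2 * s * HC)" by (simp add: algebra_simps)
    also have "\<dots> \<le> (C2 + 1) powr s * (C5 + 2 * s * HC)"
      using Pb[OF y] C5 HC s by (intro mult_right_mono) auto
    finally show ?thesis .
  qed
  \<comment> \<open>The pointwise limit of the regularised p-Laplacian. At a critical point the
    Hessian term is 0 for every n, and the rest tends to 0 if p > 2 and stays equal to the Laplacian
    if p = 2.\<close>
  define D0 where "D0 y = (if Q y > 0 then Q y powr s * A y + 2 * s * Q y powr (s - 1) * B y else if s = 0 then A y else 0)" for y
  have Q0: "V y = 0" if "y \<in> cimg c" "\<not> Q y > 0" for y
    using ginner_pos[OF c that(1), of "V y"] that(2) unfolding Q_def by blast
  have Qeps: "(\<lambda>n. Q y + \<epsilon> n) \<longlonglongrightarrow> Q y" for y using tendsto_add[OF tendsto_const \<epsilon>0] by simp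
  have Dlim: "(\<lambda>n. D n y) \<longlonglongrightarrow> D0 y" if y: "y \<in> cimg c" for y
  proof (cases "Q y > 0")
    case True
    have "(\<lambda>n. (Q y + \<epsilon> n) powr r) \<longlonglongrightarrow> Q y powr r" for r
      by (rule tendsto_powr[OF Qeps tendsto_const]) (use True in simp)
    then show ?thesis unfolding D_def P_def D0_def using True by (auto intro!: tendsto_add tendsto_mult tendsto_const)
  next
    case False
    have "B y = 0" using Q0[OF y False] bilinear_lzero[OF chart_hess_bilinear(2)[OF c U order_refl y f]] by (simp add: B_def)
    then have D: "D n y = P n y * A y" for n by (simp add: D_def)
    have Qy: "Q y = 0" using False Qnn[OF y] by simp
    show ?thesis
    proof (cases "s = 0")
      case True
      have "P n y = 1" for n using Ppos[OF y, of n] True by (simp add: P_def)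
      then show ?thesis unfolding D D0_def using True False by simp
    next
      case s0: False
      have "(\<lambda>n. P n y) \<longlonglongrightarrow> 0 powr s"
        unfolding P_def Qy using \<epsilon>0 s s0 \<epsilon>(1)
        by (intro tendsto_powr'[where b=s]) (auto intro!: always_eventually less_imp_le)
      then have "(\<lambda>n. P n y) \<longlonglongrightarrow> 0" by simp
      from tendsto_mult_right[OF this, of "A y"] show ?thesis unfolding D D0_def using False s0 by simp
    qed
  qed
  have D0nn: "D0 y \<ge> 0" if y: "y \<in> cimg c" for y
  proof -
    have sub': "(p = 2 \<longrightarrow> Q y = 0 \<longrightarrow> A y \<ge> 0) \<and> (Q y > 0 \<longrightarrow> Q y * A y + (p - 2) * B y \<ge> 0)"
      using sub[OF y] X[OF y] unfolding p_subharmonic_at_def Let_def A_def B_def Q_def V_def by blast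
    show ?thesis
    proof (cases "Q y > 0")
      case True
      have "Q y powr s * A y + 2 * s * Q y powr (s - 1) * B y = Q y powr (s - 1) * (Q y * A y + (p - 2) * B y)"
      proof -
        have "Q y powr s = Q y * Q y powr (s - 1)" using powr_mult_base[of "Q y" "s - 1"] True by simp
        moreover have "p - 2 = 2 * s" by (simp add: s_def)
        ultimately show ?thesis by (simp only:) (simp add: algebra_simps)
      qed
      also have "\<dots> \<ge> 0" using sub' True by simp
      finally show ?thesis using True by (simp add: D0_def)
    next
      case False
      then show ?thesis using sub' Qnn[OF y] by (auto simp: D0_def s_def)
    qed
  qed
  define b0 where "b0 y = indicator K y * (vol_density c y * \<eta> y * D0 y)" for y
  have Plim: "(\<lambda>n. P n y) \<longlonglongrightarrow> flux_weight p (Q y)" if y: "y \<in> cimg c" for y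
  proof (cases "s = 0")
    case True
    have "P n y = 1" for n using Ppos[OF y, of n] True by (simp add: P_def)
    then show ?thesis using True by (simp add: flux_weight_def s_def)
  next
    case False
    then have "(\<lambda>n. P n y) \<longlonglongrightarrow> Q y powr s" unfolding P_def using Ppos[OF y] s
      by (intro tendsto_powr'[OF Qeps tendsto_const]) (auto intro!: always_eventually less_imp_le)
    then show ?thesis using False by (simp add: flux_weight_def s_def)
  qed
  have Kint: "integrable lborel (\<lambda>y. C * indicator K y :: real)" for C
    using integrable_compact_support[OF K(1) continuous_on_const, of C] by (simp add: mult.commute)
  have Im: "I \<in> borel_measurable lborel"
  proof (rule borel_measurable_LIMSEQ_real)
    show "(\<lambda>n. a n y) \<longlonglongrightarrow> I y" for y
      unfolding a_def I_def E_def using Plim K(2) by (cases "y \<in> K") (auto intro!: tendsto_intros)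
    show "a n \<in> borel_measurable lborel" for n using inta by (rule borel_measurable_integrable)
  qed
  have alim: "AE y in lborel. (\<lambda>n. a n y) \<longlonglongrightarrow> I y"
    unfolding a_def I_def E_def using Plim K(2) by (intro AE_I2) (auto intro!: tendsto_intros simp: indicator_def)
  have abound: "AE y in lborel. norm (a n y) \<le> (C1 * ((C2 + 1) powr s * C3)) * indicator K y" for n
  proof (rule AE_I2)
    fix y show "norm (a n y) \<le> (C1 * ((C2 + 1) powr s * C3)) * indicator K y"
    proof (cases "y \<in> K")
      case True
      have "\<bar>vol_density c y\<bar> * (\<bar>P n y\<bar> * \<bar>E y\<bar>) \<le> C1 * ((C2 + 1) powr s * C3)"
        using C1 C2 C3 Pb[OF True, of n] True by (intro mult_mono) auto
      then show ?thesis using True by (simp add: a_def abs_mult)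
    qed (simp add: a_def)
  qed
  note adom = integral_dominated_convergence[OF Im borel_measurable_integrable[OF inta] Kint alim abound]
    integrable_dominated_convergence[OF Im borel_measurable_integrable[OF inta] Kint alim abound]
  show "integrable lborel I" by (rule adom(2))
  have blim': "(\<lambda>n. b n y) \<longlonglongrightarrow> b0 y" for y
    unfolding b_def b0_def using Dlim K(2) by (cases "y \<in> K") (auto intro!: tendsto_intros)
  have b0m: "b0 \<in> borel_measurable lborel"
    by (rule borel_measurable_LIMSEQ_real[OF blim' borel_measurable_integrable[OF intb]])
  have bbound: "AE y in lborel. norm (b n y) \<le> (C1 * C4 * ((C2 + 1) powr s * (C5 + 2 * s * HC))) * indicator K y" for n
  proof (rule AE_I2)
    fix y show "norm (b n y) \<le> (C1 * C4 * ((C2 + 1) powr s * (C5 + 2 * s * HC))) * indicator K y"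
    proof (cases "y \<in> K")
      case True
      have "\<bar>vol_density c y\<bar> * \<bar>\<eta> y\<bar> * \<bar>D n y\<bar> \<le> C1 * C4 * ((C2 + 1) powr s * (C5 + 2 * s * HC))"
        using C1 C4 C5 HC s Db[OF True, of n] True by (intro mult_mono) auto
      then show ?thesis using True by (simp add: b_def abs_mult)
    qed (simp add: b_def)
  qed
  have bconv: "(\<lambda>n. LINT y|lborel. b n y) \<longlonglongrightarrow> (LINT y|lborel. b0 y)"
    by (rule integral_dominated_convergence[OF b0m borel_measurable_integrable[OF intb] Kint AE_I2[OF blim'] bbound])
  have "(\<lambda>n. LINT y|lborel. a n y) \<longlonglongrightarrow> - (LINT y|lborel. b0 y)" unfolding ab by (rule tendsto_minus[OF bconv])
  with adom(1) have "(LINT y|lborel. I y) = - (LINT y|lborel. b0 y)" by (rule LIMSEQ_unique)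
  moreover have "(LINT y|lborel. b0 y) \<ge> 0"
  proof (rule Bochner_Integration.integral_nonneg)
    fix y show "0 \<le> b0 y"
    proof (cases "y \<in> K")
      case True
      then have y: "y \<in> cimg c" using K(2) by blast
      show ?thesis using D0nn[OF y] \<eta>(2)[OF y] vol_density_pos[OF c y] by (simp add: b0_def)
    qed (simp add: b0_def)
  qed
  ultimately show "(LINT y|lborel. I y) \<le> 0" by simp
qed

end

section \<open>Change of variables for arbitrary finite index types\<close>

text \<open>The library proves the change of variables formula for well-ordered index types only; it is transferred
  along a well-ordered copy of the index type.\<close>

typedef 'm wo = "UNIV :: 'm set" morphisms unwo Wo by simp

lemma Wo_unwo [simp]: "Wo (unwo i) = i" "unwo (Wo j) = j"
  by (simp_all add: unwo_inverse Wo_inverse)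

lemma bij_Wo: "bij Wo"
  by (rule bij_betw_byWitness[of _ unwo]) auto

lemma bij_unwo: "bij unwo"
  by (rule bij_betw_byWitness[of _ Wo]) auto

instance wo :: (finite) finite
proof
  have "finite (range (Wo :: 'a \<Rightarrow> _))" by simp
  then show "finite (UNIV :: 'a wo set)" unfolding bij_is_surj[OF bij_Wo] .
qed

definition wo_index :: "'m::finite \<Rightarrow> nat" where
  "wo_index = (SOME f. inj f)"

lemma inj_wo_index: "inj (wo_index :: 'm::finite \<Rightarrow> nat)"
proof -
  obtain f :: "'m \<Rightarrow> nat" where "inj f"
    using finite_imp_inj_to_nat_seg[OF finite_class.finite_UNIV[where 'a = 'm]] by (elim exE conjE) (rule that)
  then show ?thesis unfolding wo_index_def by (rule someI[where P = inj])
qed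

instantiation wo :: (finite) wellorder
begin

definition less_eq_wo :: "'a wo \<Rightarrow> 'a wo \<Rightarrow> bool" where
  "less_eq_wo a b \<longleftrightarrow> wo_index (unwo a) \<le> wo_index (unwo b)"

definition less_wo :: "'a wo \<Rightarrow> 'a wo \<Rightarrow> bool" where
  "less_wo a b \<longleftrightarrow> wo_index (unwo a) < wo_index (unwo b)"

instance
proof
  fix a b :: "'a wo"
  assume "a \<le> b" "b \<le> a"
  then have "wo_index (unwo a) = wo_index (unwo b)" by (simp add: less_eq_wo_def)
  then show "a = b" by (metis inj_wo_index injD Wo_unwo(1))
next
  fix P :: "'a wo \<Rightarrow> bool" and a
  assume ind: "\<And>x. (\<And>y. y < x \<Longrightarrow> P y) \<Longrightarrow> P x"
  show "P a"
    by (induction a rule: measure_induct[of "\<lambda>a. wo_index (unwo a)"]) (rule ind, simp add: less_wo_def)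
qed (auto simp: less_eq_wo_def less_wo_def)

end

definition to_wo :: "real ^ 'm \<Rightarrow> real ^ 'm wo" where "to_wo v = (\<chi> i. v $ unwo i)"
definition of_wo :: "real ^ 'm wo \<Rightarrow> real ^ 'm" where "of_wo v = (\<chi> i. v $ Wo i)"

lemma to_of_wo [simp]: "to_wo (of_wo v) = v" "of_wo (to_wo u) = u"
  by (simp_all add: to_wo_def of_wo_def vec_eq_iff)

lemma linear_to_wo: "linear (to_wo :: real ^ 'm::finite \<Rightarrow> _)" and linear_of_wo: "linear (of_wo :: _ \<Rightarrow> real ^ 'm::finite)"
  by (auto intro!: linearI simp: to_wo_def of_wo_def vec_eq_iff)

lemma bounded_linear_to_wo: "bounded_linear (to_wo :: real ^ 'm::finite \<Rightarrow> _)"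
  and bounded_linear_of_wo: "bounded_linear (of_wo :: _ \<Rightarrow> real ^ 'm::finite)"
  using linear_to_wo linear_of_wo by (simp_all add: linear_conv_bounded_linear)

lemma measurable_to_wo [measurable]: "(to_wo :: real ^ 'm::finite \<Rightarrow> _) \<in> borel_measurable borel"
  and measurable_of_wo [measurable]: "(of_wo :: _ \<Rightarrow> real ^ 'm::finite) \<in> borel_measurable borel"
  by (intro borel_measurable_continuous_onI linear_continuous_on bounded_linear_to_wo bounded_linear_of_wo)+

lemma prod_Basis_vec: "(\<Prod>b\<in>Basis. (v :: real ^ 'm::finite) \<bullet> b) = (\<Prod>i\<in>UNIV. v $ i)"
proof -
  have B: "(Basis :: (real ^ 'm) set) = range (\<lambda>i. axis i 1)" by (auto simp: Basis_vec_def)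
  have "inj (\<lambda>i::'m. axis i (1::real))" by (auto simp: inj_on_def axis_eq_axis)
  then show ?thesis unfolding B by (simp add: prod.reindex inner_axis)
qed

text \<open>Lebesgue measure is determined by its values on boxes, and relabelling coordinates takes
  boxes to boxes with the same side lengths.\<close>

lemma distr_of_wo: "distr lborel borel (of_wo :: _ \<Rightarrow> real ^ 'm::finite) = lborel"
proof (rule lborel_eqI[symmetric])
  fix l u :: "real ^ 'm"
  assume lu: "\<And>b. b \<in> Basis \<Longrightarrow> l \<bullet> b \<le> u \<bullet> b"
  have le: "l $ i \<le> u $ i" for i 
  proof -
    have "axis i 1 \<in> (Basis :: (real ^ 'm) set)" by (auto simp: Basis_vec_def)
    from lu[OF this] show ?thesis by (simp add: inner_axis)
  qed
  have "of_wo -` box l u = box (to_wo l) (to_wo u)"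
    by (auto simp: mem_box_cart of_wo_def to_wo_def) (metis Wo_unwo)+
  then have "emeasure (distr lborel borel of_wo) (box l u) = emeasure lborel (box (to_wo l) (to_wo u))"
    by (simp add: emeasure_distr)
  also have "\<dots> = ennreal (\<Prod>i\<in>UNIV. (to_wo u - to_wo l) $ i)"
    unfolding prod_Basis_vec[symmetric] by (rule emeasure_lborel_box) (auto simp: Basis_vec_def inner_axis to_wo_def le)
  also have "(\<Prod>i\<in>UNIV. (to_wo u - to_wo l) $ i) = (\<Prod>i\<in>UNIV. (u - l) $ i)"
    using prod.reindex_bij_betw[OF bij_unwo, of "\<lambda>i. (u - l) $ i"] by (simp add: to_wo_def)
  finally show "emeasure (distr lborel borel of_wo) (box l u) = (\<Prod>b\<in>Basis. (u - l) \<bullet> b)" unfolding prod_Basis_vec .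
qed simp

lemma nn_integral_of_wo:
  fixes f :: "real ^ 'm::finite \<Rightarrow> ennreal"
  assumes "f \<in> borel_measurable borel"
  shows "(\<integral>\<^sup>+ z. f (of_wo z) \<partial>lborel) = (\<integral>\<^sup>+ y. f y \<partial>lborel)"
proof -
  have "(\<integral>\<^sup>+ y. f y \<partial>lborel) = (\<integral>\<^sup>+ y. f y \<partial>distr lborel borel of_wo)" by (simp add: distr_of_wo)
  also have "\<dots> = (\<integral>\<^sup>+ z. f (of_wo z) \<partial>lborel)" by (rule nn_integral_distr) (use assms in simp_all)
  finally show ?thesis ..
qed

text \<open>Conjugation by the bijection \<open>Wo\<close> maps permutations to permutations and
  preserves signs, so the two Leibniz sums agree term by term.\<close>

lemma det_wo:
  fixes A :: "real ^ 'm ^ 'm"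
  shows "det (\<chi> i j. A $ unwo i $ unwo j) = det A"
proof -
  let ?m = "map_permutation UNIV (Wo :: 'm \<Rightarrow> _)"
  have bW: "bij_betw (Wo :: 'm \<Rightarrow> _) UNIV UNIV" using bij_Wo .
  have "?m = (\<lambda>\<pi> x. if x \<in> UNIV then Wo (\<pi> (inv_into UNIV Wo x)) else x)"
    by (simp add: fun_eq_iff map_permutation_def bij_is_surj[OF bij_Wo] restrict_id_def)
  then have bm: "bij_betw ?m {p. p permutes UNIV} {p. p permutes UNIV}"
    using bij_betw_permutations[OF bW] by metis
  have ap: "unwo (?m p (Wo i)) = p i" for p i
    by (simp add: map_permutation_apply[OF bij_is_inj[OF bij_Wo] UNIV_I])
  have pr: "(\<Prod>i\<in>UNIV. A $ unwo i $ unwo (?m p i)) = (\<Prod>i\<in>UNIV. A $ i $ p i)" for p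
    using prod.reindex_bij_betw[OF bij_Wo, of "\<lambda>i. A $ unwo i $ unwo (?m p i)"] by (simp add: ap)
  have sg: "sign (?m p) = sign p" if "p permutes UNIV" for p
    by (rule sign_map_permutation) (use that bij_is_inj[OF bij_Wo] in simp_all)
  have "det (\<chi> i j. A $ unwo i $ unwo j) =
      (\<Sum>p\<in>{p. p permutes UNIV}. of_int (sign p) * (\<Prod>i\<in>UNIV. A $ unwo i $ unwo (p i)))" by (simp add: det_def)
  also have "\<dots> = (\<Sum>p\<in>{p. p permutes UNIV}. of_int (sign (?m p)) * (\<Prod>i\<in>UNIV. A $ unwo i $ unwo (?m p i)))"
    by (rule sum.reindex_bij_betw[OF bm, symmetric])
  also have "\<dots> = det A" by (simp add: det_def pr sg)
  finally show ?thesis .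
qed

lemma det_matrix_wo:
  fixes L :: "real ^ 'm \<Rightarrow> real ^ 'm"
  shows "det (matrix (\<lambda>z. to_wo (L (of_wo z)))) = det (matrix L)"
proof -
  have "of_wo (axis j 1) = (axis (unwo j) 1 :: real ^ 'm)" for j
    by (auto simp: of_wo_def axis_def vec_eq_iff)
  note ax = this
  have "matrix (\<lambda>z. to_wo (L (of_wo z))) = (\<chi> i j. matrix L $ unwo i $ unwo j)"
    by (simp add: matrix_def vec_eq_iff to_wo_def ax)
  then show ?thesis by (simp add: det_wo)
qed

lemma nn_integral_change_of_variables_wellorder:
  fixes g :: "real ^ 'm::{finite,wellorder} \<Rightarrow> real ^ 'm::_"
  assumes S: "S \<in> sets lebesgue" and der: "\<And>x. x \<in> S \<Longrightarrow> (g has_derivative g' x) (at x within S)"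
    and inj: "inj_on g S" and f: "\<And>y. y \<in> g ` S \<Longrightarrow> 0 \<le> f y"
    and int: "(\<lambda>x. \<bar>det (matrix (g' x))\<bar> * f (g x)) absolutely_integrable_on S"
  shows "(\<integral>\<^sup>+ y. ennreal (f y) * indicator (g ` S) y \<partial>lborel) =
    (\<integral>\<^sup>+ x. ennreal (\<bar>det (matrix (g' x))\<bar> * f (g x)) * indicator S x \<partial>lborel)"
proof -
  let ?D = "\<lambda>x. \<bar>det (matrix (g' x))\<bar> * f (g x)"
  \<comment> \<open>The vector-valued formula is applied with values in the one-dimensional space
    \<open>real ^ 1\<close>.\<close>
  define F :: "real ^ 'm::_ \<Rightarrow> real ^ 1" where "F y = vec (f y)" for y
  have D: "(\<lambda>x. \<bar>det (matrix (g' x))\<bar> *\<^sub>R F (g x)) = (\<lambda>x. vec (?D x))"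
    by (simp add: fun_eq_iff vec_eq_iff F_def)
  have i: "(\<lambda>x. \<bar>det (matrix (g' x))\<bar> *\<^sub>R F (g x)) absolutely_integrable_on S"
    unfolding D absolutely_integrable_on_1_iff using int by simp
  have e: "integral S (\<lambda>x. \<bar>det (matrix (g' x))\<bar> *\<^sub>R F (g x)) = vec (integral S ?D)"
    unfolding D by (subst integral_on_1_eq) simp
  have "F absolutely_integrable_on g ` S \<and> integral (g ` S) F = vec (integral S ?D)"
    using has_absolute_integral_change_of_variables[OF S der inj, of F "vec (integral S ?D)"] i e by blast
  then have fi: "f absolutely_integrable_on g ` S" and eq: "integral (g ` S) f = integral S ?D"
    unfolding absolutely_integrable_on_1_iff[of _ F] integral_on_1_eq[of _ F] by (simp_all add: F_def vec_eq_iff)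
  have hf: "(f has_integral integral S ?D) (g ` S)"
    using integrable_integral[OF set_lebesgue_integral_eq_integral(1)[OF fi]] unfolding eq .
  have hD: "(?D has_integral integral S ?D) S"
    by (rule integrable_integral[OF set_lebesgue_integral_eq_integral(1)[OF int]])
  have "(\<integral>\<^sup>+ y. ennreal (f y) * indicator (g ` S) y \<partial>lborel) = ennreal (integral S ?D)"
    by (rule nn_integral_has_integral_lebesgue'[OF _ hf]) (rule f)
  also have "\<dots> = (\<integral>\<^sup>+ x. ennreal (\<bar>det (matrix (g' x))\<bar> * f (g x)) * indicator S x \<partial>lborel)"
    by (rule nn_integral_has_integral_lebesgue'[OF _ hD, symmetric]) (use f in simp)
  finally show ?thesis .
qed

text \<open>The product of the Jacobian and \<open>f\<close> is supplied under the name
  \<open>D\<close>, so that integrability is checked for a function of known regularity. In the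
  application \<open>D\<close> is the volume density of the source chart.\<close>

lemma nn_integral_change_of_variables:
  fixes g :: "real ^ 'm::finite \<Rightarrow> real ^ 'm::_" and f D :: "real ^ 'm::_ \<Rightarrow> real"
  assumes S: "S \<in> sets borel" and der: "\<And>x. x \<in> S \<Longrightarrow> (g has_derivative g' x) (at x)"
    and inj: "inj_on g S" and f: "\<And>y. y \<in> g ` S \<Longrightarrow> 0 \<le> f y"
    and fm: "(\<lambda>y. ennreal (f y) * indicator (g ` S) y) \<in> borel_measurable borel"
    and D: "\<And>x. x \<in> S \<Longrightarrow> D x = \<bar>det (matrix (g' x))\<bar> * f (g x)"
    and int: "integrable lborel (\<lambda>x. indicator S x * D x)"
  shows "(\<integral>\<^sup>+ y. ennreal (f y) * indicator (g ` S) y \<partial>lborel) = (\<integral>\<^sup>+ x. ennreal (D x) * indicator S x \<partial>lborel)"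
proof -
  define T where "T = of_wo -` S"
  define G where "G z = to_wo (g (of_wo z))" for z
  define G' where "G' z e = to_wo (g' (of_wo z) (of_wo e))" for z e
  define F where "F z = f (of_wo z)" for z
  have T: "T \<in> sets borel" unfolding T_def using measurable_sets[OF measurable_of_wo S] by simp
  have GT: "G ` T = of_wo -` (g ` S)"
  proof (intro set_eqI iffI)
    fix z assume "z \<in> of_wo -` (g ` S)"
    then obtain x where "x \<in> S" "of_wo z = g x" by auto
    then have "z = G (to_wo x)" "to_wo x \<in> T" by (auto simp: G_def T_def) (metis to_of_wo(1))
    then show "z \<in> G ` T" by blast
  qed (auto simp: G_def T_def)
  have dG: "(G has_derivative G' z) (at z within T)" if "z \<in> T" for z
  proof -
    have "(g has_derivative g' (of_wo z)) (at (of_wo z))" by (rule der) (use that in \<open>simp add: T_def\<close>)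
    from has_derivative_compose[OF bounded_linear_imp_has_derivative[OF bounded_linear_of_wo] this]
    have "((\<lambda>z. g (of_wo z)) has_derivative (\<lambda>e. g' (of_wo z) (of_wo e))) (at z)" .
    from bounded_linear.has_derivative[OF bounded_linear_to_wo this]
    show ?thesis unfolding G_def[abs_def] G'_def[abs_def] by (rule has_derivative_at_withinI)
  qed
  have iG: "inj_on G T"
  proof (rule inj_onI)
    fix z z' assume z: "z \<in> T" "z' \<in> T" "G z = G z'"
    have "g (of_wo z) = g (of_wo z')" using arg_cong[OF z(3), of of_wo] by (simp add: G_def)
    then have "of_wo z = of_wo z'" by (rule inj_onD[OF inj]) (use z in \<open>simp_all add: T_def\<close>)
    from arg_cong[OF this, of to_wo] show "z = z'" by simp
  qed
  have det: "D (of_wo z) = \<bar>det (matrix (G' z))\<bar> * F (G z)" if "z \<in> T" for z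
    using D[of "of_wo z"] that det_matrix_wo[of "g' (of_wo z)"] unfolding T_def G'_def[abs_def] F_def G_def by simp
  have "integrable lborel (\<lambda>z. indicator S (of_wo z) * D (of_wo z))"
  proof -
    have "integrable (distr lborel borel of_wo) (\<lambda>x. indicator S x * D x)" using int by (simp add: distr_of_wo)
    then show ?thesis by (rule integrable_distr[rotated]) simp
  qed
  moreover have "(\<lambda>z. indicator T z *\<^sub>R (\<bar>det (matrix (G' z))\<bar> * F (G z))) = (\<lambda>z. indicator S (of_wo z) * D (of_wo z))"
  proof (rule ext)
    fix z show "indicator T z *\<^sub>R (\<bar>det (matrix (G' z))\<bar> * F (G z)) = indicator S (of_wo z) * D (of_wo z)"
      by (cases "z \<in> T") (use det[of z] in \<open>simp_all add: T_def\<close>)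
  qed
  ultimately have iT: "integrable lborel (\<lambda>z. indicator T z *\<^sub>R (\<bar>det (matrix (G' z))\<bar> * F (G z)))" by simp
  have "set_integrable lebesgue T (\<lambda>z. \<bar>det (matrix (G' z))\<bar> * F (G z))"
    unfolding set_integrable_def by (rule integrable_completion[OF borel_measurable_integrable[OF iT], THEN iffD2, OF iT])
  note sT = this
  have "(\<integral>\<^sup>+ y. ennreal (f y) * indicator (g ` S) y \<partial>lborel) = (\<integral>\<^sup>+ y. ennreal (F y) * indicator (G ` T) y \<partial>lborel)"
    unfolding nn_integral_of_wo[OF fm, symmetric] by (simp add: F_def GT indicator_def)
  also have "\<dots> =
      (\<integral>\<^sup>+ x. ennreal (\<bar>det (matrix (G' x))\<bar> * F (G x)) * indicator T x \<partial>lborel)"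
  proof (rule nn_integral_change_of_variables_wellorder[OF _ dG iG _ sT])
    show "T \<in> sets lebesgue" using T by (simp add: sets_completionI_sets)
    show "F z \<ge> 0" if "z \<in> G ` T" for z using f that unfolding GT F_def by simp
  qed
  also have "\<dots> = (\<integral>\<^sup>+ z. ennreal (D (of_wo z)) * indicator S (of_wo z) \<partial>lborel)"
  proof (rule nn_integral_cong)
    fix z show "ennreal (\<bar>det (matrix (G' z))\<bar> * F (G z)) * indicator T z = ennreal (D (of_wo z)) * indicator S (of_wo z)"
      by (cases "z \<in> T") (use det[of z] in \<open>simp_all add: T_def\<close>)
  qed
  also have "\<dots> = (\<integral>\<^sup>+ x. ennreal (D x) * indicator S x \<partial>lborel)"
  proof (rule nn_integral_of_wo)
    have "(\<lambda>x. ennreal (indicator S x * D x)) \<in> borel_measurable borel"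
      using borel_measurable_integrable[OF int] by simp
    moreover have "(\<lambda>x. ennreal (indicator S x * D x)) = (\<lambda>x. ennreal (D x) * indicator S x)"
      by (auto simp: indicator_def)
    ultimately show "(\<lambda>x. ennreal (D x) * indicator S x) \<in> borel_measurable borel" by simp
  qed
  finally show ?thesis .
qed

section \<open>The Riemannian volume measure\<close>

lemma borel_vimage_open:
  fixes f :: "'a::topological_space \<Rightarrow> 'b::topological_space"
  assumes "continuous_on U f" "open U" "T \<in> sets borel"
  shows "f -` T \<inter> U \<in> sets borel"
proof -
  have "f -` T \<inter> space (restrict_space borel U) \<in> sets (restrict_space borel U)"
    by (rule measurable_sets[OF borel_measurable_continuous_on_restrict[OF assms(1)] assms(3)])
  then show ?thesis using assms(2) by (auto simp: sets_restrict_space_iff space_restrict_space)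
qed

lemma det_pullback_form:
  fixes L :: "real ^ 'm \<Rightarrow> real ^ 'm" and G H :: "real ^ 'm ^ 'm"
  assumes "linear L" and GH: "\<And>u v. u \<bullet> (G *v v) = L u \<bullet> (H *v L v)"
  shows "det G = (det (matrix L))\<^sup>2 * det H"
proof -
  define T where "T = matrix L"
  have L: "L v = T *v v" for v
    using matrix_works[of L v] assms(1) by (simp add: linear_matrix_vector_mul_eq T_def)
  have uv: "u \<bullet> (G *v v) = u \<bullet> ((transpose T ** H ** T) *v v)" for u v
  proof -
    have "u \<bullet> (G *v v) = (u v* transpose T) \<bullet> (H *v (T *v v))" 
      unfolding GH L vector_transpose_matrix ..
    also have "\<dots> = u \<bullet> (transpose T *v (H *v (T *v v)))" by (rule dot_lmul_matrix)
    finally show ?thesis by (simp only: matrix_vector_mul_assoc matrix_mul_assoc)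
  qed
  have "G *v v = (transpose T ** H ** T) *v v" for v
    by (rule vector_eq_ldot[THEN iffD1], rule allI, rule uv)
  then have "G = transpose T ** H ** T" by (simp add: matrix_eq)
  then show ?thesis by (simp add: det_mul det_transpose power2_eq_square T_def mult.commute mult.left_commute)
qed

context riemannian
begin

definition chart_measure :: "('a, 'm) chart \<Rightarrow> 'a measure" where
  "chart_measure c = distr (density (restrict_space lborel (cimg c)) (\<lambda>y. ennreal (vol_density c y))) borel (cinv c)"

lemma sets_chart_measure [simp]: "sets (chart_measure c) = sets borel" "space (chart_measure c) = UNIV"
  by (simp_all add: chart_measure_def)

lemma cinv_measurable:
  "c \<in> atlas M \<Longrightarrow> cinv c \<in> restrict_space lborel (cimg c) \<rightarrow>\<^sub>M borel"
  using borel_measurable_continuous_on_restrict[OF continuous_cinv[of c]]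
  by (simp add: measurable_def space_restrict_space sets_restrict_space)

lemma vol_density_measurable:
  "c \<in> atlas M \<Longrightarrow> vol_density c \<in> restrict_space lborel (cimg c) \<rightarrow>\<^sub>M borel"
  using borel_measurable_continuous_on_restrict[OF ck_on_continuous[OF vol_density_smooth[of c 0]]]
  by (simp add: measurable_def space_restrict_space sets_restrict_space)

lemma nn_integral_chart_measure:
  assumes "c \<in> atlas M" "F \<in> borel_measurable borel"
  shows "(\<integral>\<^sup>+ x. F x \<partial>chart_measure c) =
    (\<integral>\<^sup>+ y. ennreal (vol_density c y) * F (cinv c y) * indicator (cimg c) y \<partial>lborel)"
proof -
  note [measurable] = cinv_measurable[OF assms(1)] vol_density_measurable[OF assms(1)] assms(2)
  show ?thesis unfolding chart_measure_def
    by (subst nn_integral_distr, simp, simp, subst nn_integral_density, measurable)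
      (subst nn_integral_restrict_space, use atlasD(2)[OF assms(1)] in simp_all)
qed

lemma cmap_image_eq:
  assumes "c \<in> atlas M" "A \<subseteq> cdom c" shows "cmap c ` A = cinv c -` A \<inter> cimg c"
proof (intro set_eqI iffI)
  fix y assume "y \<in> cmap c ` A"
  then obtain x where "x \<in> A" "y = cmap c x" by blast
  then show "y \<in> cinv c -` A \<inter> cimg c" using assms cinv_cmap[OF assms(1), of x] cmap_in[of x c] by auto
next
  fix y assume "y \<in> cinv c -` A \<inter> cimg c"
  then show "y \<in> cmap c ` A" using cmap_cinv[OF assms(1), of y] by (metis IntE imageI vimageE)
qed

lemma cmap_image_borel:
  assumes "c \<in> atlas M" "A \<subseteq> cdom c" "A \<in> sets borel" shows "cmap c ` A \<in> sets borel"
  unfolding cmap_image_eq[OF assms(1,2)]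
  by (rule borel_vimage_open[OF continuous_cinv[OF assms(1)] atlasD(2)[OF assms(1)] assms(3)])

lemma emeasure_chart_measure:
  assumes "c \<in> atlas M" "A \<subseteq> cdom c" "A \<in> sets borel"
  shows "emeasure (chart_measure c) A = (\<integral>\<^sup>+ y. ennreal (vol_density c y) * indicator (cmap c ` A) y \<partial>lborel)"
proof -
  have "emeasure (chart_measure c) A = (\<integral>\<^sup>+ x. indicator A x \<partial>chart_measure c)"
    by (simp add: assms(3))
  also have "\<dots> = (\<integral>\<^sup>+ y. ennreal (vol_density c y) * indicator A (cinv c y) * indicator (cimg c) y \<partial>lborel)"
    by (rule nn_integral_chart_measure[OF assms(1)]) (use assms(3) in simp)
  also have "\<dots> = (\<integral>\<^sup>+ y. ennreal (vol_density c y) * indicator (cmap c ` A) y \<partial>lborel)"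
    unfolding cmap_image_eq[OF assms(1,2)] by (rule nn_integral_cong) (simp add: indicator_def)
  finally show ?thesis .
qed

lemma vol_density_transition:
  assumes "c \<in> atlas M" "d \<in> atlas M" "x \<in> cdom c" "x \<in> cdom d"
  shows "vol_density c (cmap c x) = \<bar>det (matrix (dir_deriv (cmap d \<circ> cinv c) (cmap c x)))\<bar> * vol_density d (cmap d x)"
proof -
  have lin: "linear (dir_deriv (cmap d \<circ> cinv c) (cmap c x))"
    by (rule bounded_linear.linear[OF has_derivative_bounded_linear[OF transition_has_derivative[OF assms]]])
  show ?thesis
    unfolding vol_density_def det_pullback_form[OF lin ginner_transition[OF assms, unfolded ginner_def]]
    by (simp add: real_sqrt_mult)
qed

text \<open>The change of variables asks for an integrable density, which a chart need not have.
  Hence \<open>A\<close> is exhausted by the sets on which coordinates and density of the first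
  chart are at most n; continuity of measures along this increasing sequence gives the claim for
  \<open>A\<close>.\<close>

lemma chart_measure_overlap:
  assumes c: "c \<in> atlas M" and d: "d \<in> atlas M" and A: "A \<subseteq> cdom c" "A \<subseteq> cdom d" "A \<in> sets borel"
  shows "emeasure (chart_measure c) A = emeasure (chart_measure d) A"
proof -
  define \<phi> where "\<phi> x = max (norm (cmap c x)) (vol_density c (cmap c x))" for x
  define B where "B n = A \<inter> (\<phi> -` {..real n} \<inter> cdom c)" for n :: nat
  have "continuous_on (cdom c) (\<lambda>x. vol_density c (cmap c x))"
    by (rule continuous_on_compose2[OF ck_on_continuous[OF vol_density_smooth[OF c, of 0]] continuous_cmap[OF c]])
      (auto simp: cimg_def)
  then have "continuous_on (cdom c) \<phi>" unfolding \<phi>_def[abs_def]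
    by (intro continuous_on_max continuous_on_norm continuous_cmap[OF c])
  from borel_vimage_open[OF this atlasD(1)[OF c]] have B: "B n \<in> sets borel" for n
    unfolding B_def by (rule sets.Int[OF A(3)]) simp
  have Bsub: "B n \<subseteq> cdom c" "B n \<subseteq> cdom d" for n using A by (auto simp: B_def)
  have inc: "incseq B"
  proof (rule incseq_SucI)
    fix n have "real n \<le> real (Suc n)" by simp
    then show "B n \<subseteq> B (Suc n)" unfolding B_def by (auto intro: order_trans)
  qed
  have un: "(\<Union>n. B n) = A"
  proof -
    have "\<exists>n. \<phi> x \<le> real n" for x by (rule real_arch_simple)
    then show ?thesis unfolding B_def using A(1) by auto
  qed
  have eq: "emeasure (chart_measure c) (B n) = emeasure (chart_measure d) (B n)" for n
  proof -
    let ?S = "cmap c ` B n" and ?\<tau> = "cmap d \<circ> cinv c"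
    have img: "?\<tau> ` ?S = cmap d ` B n"
    proof -
      have "?\<tau> ` ?S = (\<lambda>x. cmap d (cinv c (cmap c x))) ` B n" by (simp add: image_image)
      also have "\<dots> = cmap d ` B n"
        by (rule image_cong[OF refl]) (use Bsub(1)[of n] cinv_cmap[OF c] in \<open>simp add: subset_iff\<close>)
      finally show ?thesis .
    qed
    have S: "?S \<in> sets borel" by (rule cmap_image_borel[OF c Bsub(1) B])
    have Sc: "y \<in> cimg c" "cinv c y \<in> B n" "cmap c (cinv c y) = y" if "y \<in> ?S" for y
      using that Bsub(1)[of n] cinv_cmap[OF c] cmap_in[of _ c] by auto
    have bd: "norm y \<le> real n" "vol_density c y \<le> real n" if "y \<in> ?S" for y
      using Sc[OF that] by (auto simp: B_def \<phi>_def)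
    have "(\<integral>\<^sup>+ y. ennreal (vol_density d y) * indicator (?\<tau> ` ?S) y \<partial>lborel) =
        (\<integral>\<^sup>+ x. ennreal (vol_density c x) * indicator ?S x \<partial>lborel)"
    proof (rule nn_integral_change_of_variables[OF S])
      fix y assume y: "y \<in> ?S"
      have x: "cinv c y \<in> cdom c" "cinv c y \<in> cdom d" using Sc(2)[OF y] Bsub by auto
      show "(?\<tau> has_derivative dir_deriv ?\<tau> y) (at y)"
        using transition_has_derivative[OF c d x] unfolding Sc(3)[OF y] .
      show "vol_density c y = \<bar>det (matrix (dir_deriv ?\<tau> y))\<bar> * vol_density d (?\<tau> y)"
        using vol_density_transition[OF c d x] unfolding Sc(3)[OF y] by simp
    next
      show "inj_on ?\<tau> ?S"
      proof (rule inj_onI)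
        fix y z assume yz: "y \<in> ?S" "z \<in> ?S" "?\<tau> y = ?\<tau> z"
        have "cinv d (cmap d (cinv c y)) = cinv d (cmap d (cinv c z))" using yz(3) by simp
        then have "cinv c y = cinv c z"
          unfolding cinv_cmap[OF d subsetD[OF Bsub(2) Sc(2)[OF yz(1)]]] cinv_cmap[OF d subsetD[OF Bsub(2) Sc(2)[OF yz(2)]]] .
        from arg_cong[OF this, of "cmap c"] show "y = z" unfolding Sc(3)[OF yz(1)] Sc(3)[OF yz(2)] .
      qed
    next
      fix y assume "y \<in> ?\<tau> ` ?S"
      then have "y \<in> cimg d" unfolding img using Bsub(2)[of n] cmap_in[of _ d] by auto
      then show "vol_density d y \<ge> 0" using vol_density_pos[OF d] by (simp add: less_imp_le)
    next
      have T: "cmap d ` B n \<in> sets borel" by (rule cmap_image_borel[OF d Bsub(2) B])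
      have "cmap d ` B n \<subseteq> cimg d" using Bsub(2)[of n] cmap_in[of _ d] by auto
      then have "continuous_on (cmap d ` B n) (vol_density d)"
        using ck_on_continuous[OF vol_density_smooth[OF d, of 0]] by (rule continuous_on_subset[rotated])
      from borel_measurable_continuous_on_indicator[OF T this]
      have "(\<lambda>y. ennreal (indicator (cmap d ` B n) y *\<^sub>R vol_density d y)) \<in> borel_measurable borel" by simp
      moreover have "(\<lambda>y. ennreal (indicator (cmap d ` B n) y *\<^sub>R vol_density d y)) =
          (\<lambda>y. ennreal (vol_density d y) * indicator (?\<tau> ` ?S) y)"
        unfolding img by (auto simp: indicator_def)
      ultimately show "(\<lambda>y. ennreal (vol_density d y) * indicator (?\<tau> ` ?S) y) \<in> borel_measurable borel" by simp
    next
      have "?S \<subseteq> cimg c" using Sc(1) by blast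
      then have "continuous_on ?S (vol_density c)"
        using ck_on_continuous[OF vol_density_smooth[OF c, of 0]] by (rule continuous_on_subset[rotated])
      from borel_measurable_continuous_on_indicator[OF S this]
      have m: "(\<lambda>y. indicator ?S y *\<^sub>R vol_density c y) \<in> borel_measurable lborel" by simp
      have "emeasure lborel ?S \<le> emeasure lborel (cball (0 :: real ^ 'm) (real n))"
        by (rule emeasure_mono) (use bd(1) in \<open>auto\<close>)
      also have "\<dots> < \<infinity>" by (rule emeasure_lborel_cball_finite)
      finally have "integrable lborel (\<lambda>y. indicator ?S y *\<^sub>R (indicator ?S y *\<^sub>R vol_density c y))"
        by (intro integrableI_bounded_set_indicator[where B = "real n"] m)
          (use S bd(2) vol_density_pos[OF c] Sc(1) in \<open>auto simp: abs_of_pos\<close>)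
      moreover have "(\<lambda>y. indicator ?S y *\<^sub>R (indicator ?S y *\<^sub>R vol_density c y)) = (\<lambda>y. indicator ?S y * vol_density c y)"
        by (simp add: fun_eq_iff split: split_indicator)
      ultimately show "integrable lborel (\<lambda>y. indicator ?S y * vol_density c y)" by simp
    qed
    then show ?thesis unfolding img emeasure_chart_measure[OF c Bsub(1) B] emeasure_chart_measure[OF d Bsub(2) B] ..
  qed
  have "emeasure (chart_measure c) A = (SUP n. emeasure (chart_measure c) (B n))"
    unfolding un[symmetric] by (rule SUP_emeasure_incseq[symmetric]) (use B inc in auto)
  also have "\<dots> = emeasure (chart_measure d) A"
    unfolding eq unfolding un[symmetric] by (rule SUP_emeasure_incseq) (use B inc in auto)
  finally show ?thesis .
qed

lemma countable_chart_cover: "\<exists>cs :: nat \<Rightarrow> ('a, 'm) chart. (\<forall>i. cs i \<in> atlas M) \<and> (\<Union>i. cdom (cs i)) = UNIV"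
proof -
  obtain F where F: "F \<subseteq> cdom ` atlas M" "countable F" "\<Union>F = \<Union>(cdom ` atlas M)"
    by (rule Lindelof[of "cdom ` atlas M"]) (use atlasD(1) in auto)
  have un: "\<Union>F = UNIV" unfolding F(3) using charts_cover by auto
  then have ne: "F \<noteq> {}" by auto
  have "\<forall>i. \<exists>c. c \<in> atlas M \<and> cdom c = from_nat_into F i"
    using from_nat_into[OF ne] F(1) by (metis (no_types, lifting) image_iff subsetD)
  then obtain cs where cs: "\<forall>i. cs i \<in> atlas M \<and> cdom (cs i) = from_nat_into F i" by (rule choice[THEN exE])
  have "(\<Union>i. cdom (cs i)) = \<Union>(range (from_nat_into F))" using cs by simp
  also have "\<dots> = UNIV" unfolding range_from_nat_into[OF ne F(2)] by (rule un)
  finally show ?thesis using cs by blast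
qed

text \<open>\<open>riem_volume\<close> is a definite description, so nothing can be computed with it
  before this. A countable cover by chart domains is made disjoint and the chart measures of the
  pieces are added up. Agreement on overlaps gives the formula in every chart, and the formula fixes
  any such measure on each piece.\<close>

lemma riem_volume_exists_unique:
  "\<exists>!\<mu>. sets \<mu> = sets borel \<and> (\<forall>c\<in>atlas M. \<forall>A\<in>sets borel. A \<subseteq> cdom c \<longrightarrow>
     emeasure \<mu> A = (\<integral>\<^sup>+ y\<in>cmap c ` A. ennreal (sqrt (det (gram M c y))) \<partial>lborel))"
proof -
  obtain cs :: "nat \<Rightarrow> ('a, 'm) chart" where cs: "\<And>i. cs i \<in> atlas M" and un: "(\<Union>i. cdom (cs i)) = UNIV"
    using countable_chart_cover by blast
  define B where "B = disjointed (\<lambda>i. cdom (cs i))"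
  have Bb: "B i \<in> sets borel" for i
    unfolding B_def disjointed_def using atlasD(1)[OF cs] by (intro sets.Diff sets.finite_UN) auto
  have Bsub: "B i \<subseteq> cdom (cs i)" for i unfolding B_def by (rule disjointed_subset)
  have Bdis: "disjoint_family B" unfolding B_def by (rule disjoint_family_disjointed)
  have Bun: "(\<Union>i. B i) = UNIV" unfolding B_def UN_disjointed_eq by (rule un)
  have split: "emeasure \<mu> A = (\<Sum>i. emeasure \<mu> (A \<inter> B i))" if "sets \<mu> = sets borel" "A \<in> sets borel" for \<mu> A
  proof -
    have "disjoint_family (\<lambda>i. A \<inter> B i)" using Bdis by (auto simp: disjoint_family_on_def)
    then have "(\<Sum>i. emeasure \<mu> (A \<inter> B i)) = emeasure \<mu> (\<Union>i. A \<inter> B i)"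
      by (intro suminf_emeasure) (use that Bb in auto)
    also have "(\<Union>i. A \<inter> B i) = A" using Bun by blast
    finally show ?thesis ..
  qed
  define m where "m A = (\<Sum>i. emeasure (chart_measure (cs i)) (A \<inter> B i))" for A
  define \<mu> where "\<mu> = measure_of UNIV (sets borel) m"
  have s\<mu>: "sets \<mu> = sets borel" unfolding \<mu>_def by (metis sets.sets_measure_of_eq space_borel)
  have "countably_additive (sets borel) m"
  proof (rule countably_additiveI)
    fix A :: "nat \<Rightarrow> 'a set"
    assume A: "range A \<subseteq> sets borel" "disjoint_family A" "(\<Union>j. A j) \<in> sets borel"
    \<comment> \<open>The outer sum is read as an integral over counting measure, so that the
      interchange of sums is monotone convergence.\<close>
    have "(\<Sum>j. m (A j)) = (\<integral>\<^sup>+ j. (\<Sum>i. emeasure (chart_measure (cs i)) (A j \<inter> B i)) \<partial>count_space UNIV)"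
      by (simp add: m_def nn_integral_count_space_nat)
    also have "\<dots> = (\<Sum>i. \<integral>\<^sup>+ j. emeasure (chart_measure (cs i)) (A j \<inter> B i) \<partial>count_space UNIV)"
      by (rule nn_integral_suminf) simp
    also have "\<dots> = m (\<Union>j. A j)"
    proof -
      have "(\<Sum>j. emeasure (chart_measure (cs i)) (A j \<inter> B i)) = emeasure (chart_measure (cs i)) ((\<Union>j. A j) \<inter> B i)" for i
      proof -
        have "disjoint_family (\<lambda>j. A j \<inter> B i)" using A(2) by (auto simp: disjoint_family_on_def)
        then have "(\<Sum>j. emeasure (chart_measure (cs i)) (A j \<inter> B i)) = emeasure (chart_measure (cs i)) (\<Union>j. A j \<inter> B i)"
          by (intro suminf_emeasure) (use A(1) Bb in auto)
        then show ?thesis by simp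
      qed
      then show ?thesis by (simp add: m_def nn_integral_count_space_nat)
    qed
    finally show "(\<Sum>j. m (A j)) = m (\<Union>j. A j)" .
  qed
  then have em: "emeasure \<mu> A = m A" if "A \<in> sets borel" for A
    unfolding \<mu>_def using that
    by (intro emeasure_measure_of_sigma) (auto simp: positive_def m_def intro: sets.sigma_algebra_axioms[of borel, simplified])
  have spec: "emeasure \<mu> A = (\<integral>\<^sup>+ y\<in>cmap c ` A. ennreal (sqrt (det (gram M c y))) \<partial>lborel)"
    if "c \<in> atlas M" "A \<in> sets borel" "A \<subseteq> cdom c" for c A
  proof -
    have "m A = (\<Sum>i. emeasure (chart_measure c) (A \<inter> B i))" unfolding m_def
      by (intro suminf_cong chart_measure_overlap[OF cs that(1)]) (use that Bsub Bb in auto)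
    also have "\<dots> = emeasure (chart_measure c) A" by (rule split[symmetric]) (use that in auto)
    finally show ?thesis unfolding em[OF that(2)] emeasure_chart_measure[OF that(1,3,2)] vol_density_def .
  qed
  show ?thesis
  proof (rule ex1I[of _ \<mu>])
    show "sets \<mu> = sets borel \<and> (\<forall>c\<in>atlas M. \<forall>A\<in>sets borel. A \<subseteq> cdom c \<longrightarrow>
       emeasure \<mu> A = (\<integral>\<^sup>+ y\<in>cmap c ` A. ennreal (sqrt (det (gram M c y))) \<partial>lborel))"
      using s\<mu> spec by blast
  next
    fix \<nu> :: "'a measure"
    assume n: "sets \<nu> = sets borel \<and> (\<forall>c\<in>atlas M. \<forall>A\<in>sets borel. A \<subseteq> cdom c \<longrightarrow>
       emeasure \<nu> A = (\<integral>\<^sup>+ y\<in>cmap c ` A. ennreal (sqrt (det (gram M c y))) \<partial>lborel))"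
    show "\<nu> = \<mu>"
    proof (rule measure_eqI)
      show "sets \<nu> = sets \<mu>" using n s\<mu> by simp
      fix A assume "A \<in> sets \<nu>"
      then have A: "A \<in> sets borel" using n by simp
      have AB: "A \<inter> B i \<in> sets borel" "A \<inter> B i \<subseteq> cdom (cs i)" for i using A Bb Bsub by auto
      have "emeasure \<nu> (A \<inter> B i) = emeasure \<mu> (A \<inter> B i)" for i
        unfolding spec[OF cs AB] using n cs AB by blast
      then show "emeasure \<nu> A = emeasure \<mu> A"
        using split[OF conjunct1[OF n] A] split[OF s\<mu> A] by simp
    qed
  qed
qed

lemma sets_riem_volume [simp, measurable_cong]: "sets (riem_volume M) = sets borel"
  using theI'[OF riem_volume_exists_unique] unfolding riem_volume_def by (rule conjunct1)

lemma space_riem_volume [simp]: "space (riem_volume M) = UNIV"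
  using sets_eq_imp_space_eq[OF sets_riem_volume] by simp

lemma emeasure_riem_volume:
  assumes "c \<in> atlas M" "A \<subseteq> cdom c" "A \<in> sets borel"
  shows "emeasure (riem_volume M) A = emeasure (chart_measure c) A"
  using conjunct2[OF theI'[OF riem_volume_exists_unique], folded riem_volume_def] assms
  by (simp add: emeasure_chart_measure[OF assms] vol_density_def)

lemma restrict_riem_volume:
  assumes "c \<in> atlas M"
  shows "restrict_space (riem_volume M) (cdom c) = restrict_space (chart_measure c) (cdom c)"
proof (rule measure_eqI)
  show "sets (restrict_space (riem_volume M) (cdom c)) = sets (restrict_space (chart_measure c) (cdom c))"
    by (simp add: sets_restrict_space)
  fix A assume "A \<in> sets (restrict_space (riem_volume M) (cdom c))"
  then have A: "A \<subseteq> cdom c" "A \<in> sets borel"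
    using atlasD(1)[OF assms] by (auto simp: sets_restrict_space_iff)
  show "emeasure (restrict_space (riem_volume M) (cdom c)) A = emeasure (restrict_space (chart_measure c) (cdom c)) A"
    using A atlasD(1)[OF assms] by (simp add: emeasure_restrict_space emeasure_riem_volume[OF assms A])
qed

section \<open>Integrals of functions supported in one chart\<close>

lemma nn_integral_riem_volume:
  assumes "c \<in> atlas M" "F \<in> borel_measurable borel" "\<And>x. x \<notin> cdom c \<Longrightarrow> F x = 0"
  shows "(\<integral>\<^sup>+ x. F x \<partial>riem_volume M) =
    (\<integral>\<^sup>+ y. ennreal (vol_density c y) * F (cinv c y) * indicator (cimg c) y \<partial>lborel)"
proof -
  have F: "(\<lambda>x. F x * indicator (cdom c) x) = F" using assms(3) by (auto simp: indicator_def fun_eq_iff)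
  have cd: "cdom c \<in> sets borel" using atlasD(1)[OF assms(1)] by simp
  have "(\<integral>\<^sup>+ x. F x \<partial>riem_volume M) = (\<integral>\<^sup>+ x. F x \<partial>chart_measure c)"
    using nn_integral_restrict_space[of "cdom c" "riem_volume M" F] nn_integral_restrict_space[of "cdom c" "chart_measure c" F]
    unfolding restrict_riem_volume[OF assms(1)] F using cd by simp
  then show ?thesis unfolding nn_integral_chart_measure[OF assms(1,2)] .
qed

lemma integral_riem_volume:
  fixes F :: "'a \<Rightarrow> real"
  assumes c: "c \<in> atlas M" and F: "F \<in> borel_measurable borel" and z: "\<And>x. x \<notin> cdom c \<Longrightarrow> F x = 0"
  defines "G \<equiv> \<lambda>y. indicator (cimg c) y * (vol_density c y * F (cinv c y))"
  shows "integrable (riem_volume M) F \<longleftrightarrow> integrable lborel G"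
    and "(LINT x|riem_volume M. F x) = (LINT y|lborel. G y)"
proof -
  have FF: "(\<lambda>x. indicator (cdom c) x *\<^sub>R F x) = F" using z by (auto simp: indicator_def fun_eq_iff)
  have cd: "cdom c \<in> sets borel" using atlasD(1)[OF c] by simp
  note [measurable] = cinv_measurable[OF c] vol_density_measurable[OF c] F
  have ae: "AE y in restrict_space lborel (cimg c). 0 \<le> vol_density c y"
    by (rule AE_I2) (use vol_density_pos[OF c] in \<open>simp add: space_restrict_space less_imp_le\<close>)
  have ci: "cimg c \<inter> space lborel \<in> sets lborel" using atlasD(2)[OF c] by simp
  have "integrable (riem_volume M) F \<longleftrightarrow> integrable (chart_measure c) F"
    using integrable_restrict_space[of "cdom c" "riem_volume M" F] integrable_restrict_space[of "cdom c" "chart_measure c" F]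
    unfolding restrict_riem_volume[OF c] FF using cd by simp
  also have "\<dots> \<longleftrightarrow> integrable (density (restrict_space lborel (cimg c)) (\<lambda>y. ennreal (vol_density c y))) (\<lambda>y. F (cinv c y))"
    unfolding chart_measure_def by (rule integrable_distr_eq) simp_all
  also have "\<dots> \<longleftrightarrow> integrable (restrict_space lborel (cimg c)) (\<lambda>y. vol_density c y *\<^sub>R F (cinv c y))"
    by (rule integrable_density) (use ae in simp_all)
  also have "\<dots> \<longleftrightarrow> integrable lborel G" unfolding integrable_restrict_space[OF ci] G_def by simp
  finally show "integrable (riem_volume M) F \<longleftrightarrow> integrable lborel G" .
  have "(LINT x|riem_volume M. F x) = (LINT x|chart_measure c. F x)"
    using integral_restrict_space[of "cdom c" "riem_volume M" F] integral_restrict_space[of "cdom c" "chart_measure c" F]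
    unfolding restrict_riem_volume[OF c] FF using cd by simp
  also have "\<dots> = (LINT y|density (restrict_space lborel (cimg c)) (\<lambda>y. ennreal (vol_density c y)). F (cinv c y))"
    unfolding chart_measure_def by (rule integral_distr) simp_all
  also have "\<dots> = (LINT y|restrict_space lborel (cimg c). vol_density c y *\<^sub>R F (cinv c y))"
    by (rule integral_density) (use ae in simp_all)
  also have "\<dots> = (LINT y|lborel. G y)" unfolding integral_restrict_space[OF ci] G_def by simp
  finally show "(LINT x|riem_volume M. F x) = (LINT y|lborel. G y)" .
qed

end

section \<open>Functions of class \<open>C\<^sup>1\<close> on a manifold\<close>

declare ck_on.simps(2) [simp del]

text \<open>A competitor v in the capacity may be negative somewhere, so its p-th power is taken of
  the positive part; for exponents above 1 this is still C^1.\<close>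

definition pos_powr :: "real \<Rightarrow> real \<Rightarrow> real" where "pos_powr a t = max 0 t powr a"

lemma pos_powr_nonneg [simp]: "pos_powr a t \<ge> 0" and pos_powr_zero [simp]: "t \<le> 0 \<Longrightarrow> pos_powr a t = 0"
  and pos_powr_eq: "t > 0 \<Longrightarrow> pos_powr a t = t powr a"
  by (simp_all add: pos_powr_def max_def)

lemma pos_powr_pos: "t > 0 \<Longrightarrow> pos_powr a t > 0" by (simp add: pos_powr_eq)

text \<open>Only t = 0 is delicate: there the difference quotient is at most |h|^(a-1), which tends
  to 0 since a > 1.\<close>

lemma pos_powr_has_derivative:
  assumes a: "a > 1"
  shows "(pos_powr a has_real_derivative a * pos_powr (a - 1) t) (at t)"
proof -
  consider "t > 0" | "t < 0" | "t = 0" by linarith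
  then show ?thesis
  proof cases
    case 1
    have "((\<lambda>t. t powr a) has_real_derivative a * t powr (a - 1)) (at t)" by (rule has_real_derivative_powr[OF 1])
    then have "(pos_powr a has_real_derivative a * t powr (a - 1)) (at t)"
      by (rule has_field_derivative_transform_within_open[where S = "{0<..}"]) (use 1 in \<open>auto simp: pos_powr_eq\<close>)
    then show ?thesis using 1 by (simp add: pos_powr_eq)
  next
    case 2
    have "((\<lambda>t. 0) has_real_derivative 0) (at t)" by simp
    then have "(pos_powr a has_real_derivative 0) (at t)"
      by (rule has_field_derivative_transform_within_open[where S = "{..<0}"]) (use 2 in auto)
    then show ?thesis using 2 by simp
  next
    case 3
    have "((\<lambda>h::real. \<bar>h\<bar> powr (a - 1)) \<longlongrightarrow> 0) (at 0)"
      by (rule tendsto_zero_powrI[where b = "a - 1"]) (use a in \<open>auto intro!: tendsto_rabs_zero tendsto_ident_at\<close>)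
    moreover have "\<forall>\<^sub>F h in at 0. norm (pos_powr a h / h) \<le> \<bar>h\<bar> powr (a - 1)"
    proof (rule always_eventually, rule allI)
      fix h :: real
      show "norm (pos_powr a h / h) \<le> \<bar>h\<bar> powr (a - 1)"
        by (cases "h > 0") (simp add: pos_powr_eq powr_diff, simp)
    qed
    ultimately have "((\<lambda>h. pos_powr a h / h) \<longlongrightarrow> 0) (at 0)" by (rule Lim_null_comparison[rotated])
    then show ?thesis using 3 by (simp add: DERIV_def)
  qed
qed

lemma pos_powr_C1:
  assumes "a > 1" shows "ck_on 1 UNIV (pos_powr a)"
proof -
  have "continuous_on UNIV (\<lambda>t. a * pos_powr (a - 1) t)"
    unfolding pos_powr_def using assms by (intro continuous_on_mult continuous_on_const continuous_on_powr' continuous_on_max continuous_on_id) auto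
  then have "ck_on (Suc 0) UNIV (pos_powr a)"
    by (intro ck_on_realI[where f' = "\<lambda>t. a * pos_powr (a - 1) t"] pos_powr_has_derivative assms) auto
  then show ?thesis by simp
qed

context riemannian
begin

text \<open>The function tested against is the p-th power of the positive part of v times f, in
  general no better than C^1. The weak inequality and the partition of unity are therefore set up in
  this class.\<close>

definition C1_fun :: "('a \<Rightarrow> real) \<Rightarrow> bool" where
  "C1_fun u \<longleftrightarrow> (\<forall>c\<in>atlas M. ck_on 1 (cimg c) (u \<circ> cinv c))"

definition grad_pair :: "('a \<Rightarrow> real) \<Rightarrow> ('a \<Rightarrow> real) \<Rightarrow> 'a \<Rightarrow> real" where
  "grad_pair u v x = inner_at M x (gradient M u x) (gradient M v x)"

lemma C1_funD: "C1_fun u \<Longrightarrow> c \<in> atlas M \<Longrightarrow> ck_on (Suc 0) (cimg c) (u \<circ> cinv c)"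
  by (simp add: C1_fun_def)

lemma C1_funI: "(\<And>c. c \<in> atlas M \<Longrightarrow> ck_on 1 (cimg c) (u \<circ> cinv c)) \<Longrightarrow> C1_fun u"
  by (simp add: C1_fun_def)

lemma C1_fun_ck: "C1_fun u \<Longrightarrow> c \<in> atlas M \<Longrightarrow> ck_on 1 (cimg c) (u \<circ> cinv c)"
  by (simp add: C1_fun_def)

lemma C2_imp_C1: "(\<And>c. c \<in> atlas M \<Longrightarrow> ck_on 2 (cimg c) (u \<circ> cinv c)) \<Longrightarrow> C1_fun u"
  by (rule C1_funI, rule ck_on_le[of 2]) simp_all

lemma C1_has_derivative:
  "C1_fun u \<Longrightarrow> c \<in> atlas M \<Longrightarrow> y \<in> cimg c \<Longrightarrow> ((u \<circ> cinv c) has_derivative dir_deriv (u \<circ> cinv c) y) (at y)"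
  by (rule ck_on_has_derivative[OF atlasD(2) C1_funD])

lemma continuous_on_charts:
  assumes "\<And>c. c \<in> atlas M \<Longrightarrow> continuous_on (cdom c) f" shows "continuous_on UNIV f"
proof -
  have "continuous_on (\<Union>c\<in>atlas M. cdom c) f"
    by (rule continuous_on_open_UN) (use atlasD(1) assms in auto)
  moreover have "(\<Union>c\<in>atlas M. cdom c) = UNIV" using charts_cover by auto
  ultimately show ?thesis by simp
qed

lemma C1_continuous: assumes "C1_fun u" shows "continuous_on UNIV u"
proof (rule continuous_on_charts)
  fix c assume c: "c \<in> atlas M"
  have "continuous_on (cdom c) (\<lambda>x. (u \<circ> cinv c) (cmap c x))"
    by (rule continuous_on_compose2[OF ck_on_continuous[OF C1_funD[OF assms c]] continuous_cmap[OF c]]) (auto simp: cimg_def)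
  then show "continuous_on (cdom c) u"
    by (rule continuous_on_cong[THEN iffD1, rotated 2]) (simp_all add: cinv_cmap[OF c])
qed

lemma C1_mult:
  assumes "C1_fun u" "C1_fun v" shows "C1_fun (\<lambda>x. u x * v x)"
proof (rule C1_funI)
  fix c assume c: "c \<in> atlas M"
  from ck_on_mult[OF atlasD(2)[OF c] C1_fun_ck[OF assms(1) c] C1_fun_ck[OF assms(2) c]]
  show "ck_on 1 (cimg c) ((\<lambda>x. u x * v x) \<circ> cinv c)" unfolding o_def .
qed

lemma C1_pos_powr:
  assumes "C1_fun u" "a > 1" shows "C1_fun (\<lambda>x. pos_powr a (u x))"
proof (rule C1_funI)
  fix c assume c: "c \<in> atlas M"
  from ck_on_compose[OF atlasD(2)[OF c] open_UNIV subset_UNIV C1_fun_ck[OF assms(1) c] pos_powr_C1[OF assms(2)]]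
  show "ck_on 1 (cimg c) ((\<lambda>x. pos_powr a (u x)) \<circ> cinv c)" unfolding o_def .
qed

lemma test_function_C1:
  assumes "test_function M v" shows "C1_fun v"
proof (rule C1_funI)
  fix c assume c: "c \<in> atlas M"
  have "smooth_on (cmap c ` (cdom c \<inter> UNIV)) (v \<circ> cinv c)"
    using assms c unfolding test_function_def smooth_fun_on_def by blast
  then show "ck_on 1 (cimg c) (v \<circ> cinv c)" unfolding Int_UNIV_right cimg_def by (rule smooth_on_ck)
qed

lemma gradient_chart: "gradient M u x = chart_grad M (chart_at M x) (u \<circ> cinv (chart_at M x)) (cmap (chart_at M x) x)"
  by (simp add: gradient_def chart_grad_def Let_def)

lemma C1_grad_transition:
  assumes "c \<in> atlas M" "d \<in> atlas M" "x \<in> cdom c" "x \<in> cdom d" and F: "C1_fun F"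
  shows "dir_deriv (cmap d \<circ> cinv c) (cmap c x) (chart_grad M c (F \<circ> cinv c) (cmap c x)) = chart_grad M d (F \<circ> cinv d) (cmap d x)"
proof -
  let ?W = "cmap c ` (cdom c \<inter> cdom d)" and ?G = "\<lambda>z. (F \<circ> cinv d) ((cmap d \<circ> cinv c) z)"
  have W: "open ?W" "cmap c x \<in> ?W" using open_overlap[OF assms(1,2)] assms(3,4) by auto
  have D: "dir_deriv (F \<circ> cinv c) z = dir_deriv ?G z" if "z \<in> ?W" for z
    by (rule dir_deriv_cong_open[OF W(1) that chart_comp_transition[OF assms(1,2)]])
  note fd = C1_has_derivative[OF F assms(2) cmap_in[OF assms(4)]]
  have "chart_grad M c (F \<circ> cinv c) (cmap c x) = chart_grad M c ?G (cmap c x)"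
    unfolding chart_grad_def D[OF W(2)] ..
  then show ?thesis using chart_grad_transition[OF assms(1-4) fd] by simp
qed

section \<open>The pairing of two gradients\<close>

lemma grad_pair_ginner:
  assumes "C1_fun u" "C1_fun v" "c \<in> atlas M" "x \<in> cdom c"
  shows "grad_pair u v x = ginner M c (cmap c x) (chart_grad M c (u \<circ> cinv c) (cmap c x)) (chart_grad M c (v \<circ> cinv c) (cmap c x))"
  unfolding grad_pair_def inner_at_def gradient_chart
    ginner_transition[OF assms(3) chart_at(1) assms(4) chart_at(2)]
    C1_grad_transition[OF assms(3) chart_at(1) assms(4) chart_at(2) assms(1)]
    C1_grad_transition[OF assms(3) chart_at(1) assms(4) chart_at(2) assms(2)] ..

lemma grad_pair_dir_deriv:
  assumes "C1_fun u" "C1_fun v" "c \<in> atlas M" "x \<in> cdom c"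
  shows "grad_pair u v x = dir_deriv (v \<circ> cinv c) (cmap c x) (chart_grad M c (u \<circ> cinv c) (cmap c x))"
  unfolding grad_pair_ginner[OF assms]
    ginner_sym[OF assms(3) cmap_in[OF assms(4)], of "chart_grad M c (u \<circ> cinv c) (cmap c x)"]
  by (rule chart_grad[OF assms(3) cmap_in[OF assms(4)] C1_has_derivative[OF assms(2,3) cmap_in[OF assms(4)]]])

lemma grad_pair_self_nonneg: "C1_fun u \<Longrightarrow> grad_pair u u x \<ge> 0"
  unfolding grad_pair_def inner_at_def by (rule ginner_nonneg[OF chart_at(1) cmap_in[OF chart_at(2)]])

lemma grad_pair_cauchy_schwarz:
  "\<bar>grad_pair u v x\<bar> \<le> sqrt (grad_pair u u x) * sqrt (grad_pair v v x)"
proof -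
  let ?g = "ginner M (chart_at M x) (cmap (chart_at M x) x)"
  define a b where "a = gradient M u x" and "b = gradient M v x"
  note bil = bilinear_ginner[of "chart_at M x" "cmap (chart_at M x) x"]
  note g = chart_at(1)[of x] cmap_in[OF chart_at(2)[of x]]
  have "(?g a b)\<^sup>2 \<le> ?g a a * ?g b b"
  proof (cases "b = 0")
    case True then show ?thesis by (simp add: bilinear_rzero[OF bil])
  next
    case False
    then have pos: "?g b b > 0" by (rule ginner_pos[OF g])
    define t where "t = ?g a b / ?g b b"
    have "0 \<le> ?g (a - t *\<^sub>R b) (a - t *\<^sub>R b)" by (rule ginner_nonneg[OF g])
    also have "\<dots> = ?g a a - 2 * t * ?g a b + t\<^sup>2 * ?g b b"
      by (simp add: bilinear_lsub[OF bil] bilinear_rsub[OF bil] bilinear_lmul[OF bil] bilinear_rmul[OF bil]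
          ginner_sym[OF g, of b a] power2_eq_square algebra_simps)
    also have "\<dots> = ?g a a - (?g a b)\<^sup>2 / ?g b b"
      using pos by (simp add: t_def field_simps power2_eq_square)
    finally show ?thesis using pos by (simp add: field_simps)
  qed
  then have "sqrt ((?g a b)\<^sup>2) \<le> sqrt (?g a a * ?g b b)" by (rule real_sqrt_le_mono)
  then show ?thesis by (simp add: grad_pair_def inner_at_def a_def b_def real_sqrt_mult)
qed

lemma grad_pair_continuous:
  assumes "C1_fun u" "C1_fun v" shows "continuous_on UNIV (grad_pair u v)"
proof (rule continuous_on_charts)
  fix c assume c: "c \<in> atlas M"
  have V: "continuous_on (cimg c) (chart_grad M c (w \<circ> cinv c))" if "C1_fun w" for w
    using chart_grad_smooth[OF c atlasD(2)[OF c] subset_refl C1_funD[OF that c]] by simp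
  have G: "continuous_on (cimg c) (gram M c)" by (rule ck_on_continuous[OF gram_smooth[OF c, of 0]])
  have "continuous_on (cimg c) (\<lambda>y. ginner M c y (chart_grad M c (u \<circ> cinv c) y) (chart_grad M c (v \<circ> cinv c) y))"
    unfolding ginner_def matrix_vector_mult_def
    by (intro continuous_on_inner continuous_on_vec_lambda continuous_on_sum continuous_on_mult continuous_on_component V assms G)
  from continuous_on_compose2[OF this continuous_cmap[OF c]]
  have "continuous_on (cdom c) (\<lambda>x. ginner M c (cmap c x) (chart_grad M c (u \<circ> cinv c) (cmap c x)) (chart_grad M c (v \<circ> cinv c) (cmap c x)))"
    by (simp add: cimg_def)
  then show "continuous_on (cdom c) (grad_pair u v)"
    by (rule continuous_on_cong[THEN iffD1, rotated 2]) (simp_all add: grad_pair_ginner[OF assms c])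
qed

lemma grad_pair_borel: "C1_fun u \<Longrightarrow> C1_fun v \<Longrightarrow> grad_pair u v \<in> borel_measurable borel"
  by (rule borel_measurable_continuous_onI[OF grad_pair_continuous])

lemma grad_pair_zero_off:
  assumes "C1_fun u" "C1_fun v" "open U" "x \<in> U" "\<And>z. z \<in> U \<Longrightarrow> v z = 0"
  shows "grad_pair u v x = 0"
proof -
  obtain c where c: "c \<in> atlas M" "x \<in> cdom c" using charts_cover by blast
  let ?W = "cmap c ` (cdom c \<inter> U)"
  have "dir_deriv (v \<circ> cinv c) (cmap c x) = dir_deriv (\<lambda>y. 0) (cmap c x)"
    by (rule dir_deriv_cong_open[OF open_cmap_image[OF c(1) assms(3)]])
      (use c assms(4,5) cinv_cmap[OF c(1)] in auto)
  then show ?thesis unfolding grad_pair_dir_deriv[OF assms(1,2) c] by simp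
qed

lemma grad_pair_sum:
  assumes u: "C1_fun u" and v: "C1_fun v" and \<eta>: "\<And>i. i \<in> I \<Longrightarrow> C1_fun (\<eta> i)" "\<And>x. v x = (\<Sum>i\<in>I. \<eta> i x)"
  shows "grad_pair u v x = (\<Sum>i\<in>I. grad_pair u (\<eta> i) x)"
proof -
  obtain c where c: "c \<in> atlas M" "x \<in> cdom c" using charts_cover by blast
  have "((\<lambda>y. \<Sum>i\<in>I. (\<eta> i \<circ> cinv c) y) has_derivative (\<lambda>e. \<Sum>i\<in>I. dir_deriv (\<eta> i \<circ> cinv c) (cmap c x) e)) (at (cmap c x))"
    by (intro has_derivative_sum C1_has_derivative \<eta>(1) c(1) cmap_in[OF c(2)])
  moreover have "(\<lambda>y. \<Sum>i\<in>I. (\<eta> i \<circ> cinv c) y) = v \<circ> cinv c" by (simp add: fun_eq_iff \<eta>(2))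
  ultimately have "dir_deriv (v \<circ> cinv c) (cmap c x) = (\<lambda>e. \<Sum>i\<in>I. dir_deriv (\<eta> i \<circ> cinv c) (cmap c x) e)"
    by (intro dir_deriv_eq) simp
  then show ?thesis
    unfolding grad_pair_dir_deriv[OF u v c] by (simp add: grad_pair_dir_deriv[OF u \<eta>(1) c])
qed

lemma grad_pair_test:
  assumes f: "C1_fun f" and v: "C1_fun v" and a: "a > 1"
  shows "grad_pair f (\<lambda>x. pos_powr a (v x) * f x) x =
    pos_powr a (v x) * grad_pair f f x + a * pos_powr (a - 1) (v x) * f x * grad_pair f v x"
proof -
  obtain c where c: "c \<in> atlas M" "x \<in> cdom c" using charts_cover by blast
  note y = cmap_in[OF c(2)]
  have P: "(pos_powr a has_derivative (*) (a * pos_powr (a - 1) (v x))) (at ((v \<circ> cinv c) (cmap c x)))"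
    using pos_powr_has_derivative[OF a, of "v x"] by (simp add: has_field_derivative_def cinv_cmap[OF c])
  have "((\<lambda>y. pos_powr a ((v \<circ> cinv c) y) * (f \<circ> cinv c) y) has_derivative
      (\<lambda>e. pos_powr a ((v \<circ> cinv c) (cmap c x)) * dir_deriv (f \<circ> cinv c) (cmap c x) e
        + a * pos_powr (a - 1) (v x) * dir_deriv (v \<circ> cinv c) (cmap c x) e * (f \<circ> cinv c) (cmap c x))) (at (cmap c x))"
    by (rule has_derivative_mult[OF has_derivative_compose[OF C1_has_derivative[OF v c(1) y] P] C1_has_derivative[OF f c(1) y]])
  moreover have "(\<lambda>y. pos_powr a ((v \<circ> cinv c) y) * (f \<circ> cinv c) y) = (\<lambda>x. pos_powr a (v x) * f x) \<circ> cinv c"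
    by (simp add: fun_eq_iff)
  ultimately have D: "dir_deriv ((\<lambda>x. pos_powr a (v x) * f x) \<circ> cinv c) (cmap c x) =
      (\<lambda>e. pos_powr a ((v \<circ> cinv c) (cmap c x)) * dir_deriv (f \<circ> cinv c) (cmap c x) e
        + a * pos_powr (a - 1) (v x) * dir_deriv (v \<circ> cinv c) (cmap c x) e * (f \<circ> cinv c) (cmap c x))"
    by (intro dir_deriv_eq) simp
  have "grad_pair f (\<lambda>x. pos_powr a (v x) * f x) x =
      dir_deriv ((\<lambda>x. pos_powr a (v x) * f x) \<circ> cinv c) (cmap c x) (chart_grad M c (f \<circ> cinv c) (cmap c x))"
    by (rule grad_pair_dir_deriv[OF f C1_mult[OF C1_pos_powr[OF v a] f] c])
  then show ?thesis
    unfolding D by (simp add: grad_pair_dir_deriv[OF f v c] grad_pair_dir_deriv[OF f f c] cinv_cmap[OF c])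
qed

section \<open>The weak inequality on the manifold\<close>

lemma weak_inequality_local:
  assumes p: "p \<ge> 2" and f: "\<And>c. c \<in> atlas M \<Longrightarrow> ck_on 2 (cimg c) (f \<circ> cinv c)"
    and sub: "\<And>c x. c \<in> atlas M \<Longrightarrow> x \<in> cdom c \<Longrightarrow> p_subharmonic_at p c (f \<circ> cinv c) (cmap c x)"
    and \<eta>: "C1_fun \<eta>" "\<And>x. \<eta> x \<ge> 0" and c: "c \<in> atlas M" and K: "compact K" "K \<subseteq> cimg c"
    and z: "\<And>x. x \<notin> cinv c ` K \<Longrightarrow> \<eta> x = 0"
  defines "J \<equiv> \<lambda>x. flux_weight p (grad_pair f f x) * grad_pair f \<eta> x"
  shows "integrable (riem_volume M) J" "(LINT x|riem_volume M. J x) \<le> 0"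
proof -
  have f1: "C1_fun f" by (rule C2_imp_C1) (rule f)
  have Jb: "J \<in> borel_measurable borel"
  proof -
    note [measurable] = grad_pair_borel[OF f1 f1] grad_pair_borel[OF f1 \<eta>(1)]
    show ?thesis unfolding J_def flux_weight_def by measurable
  qed
  have "compact (cinv c ` K)" by (rule compact_continuous_image[OF continuous_on_subset[OF continuous_cinv[OF c] K(2)] K(1)])
  then have op: "open (- (cinv c ` K))" using compact_imp_closed by blast
  have J0: "J x = 0" if "x \<notin> cinv c ` K" for x
    unfolding J_def by (subst grad_pair_zero_off[OF f1 \<eta>(1) op]) (use that z in auto)
  have Kc: "cinv c ` K \<subseteq> cdom c" using K(2) cinv_in[OF c] by blast
  have J0': "J x = 0" if "x \<notin> cdom c" for x using J0 that Kc by blast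
  define V where "V = chart_grad M c (f \<circ> cinv c)"
  define I where "I y = indicator K y * (vol_density c y * (flux_weight p (ginner M c y (V y) (V y)) * dir_deriv (\<eta> \<circ> cinv c) y (V y)))" for y
  have sub': "p_subharmonic_at p c (f \<circ> cinv c) y" if "y \<in> cimg c" for y
    using sub[OF c cinv_in[OF c that]] unfolding cmap_cinv[OF c that] .
  have \<eta>1: "ck_on 1 (cimg c) (\<eta> \<circ> cinv c)" using \<eta>(1) c by (simp add: C1_fun_def)
  have notK: "cinv c y \<notin> cinv c ` K" if y: "y \<in> cimg c" "y \<notin> K" for y
  proof
    assume "cinv c y \<in> cinv c ` K"
    then obtain k where k: "k \<in> K" "cinv c y = cinv c k" by blast
    have "y = k" using arg_cong[OF k(2), of "cmap c"] unfolding cmap_cinv[OF c y(1)] cmap_cinv[OF c subsetD[OF K(2) k(1)]] .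
    then show False using k(1) y(2) by simp
  qed
  have \<eta>0: "(\<eta> \<circ> cinv c) y = 0" if "y \<in> cimg c" "y \<notin> K" for y using z[OF notK[OF that]] by simp
  have w: "integrable lborel I" "(LINT y|lborel. I y) \<le> 0"
    using chart_weak_inequality[OF c f[OF c] p sub' \<eta>1 _ K \<eta>0, folded V_def, folded I_def] \<eta>(2) by simp_all
  have "indicator (cimg c) y * (vol_density c y * J (cinv c y)) = I y" for y
  proof (cases "y \<in> K")
    case True
    then have y: "y \<in> cimg c" using K(2) by blast
    have "J (cinv c y) = flux_weight p (ginner M c y (V y) (V y)) * dir_deriv (\<eta> \<circ> cinv c) y (V y)"
      unfolding J_def grad_pair_ginner[OF f1 f1 c cinv_in[OF c y]] grad_pair_dir_deriv[OF f1 \<eta>(1) c cinv_in[OF c y]]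
        cmap_cinv[OF c y] V_def ..
    then show ?thesis using True y by (simp add: I_def)
  next
    case False
    then show ?thesis using J0[OF notK[of y]] by (cases "y \<in> cimg c") (simp_all add: I_def)
  qed
  then have G: "(\<lambda>y. indicator (cimg c) y * (vol_density c y * J (cinv c y))) = I" by (rule ext)
  have "integrable (riem_volume M) J \<longleftrightarrow> integrable lborel (\<lambda>y. indicator (cimg c) y * (vol_density c y * J (cinv c y)))"
    by (rule integral_riem_volume(1)[OF c Jb]) (rule J0')
  then show "integrable (riem_volume M) J" unfolding G using w(1) by (rule iffD2)
  have "(LINT x|riem_volume M. J x) = (LINT y|lborel. indicator (cimg c) y * (vol_density c y * J (cinv c y)))"
    by (rule integral_riem_volume(2)[OF c Jb]) (rule J0')
  then show "(LINT x|riem_volume M. J x) \<le> 0" unfolding G using w(2) by (rule ord_eq_le_trans)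
qed

text \<open>In a chart take the square of the positive part of e^2 - |y - a|^2 and extend it by 0.
  The image of the closed ball is compact, hence closed, so the chart domain and the complement of
  that image form an open cover, on each member of which the function is visibly C^1.\<close>

lemma bump_function_exists:
  "\<exists>b. C1_fun b \<and> (\<forall>z. b z \<ge> 0) \<and> b x > 0 \<and>
    (\<exists>c K. c \<in> atlas M \<and> compact K \<and> K \<subseteq> cimg c \<and> (\<forall>z. z \<notin> cinv c ` K \<longrightarrow> b z = 0))"
proof -
  obtain c where c: "c \<in> atlas M" "x \<in> cdom c" using charts_cover by blast
  define a where "a = cmap c x"
  obtain e where e: "e > 0" "cball a e \<subseteq> cimg c"
    using open_contains_cball[of "cimg c"] atlasD(2)[OF c(1)] cmap_in[OF c(2)] unfolding a_def by blast
  define K where "K = cball a e"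
  define b where "b z = (if z \<in> cdom c then pos_powr 2 (e\<^sup>2 - (cmap c z - a) \<bullet> (cmap c z - a)) else 0)" for z
  have K: "compact K" "K \<subseteq> cimg c" by (simp_all add: K_def e(2))
  have "compact (cinv c ` K)" by (rule compact_continuous_image[OF continuous_on_subset[OF continuous_cinv[OF c(1)] K(2)] K(1)])
  then have op: "open (- (cinv c ` K))" using compact_imp_closed by blast
  have Kc: "cinv c ` K \<subseteq> cdom c" by (rule image_subsetI) (rule cinv_in[OF c(1) subsetD[OF K(2)]])
  have b0: "b z = 0" if "z \<notin> cinv c ` K" for z
  proof (cases "z \<in> cdom c")
    case True
    then have "cmap c z \<notin> K" using that cinv_cmap[OF c(1) True] by (metis imageI)
    then have "e < norm (cmap c z - a)" by (simp add: K_def dist_norm norm_minus_commute)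
    then have "e\<^sup>2 \<le> (norm (cmap c z - a))\<^sup>2" using e(1) by (intro power_mono) auto
    then show ?thesis using True by (simp add: b_def power2_norm_eq_inner)
  qed (simp add: b_def)
  have b1: "C1_fun b"
  proof (rule C1_funI)
    fix d assume d: "d \<in> atlas M"
    show "ck_on 1 (cimg d) (b \<circ> cinv d)"
    proof (rule ck_on_local[OF atlasD(2)[OF d]])
      fix y assume y: "y \<in> cimg d"
      let ?x = "cinv d y"
      have xd: "?x \<in> cdom d" "cmap d ?x = y" using cinv_in[OF d y] cmap_cinv[OF d y] by auto
      show "\<exists>W. open W \<and> y \<in> W \<and> W \<subseteq> cimg d \<and> ck_on 1 W (b \<circ> cinv d)"
      proof (cases "?x \<in> cdom c")
        case True
        let ?W = "cmap d ` (cdom d \<inter> cdom c)"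
        have W: "open ?W" by (rule open_overlap[OF d c(1)])
        have y: "y \<in> ?W" using xd True by (metis IntI imageI)
        have t: "ck_on 1 ?W (cmap c \<circ> cinv d)" by (rule transition_smooth[OF d c(1)])
        have t2: "ck_on 1 ?W (\<lambda>z. e\<^sup>2 - ((cmap c \<circ> cinv d) z - a) \<bullet> ((cmap c \<circ> cinv d) z - a))"
          by (intro ck_on_diff ck_on_inner ck_on_const W t)
        have "ck_on 1 ?W (\<lambda>z. pos_powr 2 (e\<^sup>2 - ((cmap c \<circ> cinv d) z - a) \<bullet> ((cmap c \<circ> cinv d) z - a)))"
          by (rule ck_on_compose[OF W open_UNIV subset_UNIV t2 pos_powr_C1]) simp
        then have "ck_on 1 ?W (b \<circ> cinv d)"
          by (rule ck_on_cong[OF W, rotated]) (auto simp: b_def cinv_cmap[OF d])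
        moreover have "?W \<subseteq> cimg d" by (auto simp: cimg_def)
        ultimately show ?thesis using W y by blast
      next
        case False
        let ?W = "cmap d ` (cdom d \<inter> - (cinv c ` K))"
        have W: "open ?W" by (rule open_cmap_image[OF d op])
        have "?x \<notin> cinv c ` K" using False Kc by blast
        then have y: "y \<in> ?W" using xd by (metis ComplI IntI imageI)
        have "ck_on 1 ?W (b \<circ> cinv d)"
          by (rule ck_on_cong[OF W _ ck_on_const[OF W, of 1 0]]) (use b0 cinv_cmap[OF d] in auto)
        moreover have "?W \<subseteq> cimg d" by (auto simp: cimg_def)
        ultimately show ?thesis using W y by blast
      qed
    qed
  qed
  have b2: "b x > 0" using c(2) e(1) by (simp add: b_def a_def pos_powr_pos)
  have b3: "b z \<ge> 0" for z by (simp add: b_def)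
  show ?thesis 
  proof (rule exI[of _ b], intro conjI)
    show "\<exists>c K. c \<in> atlas M \<and> compact K \<and> K \<subseteq> cimg c \<and> (\<forall>z. z \<notin> cinv c ` K \<longrightarrow> b z = 0)"
      by (rule exI[of _ c], rule exI[of _ K]) (simp add: c(1) K b0)
  qed (simp_all add: b1 b2 b3)
qed

text \<open>Partition of unity: finitely many bump functions with positive sum s on the support of
  \<eta> split \<eta> into the functions \<eta> b / s, each supported in one chart. Both claims are
  additive in \<eta>.\<close>

lemma weak_inequality:
  assumes p: "p \<ge> 2" and f: "\<And>c. c \<in> atlas M \<Longrightarrow> ck_on 2 (cimg c) (f \<circ> cinv c)"
    and sub: "\<And>c x. c \<in> atlas M \<Longrightarrow> x \<in> cdom c \<Longrightarrow> p_subharmonic_at p c (f \<circ> cinv c) (cmap c x)"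
    and \<eta>: "C1_fun \<eta>" "\<And>x. \<eta> x \<ge> 0" and cpt: "compact (closure {x. \<eta> x \<noteq> 0})"
  defines "J \<equiv> \<lambda>x. flux_weight p (grad_pair f f x) * grad_pair f \<eta> x"
  shows "integrable (riem_volume M) J" "(LINT x|riem_volume M. J x) \<le> 0"
proof -
  have f1: "C1_fun f" by (rule C2_imp_C1) (rule f)
  let ?K0 = "closure {x. \<eta> x \<noteq> 0}"
  define P where "P x b \<longleftrightarrow> C1_fun b \<and> (\<forall>z. b z \<ge> 0) \<and> b x > 0 \<and>
    (\<exists>c K. c \<in> atlas M \<and> compact K \<and> K \<subseteq> cimg c \<and> (\<forall>z. z \<notin> cinv c ` K \<longrightarrow> b z = 0))" for x b
  have "\<forall>x. \<exists>b. P x b" unfolding P_def by (rule allI, rule bump_function_exists)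
  from choice[OF this] obtain bb where "\<forall>x. P x (bb x)" ..
  then have P: "P x (bb x)" for x ..
  have bb: "C1_fun (bb x)" "bb x z \<ge> 0" "bb x x > 0"
    "\<exists>c K. c \<in> atlas M \<and> compact K \<and> K \<subseteq> cimg c \<and> (\<forall>z. z \<notin> cinv c ` K \<longrightarrow> bb x z = 0)" for x z
    using P[of x] unfolding P_def by simp_all
  have op: "open {z. bb x z > 0}" for x
    by (rule open_Collect_less[OF continuous_on_const C1_continuous[OF bb(1)]])
  obtain T where T: "T \<subseteq> ?K0" "finite T" "?K0 \<subseteq> (\<Union>x\<in>T. {z. bb x z > 0})"
    by (rule compactE_image[OF cpt, of ?K0 "\<lambda>x. {z. bb x z > 0}"]) (use op bb(3) in auto)
  define s where "s z = (\<Sum>x\<in>T. bb x z)" for z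
  have s0: "s z \<ge> 0" for z unfolding s_def by (rule sum_nonneg) (rule bb(2))
  have sK: "s z > 0" if zK: "z \<in> ?K0" for z
  proof -
    obtain x where x: "x \<in> T" "bb x z > 0" using subsetD[OF T(3) zK] by blast
    show ?thesis unfolding s_def by (rule sum_pos2[OF T(2) x(1)]) (use x(2) bb(2) in auto)
  qed
  have off: "\<eta> z = 0" if "z \<notin> ?K0" for z using that closure_subset[of "{x. \<eta> x \<noteq> 0}"] by auto
  have sC: "ck_on 1 (cimg c) (s \<circ> cinv c)" if c: "c \<in> atlas M" for c
  proof -
    have "ck_on 1 (cimg c) (\<lambda>y. \<Sum>x\<in>T. (bb x \<circ> cinv c) y)"
      by (rule ck_on_sum[OF atlasD(2)[OF c]]) (rule C1_fun_ck[OF bb(1) c])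
    then show ?thesis unfolding s_def[abs_def] o_def .
  qed
  have "C1_fun s" by (rule C1_funI) (rule sC)
  then have sop: "open {z. s z > 0}" by (intro open_Collect_less continuous_on_const C1_continuous)
  define \<beta> where "\<beta> x z = \<eta> z * bb x z / s z" for x z
  have \<beta>C: "C1_fun (\<beta> x)" for x
  proof (rule C1_funI)
    fix c assume c: "c \<in> atlas M"
    show "ck_on 1 (cimg c) (\<beta> x \<circ> cinv c)"
    proof (rule ck_on_local[OF atlasD(2)[OF c]])
      fix y assume y: "y \<in> cimg c"
      have xd: "cinv c y \<in> cdom c" "cmap c (cinv c y) = y" using cinv_in[OF c y] cmap_cinv[OF c y] by auto
      have mem: "y \<in> cmap c ` (cdom c \<inter> U)" if "cinv c y \<in> U" for U
        using xd that by (metis IntI imageI)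
      have sub: "cmap c ` (cdom c \<inter> U) \<subseteq> cimg c" for U by (auto simp: cimg_def)
      have inU: "cinv c z \<in> U" if "z \<in> cmap c ` (cdom c \<inter> U)" for z U
        using that cinv_cmap[OF c] by auto
      show "\<exists>W. open W \<and> y \<in> W \<and> W \<subseteq> cimg c \<and> ck_on 1 W (\<beta> x \<circ> cinv c)"
      proof (cases "s (cinv c y) > 0")
        case True
        let ?W = "cmap c ` (cdom c \<inter> {z. s z > 0})"
        have W: "open ?W" by (rule open_cmap_image[OF c sop])
        have k: "ck_on 1 ?W (u \<circ> cinv c)" if "ck_on 1 (cimg c) (u \<circ> cinv c)" for u :: "'a \<Rightarrow> real"
          by (rule ck_on_open_subset[OF that atlasD(2)[OF c] W sub])
        have k1: "ck_on 1 ?W (\<eta> \<circ> cinv c)" "ck_on 1 ?W (bb x \<circ> cinv c)" "ck_on 1 ?W (s \<circ> cinv c)"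
          by (rule k[OF C1_fun_ck[OF \<eta>(1) c]], rule k[OF C1_fun_ck[OF bb(1) c]], rule k[OF sC[OF c]])
        have "ck_on 1 ?W (\<lambda>z. (\<eta> \<circ> cinv c) z * (bb x \<circ> cinv c) z / (s \<circ> cinv c) z)"
          by (rule ck_on_divide[OF W ck_on_mult[OF W k1(1,2)] k1(3)]) (use inU[of _ "{z. s z > 0}"] in force)
        then have "ck_on 1 ?W (\<beta> x \<circ> cinv c)" unfolding \<beta>_def[abs_def] o_def .
        then show ?thesis using W mem[of "{z. s z > 0}"] True sub by blast
      next
        \<comment> \<open>Where s is not positive the point lies off the closed support of \<eta>,
          so \<eta> and with it the quotient vanish on a neighbourhood, whatever the
          denominator.\<close>
        case False
        let ?W = "cmap c ` (cdom c \<inter> - ?K0)"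
        have W: "open ?W" by (rule open_cmap_image[OF c open_Compl[OF closed_closure]])
        have "0 = (\<beta> x \<circ> cinv c) z" if z: "z \<in> ?W" for z
          using off[of "cinv c z"] inU[OF z] by (simp add: \<beta>_def)
        then have "ck_on 1 ?W (\<beta> x \<circ> cinv c)" by (rule ck_on_cong[OF W _ ck_on_const[OF W, of 1 0]])
        then show ?thesis using W mem[of "- ?K0"] False sK sub by blast
      qed
    qed
  qed
  have \<beta>0: "\<beta> x z \<ge> 0" for x z unfolding \<beta>_def by (intro divide_nonneg_nonneg mult_nonneg_nonneg \<eta>(2) bb(2) s0)
  have \<eta>sum: "\<eta> z = (\<Sum>x\<in>T. \<beta> x z)" for z
  proof (cases "z \<in> ?K0")
    case True
    have "(\<Sum>x\<in>T. \<beta> x z) = \<eta> z * s z / s z" by (simp add: \<beta>_def s_def sum_distrib_left sum_divide_distrib)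
    then show ?thesis using sK[OF True] by simp
  next
    case False then show ?thesis using off[OF False] by (simp add: \<beta>_def)
  qed
  let ?J = "\<lambda>x z. flux_weight p (grad_pair f f z) * grad_pair f (\<beta> x) z"
  have loc: "integrable (riem_volume M) (?J x) \<and> (LINT z|riem_volume M. ?J x z) \<le> 0" for x
  proof -
    obtain c K where cK: "c \<in> atlas M" "compact K" "K \<subseteq> cimg c" "\<And>z. z \<notin> cinv c ` K \<Longrightarrow> bb x z = 0" 
      using bb(4)[of x] by (elim exE conjE) (rule that, auto)
    have z: "\<beta> x z = 0" if "z \<notin> cinv c ` K" for z using cK(4)[OF that] by (simp add: \<beta>_def)
    have "integrable (riem_volume M) (?J x)"
      by (rule weak_inequality_local(1)[where f = f and \<eta> = "\<beta> x" and c = c and K = K, OF p _ _ \<beta>C \<beta>0 cK(1-3)])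
        (erule f, erule (1) sub, erule z)
    moreover have "(LINT z|riem_volume M. ?J x z) \<le> 0"
      by (rule weak_inequality_local(2)[where f = f and \<eta> = "\<beta> x" and c = c and K = K, OF p _ _ \<beta>C \<beta>0 cK(1-3)])
        (erule f, erule (1) sub, erule z)
    ultimately show ?thesis by (rule conjI)
  qed
  have J: "J = (\<lambda>z. \<Sum>x\<in>T. ?J x z)"
    unfolding J_def by (rule ext) (simp only: grad_pair_sum[OF f1 \<eta>(1) \<beta>C \<eta>sum] sum_distrib_left)
  show "integrable (riem_volume M) J" unfolding J by (rule Bochner_Integration.integrable_sum) (use loc in blast)
  have "(LINT z|riem_volume M. J z) = (\<Sum>x\<in>T. LINT z|riem_volume M. ?J x z)"
    unfolding J by (rule Bochner_Integration.integral_sum) (use loc in blast)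
  also have "\<dots> \<le> 0" by (rule sum_nonpos) (use loc in blast)
  finally show "(LINT z|riem_volume M. J z) \<le> 0" .
qed

end

section \<open>The capacity estimate\<close>

lemma flux_weight_mult:
  assumes "p \<ge> 2" "a \<ge> (0::real)"
  shows "flux_weight p (a\<^sup>2) * a\<^sup>2 = a powr p" "flux_weight p (a\<^sup>2) * a = a powr (p - 1)"
proof -
  have "flux_weight p (a\<^sup>2) * a\<^sup>2 = a powr p \<and> flux_weight p (a\<^sup>2) * a = a powr (p - 1)"
  proof (cases "a = 0")
    case False
    then have a: "a > 0" using assms(2) by simp
    have sq: "a\<^sup>2 = a powr 2" using a by simp
    have "flux_weight p (a\<^sup>2) = a powr (p - 2)"
    proof (cases "p = 2")
      case False
      then have "flux_weight p (a\<^sup>2) = (a powr 2) powr ((p - 2) / 2)" by (simp only: flux_weight_def sq if_False)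
      also have "\<dots> = a powr (2 * ((p - 2) / 2))" by (rule powr_powr)
      also have "2 * ((p - 2) / 2) = p - 2" by simp
      finally show ?thesis .
    qed (use a in \<open>simp add: flux_weight_def\<close>)
    moreover have "a powr (p - 2) * a\<^sup>2 = a powr p" unfolding sq powr_add[symmetric] by simp
    moreover have "a powr (p - 2) * a = a powr (p - 1)"
      using powr_add[of a "p - 2" 1] a by simp
    ultimately show ?thesis by simp
  qed (use assms in simp)
  then show "flux_weight p (a\<^sup>2) * a\<^sup>2 = a powr p" "flux_weight p (a\<^sup>2) * a = a powr (p - 1)" by simp_all
qed

text \<open>No convexity is involved. If 2 D b \<le> s, the left-hand side is at most half of s^p;
  otherwise s < 2 D b, and monotonicity of the power bounds s^(p-1).\<close>

lemma young_type_inequality: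
  fixes s b D p :: real
  assumes p: "p \<ge> 2" and s: "s \<ge> 0" and b: "b \<ge> 0" and D: "D > 0"
  shows "D * (s powr (p - 1) * b) \<le> s powr p / 2 + D * (2 * D) powr (p - 1) * b powr p"
proof (cases "2 * D * b \<le> s")
  case True
  have "s powr (p - 1) * (2 * D * b) \<le> s powr (p - 1) * s" by (rule mult_left_mono[OF True]) simp
  also have "\<dots> = s powr p" using s powr_add[of s "p - 1" 1] by (cases "s = 0") simp_all
  finally have "D * (s powr (p - 1) * b) \<le> s powr p / 2" by (simp add: algebra_simps)
  moreover have "0 \<le> D * (2 * D) powr (p - 1) * b powr p" using D by simp
  ultimately show ?thesis by linarith
next
  case False
  then have bp: "b > 0" using s b D by (cases "b = 0") auto
  have "s powr (p - 1) \<le> (2 * D * b) powr (p - 1)" by (rule powr_mono2) (use False s p in auto)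
  also have "\<dots> = (2 * D) powr (p - 1) * b powr (p - 1)" using D b by (simp add: powr_mult)
  finally have "s powr (p - 1) * b \<le> (2 * D) powr (p - 1) * b powr (p - 1) * b" by (rule mult_right_mono) (rule b)
  also have "\<dots> = (2 * D) powr (p - 1) * b powr p" using bp powr_add[of b "p - 1" 1] by simp
  finally have "D * (s powr (p - 1) * b) \<le> D * ((2 * D) powr (p - 1) * b powr p)" by (rule mult_left_mono) (use D in simp)
  moreover have "0 \<le> s powr p / 2" by simp
  ultimately show ?thesis unfolding mult.assoc by linarith
qed

text \<open>To be read with a = |\<nabla>f|, b = |\<nabla>v|, V the positive part of v, y = f and g
  = <\<nabla>f, \<nabla>v>. The bracket is then the derivative of V^p f along \<nabla>f, and the
  cross term is absorbed with s = V a in Young's inequality. The summand 1 in D = p (B + 1) keeps D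
  positive when B = 0.\<close>

lemma flux_lower_bound:
  fixes a b V y B g p :: real
  assumes p: "p \<ge> 2" and a: "a \<ge> 0" and b: "b \<ge> 0" and V: "V \<ge> 0" and y: "0 \<le> y" "y \<le> B" and g: "\<bar>g\<bar> \<le> a * b"
  defines "D \<equiv> p * (B + 1)"
  shows "V powr p * a powr p / 2 \<le>
    flux_weight p (a\<^sup>2) * (V powr p * a\<^sup>2 + p * V powr (p - 1) * y * g) + D * (2 * D) powr (p - 1) * b powr p"
proof -
  have D: "D > 0" unfolding D_def using p y by (intro mult_pos_pos) auto
  have fw: "flux_weight p (a\<^sup>2) \<ge> 0" by (simp add: flux_weight_def)
  have "- g \<le> a * b" using g by linarith
  then have "(p * V powr (p - 1) * y) * (- g) \<le> (p * V powr (p - 1) * y) * (a * b)"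
    by (rule mult_left_mono) (use p y in simp)
  then have "flux_weight p (a\<^sup>2) * ((p * V powr (p - 1) * y) * (- g)) \<le> flux_weight p (a\<^sup>2) * ((p * V powr (p - 1) * y) * (a * b))"
    by (rule mult_left_mono[OF _ fw])
  also have "\<dots> = (p * y) * (V powr (p - 1) * (flux_weight p (a\<^sup>2) * a) * b)" by (simp add: algebra_simps)
  also have "\<dots> = (p * y) * ((V * a) powr (p - 1) * b)"
    using V a by (simp add: flux_weight_mult(2)[OF p a] powr_mult)
  also have "\<dots> \<le> D * ((V * a) powr (p - 1) * b)"
    unfolding D_def by (rule mult_right_mono) (use p y b in \<open>auto intro!: mult_left_mono\<close>)
  also have "\<dots> \<le> (V * a) powr p / 2 + D * (2 * D) powr (p - 1) * b powr p"
    by (rule young_type_inequality[OF p _ b D]) (use V a in simp)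
  also have "(V * a) powr p = V powr p * a powr p" using V a by (simp add: powr_mult)
  finally have 1: "flux_weight p (a\<^sup>2) * ((p * V powr (p - 1) * y) * (- g)) \<le> V powr p * a powr p / 2 + D * (2 * D) powr (p - 1) * b powr p" .
  have "flux_weight p (a\<^sup>2) * (V powr p * a\<^sup>2 + p * V powr (p - 1) * y * g) =
      V powr p * (flux_weight p (a\<^sup>2) * a\<^sup>2) - flux_weight p (a\<^sup>2) * ((p * V powr (p - 1) * y) * (- g))"
    by (simp add: algebra_simps)
  then show ?thesis using 1 unfolding flux_weight_mult(1)[OF p a] by linarith
qed

context riemannian
begin

lemma norm_at_gradient: "norm_at M x (gradient M u x) = sqrt (grad_pair u u x)"
  by (simp add: norm_at_def grad_pair_def)

text \<open>The Caccioppoli inequality. The weak inequality removes the flux term J from the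
  integrated pointwise bound, and on \<open>K\<close> the factor v^p is at least 1.\<close>

lemma capacity_energy_estimate:
  assumes p: "p \<ge> 2" and f: "\<And>c. c \<in> atlas M \<Longrightarrow> ck_on 2 (cimg c) (f \<circ> cinv c)"
    and sub: "\<And>c x. c \<in> atlas M \<Longrightarrow> x \<in> cdom c \<Longrightarrow> p_subharmonic_at p c (f \<circ> cinv c) (cmap c x)"
    and bnd: "\<And>x. 0 \<le> f x" "\<And>x. f x \<le> B" and v: "test_function M v" "\<And>x. x \<in> K \<Longrightarrow> v x \<ge> 1"
  defines "D \<equiv> p * (B + 1)"
  shows "(\<integral>\<^sup>+ x. ennreal (indicator K x * (sqrt (grad_pair f f x) powr p / 2)) \<partial>riem_volume M) \<le>
    ennreal (D * (2 * D) powr (p - 1)) * (\<integral>\<^sup>+ x. ennreal (norm_at M x (gradient M v x) powr p) \<partial>riem_volume M)"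
proof -
  let ?\<mu> = "riem_volume M"
  define C where "C = D * (2 * D) powr (p - 1)"
  have "0 \<le> B" using order_trans[OF bnd] .
  then have C0: "C \<ge> 0" unfolding C_def D_def using p by simp
  have f1: "C1_fun f" by (rule C2_imp_C1) (rule f)
  have v1: "C1_fun v" by (rule test_function_C1[OF v(1)])
  have p1: "p > 1" using p by simp
  define \<eta> where "\<eta> x = pos_powr p (v x) * f x" for x
  have \<eta>1: "C1_fun \<eta>" unfolding \<eta>_def[abs_def] by (rule C1_mult[OF C1_pos_powr[OF v1 p1] f1])
  have \<eta>0: "\<eta> x \<ge> 0" for x unfolding \<eta>_def using bnd(1) by simp
  have \<eta>c: "compact (closure {x. \<eta> x \<noteq> 0})"
  proof -
    have c: "compact (closure {x. v x \<noteq> 0})" using v(1) unfolding test_function_def by (rule conjunct2)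
    have "{x. \<eta> x \<noteq> 0} \<subseteq> {x. v x \<noteq> 0}" unfolding \<eta>_def by auto
    from closure_mono[OF this] show ?thesis
      using compact_Int_closed[OF c closed_closure, of "{x. \<eta> x \<noteq> 0}"] by (simp add: Int_absorb1)
  qed
  define J where "J x = flux_weight p (grad_pair f f x) * grad_pair f \<eta> x" for x
  define H where "H x = C * sqrt (grad_pair v v x) powr p" for x
  have Ji: "integrable ?\<mu> J" and J0: "(LINT x|?\<mu>. J x) \<le> 0"
  proof -
    show "integrable ?\<mu> J" unfolding J_def[abs_def]
      by (rule weak_inequality(1)[where f = f and \<eta> = \<eta>, OF p _ _ \<eta>1 \<eta>0 \<eta>c]) (erule f, erule (1) sub)
    show "(LINT x|?\<mu>. J x) \<le> 0" unfolding J_def[abs_def]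
      by (rule weak_inequality(2)[where f = f and \<eta> = \<eta>, OF p _ _ \<eta>1 \<eta>0 \<eta>c]) (erule f, erule (1) sub)
  qed
  have pt: "indicator K x * (sqrt (grad_pair f f x) powr p / 2) \<le> J x + H x" for x
  proof -
    let ?V = "max 0 (v x)" and ?a = "sqrt (grad_pair f f x)" and ?b = "sqrt (grad_pair v v x)"
    have a0: "?a \<ge> 0" "?b \<ge> 0" using grad_pair_self_nonneg[OF f1] grad_pair_self_nonneg[OF v1] by simp_all
    have aa: "?a\<^sup>2 = grad_pair f f x" using grad_pair_self_nonneg[OF f1] by simp
    have "?V powr p * ?a powr p / 2 \<le>
      flux_weight p (?a\<^sup>2) * (?V powr p * ?a\<^sup>2 + p * ?V powr (p - 1) * f x * grad_pair f v x) + D * (2 * D) powr (p - 1) * ?b powr p"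
      unfolding D_def by (rule flux_lower_bound[OF p a0 _ bnd grad_pair_cauchy_schwarz]) simp
    also have "\<dots> = J x + H x"
      unfolding aa J_def H_def C_def \<eta>_def[abs_def] grad_pair_test[OF f1 v1 p1] unfolding pos_powr_def by simp
    finally have 1: "?V powr p * ?a powr p / 2 \<le> J x + H x" .
    have "indicator K x * (?a powr p / 2) \<le> ?V powr p * (?a powr p / 2)"
    proof (rule mult_right_mono)
      show "indicator K x \<le> ?V powr p"
      proof (cases "x \<in> K")
        case True
        then have "1 \<le> ?V" using v(2)[OF True] by (auto simp: max_def)
        then have "1 \<le> ?V powr p" using p by (intro ge_one_powr_ge_zero) auto
        then show ?thesis using True by simp
      qed simp
    qed simp
    then show ?thesis using 1 by simp
  qed
  have Hb: "H \<in> borel_measurable ?\<mu>"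
  proof -
    note [measurable] = grad_pair_borel[OF v1 v1]
    have "H \<in> borel_measurable borel" unfolding H_def[abs_def] by measurable
    then show ?thesis by (simp cong: measurable_cong_sets)
  qed
  have H0: "H x \<ge> 0" for x unfolding H_def using C0 by simp
  have HC: "(\<integral>\<^sup>+ x. ennreal (H x) \<partial>?\<mu>) = ennreal C * (\<integral>\<^sup>+ x. ennreal (norm_at M x (gradient M v x) powr p) \<partial>?\<mu>)"
  proof -
    note [measurable] = grad_pair_borel[OF v1 v1]
    have m: "(\<lambda>x. ennreal (sqrt (grad_pair v v x) powr p)) \<in> borel_measurable borel" by measurable
    have m': "(\<lambda>x. ennreal (sqrt (grad_pair v v x) powr p)) \<in> borel_measurable ?\<mu>"
      using m by (simp cong: measurable_cong_sets)
    show ?thesis unfolding norm_at_gradient H_def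
      using nn_integral_cmult[OF m', of "ennreal C"] C0 by (simp add: ennreal_mult)
  qed
  have "(\<integral>\<^sup>+ x. ennreal (indicator K x * (sqrt (grad_pair f f x) powr p / 2)) \<partial>?\<mu>) \<le> (\<integral>\<^sup>+ x. ennreal (H x) \<partial>?\<mu>)"
  \<comment> \<open>With infinite energy of v there is nothing to show; with finite energy H is
    integrable, so the integral of J + H can be split.\<close>
  proof (cases "(\<integral>\<^sup>+ x. ennreal (H x) \<partial>?\<mu>) = \<infinity>")
    case False
    then have fin: "(\<integral>\<^sup>+ x. ennreal (H x) \<partial>?\<mu>) < \<infinity>" by (simp add: top.not_eq_extremum)
    have Hi: "integrable ?\<mu> H" by (rule integrableI_nonneg[OF Hb _ fin]) (simp add: H0)
    have JH0: "J x + H x \<ge> 0" for x by (rule order_trans[OF _ pt[of x]]) simp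
    have "(\<integral>\<^sup>+ x. ennreal (indicator K x * (sqrt (grad_pair f f x) powr p / 2)) \<partial>?\<mu>) \<le> (\<integral>\<^sup>+ x. ennreal (J x + H x) \<partial>?\<mu>)"
      by (rule nn_integral_mono) (rule ennreal_leI[OF pt])
    also have "\<dots> = ennreal (LINT x|?\<mu>. J x + H x)"
      by (rule nn_integral_eq_integral) (use Ji Hi JH0 in simp_all)
    also have "\<dots> \<le> ennreal (LINT x|?\<mu>. H x)"
      using J0 by (intro ennreal_leI) (simp add: Bochner_Integration.integral_add[OF Ji Hi])
    also have "\<dots> = (\<integral>\<^sup>+ x. ennreal (H x) \<partial>?\<mu>)"
      by (rule nn_integral_eq_integral[symmetric]) (use Hi H0 in simp_all)
    finally show ?thesis .
  qed simp
  then show ?thesis unfolding HC C_def .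
qed

text \<open>A function with vanishing gradient is constant on coordinate balls, so the level set
  through y is open. Its complement is open by continuity, and connectedness makes the function
  constant.\<close>

lemma gradient_nonzero_exists:
  assumes conn: "connected (UNIV :: 'a set)" and f: "C1_fun f" and ne: "f y \<noteq> f z"
  shows "\<exists>x. grad_pair f f x > 0"
proof (rule ccontr)
  assume "\<not> (\<exists>x. grad_pair f f x > 0)"
  then have zero: "grad_pair f f x = 0" for x using grad_pair_self_nonneg[OF f, of x] by (metis order_le_less)
  have loc: "\<exists>U. open U \<and> x \<in> U \<and> (\<forall>u\<in>U. f u = f x)" for x
  proof -
    obtain c where c: "c \<in> atlas M" "x \<in> cdom c" using charts_cover by blast
    obtain e where e: "e > 0" "ball (cmap c x) e \<subseteq> cimg c"
      using open_contains_ball[of "cimg c"] atlasD(2)[OF c(1)] cmap_in[OF c(2)] by blast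
    have d0: "((f \<circ> cinv c) has_derivative (\<lambda>e. 0)) (at y)" if y: "y \<in> cimg c" for y
    proof -
      note D = C1_has_derivative[OF f c(1) y]
      have V: "chart_grad M c (f \<circ> cinv c) y = 0"
      proof (rule ccontr)
        assume "chart_grad M c (f \<circ> cinv c) y \<noteq> 0"
        from ginner_pos[OF c(1) y this] show False
          using zero[of "cinv c y"] unfolding grad_pair_ginner[OF f f c(1) cinv_in[OF c(1) y]] cmap_cinv[OF c(1) y] by simp
      qed
      have "dir_deriv (f \<circ> cinv c) y = (\<lambda>e. 0)"
        using chart_grad[OF c(1) y D] unfolding V by (simp add: fun_eq_iff bilinear_lzero[OF bilinear_ginner])
      then show ?thesis using D by simp
    qed
    have const: "(f \<circ> cinv c) y = (f \<circ> cinv c) (cmap c x)" if y: "y \<in> ball (cmap c x) e" for y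
    proof (rule has_derivative_zero_unique[OF convex_ball, of "cmap c x" e])
      fix t assume "t \<in> ball (cmap c x) e"
      then show "((f \<circ> cinv c) has_derivative (\<lambda>h. 0)) (at t within ball (cmap c x) e)"
        using d0[of t] e(2) by (blast intro: has_derivative_at_withinI)
    qed (use y e(1) in auto)
    define U where "U = cmap c -` ball (cmap c x) e \<inter> cdom c"
    have "open U" unfolding U_def
      using continuous_open_preimage[OF continuous_cmap[OF c(1)] atlasD(1)[OF c(1)] open_ball] by (simp add: Int_commute)
    moreover have "x \<in> U" using c(2) e(1) by (simp add: U_def)
    moreover have "f u = f x" if "u \<in> U" for u
      using const[of "cmap c u"] that cinv_cmap[OF c(1), of u] cinv_cmap[OF c] by (simp add: U_def)
    ultimately show ?thesis by blast
  qed
  have fc: "continuous_on UNIV f" by (rule C1_continuous[OF f])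
  have A: "open {x. f x = f y}"
  proof (subst open_subopen, intro ballI)
    fix x assume "x \<in> {x. f x = f y}"
    then show "\<exists>T. open T \<and> x \<in> T \<and> T \<subseteq> {x. f x = f y}" using loc[of x] by auto
  qed
  have B: "open {x. f x \<noteq> f y}" by (rule open_Collect_neq[OF fc continuous_on_const])
  have "{x. f x = f y} \<inter> UNIV = {} \<or> {x. f x \<noteq> f y} \<inter> UNIV = {}" by (rule connectedD[OF conn A B]) auto
  then have "f y \<noteq> f y \<or> f z = f y" by blast
  then show False using ne by simp
qed

text \<open>\<open>K\<close> is the image of a closed coordinate ball on which the gradient has no
  zero. In coordinates the integrand has a positive minimum there, and the ball has positive
  Lebesgue measure.\<close>

lemma energy_positive:
  assumes f: "C1_fun f" and p: "p > 0" and x: "grad_pair f f x > 0"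
  shows "\<exists>K. compact K \<and> (\<integral>\<^sup>+ x. ennreal (indicator K x * (sqrt (grad_pair f f x) powr p / 2)) \<partial>riem_volume M) > 0"
proof -
  obtain c where c: "c \<in> atlas M" "x \<in> cdom c" using charts_cover by blast
  have gop: "open {z. grad_pair f f z > 0}"
    by (rule open_Collect_less[OF continuous_on_const grad_pair_continuous[OF f f]])
  let ?W = "cmap c ` (cdom c \<inter> {z. grad_pair f f z > 0})"
  have "open ?W" by (rule open_cmap_image[OF c(1) gop])
  moreover have "cmap c x \<in> ?W" using c(2) x by blast
  ultimately obtain e where e: "e > 0" "cball (cmap c x) e \<subseteq> ?W" using open_contains_cball by blast
  define L where "L = cball (cmap c x) e"
  have L: "L \<subseteq> cimg c" "\<And>y. y \<in> L \<Longrightarrow> grad_pair f f (cinv c y) > 0" "compact L" "L \<noteq> {}"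
    using e cinv_cmap[OF c(1)] cmap_in by (auto simp: L_def cimg_def)
  define K where "K = cinv c ` L"
  have K: "compact K" "K \<subseteq> cdom c"
    unfolding K_def using compact_continuous_image[OF continuous_on_subset[OF continuous_cinv[OF c(1)] L(1)] L(3)]
      cinv_in[OF c(1)] L(1) by auto
  define G where "G y = vol_density c y * (sqrt (grad_pair f f (cinv c y)) powr p / 2)" for y
  have "continuous_on L G" unfolding G_def
  proof (intro continuous_on_mult continuous_on_divide continuous_on_const continuous_on_powr' continuous_on_real_sqrt)
    show "continuous_on L (vol_density c)"
      by (rule continuous_on_subset[OF ck_on_continuous[OF vol_density_smooth[OF c(1), of 0]] L(1)])
    show "continuous_on L (\<lambda>y. grad_pair f f (cinv c y))"
      by (rule continuous_on_compose2[OF grad_pair_continuous[OF f f] continuous_on_subset[OF continuous_cinv[OF c(1)] L(1)]]) simp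
  qed (use L(2) p in \<open>auto simp: less_imp_le\<close>)
  from continuous_attains_inf[OF L(3,4) this] obtain y0 where y0: "y0 \<in> L" "\<forall>y\<in>L. G y0 \<le> G y" by blast
  have m0: "G y0 > 0" unfolding G_def
    using vol_density_pos[OF c(1) subsetD[OF L(1) y0(1)]] L(2)[OF y0(1)] by simp
  let ?F = "\<lambda>x. ennreal (indicator K x * (sqrt (grad_pair f f x) powr p / 2))"
  have Kb: "K \<in> sets borel" using K(1) by (rule borel_compact)
  have Fb: "?F \<in> borel_measurable borel"
  proof -
    note [measurable] = grad_pair_borel[OF f f] Kb
    show ?thesis by measurable
  qed
  have "0 < ennreal (G y0) * emeasure lborel L"
  proof -
    have "emeasure lborel L \<noteq> 0"
      using content_cball_pos[OF e(1), of "cmap c x"] unfolding L_def measure_def by (auto simp: emeasure_completion)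
    then show ?thesis using m0 by (simp add: ennreal_zero_less_mult_iff zero_less_iff_neq_zero)
  qed
  also have "\<dots> = (\<integral>\<^sup>+ y. ennreal (G y0) * indicator L y \<partial>lborel)"
    by (rule nn_integral_cmult_indicator[symmetric]) (simp add: L_def)
  also have "\<dots> \<le> (\<integral>\<^sup>+ y. ennreal (vol_density c y) * ?F (cinv c y) * indicator (cimg c) y \<partial>lborel)"
  proof (rule nn_integral_mono)
    fix y
    show "ennreal (G y0) * indicator L y \<le> ennreal (vol_density c y) * ?F (cinv c y) * indicator (cimg c) y"
    proof (cases "y \<in> L")
      case True
      have "vol_density c y \<ge> 0" using vol_density_pos[OF c(1) subsetD[OF L(1) True]] by simp
      then have "ennreal (vol_density c y) * ?F (cinv c y) = ennreal (G y)"
        unfolding G_def by (subst ennreal_mult) (use True in \<open>simp_all add: K_def\<close>)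
      moreover have "ennreal (G y0) \<le> ennreal (G y)" by (rule ennreal_leI) (use y0(2) True in blast)
      ultimately show ?thesis using True subsetD[OF L(1) True] by simp
    qed simp
  qed
  also have "\<dots> = (\<integral>\<^sup>+ x. ?F x \<partial>riem_volume M)"
    by (rule nn_integral_riem_volume[OF c(1) Fb, symmetric]) (use K(2) in \<open>auto simp: indicator_def\<close>)
  finally show ?thesis using K(1) by blast
qed

text \<open>The energy of f on \<open>K\<close>, divided by the constant of the Caccioppoli
  inequality, is a lower bound for the energy of every competitor, hence for the infimum.\<close>

lemma p_hyperbolicI:
  assumes p: "p \<ge> 2" and conn: "connected (UNIV :: 'a set)"
    and f: "\<And>c. c \<in> atlas M \<Longrightarrow> ck_on 2 (cimg c) (f \<circ> cinv c)"
    and sub: "\<And>c x. c \<in> atlas M \<Longrightarrow> x \<in> cdom c \<Longrightarrow> p_subharmonic_at p c (f \<circ> cinv c) (cmap c x)"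
    and bnd: "\<And>x. 0 \<le> f x" "\<And>x. f x \<le> B" and ne: "f y \<noteq> f z"
  shows "p_hyperbolic p M"
proof -
  have f1: "C1_fun f" by (rule C2_imp_C1) (rule f)
  have p0: "p > 0" using p by simp
  obtain x where "grad_pair f f x > 0" using gradient_nonzero_exists[OF conn f1 ne] by blast
  from energy_positive[OF f1 p0 this] obtain K where K: "compact K"
    "(\<integral>\<^sup>+ x. ennreal (indicator K x * (sqrt (grad_pair f f x) powr p / 2)) \<partial>riem_volume M) > 0" (is "?\<kappa> > 0") by blast
  define C where "C = p * (B + 1) * (2 * (p * (B + 1))) powr (p - 1)"
  have "0 \<le> B" using order_trans[OF bnd(1)[of x] bnd(2)[of x]] .
  then have C: "C > 0" unfolding C_def using p by simp
  have "?\<kappa> / ennreal C \<le> p_capacity p M K" unfolding p_capacity_def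
  proof (rule INF_greatest)
    fix v assume "v \<in> {u. test_function M u \<and> (\<forall>x\<in>K. 1 \<le> u x)}"
    then have v: "test_function M v" "\<And>x. x \<in> K \<Longrightarrow> v x \<ge> 1" by auto
    have "?\<kappa> \<le> ennreal C * (\<integral>\<^sup>+ x. ennreal (norm_at M x (gradient M v x) powr p) \<partial>riem_volume M)"
      unfolding C_def by (rule capacity_energy_estimate[where f = f, OF p _ _ bnd v(1)]) (erule f, erule (1) sub, erule v(2))
    then show "?\<kappa> / ennreal C \<le> (\<integral>\<^sup>+ x. ennreal (norm_at M x (gradient M v x) powr p) \<partial>riem_volume M)"
      by (rule divide_le_posI_ennreal[rotated]) (use C in simp)
  qed
  moreover have "0 < ?\<kappa> / ennreal C" using K(2) by (simp add: ennreal_zero_less_divide)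
  ultimately have "0 < p_capacity p M K" by (rule less_le_trans[rotated])
  then show ?thesis unfolding p_hyperbolic_def using K(1) by blast
qed

end

theorem theorem4p1:
  fixes N :: "('a::{t2_space, second_countable_topology}, 'n::finite) riem"
    and q :: 'a
    and S :: "('s::{t2_space, second_countable_topology}, 'm::finite) riem"
    and \<iota> :: "'s \<Rightarrow> 'a"
    and w g lam h :: "real \<Rightarrow> real"
    and \<rho> p :: real
    and D :: "'s set"
  assumes "riemannian_manifold N" and "riem_complete N" and "is_pole N q"
    and "riemannian_manifold S" and "\<not> compact (UNIV :: 's set)" and "connected (UNIV :: 's set)"
    and "riem_complete S" and "riemannian_submanifold S N \<iota>"
    and "p \<ge> 2"
    and "comparison_constellation N q S \<iota> {0..} w \<rho> D g lam h"
    and "\<forall>r>0. balance CARD('m) p w h lam r \<ge> 0"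
    and "\<exists>L. ((\<lambda>R. integral {\<rho>..R} (Lambda_fun CARD('m) p w g h lam)) \<longlongrightarrow> L) at_top"
  shows "p_hyperbolic p S"
proof -
  obtain E where E: "is_exp_map N q E" "bij E" "continuous_on UNIV E"
    "\<And>c. c \<in> atlas N \<Longrightarrow> smooth_on (E -` cdom c) (cmap c \<circ> E)"
    "\<And>c. c \<in> atlas N \<Longrightarrow> smooth_on (cmap c ` cdom c) (inv E \<circ> cinv c)"
    using assms(3) unfolding is_pole_def by blast
  note cc = assms(10)[unfolded comparison_constellation_def]
  have warp: "warping_function {0..} w" and ball: "extrinsic_ball N q \<iota> \<rho> D" and cl: "compact (closure D)"
    and gs: "smooth_on {0..} g" and ls: "smooth_on {0..} lam" and hs: "smooth_on {0..} h"
    and gpos: "\<forall>r\<in>{0..}. 0 < g r \<and> g r \<le> 1"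
    and curv: "\<forall>x u v. x \<noteq> q \<longrightarrow> riem_dist N q x \<in> {0..} \<longrightarrow> is_radial_vector N q x u \<longrightarrow>
        (\<forall>a b. a *\<^sub>R u + b *\<^sub>R v = 0 \<longrightarrow> a = 0 \<and> b = 0) \<longrightarrow>
        sectional_curvature N x u v \<le> model_radial_curvature {0..} w (riem_dist N q x)"
    and bds: "\<forall>x. \<iota> x \<noteq> q \<longrightarrow> riem_dist N q (\<iota> x) \<in> {0..} \<longrightarrow>
        radial_tangency S N q \<iota> x \<le> g (riem_dist N q (\<iota> x)) \<and>
        radial_second_fund S N q \<iota> x \<le> lam (riem_dist N q (\<iota> x)) \<and>
        radial_mean_convexity S N q \<iota> x \<le> h (riem_dist N q (\<iota> x))"
    using cc by - ((elim conjE, assumption)+)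
  have rn: "riem_dist N q x \<in> {0..}" for x by (simp add: riem_dist_def)
  have sf: "submfd N q E S \<iota>"
    by (intro submfd.intro pole.intro riemannian.intro pole_axioms.intro submfd_axioms.intro assms(1) assms(4) assms(8) E)
  interpret submfd N q E S \<iota> by (rule sf)
  interpret comparison N q E S \<iota> w g lam h
  proof (intro comparison.intro sf comparison_axioms.intro warp)
    fix x u v
    assume "x \<noteq> q" "is_radial_vector N q x u" "\<forall>a b. a *\<^sub>R u + b *\<^sub>R v = 0 \<longrightarrow> a = 0 \<and> b = 0"
    then show "sectional_curvature N x u v \<le> model_radial_curvature {0..} w (riem_dist N q x)"
      using curv rn by blast
  next
    fix x assume "\<iota> x \<noteq> q"
    then show "radial_tangency S N q \<iota> x \<le> g (rS x) \<and> radial_second_fund S N q \<iota> x \<le> lam (rS x) \<and>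
        radial_mean_convexity S N q \<iota> x \<le> h (rS x)"
      unfolding rS_def using bds rn by blast
  qed
  have Dc: "D \<in> components {x. rS x < \<rho>}" using ball unfolding extrinsic_ball_def rS_def .
  obtain y where y: "y \<in> D" using in_components_nonempty[OF Dc] by blast
  have y\<rho>: "rS y < \<rho>" using in_components_subset[OF Dc] y by blast
  have \<rho>: "\<rho> > 0" using y\<rho> rS_nonneg[of y] by linarith
  \<comment> \<open>Otherwise the sublevel set is all of the connected \<open>S\<close>, which is
    then its only component \<open>D\<close>; precompactness of \<open>D\<close> contradicts
    non-compactness of \<open>S\<close>.\<close>
  have "\<exists>z. rS z \<ge> \<rho>"
  proof (rule ccontr)
    assume "\<not> (\<exists>z. rS z \<ge> \<rho>)"
    then have U: "{x. rS x < \<rho>} = UNIV" by (auto simp: not_le)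
    have "D = UNIV" using Dc assms(6) unfolding U by (simp add: components_eq_sing_iff[THEN iffD2])
    then show False using cl assms(5) by simp
  qed
  then obtain z where z: "rS z \<ge> \<rho>" by blast
  \<comment> \<open>Half way between r(y) and \<rho>: then f vanishes at y in the ball and is
    positive at z outside it, while c0 > 0 leaves a neighbourhood of the pole where f is 0.\<close>
  define c0 where "c0 = (rS y + \<rho>) / 2"
  have c0: "0 < c0" "c0 < \<rho>" "rS y \<le> c0" using y\<rho> \<rho> rS_nonneg[of y] by (simp_all add: c0_def)
  obtain L where L: "((\<lambda>R. integral {\<rho>..R} (Lambda_fun CARD('m) p w g h lam)) \<longlongrightarrow> L) at_top" using assms(12) by blast
  have gp: "0 < g r" if "r > 0" for r using gpos that by simp
  obtain \<Phi> \<Phi>1 \<Phi>2 B where \<Phi>: "ck_on 2 {0<..} \<Phi>"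
    "\<And>r. r > 0 \<Longrightarrow> (\<Phi> has_real_derivative \<Phi>1 r) (at r)" "\<And>r. r > 0 \<Longrightarrow> (\<Phi>1 has_real_derivative \<Phi>2 r) (at r)"
    "\<And>r. r \<le> c0 \<Longrightarrow> \<Phi> r = 0" "\<And>r. r > c0 \<Longrightarrow> \<Phi> r > 0" "\<And>r. r > 0 \<Longrightarrow> \<Phi>1 r \<ge> 0"
    "\<And>r. r > 0 \<Longrightarrow> \<Phi>2 r \<ge> (eta w r - balance CARD('m) p w h lam r / ((p - 1) * (g r)\<^sup>2)) * \<Phi>1 r"
    "\<And>r. \<Phi> r \<ge> 0" "\<And>r. \<Phi> r \<le> B"
    by (rule radial_profile[OF warp gs ls hs gp assms(9) c0(1,2) L]) (assumption, rule that)
  have bal: "balance CARD('m) p w h lam r \<ge> 0" if "r > 0" for r using assms(11) that by blast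
  show ?thesis
  proof (rule S.p_hyperbolicI[where f = "\<lambda>x. \<Phi> (rS x)" and B = B and y = y and z = z, OF assms(9,6)])
    fix c assume c: "c \<in> atlas S"
    show "ck_on 2 (cimg c) ((\<lambda>x. \<Phi> (rS x)) \<circ> cinv c)"
      by (rule radial_function_smooth[OF c \<Phi>(1) \<Phi>(2) \<Phi>(3) c0(1) \<Phi>(4)])
  next
    fix c x assume cx: "c \<in> atlas S" "x \<in> cdom c"
    show "S.p_subharmonic_at p c ((\<lambda>x. \<Phi> (rS x)) \<circ> cinv c) (cmap c x)"
      by (rule radial_p_subharmonic[OF \<Phi>(1) \<Phi>(2) \<Phi>(3) c0(1) \<Phi>(4) \<Phi>(6) \<Phi>(7) assms(9) gp bal cx])
  next
    show "\<Phi> (rS y) \<noteq> \<Phi> (rS z)" using \<Phi>(4)[OF c0(3)] \<Phi>(5)[of "rS z"] z c0(2) by simp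
  qed (rule \<Phi>(8), rule \<Phi>(9))
qed

end
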